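(* Let $\mathcal{P}$ be a finite classical polar space of rank $n$ and let $t$ be an integer with $1<t<n$. Suppose that $\mathcal{P}$ contains a $t$-Steiner system. Then one of the following holds: (1) $t=2$ and $\mathcal{P}={}^2A_{2n}$ or $\mathcal{P}={}^2D_{n+1}$, with $n$ odd; (2) $t=n-1$ and either $\mathcal{P}={}^2A_{2n}$ or ${}^2D_{n+1}$ with $q\ge 3$, or $\mathcal{P}=D_n$.
   Context: Let $q$ be a prime power. The six finite classical polar spaces of rank $n$ are defined as follows; each consists of the totally isotropic subspaces of a vector space $V$ equipped with a nondegenerate form. A subspace $U$ is totally isotropic if the form vanishes on $U\times U$ (for a sesquilinear/alternating form), respectively if the quadratic form vanishes on every vector of $U$. The maximal totally isotropic subspaces are called generators; in all six cases below they have dimension $n$. - ${}^2A_{2n-1}$: $V=\mathbb{F}_{q^2}^{2n}$ with a nondegenerate Hermitian form. - ${}^2A_{2n}$: $V=\mathbb{F}_{q^2}^{2n+1}$ with a nondegenerate Hermitian form. - $C_n$: $V=\mathbb{F}_q^{2n}$ with a nondegenerate alternating form. - $D_n$: $V=\mathbb{F}_q^{2n}$ with a nondegenerate hyperbolic quadratic form (Witt index $n$). - $B_n$: $V=\mathbb{F}_q^{2n+1}$ with a nondegenerate (parabolic) quadratic form. - ${}^2D_{n+1}$: $V=\mathbb{F}_q^{2n+2}$ with a nondegenerate elliptic quadratic form (Witt index $n$). A $t$-Steiner system in a polar space $\mathcal{P}$ of rank $n$ is a set $Y$ of generators of $\mathcal{P}$ such that every totally isotropic $t$-dimensional subspace of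 $V$ is contained in exactly one member of $Y$. *)

theory Defs
  imports "HOL-Analysis.Cartesian_Space" "HOL-Number_Theory.Prime_Powers"
begin

definition bilinear_form :: "('a::field ^ 'm \<Rightarrow> 'a ^ 'm \<Rightarrow> 'a) \<Rightarrow> bool" where
  "bilinear_form B \<longleftrightarrow>
     (\<forall>v. Vector_Spaces.linear (*s) (*) (\<lambda>u. B u v)) \<and>
     (\<forall>u. Vector_Spaces.linear (*s) (*) (\<lambda>v. B u v))"

definition alternating_form :: "('a::field ^ 'm \<Rightarrow> 'a ^ 'm \<Rightarrow> 'a) \<Rightarrow> bool" where
  "alternating_form B \<longleftrightarrow> bilinear_form B \<and> (\<forall>u. B u u = 0)"

text \<open>
  Over the field with \<open>q\<^sup>2\<close> elements the conjugation is \<open>x \<mapsto> x ^ q\<close>.  Conjugate-linearity in the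
  second argument follows from the two conditions below.
\<close>

definition hermitian_form :: "nat \<Rightarrow> ('a::field ^ 'm \<Rightarrow> 'a ^ 'm \<Rightarrow> 'a) \<Rightarrow> bool" where
  "hermitian_form q B \<longleftrightarrow>
     (\<forall>v. Vector_Spaces.linear (*s) (*) (\<lambda>u. B u v)) \<and>
     (\<forall>u v. B v u = B u v ^ q)"

definition nondegenerate :: "('a::field ^ 'm \<Rightarrow> 'a ^ 'm \<Rightarrow> 'a) \<Rightarrow> bool" where
  "nondegenerate B \<longleftrightarrow> (\<forall>u. (\<forall>v. B u v = 0) \<longrightarrow> u = 0)"

definition polarization :: "('a::field ^ 'm \<Rightarrow> 'a) \<Rightarrow> 'a ^ 'm \<Rightarrow> 'a ^ 'm \<Rightarrow> 'a" where
  "polarization Q u v = Q (u + v) - Q u - Q v"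

definition quadratic_form :: "('a::field ^ 'm \<Rightarrow> 'a) \<Rightarrow> bool" where
  "quadratic_form Q \<longleftrightarrow>
     (\<forall>c u. Q (c *s u) = c\<^sup>2 * Q u) \<and> bilinear_form (polarization Q)"

text \<open>
  In characteristic 2 and odd dimension the polarization always has a nonzero radical, so
  nondegeneracy of a quadratic form only asks that the radical contain no nonzero singular vector.
\<close>

definition nondegenerate_quadratic :: "('a::field ^ 'm \<Rightarrow> 'a) \<Rightarrow> bool" where
  "nondegenerate_quadratic Q \<longleftrightarrow>
     (\<forall>u. Q u = 0 \<and> (\<forall>v. polarization Q u v = 0) \<longrightarrow> u = 0)"

definition isotropic_subspaces :: "('a::field ^ 'm \<Rightarrow> 'a ^ 'm \<Rightarrow> 'a) \<Rightarrow> ('a ^ 'm) set set" where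
  "isotropic_subspaces B = {U. vec.subspace U \<and> (\<forall>u\<in>U. \<forall>v\<in>U. B u v = 0)}"

definition singular_subspaces :: "('a::field ^ 'm \<Rightarrow> 'a) \<Rightarrow> ('a ^ 'm) set set" where
  "singular_subspaces Q = {U. vec.subspace U \<and> (\<forall>u\<in>U. Q u = 0)}"

definition witt_index :: "('a::field ^ 'm \<Rightarrow> 'a) \<Rightarrow> nat" where
  "witt_index Q = Max (vec.dim ` singular_subspaces Q)"

text \<open>
  \<open>Two_A_odd\<close> and \<open>Two_A_even\<close> stand for \<open>\<^sup>2A\<close> with index \<open>2n - 1\<close> and \<open>2n\<close>, that is, Hermitian forms in
  dimension \<open>2n\<close> and \<open>2n + 1\<close>.
\<close>

datatype polar_type = Two_A_odd | Two_A_even | Type_C | Type_D | Type_B | Two_D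

text \<open>
  \<open>classical_polar_space T q n P\<close>: the set \<open>P\<close> of subspaces is the classical polar space of type \<open>T\<close>
  and rank \<open>n\<close> with parameter \<open>q\<close>.  In the Hermitian cases the underlying field has \<open>q\<^sup>2\<close> elements.
\<close>

fun classical_polar_space ::
  "polar_type \<Rightarrow> nat \<Rightarrow> nat \<Rightarrow> ('a::{field,finite} ^ 'm) set set \<Rightarrow> bool" where
  "classical_polar_space Two_A_odd q n P \<longleftrightarrow> CARD('a) = q\<^sup>2 \<and> CARD('m) = 2 * n \<and>
     (\<exists>B. hermitian_form q B \<and> nondegenerate B \<and> P = isotropic_subspaces B)"
| "classical_polar_space Two_A_even q n P \<longleftrightarrow> CARD('a) = q\<^sup>2 \<and> CARD('m) = 2 * n + 1 \<and>
     (\<exists>B. hermitian_form q B \<and> nondegenerate B \<and> P = isotropic_subspaces B)"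
| "classical_polar_space Type_C q n P \<longleftrightarrow> CARD('a) = q \<and> CARD('m) = 2 * n \<and>
     (\<exists>B. alternating_form B \<and> nondegenerate B \<and> P = isotropic_subspaces B)"
| "classical_polar_space Type_D q n P \<longleftrightarrow> CARD('a) = q \<and> CARD('m) = 2 * n \<and>
     (\<exists>Q. quadratic_form Q \<and> nondegenerate_quadratic Q \<and> witt_index Q = n \<and>
          P = singular_subspaces Q)"
| "classical_polar_space Type_B q n P \<longleftrightarrow> CARD('a) = q \<and> CARD('m) = 2 * n + 1 \<and>
     (\<exists>Q. quadratic_form Q \<and> nondegenerate_quadratic Q \<and> P = singular_subspaces Q)"
| "classical_polar_space Two_D q n P \<longleftrightarrow> CARD('a) = q \<and> CARD('m) = 2 * n + 2 \<and>
     (\<exists>Q. quadratic_form Q \<and> nondegenerate_quadratic Q \<and> witt_index Q = n \<and>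
          P = singular_subspaces Q)"

definition generators :: "('a::field ^ 'm) set set \<Rightarrow> ('a ^ 'm) set set" where
  "generators P = {U \<in> P. \<forall>W\<in>P. U \<subseteq> W \<longrightarrow> W = U}"

definition steiner_system ::
  "nat \<Rightarrow> ('a::field ^ 'm) set set \<Rightarrow> ('a ^ 'm) set set \<Rightarrow> bool" where
  "steiner_system t P Y \<longleftrightarrow>
     Y \<subseteq> generators P \<and> (\<forall>U\<in>P. vec.dim U = t \<longrightarrow> (\<exists>!W. W \<in> Y \<and> U \<subseteq> W))"

end

theory Submission
  imports Defs "HOL-Computational_Algebra.Polynomial"
begin

text \<open>
  Passing to the residue of a subspace of dimension \<open>t - 2\<close> or \<open>t - 3\<close> reduces everything to \<open>t = 2\<close> and
  \<open>t = 3\<close>.  Fix a member \<open>U\<close> of the system.  The design equations express the number of members meeting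
  \<open>U\<close> in a given dimension through few unknowns.  On the totally isotropic subspaces of dimension \<open>n\<close> or
  \<open>n - 1\<close>, the function \<open>S \<mapsto> (-1/y)\<close> to the power \<open>k - dim (S \<inter> U)\<close> sums to zero over the subspaces
  through a fixed one of codimension one, for a suitable \<open>y\<close>; it generates an eigenspace of the
  association scheme, and positive semidefiniteness of the projection to it is a linear inequality for
  the intersection numbers.  It excludes \<open>t = 2\<close> for even rank, \<open>t = 3\<close> for even rank at least \<open>6\<close>, and for
  \<open>E \<le> Q\<close> also \<open>t = 2\<close> for odd rank at least \<open>5\<close>.

  Rank 3 with \<open>1 < E \<le> Q\<close> and rank 4 with \<open>t = 3\<close> over the field with four elements need a finer
  inequality, which lives on the generators opposite to a fixed member: there one projects the indicator
  function of the system to the functions with vanishing sums over the opposite generators through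
  each subspace of dimension \<open>n - 1\<close>.

  For \<open>\<^sup>2D\<close> with \<open>q = 2\<close> the rank 3 residue is the elliptic quadric in projective dimension 7 over the
  field with two elements.  Two disjoint members span a hyperbolic quadric, which fixes coordinates up
  to a small group, and a case analysis shows that they cannot be completed to a Steiner system.
\<close>

section \<open>Counting subspaces over a finite field\<close>

text \<open>The type of the space enters only through the field size Q and the number E + 1 of
  generators through a hyperplane of a generator. For \<open>E = 1\<close> the design equations
  alone would give a negative number of disjoint members. The two surviving families have E = q^3
  with Q = q^2, and E = Q^2; both satisfy E \<le> Q^2, the bound that the linear inequalities can
  absorb.

  The sign of the kernel alternates with the rank, so each of the levels n and n - 1 is decisive for
  one parity only; hence two levels, and hence odd rank with t = 2 can survive. The residues of
  dimension t - 2 and t - 3 have ranks n - t + 2 and n - t + 3, and excluding even rank in both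
  leaves t = 2 with n odd, or t = n - 1.

  In rank 3 the estimate on opposite generators has the sign of (E + Q)(E - Q - 1), so it ends
  exactly at E = Q. Thus E = 8, Q = 4 and E = 4, Q = 2 need arguments of their own: the former one
  rank higher and seen from a generator outside the system, the latter by a finite search.\<close>

lemma card_subspace:
  fixes U :: "('a::{field,finite} ^ 'm) set"
  assumes "vec.subspace U"
  shows "card U = CARD('a) ^ vec.dim U"
proof -
  obtain B where B: "B \<subseteq> U" "vec.independent B" "U \<subseteq> vec.span B" "card B = vec.dim U"
    using vec.basis_exists by metis
  have fB: "finite B" by simp
  have sp: "vec.span B = U"
    using B assms by (metis vec.span_minimal subset_antisym)
  let ?f = "\<lambda>c. \<Sum>b\<in>B. c b *s b"
  have img: "?f ` (B \<rightarrow>\<^sub>E UNIV) = U"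
  proof
    have "?f c \<in> U" for c
      using B(1) assms by (intro vec.subspace_sum vec.subspace_scale) auto
    then show "?f ` (B \<rightarrow>\<^sub>E UNIV) \<subseteq> U" by blast
    show "U \<subseteq> ?f ` (B \<rightarrow>\<^sub>E UNIV)"
    proof
      fix u assume "u \<in> U"
      then have "u \<in> vec.span B" using sp by simp
      then obtain c where c: "u = (\<Sum>b\<in>B. c b *s b)"
        unfolding vec.span_finite[OF fB] by auto
      have "u = ?f (restrict c B)" unfolding c by (intro sum.cong) auto
      then show "u \<in> ?f ` (B \<rightarrow>\<^sub>E UNIV)" by (rule image_eqI[of _ ?f]) (auto simp: PiE_def extensional_def)
    qed
  qed
  have inj: "inj_on ?f (B \<rightarrow>\<^sub>E UNIV)"
  proof (rule inj_onI)
    fix c d assume cd: "c \<in> B \<rightarrow>\<^sub>E UNIV" "d \<in> B \<rightarrow>\<^sub>E UNIV" "?f c = ?f d"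
    have "(\<Sum>b\<in>B. (c b - d b) *s b) = 0"
      using cd(3) by (simp add: vec.scale_left_diff_distrib sum_subtractf)
    then have "\<forall>b\<in>B. c b - d b = 0"
      using vec.independentD[OF B(2) fB subset_refl, of "\<lambda>b. c b - d b"] by (intro ballI)
    then have "\<forall>b\<in>B. c b = d b" by simp
    then show "c = d" using cd(1,2) by (intro PiE_ext) auto
  qed
  have "card U = card (B \<rightarrow>\<^sub>E (UNIV :: 'a set))"
    using card_image[OF inj] img by simp
  also have "\<dots> = CARD('a) ^ card B" by (simp add: card_PiE[OF fB])
  finally show ?thesis using B(4) by simp
qed

lemma CARD_field_gt_1: "1 < CARD('a::{field,finite})"
proof -
  have "card {0, 1 :: 'a} \<le> CARD('a)" by (rule card_mono) auto
  then show ?thesis by simp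
qed

lemma span_Un_subspaces:
  fixes U W :: "('a::field ^ 'm) set"
  assumes "vec.subspace U" "vec.subspace W"
  shows "vec.span (U \<union> W) = {x + y |x y. x \<in> U \<and> y \<in> W}"
proof -
  have "vec.span U = U" "vec.span W = W" using assms by (auto simp: vec.span_eq_iff)
  then show ?thesis by (simp only: vec.span_Un)
qed

text \<open>Addition maps \<open>U \<times> W\<close> onto the span with all fibres of size
  \<open>card (U \<inter> W)\<close>; the dimensions are the exponents in the resulting identity of
  cardinalities.\<close>

lemma dim_span_Un:
  fixes U W :: "('a::{field,finite} ^ 'm) set"
  assumes U: "vec.subspace U" and W: "vec.subspace W"
  shows "vec.dim (vec.span (U \<union> W)) + vec.dim (U \<inter> W) = vec.dim U + vec.dim W"
proof -
  let ?S = "vec.span (U \<union> W)"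
  have UW: "vec.subspace (U \<inter> W)" using assms vec.subspace_inter by blast
  let ?f = "\<lambda>(x, y). x + (y :: 'a ^ 'm)"
  have img: "?f ` (U \<times> W) = ?S" unfolding span_Un_subspaces[OF U W] by auto
  have fib: "card {p \<in> U \<times> W. ?f p = s} = card (U \<inter> W)" if s: "s \<in> ?S" for s
  proof -
    obtain x y where xy: "x \<in> U" "y \<in> W" "s = x + y"
      using s unfolding span_Un_subspaces[OF U W] by auto
    have "bij_betw (\<lambda>z. (x + z, y - z)) (U \<inter> W) {p \<in> U \<times> W. ?f p = s}"
    proof (rule bij_betwI[where g = "\<lambda>p. fst p - x"])
      show "(\<lambda>z. (x + z, y - z)) \<in> U \<inter> W \<rightarrow> {p \<in> U \<times> W. ?f p = s}"
        using xy U W by (auto intro: vec.subspace_add vec.subspace_diff)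
      show "(\<lambda>p. fst p - x) \<in> {p \<in> U \<times> W. ?f p = s} \<rightarrow> U \<inter> W"
      proof (clarsimp simp: xy, intro conjI)
        fix a b assume ab: "a \<in> U" "b \<in> W" "a + b = x + y"
        show "a - x \<in> U" using ab xy U by (auto intro: vec.subspace_diff)
        have "a - x = y - b" using ab(3) by (simp add: algebra_simps eq_diff_eq diff_eq_eq)
        then show "a - x \<in> W" using ab xy W by (auto intro: vec.subspace_diff)
      qed
    qed (auto simp: xy algebra_simps)
    from bij_betw_same_card[OF this] show ?thesis by (rule sym)
  qed
  have "card (U \<times> W) = (\<Sum>p\<in>U \<times> W. 1)" by simp
  also have "\<dots> = (\<Sum>s\<in>?f ` (U \<times> W). \<Sum>p\<in>{p \<in> U \<times> W. ?f p = s}. 1)"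
    by (rule sum.image_gen) simp
  also have "\<dots> = (\<Sum>s\<in>?S. card {p \<in> U \<times> W. ?f p = s})" unfolding img by simp
  also have "\<dots> = card ?S * card (U \<inter> W)" using fib by simp
  finally have "card ?S * card (U \<inter> W) = card U * card W" by (simp add: card_cartesian_product)
  then have "CARD('a) ^ (vec.dim ?S + vec.dim (U \<inter> W)) = CARD('a) ^ (vec.dim U + vec.dim W)"
    using card_subspace[OF vec.subspace_span, of "U \<union> W"] card_subspace[OF UW] card_subspace[OF U]
      card_subspace[OF W] by (simp add: power_add)
  then show ?thesis using CARD_field_gt_1[where 'a = 'a] power_inject_exp by blast
qed

lemma subspace_dim_eq:
  fixes U W :: "('a::field ^ 'm) set"
  assumes "vec.subspace U" "vec.subspace W" "U \<subseteq> W" "vec.dim W \<le> vec.dim U"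
  shows "U = W"
  using assms vec.subspace_dim_equal by blast

lemma dim_span_insert:
  fixes U :: "('a::field ^ 'm) set"
  assumes "vec.subspace U" "x \<notin> U"
  shows "vec.dim (vec.span (insert x U)) = vec.dim U + 1"
proof -
  have "vec.span U = U" using assms by (auto simp: vec.span_eq_iff)
  then have "x \<notin> vec.span U" using assms(2) by metis
  then show ?thesis by (simp only: vec.dim_span vec.dim_insert if_False)
qed

lemma span_insert_eq:
  fixes U :: "('a::field ^ 'm) set"
  assumes "vec.subspace U"
  shows "vec.span (insert x U) = {c *s x + u |c u. u \<in> U}"
proof -
  have "vec.span (insert x U) = vec.span ({x} \<union> U)" by simp
  also have "\<dots> = {a + b |a b. a \<in> vec.span {x} \<and> b \<in> vec.span U}" by (rule vec.span_Un)
  moreover have "vec.span U = U" using assms by (auto simp: vec.span_eq_iff)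
  ultimately show ?thesis by (auto simp: vec.span_singleton)
qed

lemma subspace_eq_span_insert:
  fixes U W :: "('a::field ^ 'm) set"
  assumes "vec.subspace U" "vec.subspace W" "U \<subseteq> W" "vec.dim W = vec.dim U + 1" "x \<in> W" "x \<notin> U"
  shows "W = vec.span (insert x U)"
  using subspace_dim_eq[OF vec.subspace_span assms(2), of "insert x U"]
    dim_span_insert[OF assms(1,6)] assms vec.span_minimal[of "insert x U" W] by auto

lemma dim_le_subspace:
  fixes U W :: "('a::field ^ 'm) set"
  shows "U \<subseteq> W \<Longrightarrow> vec.dim U \<le> vec.dim W"
  by (rule vec.dim_subset)

section \<open>Gaussian numbers (q^k - 1)/(q - 1) and intervals of the subspace lattice\<close>

definition gnum :: "nat \<Rightarrow> nat \<Rightarrow> nat" where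
  "gnum q k = (\<Sum>i<k. q ^ i)"

lemma gnum_0 [simp]: "gnum q 0 = 0" and gnum_1 [simp]: "gnum q (Suc 0) = 1"
  by (simp_all add: gnum_def)

lemma gnum_Suc: "gnum q (Suc k) = gnum q k + q ^ k"
  by (simp add: gnum_def)

lemma gnum_Suc': "gnum q (Suc k) = 1 + q * gnum q k"
proof (induction k)
  case (Suc k)
  have "gnum q (Suc (Suc k)) = gnum q (Suc k) + q * q ^ k" by (simp add: gnum_Suc)
  also have "\<dots> = 1 + q * (gnum q k + q ^ k)" by (simp add: Suc algebra_simps)
  finally show ?case by (simp add: gnum_Suc)
qed simp

lemma gnum_pos: "k > 0 \<Longrightarrow> gnum q k > 0"
  by (cases k) (simp_all add: gnum_Suc')

lemma gnum_mult: "q > 0 \<Longrightarrow> (q - 1) * gnum q k = q ^ k - 1"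
proof (induction k)
  case (Suc k)
  have "(q - 1) * gnum q (Suc k) = (q ^ k - 1) + (q - 1) * q ^ k"
    using Suc by (simp add: gnum_Suc algebra_simps)
  also have "\<dots> = q * q ^ k - 1"
    using Suc.prems by (simp add: diff_mult_distrib)
  finally show ?case by simp
qed simp

definition covers_above where
  "covers_above A B = {S. vec.subspace S \<and> A \<subseteq> S \<and> S \<subseteq> B \<and> vec.dim S = vec.dim A + 1}"

definition covers_below where
  "covers_below A B = {S. vec.subspace S \<and> A \<subseteq> S \<and> S \<subseteq> B \<and> vec.dim S + 1 = vec.dim B}"

text \<open>The sets \<open>S - A\<close> partition \<open>B - A\<close> into blocks of equal
  size.\<close>

lemma card_covers_above:
  fixes A B :: "('a::{field,finite} ^ 'm) set"
  assumes A: "vec.subspace A" and B: "vec.subspace B" and AB: "A \<subseteq> B"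
  shows "card (covers_above A B) = gnum CARD('a) (vec.dim B - vec.dim A)"
proof -
  let ?q = "CARD('a)" let ?a = "vec.dim A" let ?b = "vec.dim B"
  let ?C = "covers_above A B"
  have ab: "?a \<le> ?b" using AB by (rule dim_le_subspace)
  have U: "(\<Union>S\<in>?C. S - A) = B - A"
  proof
    show "B - A \<subseteq> (\<Union>S\<in>?C. S - A)"
    proof
      fix x assume x: "x \<in> B - A"
      have "vec.span (insert x A) \<in> ?C"
        using x A B AB dim_span_insert[OF A, of x] vec.span_minimal[of "insert x A" B]
        by (auto simp: covers_above_def intro: vec.span_base)
      moreover have "x \<in> vec.span (insert x A)" by (simp add: vec.span_base)
      ultimately show "x \<in> (\<Union>S\<in>?C. S - A)" using x by blast
    qed
  qed (auto simp: covers_above_def)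
  have disj: "\<forall>S\<in>?C. \<forall>T\<in>?C. S \<noteq> T \<longrightarrow> (S - A) \<inter> (T - A) = {}"
  proof (intro ballI impI)
    fix S T assume ST: "S \<in> ?C" "T \<in> ?C" "S \<noteq> T"
    show "(S - A) \<inter> (T - A) = {}"
    proof (rule ccontr)
      assume "(S - A) \<inter> (T - A) \<noteq> {}"
      then obtain x where x: "x \<in> S" "x \<in> T" "x \<notin> A" by auto
      have "S' = vec.span (insert x A)" if "S' \<in> ?C" "x \<in> S'" for S'
        using that A x(3) subspace_eq_span_insert[of A S' x] by (simp add: covers_above_def)
      then show False using ST x by metis
    qed
  qed
  have c1: "card (S - A) = ?q ^ ?a * (?q - 1)" if "S \<in> ?C" for S
    unfolding mult.commute[of "?q ^ ?a"] using that card_subspace[OF A] card_subspace[of S]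
    by (auto simp: covers_above_def card_Diff_subset diff_mult_distrib)
  have "card (B - A) = (\<Sum>S\<in>?C. card (S - A))"
    unfolding U[symmetric] by (rule card_UN_disjoint) (use disj in auto)
  also have "\<dots> = card ?C * (?q ^ ?a * (?q - 1))" using c1 by simp
  finally have "card ?C * (?q ^ ?a * (?q - 1)) = ?q ^ ?b - ?q ^ ?a"
    using card_subspace[OF A] card_subspace[OF B] AB by (simp add: card_Diff_subset)
  also have "\<dots> = ?q ^ ?a * (?q ^ (?b - ?a) - 1)"
    using ab by (simp add: diff_mult_distrib2 flip: power_add)
  also have "\<dots> = ?q ^ ?a * ((?q - 1) * gnum ?q (?b - ?a))"
    by (subst gnum_mult) simp_all
  finally have "(?q ^ ?a * (?q - 1)) * card ?C = (?q ^ ?a * (?q - 1)) * gnum ?q (?b - ?a)"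
    by (simp add: algebra_simps)
  moreover have "?q ^ ?a * (?q - 1) \<noteq> 0" using CARD_field_gt_1[where 'a = 'a] by simp
  ultimately show ?thesis by (metis mult_left_cancel)
qed

lemma double_count:
  assumes "finite A" "finite B"
  shows "(\<Sum>x\<in>A. card {y \<in> B. R x y}) = (\<Sum>y\<in>B. card {x \<in> A. R x y})"
proof -
  have "(\<Sum>x\<in>A. card {y \<in> B. R x y}) = (\<Sum>x\<in>A. \<Sum>y\<in>B. if R x y then 1 else 0)"
    using assms by (intro sum.cong) (auto simp: sum.If_cases Collect_conj_eq Int_commute)
  also have "\<dots> = (\<Sum>y\<in>B. \<Sum>x\<in>A. if R x y then 1 else 0)" by (rule sum.swap)
  also have "\<dots> = (\<Sum>y\<in>B. card {x \<in> A. R x y})"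
    using assms by (intro sum.cong) (auto simp: sum.If_cases Collect_conj_eq Int_commute)
  finally show ?thesis .
qed

definition subs_between where
  "subs_between A B k = {S. vec.subspace S \<and> A \<subseteq> S \<and> S \<subseteq> B \<and> vec.dim S = vec.dim A + k}"

lemma card_subs_between_step:
  fixes A B :: "('a::{field,finite} ^ 'm) set"
  assumes A: "vec.subspace A" and B: "vec.subspace B" and AB: "A \<subseteq> B"
    and below: "\<And>T. T \<in> subs_between A B (Suc k) \<Longrightarrow> card (covers_below A T) = c"
  shows "card (subs_between A B k) * gnum CARD('a) (vec.dim B - vec.dim A - k)
       = card (subs_between A B (Suc k)) * c"
proof -
  let ?X = "subs_between A B k" and ?Y = "subs_between A B (Suc k)"
  have "(\<Sum>S\<in>?X. card {T \<in> ?Y. S \<subseteq> T}) = (\<Sum>T\<in>?Y. card {S \<in> ?X. S \<subseteq> T})"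
    by (rule double_count) auto
  moreover have "card {T \<in> ?Y. S \<subseteq> T} = gnum CARD('a) (vec.dim B - vec.dim A - k)" if "S \<in> ?X" for S
  proof -
    have "{T \<in> ?Y. S \<subseteq> T} = covers_above S B"
      using that by (auto simp: subs_between_def covers_above_def)
    then show ?thesis using card_covers_above[of S B] that B by (simp add: subs_between_def)
  qed
  moreover have "card {S \<in> ?X. S \<subseteq> T} = c" if "T \<in> ?Y" for T
  proof -
    have "{S \<in> ?X. S \<subseteq> T} = covers_below A T"
      using that by (auto simp: subs_between_def covers_below_def)
    then show ?thesis using below[OF that] by simp
  qed
  ultimately show ?thesis by simp
qed

lemma subs_between_full:
  assumes "vec.subspace B" "A \<subseteq> B" "vec.dim B = vec.dim A + k"
  shows "subs_between A B k = {B}"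
proof -
  have "S = B" if "vec.subspace S" "S \<subseteq> B" "vec.dim S = vec.dim A + k" for S
    using subspace_dim_eq[OF that(1) assms(1) that(2)] that(3) assms(3) by simp
  then show ?thesis using assms unfolding subs_between_def by blast
qed

lemma subs_between_0:
  assumes "vec.subspace A" "A \<subseteq> B"
  shows "subs_between A B 0 = {A}"
proof -
  have "S = A" if "vec.subspace S" "A \<subseteq> S" "vec.dim S = vec.dim A + 0" for S
    using subspace_dim_eq[OF assms(1) that(1,2)] that(3) by simp
  then show ?thesis using assms unfolding subs_between_def by auto
qed

text \<open>Duality is replaced by double counting: in the interval from A to B every minimal and
  every maximal proper element is incident with \<open>gnum q c\<close> of the other kind, by
  induction and by \<open>card_covers_above\<close>, so there are equally many of both.\<close>

lemma card_covers_below_aux: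
  fixes A B :: "('a::{field,finite} ^ 'm) set"
  assumes "vec.subspace A" "vec.subspace B" "A \<subseteq> B" "vec.dim B - vec.dim A = c"
  shows "card (covers_below A B) = gnum CARD('a) c"
  using assms
proof (induction c arbitrary: A)
  case 0
  then have "vec.dim B \<le> vec.dim A" by simp
  then have "covers_below A B = {}" by (auto simp: covers_below_def dest: dim_le_subspace)
  then show ?case by simp
next
  case (Suc c)
  show ?case
  proof (cases "c = 0")
    case True
    then have "vec.dim B = vec.dim A + 1" using Suc.prems by simp
    moreover have "S = A" if "vec.subspace S" "A \<subseteq> S" "vec.dim S + 1 = vec.dim B" for S
      using subspace_dim_eq[OF Suc.prems(1) that(1,2)] that(3) \<open>vec.dim B = vec.dim A + 1\<close> by simp
    ultimately have "covers_below A B = {A}"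
      using Suc.prems unfolding covers_below_def by auto
    then show ?thesis using True by simp
  next
    case False
    let ?q = "CARD('a)"
    let ?X = "covers_above A B" and ?Y = "covers_below A B"
    have "(\<Sum>S\<in>?X. card {T \<in> ?Y. S \<subseteq> T}) = (\<Sum>T\<in>?Y. card {S \<in> ?X. S \<subseteq> T})"
      by (rule double_count) auto
    moreover have "card {T \<in> ?Y. S \<subseteq> T} = gnum ?q c" if "S \<in> ?X" for S
    proof -
      have "{T \<in> ?Y. S \<subseteq> T} = covers_below S B"
        using that by (auto simp: covers_above_def covers_below_def)
      then show ?thesis using Suc.IH[of S] that Suc.prems by (auto simp: covers_above_def)
    qed
    moreover have "card {S \<in> ?X. S \<subseteq> T} = gnum ?q c" if "T \<in> ?Y" for T
    proof -
      have "{S \<in> ?X. S \<subseteq> T} = covers_above A T"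
        using that by (auto simp: covers_above_def covers_below_def)
      moreover have "vec.dim T - vec.dim A = c" using that Suc.prems by (auto simp: covers_below_def)
      ultimately show ?thesis
        using card_covers_above[of A T] that Suc.prems by (auto simp: covers_below_def)
    qed
    ultimately have "card ?X * gnum ?q c = card ?Y * gnum ?q c" by simp
    then have "card ?Y = card ?X" using gnum_pos[of c ?q] False by simp
    then show ?thesis using card_covers_above[of A B] Suc.prems by simp
  qed
qed

lemma card_covers_below:
  fixes A B :: "('a::{field,finite} ^ 'm) set"
  assumes "vec.subspace A" "vec.subspace B" "A \<subseteq> B"
  shows "card (covers_below A B) = gnum CARD('a) (vec.dim B - vec.dim A)"
  using card_covers_below_aux[OF assms refl] .

lemma card_subs_between_Suc:
  fixes A B :: "('a::{field,finite} ^ 'm) set"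
  assumes A: "vec.subspace A" and B: "vec.subspace B" and AB: "A \<subseteq> B"
  shows "card (subs_between A B k) * gnum CARD('a) (vec.dim B - vec.dim A - k)
       = card (subs_between A B (Suc k)) * gnum CARD('a) (Suc k)"
proof (rule card_subs_between_step[OF A B AB])
  fix T assume "T \<in> subs_between A B (Suc k)"
  then show "card (covers_below A T) = gnum CARD('a) (Suc k)"
    using card_covers_below[OF A, of T] by (auto simp: subs_between_def)
qed

text \<open>The Gaussian binomial coefficient, real-valued so that the recursion may divide.
  Truncated subtraction makes it vanish for k > c.\<close>

fun gbinom :: "nat \<Rightarrow> nat \<Rightarrow> nat \<Rightarrow> real" where
  "gbinom q c 0 = 1"
| "gbinom q c (Suc k) = gbinom q c k * gnum q (c - k) / gnum q (Suc k)"

lemma card_subs_between: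
  fixes A B :: "('a::{field,finite} ^ 'm) set"
  assumes A: "vec.subspace A" and B: "vec.subspace B" and AB: "A \<subseteq> B"
  shows "real (card (subs_between A B k)) = gbinom CARD('a) (vec.dim B - vec.dim A) k"
proof (induction k)
  case 0
  then show ?case using subs_between_0[OF A AB] by simp
next
  case (Suc k)
  have "gnum CARD('a) (Suc k) > 0" by (rule gnum_pos) simp
  moreover have "real (card (subs_between A B k)) * gnum CARD('a) (vec.dim B - vec.dim A - k)
       = real (card (subs_between A B (Suc k))) * gnum CARD('a) (Suc k)"
    using card_subs_between_Suc[OF assms, of k] by (metis of_nat_mult)
  ultimately show ?case using Suc by (simp add: field_simps)
qed

section \<open>Polar spaces\<close>

text \<open>Only the zero relation of the form is kept. \<open>perp_codim\<close> records that
  orthogonality to one vector is a single linear condition.\<close>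

locale perp_space =
  fixes perp :: "'a::{field,finite} ^ 'm \<Rightarrow> 'a ^ 'm \<Rightarrow> bool"
  assumes perp_sym: "perp x y \<Longrightarrow> perp y x"
    and perp_subspace: "vec.subspace {y. perp x y}"
    and perp_codim: "vec.subspace C \<Longrightarrow> vec.dim C \<le> vec.dim (C \<inter> {y. perp x y}) + 1"
begin

definition orth :: "('a ^ 'm) set \<Rightarrow> ('a ^ 'm) set" where
  "orth A = {y. \<forall>x\<in>A. perp x y}"

lemma orthI: "(\<And>x. x \<in> A \<Longrightarrow> perp x y) \<Longrightarrow> y \<in> orth A"
  by (simp add: orth_def)

lemma orthD: "y \<in> orth A \<Longrightarrow> x \<in> A \<Longrightarrow> perp x y"
  by (simp add: orth_def)

lemma subspace_orth: "vec.subspace (orth A)"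
proof -
  have "orth A = \<Inter> ((\<lambda>x. {y. perp x y}) ` A)" by (auto simp: orth_def)
  then show ?thesis by (metis (mono_tags, lifting) imageE perp_subspace vec.subspace_Inter)
qed

lemma orth_anti: "A \<subseteq> B \<Longrightarrow> orth B \<subseteq> orth A"
  by (auto simp: orth_def)

lemma subset_orth_sym: "A \<subseteq> orth B \<Longrightarrow> B \<subseteq> orth A"
  by (auto simp: orth_def intro: perp_sym)

lemma orth_Un: "orth (A \<union> B) = orth A \<inter> orth B"
  by (auto simp: orth_def)

lemma orth_span: "orth (vec.span A) = orth A"
proof
  show "orth (vec.span A) \<subseteq> orth A" by (intro orth_anti vec.span_superset)
  have "vec.span A \<subseteq> orth (orth A)"
    by (rule vec.span_minimal[OF subset_orth_sym[OF subset_refl] subspace_orth])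
  then show "orth A \<subseteq> orth (vec.span A)" by (rule subset_orth_sym)
qed

lemma dim_le_orth_card:
  assumes C: "vec.subspace C" and X: "finite X"
  shows "vec.dim C \<le> vec.dim (C \<inter> orth X) + card X"
  using X
proof (induction X)
  case empty
  then show ?case by (simp add: orth_def)
next
  case (insert x X)
  have "vec.subspace (C \<inter> orth X)" using C subspace_orth vec.subspace_inter by blast
  from perp_codim[OF this, of x]
  have "vec.dim (C \<inter> orth X) \<le> vec.dim ((C \<inter> orth X) \<inter> {y. perp x y}) + 1" .
  moreover have "(C \<inter> orth X) \<inter> {y. perp x y} = C \<inter> orth (insert x X)" by (auto simp: orth_def)
  ultimately show ?case using insert by simp
qed

text \<open>Extend a basis of \<open>A \<inter> orth C\<close> to a basis of A: only the added
  vectors impose conditions on C, each at most one. Exchanging A and C turns the estimate into the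
  equality \<open>dim_pairing\<close>.\<close>

lemma dim_pairing_le:
  assumes A: "vec.subspace A" and C: "vec.subspace C"
  shows "vec.dim C + vec.dim (A \<inter> orth C) \<le> vec.dim (C \<inter> orth A) + vec.dim A"
proof -
  let ?A0 = "A \<inter> orth C"
  obtain B0 where B0: "B0 \<subseteq> ?A0" "vec.independent B0" "?A0 \<subseteq> vec.span B0" "card B0 = vec.dim ?A0"
    using vec.basis_exists by metis
  obtain B where B: "B0 \<subseteq> B" "B \<subseteq> A" "vec.independent B" "A \<subseteq> vec.span B"
    using vec.maximal_independent_subset_extend[of B0 A] B0 by auto
  have cB: "card B = vec.dim A" using vec.basis_card_eq_dim B by blast
  let ?X = "B - B0"
  have X: "card ?X + vec.dim ?A0 = vec.dim A"
    using cB B0(4) B(1) by (metis card_Diff_subset card_mono finite le_add_diff_inverse2)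
  have "C \<inter> orth ?X \<subseteq> orth B"
  proof
    fix y assume y: "y \<in> C \<inter> orth ?X"
    show "y \<in> orth B"
    proof (rule orthI)
      fix x assume "x \<in> B"
      then consider "x \<in> orth C" | "x \<in> ?X" using B0(1) by blast
      then show "perp x y"
      proof cases
        case 1
        then have "perp y x" using orthD y by blast
        then show ?thesis by (rule perp_sym)
      next
        case 2
        then show ?thesis using orthD y by blast
      qed
    qed
  qed
  moreover have "orth B \<subseteq> orth A" using B(4) orth_anti orth_span by metis
  ultimately have "C \<inter> orth ?X \<subseteq> C \<inter> orth A" by blast
  then have "vec.dim (C \<inter> orth ?X) \<le> vec.dim (C \<inter> orth A)" by (rule dim_le_subspace)
  moreover have "vec.dim C \<le> vec.dim (C \<inter> orth ?X) + card ?X"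
    by (rule dim_le_orth_card[OF C]) simp
  ultimately show ?thesis using X by linarith
qed

lemma dim_pairing:
  assumes "vec.subspace A" "vec.subspace C"
  shows "vec.dim C + vec.dim (A \<inter> orth C) = vec.dim (C \<inter> orth A) + vec.dim A"
  using dim_pairing_le[OF assms] dim_pairing_le[OF assms(2,1)] by linarith

end

text \<open>The predicate \<open>sing\<close> unifies the three kinds of forms: vanishing of a
  quadratic form, isotropy for a Hermitian form, and the constant True for an alternating
  form.\<close>

locale singular_space = perp_space perp
  for perp :: "'a::{field,finite} ^ 'm \<Rightarrow> 'a ^ 'm \<Rightarrow> bool" +
  fixes sing :: "'a ^ 'm \<Rightarrow> bool"
  assumes sing_0: "sing 0"
    and sing_scale: "sing x \<Longrightarrow> sing (c *s x)"
    and sing_add: "sing x \<Longrightarrow> sing y \<Longrightarrow> perp x y \<Longrightarrow> sing (x + y)"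
    and sing_perp: "sing x \<Longrightarrow> perp x x"
begin

definition PP :: "('a ^ 'm) set set" where
  "PP = {U. vec.subspace U \<and> (\<forall>u\<in>U. sing u) \<and> U \<subseteq> orth U}"

lemma PP_subspace: "U \<in> PP \<Longrightarrow> vec.subspace U"
  and PP_sing: "U \<in> PP \<Longrightarrow> u \<in> U \<Longrightarrow> sing u"
  and PP_orth: "U \<in> PP \<Longrightarrow> U \<subseteq> orth U"
  by (auto simp: PP_def)

lemma zero_PP: "{0} \<in> PP"
  using sing_perp[OF sing_0] by (simp add: PP_def sing_0 orth_def)

lemma PP_perp: "U \<in> PP \<Longrightarrow> u \<in> U \<Longrightarrow> v \<in> U \<Longrightarrow> perp u v"
  using PP_orth orthD by blast

lemma PP_down: "U \<in> PP \<Longrightarrow> vec.subspace W \<Longrightarrow> W \<subseteq> U \<Longrightarrow> W \<in> PP"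
  unfolding PP_def orth_def by blast

lemma PP_Int: "U \<in> PP \<Longrightarrow> vec.subspace W \<Longrightarrow> U \<inter> W \<in> PP"
  by (rule PP_down[of U]) (auto intro: vec.subspace_inter PP_subspace)

lemma PP_span_Un:
  assumes S: "S \<in> PP" and T: "T \<in> PP" and ST: "S \<subseteq> orth T"
  shows "vec.span (S \<union> T) \<in> PP"
proof -
  have TS: "T \<subseteq> orth S" using ST by (rule subset_orth_sym)
  have "S \<union> T \<subseteq> orth (S \<union> T)" using ST TS S T PP_orth by (auto simp: orth_Un)
  then have "vec.span (S \<union> T) \<subseteq> orth (vec.span (S \<union> T))"
    unfolding orth_span by (intro vec.span_minimal subspace_orth)
  moreover have "sing u" if u: "u \<in> vec.span (S \<union> T)" for u
  proof -
    obtain x y where "u = x + y" "x \<in> S" "y \<in> T"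
      using u span_Un_subspaces[OF PP_subspace[OF S] PP_subspace[OF T]] by blast
    then show ?thesis using PP_sing[OF S] PP_sing[OF T] TS orthD sing_add by blast
  qed
  ultimately show ?thesis by (simp add: PP_def)
qed

lemma PP_insert:
  assumes U: "U \<in> PP" and x: "sing x" "x \<in> orth U"
  shows "vec.span (insert x U) \<in> PP"
proof -
  have "x \<in> orth {x}" using sing_perp[OF x(1)] by (simp add: orth_def)
  moreover have "U \<subseteq> orth {x}" using x(2) by (auto simp: orth_def intro: perp_sym)
  ultimately have "insert x U \<subseteq> orth (insert x U)"
    using PP_orth[OF U] x(2) by (auto simp: orth_def)
  then have "vec.span (insert x U) \<subseteq> orth (vec.span (insert x U))"
    unfolding orth_span by (intro vec.span_minimal subspace_orth)
  moreover have "sing u" if u: "u \<in> vec.span (insert x U)" for u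
  proof -
    obtain c y where cy: "u = c *s x + y" "y \<in> U"
      using u span_insert_eq[OF PP_subspace[OF U]] by blast
    have "perp y x" using cy(2) x(2) orthD by blast
    then have "c *s x \<in> {z. perp y z}" using vec.subspace_scale[OF perp_subspace] by blast
    then have "perp (c *s x) y" using perp_sym by blast
    then show ?thesis unfolding cy(1) by (intro sing_add sing_scale x(1) PP_sing[OF U cy(2)])
  qed
  ultimately show ?thesis by (simp add: PP_def)
qed

end

text \<open>
  Over a field with \<open>Q\<close> elements the parameter \<open>E\<close> is \<open>1\<close> for \<open>D\<^sub>n\<close>, \<open>Q\<close> for \<open>B\<^sub>n\<close> and \<open>C\<^sub>n\<close>, and \<open>Q\<^sup>2\<close> for
  \<open>\<^sup>2D\<close>.  For \<open>Q = q\<^sup>2\<close> and a Hermitian form it is \<open>q\<close> in even and \<open>q\<^sup>3\<close> in odd dimension.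
\<close>

locale polar_space = singular_space perp sing
  for perp :: "'a::{field,finite} ^ 'm \<Rightarrow> 'a ^ 'm \<Rightarrow> bool" and sing +
  fixes n E :: nat
  assumes gen_ex: "U \<in> PP \<Longrightarrow> \<exists>G\<in>PP. U \<subseteq> G \<and> vec.dim G = n"
    and PP_dim_le: "U \<in> PP \<Longrightarrow> vec.dim U \<le> n"
    and gen_count: "S \<in> PP \<Longrightarrow> vec.dim S + 1 = n \<Longrightarrow> card {G \<in> PP. vec.dim G = n \<and> S \<subseteq> G} = E + 1"
begin

definition gens :: "('a ^ 'm) set set" where
  "gens = {G \<in> PP. vec.dim G = n}"

lemma gens_PP: "G \<in> gens \<Longrightarrow> G \<in> PP" and gens_dim: "G \<in> gens \<Longrightarrow> vec.dim G = n"
  and gens_subspace: "G \<in> gens \<Longrightarrow> vec.subspace G"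
  by (auto simp: gens_def PP_def)

lemma gen_exE: assumes "U \<in> PP" obtains G where "G \<in> gens" "U \<subseteq> G"
  using gen_ex[OF assms] by (auto simp: gens_def)

lemma gens_count: "S \<in> PP \<Longrightarrow> vec.dim S + 1 = n \<Longrightarrow> card {G \<in> gens. S \<subseteq> G} = E + 1"
  using gen_count[of S] by (simp add: gens_def conj_ac)

lemma gens_eqI: "G \<in> gens \<Longrightarrow> G' \<in> gens \<Longrightarrow> G \<subseteq> G' \<Longrightarrow> G = G'"
  using subspace_dim_eq[of G G'] by (simp add: gens_dim gens_subspace)

lemma gens_max: assumes "G \<in> gens" "sing x" "x \<in> orth G" shows "x \<in> G"
proof (rule ccontr)
  assume "x \<notin> G"
  then have "vec.dim (vec.span (insert x G)) = n + 1"
    using dim_span_insert[of G x] assms by (simp add: gens_subspace gens_dim)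
  then show False using PP_dim_le[OF PP_insert[OF gens_PP[OF assms(1)] assms(2,3)]] by simp
qed

lemma PP_Int_orth_gen: assumes "S \<in> PP" "G \<in> gens" shows "S \<inter> orth G = S \<inter> G"
proof -
  have "x \<in> G" if "x \<in> S" "x \<in> orth G" for x
    using gens_max[OF assms(2) PP_sing[OF assms(1) that(1)] that(2)] .
  then show ?thesis using PP_orth[OF gens_PP[OF assms(2)]] by blast
qed

lemma dim_gen_orth:
  assumes S: "S \<in> PP" and G: "G \<in> gens"
  shows "vec.dim (G \<inter> orth S) + vec.dim S = n + vec.dim (S \<inter> G)"
  using dim_pairing[OF PP_subspace[OF S] gens_subspace[OF G]] PP_Int_orth_gen[OF assms] gens_dim[OF G]
  by simp

text \<open>The projection of G to the residue of S: the generator through S that contains the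
  intersection with G of every totally singular subspace through S
  (\<open>Int_subset_proj\<close>).\<close>

definition proj :: "('a ^ 'm) set \<Rightarrow> ('a ^ 'm) set \<Rightarrow> ('a ^ 'm) set" where
  "proj S G = vec.span (S \<union> (G \<inter> orth S))"

lemma subspace_Int_orth: "vec.subspace G \<Longrightarrow> vec.subspace (G \<inter> orth S)"
  by (rule vec.subspace_inter[OF _ subspace_orth])

lemma proj_superset: "S \<subseteq> proj S G" and proj_superset': "G \<inter> orth S \<subseteq> proj S G"
  unfolding proj_def using vec.span_superset[of "S \<union> (G \<inter> orth S)"] by auto

lemma proj_gens:
  assumes S: "S \<in> PP" and G: "G \<in> gens"
  shows "proj S G \<in> gens"
proof -
  have GS: "G \<inter> orth S \<in> PP" using gens_PP[OF G] subspace_orth by (rule PP_Int)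
  have "S \<subseteq> orth (G \<inter> orth S)" by (rule subset_orth_sym) simp
  then have P: "proj S G \<in> PP" unfolding proj_def by (rule PP_span_Un[OF S GS])
  have "S \<inter> (G \<inter> orth S) = S \<inter> G" using PP_orth[OF S] by blast
  then have "vec.dim (proj S G) + vec.dim (S \<inter> G) = vec.dim S + vec.dim (G \<inter> orth S)"
    using dim_span_Un[OF PP_subspace[OF S] PP_subspace[OF GS]] by (simp add: proj_def)
  then have "vec.dim (proj S G) = n" using dim_gen_orth[OF assms] by simp
  then show ?thesis using P by (simp add: gens_def)
qed

lemma proj_orth: "S \<in> PP \<Longrightarrow> proj S G \<subseteq> orth S"
  unfolding proj_def by (intro vec.span_minimal subspace_orth) (use PP_orth in auto)

lemma proj_Int: "S \<in> PP \<Longrightarrow> proj S G \<inter> G = G \<inter> orth S"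
  using proj_orth[of S G] proj_superset'[of G S] by blast

lemma PP_subset_orth: "W \<in> PP \<Longrightarrow> S \<subseteq> W \<Longrightarrow> W \<subseteq> orth S"
  by (rule subset_trans[OF PP_orth orth_anti])

lemma Int_subset_proj: "W \<in> PP \<Longrightarrow> S \<subseteq> W \<Longrightarrow> W \<inter> G \<subseteq> proj S G"
  using PP_subset_orth[of W S] proj_superset'[of G S] by blast

lemma dim_proj_Int:
  assumes "S \<in> PP" "G \<in> gens"
  shows "vec.dim (proj S G \<inter> G) + vec.dim S = n + vec.dim (S \<inter> G)"
  using dim_gen_orth[OF assms] proj_Int[OF assms(1)] by simp

lemma dim_Int_Suc_le:
  fixes A S G :: "('a ^ 'm) set"
  assumes "vec.subspace A" "vec.subspace S" "vec.subspace G" "A \<subseteq> S" "vec.dim S = vec.dim A + 1"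
  shows "vec.dim (S \<inter> G) \<le> vec.dim (A \<inter> G) + 1"
proof -
  have SG: "vec.subspace (S \<inter> G)" using assms vec.subspace_inter by blast
  have "vec.span (A \<union> (S \<inter> G)) \<subseteq> S" using assms by (intro vec.span_minimal) auto
  then have "vec.dim (vec.span (A \<union> (S \<inter> G))) \<le> vec.dim S" by (rule dim_le_subspace)
  moreover have "A \<inter> (S \<inter> G) = A \<inter> G" using assms by blast
  ultimately show ?thesis using dim_span_Un[OF assms(1) SG] assms(5) by simp
qed

text \<open>This reduces counting covers of A by their intersection with G to the case of a
  generator containing A: the covers that gain a dimension are those inside
  \<open>proj A G\<close>.\<close>

lemma subset_proj_iff:
  assumes A: "A \<in> PP" and G: "G \<in> gens" and S: "S \<in> PP" "A \<subseteq> S" "vec.dim S = vec.dim A + 1"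
  shows "S \<subseteq> proj A G \<longleftrightarrow> vec.dim (S \<inter> G) = vec.dim (A \<inter> G) + 1"
proof -
  have sub: "vec.subspace A" "vec.subspace S" "vec.subspace G" "vec.subspace (A \<inter> G)" "vec.subspace (S \<inter> G)"
    using A S G by (auto simp: PP_subspace gens_subspace vec.subspace_inter)
  have le: "vec.dim (S \<inter> G) \<le> vec.dim (A \<inter> G) + 1"
    using dim_Int_Suc_le[OF sub(1-3) S(2,3)] .
  show ?thesis
  proof
    assume SG: "S \<subseteq> proj A G"
    have "A \<noteq> S" using S(3) by auto
    then obtain s where s: "s \<in> S" "s \<notin> A" using S(2) by auto
    have subGA: "vec.subspace (G \<inter> orth A)" by (rule subspace_Int_orth[OF sub(3)])
    obtain a g where ag: "s = a + g" "a \<in> A" "g \<in> G \<inter> orth A"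
      using SG s(1) unfolding proj_def span_Un_subspaces[OF sub(1) subGA] by blast
    have "g = s - a" using ag by simp
    then have "g \<in> S" using s(1) ag(2) S(2) sub(2) vec.subspace_diff by blast
    moreover have "g \<notin> A" using ag s(2) sub(1) vec.subspace_add by blast
    ultimately have "A \<inter> G \<noteq> S \<inter> G" using ag by blast
    then have "\<not> vec.dim (S \<inter> G) \<le> vec.dim (A \<inter> G)"
      using subspace_dim_eq[OF sub(4,5)] S(2) by blast
    then show "vec.dim (S \<inter> G) = vec.dim (A \<inter> G) + 1" using le by simp
  next
    assume d: "vec.dim (S \<inter> G) = vec.dim (A \<inter> G) + 1"
    have "\<not> S \<inter> G \<subseteq> A"
    proof
      assume "S \<inter> G \<subseteq> A"
      then have "S \<inter> G = A \<inter> G" using S(2) by blast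
      then show False using d by simp
    qed
    then obtain g where g: "g \<in> S \<inter> G" "g \<notin> A" by blast
    have "S = vec.span (insert g A)"
      using subspace_eq_span_insert[OF sub(1,2) S(2,3)] g by blast
    moreover have "g \<in> proj A G" using g Int_subset_proj[OF S(1,2)] by blast
    ultimately show "S \<subseteq> proj A G"
      using proj_superset[of A G] gens_subspace[OF proj_gens[OF A G]]
      by (metis insert_subset vec.span_minimal)
  qed
qed

lemma covers_gen: "G \<in> gens \<Longrightarrow> A \<in> PP \<Longrightarrow> A \<subseteq> G \<Longrightarrow>
  {S \<in> PP. A \<subseteq> S \<and> vec.dim S = vec.dim A + 1 \<and> S \<subseteq> G} = covers_above A G"
  using PP_down[OF gens_PP[of G]] PP_subspace unfolding covers_above_def by blast

lemma card_covers_inside: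
  assumes A: "A \<in> PP" and G: "G \<in> gens" "A \<subseteq> G"
  shows "card {S \<in> PP. A \<subseteq> S \<and> vec.dim S = vec.dim A + 1 \<and> S \<subseteq> G} = gnum CARD('a) (n - vec.dim A)"
  unfolding covers_gen[OF G(1) A G(2)]
  using card_covers_above[OF PP_subspace[OF A] gens_subspace[OF G(1)] G(2)] gens_dim[OF G(1)] by simp

lemma gens_Int_eq:
  assumes "G \<in> gens" "W \<in> gens" "W \<noteq> G" "vec.subspace H" "vec.dim H + 1 = n" "H \<subseteq> G" "H \<subseteq> W"
  shows "W \<inter> G = H"
proof -
  have sub: "vec.subspace (W \<inter> G)" using assms gens_subspace vec.subspace_inter by blast
  have "vec.dim (W \<inter> G) \<noteq> n"
    using subspace_dim_eq[OF sub gens_subspace[OF assms(1)]] subspace_dim_eq[OF sub gens_subspace[OF assms(2)]]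
      assms gens_dim by fastforce
  moreover have "vec.dim (W \<inter> G) \<le> n" using dim_le_subspace[of "W \<inter> G" G] gens_dim[OF assms(1)] by simp
  ultimately show ?thesis using subspace_dim_eq[OF assms(4) sub] assms(5-7) by auto
qed

text \<open>A cover S outside G determines the hyperplane \<open>G \<inter> orth S\<close> of G and
  the generator \<open>proj S G\<close> through it. Conversely, a hyperplane H through A and one of
  the E further generators W through H account for the covers of A in W that are not in H.\<close>

lemma card_covers_outside:
  assumes A: "A \<in> PP" and G: "G \<in> gens" "A \<subseteq> G"
  shows "card {S \<in> PP. A \<subseteq> S \<and> vec.dim S = vec.dim A + 1 \<and> \<not> S \<subseteq> G}
       = gnum CARD('a) (n - vec.dim A) * (E * CARD('a) ^ (n - vec.dim A - 1))"
proof -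
  let ?k = "vec.dim A"
  let ?X = "{S \<in> PP. A \<subseteq> S \<and> vec.dim S = ?k + 1 \<and> \<not> S \<subseteq> G}"
  let ?W = "\<lambda>H. {W \<in> gens. H \<subseteq> W} - {G}"
  let ?D = "SIGMA H:covers_below A G. ?W H"
  let ?f = "\<lambda>(H, W). covers_above A W - covers_above A H"
  have sA: "vec.subspace A" and sG: "vec.subspace G" using A G by (auto simp: PP_subspace gens_subspace)
  have H: "vec.subspace H" "A \<subseteq> H" "H \<subseteq> G" "vec.dim H + 1 = n" "H \<in> PP" if "H \<in> covers_below A G" for H
    using that gens_dim[OF G(1)] PP_down[OF gens_PP[OF G(1)]] by (auto simp: covers_below_def)
  have inj: "G \<inter> orth S = H \<and> W = proj S G" and X: "S \<in> ?X"
    if HW: "H \<in> covers_below A G" "W \<in> ?W H" and S: "S \<in> covers_above A W - covers_above A H" for H W S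
  proof -
    have W: "W \<in> gens" "H \<subseteq> W" "W \<noteq> G" using HW by auto
    have S': "vec.subspace S" "A \<subseteq> S" "S \<subseteq> W" "vec.dim S = ?k + 1" "\<not> S \<subseteq> H"
      using S by (auto simp: covers_above_def)
    have SP: "S \<in> PP" using PP_down[OF gens_PP[OF W(1)] S'(1,3)] .
    have WG: "W \<inter> G = H" using gens_Int_eq[OF G(1) W(1) W(3)] H[OF HW(1)] W(2) by blast
    then have nSG: "\<not> S \<subseteq> G" using S' by blast
    then show "S \<in> ?X" using SP S' by blast
    have "H \<subseteq> G \<inter> orth S" using H(3)[OF HW(1)] W(2) PP_subset_orth[OF gens_PP[OF W(1)] S'(3)] by blast
    moreover have "vec.dim (G \<inter> orth S) \<le> vec.dim H"
    proof -
      have sSG: "vec.subspace (S \<inter> G)" using S'(1) sG vec.subspace_inter by blast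
      have "vec.dim (S \<inter> G) \<noteq> ?k + 1" using subspace_dim_eq[OF sSG S'(1)] nSG S'(4) by auto
      moreover have "vec.dim (S \<inter> G) \<le> ?k + 1" using dim_le_subspace[of "S \<inter> G" S] S'(4) by simp
      ultimately show ?thesis using dim_gen_orth[OF SP G(1)] S'(4) H(4)[OF HW(1)] by simp
    qed
    ultimately have eq: "H = G \<inter> orth S"
      using subspace_dim_eq[OF H(1)[OF HW(1)] subspace_Int_orth[OF sG]] by blast
    have "proj S G \<subseteq> W" unfolding proj_def eq[symmetric]
      using S'(3) W(2) by (intro vec.span_minimal gens_subspace[OF W(1)]) auto
    then show "G \<inter> orth S = H \<and> W = proj S G"
      using eq gens_eqI[OF proj_gens[OF SP G(1)] W(1)] by auto
  qed
  have "?X = (\<Union>p\<in>?D. ?f p)"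
  proof
    show "(\<Union>p\<in>?D. ?f p) \<subseteq> ?X" using X by fast
    show "?X \<subseteq> (\<Union>p\<in>?D. ?f p)"
    proof
      fix S assume "S \<in> ?X"
      then have S: "S \<in> PP" "A \<subseteq> S" "vec.dim S = ?k + 1" "\<not> S \<subseteq> G" by auto
      let ?H = "G \<inter> orth S" and ?V = "proj S G"
      have sS: "vec.subspace S" using S(1) by (rule PP_subspace)
      have sSG: "vec.subspace (S \<inter> G)" using sS sG vec.subspace_inter by blast
      have "A \<subseteq> S \<inter> G" using S(2) G(2) by blast
      then have "?k \<le> vec.dim (S \<inter> G)" by (rule dim_le_subspace)
      moreover have "vec.dim (S \<inter> G) \<noteq> ?k + 1" using subspace_dim_eq[OF sSG sS] S(3,4) by auto
      moreover have "vec.dim (S \<inter> G) \<le> ?k + 1" using dim_le_subspace[of "S \<inter> G" S] S(3) by simp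
      ultimately have dH: "vec.dim ?H + 1 = n" using dim_gen_orth[OF S(1) G(1)] S(3) by simp
      have HA: "?H \<in> covers_below A G"
        using dH G(2) PP_subset_orth[OF S(1) subset_refl] S(2) subspace_Int_orth[OF sG] gens_dim[OF G(1)]
        by (auto simp: covers_below_def)
      have V: "?V \<in> ?W ?H"
        using proj_gens[OF S(1) G(1)] proj_superset'[of G S] proj_superset[of S G] S(4) by auto
      have "S \<in> covers_above A ?V - covers_above A ?H"
        using sS S proj_superset[of S G] by (auto simp: covers_above_def)
      then show "S \<in> (\<Union>p\<in>?D. ?f p)" using HA V by blast
    qed
  qed
  then have "card ?X = card (\<Union>p\<in>?D. ?f p)" by simp
  also have "\<dots> = (\<Sum>p\<in>?D. card (?f p))"
  proof (rule card_UN_disjoint)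
    show "\<forall>p\<in>?D. \<forall>p'\<in>?D. p \<noteq> p' \<longrightarrow> ?f p \<inter> ?f p' = {}"
    proof (intro ballI impI)
      fix p p' assume pp: "p \<in> ?D" "p' \<in> ?D" "p \<noteq> p'"
      obtain H W H' W' where e: "p = (H, W)" "p' = (H', W')" by fastforce
      show "?f p \<inter> ?f p' = {}"
      proof (rule ccontr)
        assume "?f p \<inter> ?f p' \<noteq> {}"
        then obtain S where "S \<in> covers_above A W - covers_above A H" "S \<in> covers_above A W' - covers_above A H'"
          using e by auto
        then have "H = H'" "W = W'" using inj[of H W S] inj[of H' W' S] pp e by auto
        then show False using pp e by simp
      qed
    qed
  qed auto
  also have "\<dots> = (\<Sum>p\<in>?D. CARD('a) ^ (n - ?k - 1))"
  proof (rule sum.cong[OF refl])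
    fix p assume "p \<in> ?D"
    then obtain H W where p: "p = (H, W)" "H \<in> covers_below A G" "W \<in> gens" "H \<subseteq> W" by auto
    have Hk: "?k \<le> vec.dim H" using H(2)[OF p(2)] by (rule dim_le_subspace)
    have "card (?f p) = card (covers_above A W) - card (covers_above A H)"
      unfolding p(1) prod.case using p(4) by (intro card_Diff_subset) (auto simp: covers_above_def)
    also have "\<dots> = gnum CARD('a) (n - ?k) - gnum CARD('a) (n - ?k - 1)"
      using card_covers_above[OF sA gens_subspace[OF p(3)]] card_covers_above[OF sA H(1,2)[OF p(2)]]
        H(2,4)[OF p(2)] p(4) gens_dim[OF p(3)] by (auto simp: algebra_simps)
    also have "\<dots> = CARD('a) ^ (n - ?k - 1)"
    proof -
      have "n - ?k = Suc (n - ?k - 1)" using Hk H(4)[OF p(2)] by simp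
      then show ?thesis by (metis add_diff_cancel_left' gnum_Suc)
    qed
    finally show "card (?f p) = CARD('a) ^ (n - ?k - 1)" .
  qed
  also have "\<dots> = card ?D * CARD('a) ^ (n - ?k - 1)" by simp
  also have "card ?D = (\<Sum>H\<in>covers_below A G. card (?W H))" by (rule card_SigmaI) auto
  also have "\<dots> = (\<Sum>H\<in>covers_below A G. E)"
  proof (rule sum.cong[OF refl])
    fix H assume HH: "H \<in> covers_below A G"
    have "G \<in> {W \<in> gens. H \<subseteq> W}" using G H[OF HH] by simp
    then show "card (?W H) = E" using gens_count[OF H(5,4)[OF HH]] by (simp add: card_Diff_singleton)
  qed
  also have "\<dots> = gnum CARD('a) (n - ?k) * E"
    using card_covers_below[OF sA sG G(2)] gens_dim[OF G(1)] by simp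
  finally show ?thesis by (simp add: algebra_simps)
qed

lemma card_covers_near:
  assumes A: "A \<in> PP" and G: "G \<in> gens"
  shows "card {S \<in> PP. A \<subseteq> S \<and> vec.dim S = vec.dim A + 1 \<and> vec.dim (S \<inter> G) = vec.dim (A \<inter> G) + 1}
       = gnum CARD('a) (n - vec.dim A)" (is "?n")
    and "card {S \<in> PP. A \<subseteq> S \<and> vec.dim S = vec.dim A + 1 \<and> vec.dim (S \<inter> G) = vec.dim (A \<inter> G)}
       = gnum CARD('a) (n - vec.dim A) * (E * CARD('a) ^ (n - vec.dim A - 1))" (is "?f")
proof -
  have eq: "{S \<in> PP. A \<subseteq> S \<and> vec.dim S = vec.dim A + 1 \<and> vec.dim (S \<inter> G) = vec.dim (A \<inter> G) + 1}
     = {S \<in> PP. A \<subseteq> S \<and> vec.dim S = vec.dim A + 1 \<and> S \<subseteq> proj A G}"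
    using subset_proj_iff[OF A G] by blast
  show ?n unfolding eq by (rule card_covers_inside[OF A proj_gens[OF A G] proj_superset])
  have mono: "vec.dim (A \<inter> G) \<le> vec.dim (S \<inter> G)" if "A \<subseteq> S" for S
    using that by (intro dim_le_subspace) auto
  have "vec.dim (S \<inter> G) = vec.dim (A \<inter> G) \<longleftrightarrow> vec.dim (S \<inter> G) \<noteq> vec.dim (A \<inter> G) + 1"
    if "S \<in> PP" "A \<subseteq> S" "vec.dim S = vec.dim A + 1" for S
    using mono[OF that(2)] dim_Int_Suc_le[OF PP_subspace[OF A] PP_subspace[OF that(1)] gens_subspace[OF G] that(2,3)]
    by linarith
  then have "{S \<in> PP. A \<subseteq> S \<and> vec.dim S = vec.dim A + 1 \<and> vec.dim (S \<inter> G) = vec.dim (A \<inter> G)}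
     = {S \<in> PP. A \<subseteq> S \<and> vec.dim S = vec.dim A + 1 \<and> \<not> S \<subseteq> proj A G}"
    using subset_proj_iff[OF A G] by blast
  then show ?f using card_covers_outside[OF A proj_gens[OF A G] proj_superset] by simp
qed

lemma card_covers:
  assumes A: "A \<in> PP"
  shows "card {S \<in> PP. A \<subseteq> S \<and> vec.dim S = vec.dim A + 1}
       = gnum CARD('a) (n - vec.dim A) * (E * CARD('a) ^ (n - vec.dim A - 1) + 1)"
proof -
  obtain G where G: "G \<in> gens" "A \<subseteq> G" using gen_exE[OF A] .
  let ?X = "\<lambda>Q. {S \<in> PP. A \<subseteq> S \<and> vec.dim S = vec.dim A + 1 \<and> Q S}"
  have "{S \<in> PP. A \<subseteq> S \<and> vec.dim S = vec.dim A + 1} = ?X (\<lambda>S. S \<subseteq> G) \<union> ?X (\<lambda>S. \<not> S \<subseteq> G)" by blast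
  then have "card {S \<in> PP. A \<subseteq> S \<and> vec.dim S = vec.dim A + 1} = card (?X (\<lambda>S. S \<subseteq> G)) + card (?X (\<lambda>S. \<not> S \<subseteq> G))"
    by (simp only:) (rule card_Un_disjoint, auto)
  then show ?thesis
    unfolding card_covers_inside[OF A G] card_covers_outside[OF A G] by (simp add: algebra_simps)
qed

end

text \<open>For d \<le> c this is the Gaussian binomial coefficient times q^(d(d-1)/2), because gnum
  q c - gnum q d = q^d gnum q (c - d). The factor at d = c is zero, so all later values
  vanish.\<close>

fun layer_coeff :: "nat \<Rightarrow> nat \<Rightarrow> nat \<Rightarrow> real" where
  "layer_coeff q c 0 = 1"
| "layer_coeff q c (Suc d) = layer_coeff q c d * (gnum q c - real (gnum q d)) / gnum q (Suc d)"

lemma layer_coeff_nonneg: "layer_coeff q c d \<ge> 0"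
proof -
  have z: "layer_coeff q c (c + Suc i) = 0" for i
  proof (induction i)
    case (Suc i)
    have "layer_coeff q c (Suc (c + Suc i)) = 0" by (simp only: layer_coeff.simps Suc mult_zero_left div_0)
    then show ?case by simp
  qed simp
  have *: "layer_coeff q c d = 0" if "d > c" for d
    using z[of "d - c - 1"] that by simp
  have mono: "gnum q d \<le> gnum q c" if "d \<le> c" for d
    unfolding gnum_def using that by (intro sum_mono2) auto
  show "layer_coeff q c d \<ge> 0"
  proof (cases "d \<le> c")
    case True
    then show ?thesis
    proof (induction d)
      case (Suc d)
      then show ?case using mono[of d] by simp
    qed simp
  next
    case False
    then show ?thesis using * by simp
  qed
qed

section \<open>Steiner systems in residues\<close>

context polar_space
begin

text \<open>
  All members contain \<open>R\<close>: this is a Steiner system in the residue of \<open>R\<close>.  Dimensions are not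
  reduced modulo \<open>R\<close>.
\<close>

definition steiner :: "('a ^ 'm) set \<Rightarrow> nat \<Rightarrow> ('a ^ 'm) set set \<Rightarrow> bool" where
  "steiner R t Y \<longleftrightarrow> R \<in> PP \<and> vec.dim R \<le> t \<and> t \<le> n \<and> Y \<subseteq> gens \<and> (\<forall>W\<in>Y. R \<subseteq> W) \<and>
     (\<forall>S\<in>PP. R \<subseteq> S \<and> vec.dim S = t \<longrightarrow> (\<exists>!W. W \<in> Y \<and> S \<subseteq> W))"

definition lam :: "nat \<Rightarrow> nat \<Rightarrow> nat" where
  "lam t j = (\<Prod>i\<in>{j..<t}. E * CARD('a) ^ (n - Suc i) + 1)"

lemma steiner_residue:
  assumes "steiner R t Y" "A \<in> PP" "R \<subseteq> A" "vec.dim A \<le> t"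
  shows "steiner A t {W \<in> Y. A \<subseteq> W}"
  unfolding steiner_def
proof (intro conjI ballI impI)
  fix S assume S: "S \<in> PP" "A \<subseteq> S \<and> vec.dim S = t"
  then obtain W where W: "W \<in> Y" "S \<subseteq> W" "\<And>W'. W' \<in> Y \<Longrightarrow> S \<subseteq> W' \<Longrightarrow> W' = W"
    using assms unfolding steiner_def by (metis subset_trans)
  moreover have "A \<subseteq> W" using S W(2) by blast
  ultimately show "\<exists>!W. W \<in> {W \<in> Y. A \<subseteq> W} \<and> S \<subseteq> W" by blast
qed (use assms in \<open>auto simp: steiner_def\<close>)

lemma steiner_gens: "steiner R t Y \<Longrightarrow> W \<in> Y \<Longrightarrow> W \<in> gens"
  and steiner_base: "steiner R t Y \<Longrightarrow> W \<in> Y \<Longrightarrow> R \<subseteq> W"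
  and steiner_PP: "steiner R t Y \<Longrightarrow> R \<in> PP"
  by (auto simp: steiner_def)

text \<open>The dimension of S may exceed t: some t-dimensional subspace lies between R and S
  because the Gaussian count of such subspaces is positive, and uniqueness is applied to it.\<close>

lemma steiner_eq:
  assumes "steiner R t Y" "S \<in> PP" "R \<subseteq> S" "t \<le> vec.dim S" "W \<in> Y" "W' \<in> Y" "S \<subseteq> W" "S \<subseteq> W'"
  shows "W = W'"
proof -
  have R: "vec.subspace R" "vec.dim R \<le> t" using assms(1) by (auto simp: steiner_def PP_subspace)
  have S: "vec.subspace S" using assms(2) by (rule PP_subspace)
  have "real (card (subs_between R S (t - vec.dim R))) > 0"
  proof -
    have pos: "k \<le> vec.dim S - vec.dim R \<Longrightarrow> gbinom CARD('a) (vec.dim S - vec.dim R) k > 0" for k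
    proof (induction k)
      case (Suc k)
      then show ?case using gnum_pos[of "vec.dim S - vec.dim R - k" "CARD('a)"] gnum_pos[of "Suc k" "CARD('a)"]
        by simp
    qed simp
    show ?thesis unfolding card_subs_between[OF R(1) S assms(3)] by (rule pos) (use assms(4) in simp)
  qed
  then obtain T where T: "T \<in> subs_between R S (t - vec.dim R)"
    by (metis card.empty ex_in_conv less_irrefl of_nat_0)
  then have "T \<in> PP" "R \<subseteq> T" "vec.dim T = t" "T \<subseteq> S"
    using R(2) PP_down[OF assms(2)] by (auto simp: subs_between_def)
  then show ?thesis using assms(1,5-8) unfolding steiner_def by (metis subset_trans)
qed

lemma steiner_dim_Int:
  assumes "steiner R t Y" "W \<in> Y" "W' \<in> Y" "W \<noteq> W'"
  shows "vec.dim (W \<inter> W') < t"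
proof (rule ccontr)
  assume "\<not> vec.dim (W \<inter> W') < t"
  moreover have "W \<inter> W' \<in> PP" using assms PP_Int[OF gens_PP gens_subspace] steiner_gens by blast
  ultimately show False using steiner_eq[OF assms(1), of "W \<inter> W'" W W'] assms steiner_base[OF assms(1)] by auto
qed

lemma lam_self [simp]: "lam t t = 1"
  by (simp add: lam_def)

lemma lam_step: "j < t \<Longrightarrow> lam t j = (E * CARD('a) ^ (n - Suc j) + 1) * lam t (Suc j)"
  by (simp add: lam_def prod.atLeast_Suc_lessThan)

text \<open>Downward induction on the dimension. Pairs of a cover S of A and a member through S are
  counted twice, and the factor \<open>gnum\<close> common to both counts cancels against the number
  of covers of A.\<close>

lemma card_steiner_above:
  assumes st: "steiner R t Y" and A: "A \<in> PP" "R \<subseteq> A" "vec.dim A \<le> t"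
  shows "card {W \<in> Y. A \<subseteq> W} = lam t (vec.dim A)"
  using A
proof (induction "t - vec.dim A" arbitrary: A)
  case 0
  then have "\<exists>!W. W \<in> Y \<and> A \<subseteq> W" using st by (auto simp: steiner_def)
  then obtain W where "{W \<in> Y. A \<subseteq> W} = {W}" by blast
  then show ?case using 0 by simp
next
  case (Suc d)
  let ?k = "vec.dim A"
  let ?X = "{S \<in> PP. A \<subseteq> S \<and> vec.dim S = ?k + 1}" and ?Y = "{W \<in> Y. A \<subseteq> W}"
  have kt: "?k < t" "t \<le> n" using Suc.hyps(2) st by (auto simp: steiner_def)
  have "(\<Sum>S\<in>?X. card {W \<in> ?Y. S \<subseteq> W}) = (\<Sum>W\<in>?Y. card {S \<in> ?X. S \<subseteq> W})"
    by (rule double_count) auto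
  moreover have "card {W \<in> ?Y. S \<subseteq> W} = lam t (Suc ?k)" if S: "S \<in> ?X" for S
  proof -
    have "{W \<in> ?Y. S \<subseteq> W} = {W \<in> Y. S \<subseteq> W}" using S by blast
    moreover have "card {W \<in> Y. S \<subseteq> W} = lam t (vec.dim S)"
      using S Suc.hyps(2) Suc.prems kt by (intro Suc.hyps(1)) auto
    ultimately show ?thesis using S by simp
  qed
  moreover have "card {S \<in> ?X. S \<subseteq> W} = gnum CARD('a) (n - ?k)" if W: "W \<in> ?Y" for W
  proof -
    have "{S \<in> ?X. S \<subseteq> W} = {S \<in> PP. A \<subseteq> S \<and> vec.dim S = ?k + 1 \<and> S \<subseteq> W}" by blast
    then show ?thesis using card_covers_inside[OF Suc.prems(1), of W] W steiner_gens[OF st] by simp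
  qed
  ultimately have "card ?X * lam t (Suc ?k) = card ?Y * gnum CARD('a) (n - ?k)" by simp
  then have "gnum CARD('a) (n - ?k) * ((E * CARD('a) ^ (n - Suc ?k) + 1) * lam t (Suc ?k))
      = gnum CARD('a) (n - ?k) * card ?Y"
    unfolding card_covers[OF Suc.prems(1)] by (simp add: algebra_simps)
  moreover have "gnum CARD('a) (n - ?k) > 0" using kt by (intro gnum_pos) simp
  ultimately have "(E * CARD('a) ^ (n - Suc ?k) + 1) * lam t (Suc ?k) = card ?Y" by simp
  then show ?case using lam_step[OF kt(1)] by simp
qed

text \<open>The design equation of order j: incidences between the j-dimensional subspaces of G over
  R and the members. It holds for every generator G over R; in rank 4 it is applied to one outside
  Y.\<close>

lemma steiner_design_sum:
  assumes st: "steiner R t Y" and G: "G \<in> gens" "R \<subseteq> G" and j: "vec.dim R + j \<le> t"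
  shows "(\<Sum>W\<in>Y. gbinom CARD('a) (vec.dim (G \<inter> W) - vec.dim R) j)
       = gbinom CARD('a) (n - vec.dim R) j * lam t (vec.dim R + j)"
proof -
  have R: "R \<in> PP" "vec.subspace R" using steiner_PP[OF st] by (auto simp: PP_subspace)
  let ?X = "subs_between R G j"
  have "(\<Sum>S\<in>?X. card {W \<in> Y. S \<subseteq> W}) = (\<Sum>W\<in>Y. card {S \<in> ?X. S \<subseteq> W})"
    by (rule double_count) auto
  moreover have "card {W \<in> Y. S \<subseteq> W} = lam t (vec.dim R + j)" if S: "S \<in> ?X" for S
  proof -
    have "S \<in> PP" "R \<subseteq> S" "vec.dim S = vec.dim R + j"
      using S PP_down[OF gens_PP[OF G(1)]] by (auto simp: subs_between_def)
    then show ?thesis using card_steiner_above[OF st, of S] j by simp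
  qed
  moreover have "real (card {S \<in> ?X. S \<subseteq> W}) = gbinom CARD('a) (vec.dim (G \<inter> W) - vec.dim R) j" if W: "W \<in> Y" for W
  proof -
    have "{S \<in> ?X. S \<subseteq> W} = subs_between R (G \<inter> W) j" by (auto simp: subs_between_def)
    moreover have "vec.subspace (G \<inter> W)" "R \<subseteq> G \<inter> W"
      using vec.subspace_inter[OF gens_subspace[OF G(1)] gens_subspace[OF steiner_gens[OF st W]]]
        G(2) steiner_base[OF st W] by auto
    ultimately show ?thesis using card_subs_between[OF R(2)] by simp
  qed
  ultimately have "card ?X * lam t (vec.dim R + j) = (\<Sum>W\<in>Y. card {S \<in> ?X. S \<subseteq> W})"
    and eq: "(\<Sum>W\<in>Y. real (card {S \<in> ?X. S \<subseteq> W})) = (\<Sum>W\<in>Y. gbinom CARD('a) (vec.dim (G \<inter> W) - vec.dim R) j)"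
    by simp_all
  then have "real (card ?X * lam t (vec.dim R + j)) = real (\<Sum>W\<in>Y. card {S \<in> ?X. S \<subseteq> W})"
    by (simp only:)
  then have "real (card ?X) * lam t (vec.dim R + j) = (\<Sum>W\<in>Y. real (card {S \<in> ?X. S \<subseteq> W}))"
    by (simp only: of_nat_mult of_nat_sum)
  then have "real (card ?X) * lam t (vec.dim R + j) = (\<Sum>W\<in>Y. gbinom CARD('a) (vec.dim (G \<inter> W) - vec.dim R) j)"
    using eq by simp
  then show ?thesis
    using card_subs_between[OF R(2) gens_subspace[OF G(1)] G(2)] gens_dim[OF G(1)] by simp
qed

lemma steiner_nonempty: "steiner R t Y \<Longrightarrow> Y \<noteq> {}"
proof
  assume st: "steiner R t Y" and "Y = {}"
  then have "lam t (vec.dim R) = 0"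
    using card_steiner_above[OF st steiner_PP[OF st] subset_refl] by (simp add: steiner_def)
  then show False by (simp add: lam_def)
qed

section \<open>The linear programming inequality\<close>

definition level :: "('a ^ 'm) set \<Rightarrow> nat \<Rightarrow> ('a ^ 'm) set set" where
  "level R k = {S \<in> PP. R \<subseteq> S \<and> vec.dim S = k}"

text \<open>The denominator is the ratio between the number of covers that keep the dimension of the
  intersection with U and the number that raise it. Passing to the former costs a factor -1/y, so
  the two contributions cancel in \<open>tau_sum_zero\<close>.\<close>

definition tau :: "nat \<Rightarrow> ('a ^ 'm) set \<Rightarrow> ('a ^ 'm) set \<Rightarrow> real" where
  "tau k U S = (- 1 / (E * CARD('a) ^ (n - k))) ^ (k - vec.dim (S \<inter> U))"

lemma tau_sum_zero:
  assumes A: "A \<in> level R k" and k: "k < n" and U: "U \<in> gens" and E: "E > 0"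
  shows "(\<Sum>S | S \<in> level R (Suc k) \<and> A \<subseteq> S. tau (Suc k) U S) = 0"
proof -
  let ?y = "real (E * CARD('a) ^ (n - Suc k))"
  have y: "?y > 0" using E by simp
  have AP: "A \<in> PP" "R \<subseteq> A" "vec.dim A = k" using A by (auto simp: level_def)
  let ?X = "{S. S \<in> level R (Suc k) \<and> A \<subseteq> S}"
  let ?N = "{S \<in> PP. A \<subseteq> S \<and> vec.dim S = vec.dim A + 1 \<and> vec.dim (S \<inter> U) = vec.dim (A \<inter> U) + 1}"
  let ?F = "{S \<in> PP. A \<subseteq> S \<and> vec.dim S = vec.dim A + 1 \<and> vec.dim (S \<inter> U) = vec.dim (A \<inter> U)}"
  have le: "vec.dim (A \<inter> U) \<le> k" using dim_le_subspace[of "A \<inter> U" A] AP(3) by simp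
  have X: "?X = ?N \<union> ?F"
  proof -
    have "vec.dim (S \<inter> U) = vec.dim (A \<inter> U) \<or> vec.dim (S \<inter> U) = vec.dim (A \<inter> U) + 1"
      if "S \<in> PP" "A \<subseteq> S" "vec.dim S = vec.dim A + 1" for S
      using dim_Int_Suc_le[OF PP_subspace[OF AP(1)] PP_subspace[OF that(1)] gens_subspace[OF U] that(2,3)]
        dim_le_subspace[of "A \<inter> U" "S \<inter> U"] that(2) by fastforce
    then show ?thesis using AP by (auto simp: level_def)
  qed
  have "sum (tau (Suc k) U) ?X = sum (tau (Suc k) U) ?N + sum (tau (Suc k) U) ?F"
    unfolding X by (rule sum.union_disjoint) auto
  also have "sum (tau (Suc k) U) ?N = (\<Sum>S\<in>?N. (- 1 / ?y) ^ (k - vec.dim (A \<inter> U)))"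
    by (intro sum.cong) (auto simp: tau_def)
  also have "\<dots> = gnum CARD('a) (n - k) * (- 1 / ?y) ^ (k - vec.dim (A \<inter> U))"
    using card_covers_near(1)[OF AP(1) U] AP(3) by simp
  also have "sum (tau (Suc k) U) ?F = (\<Sum>S\<in>?F. (- 1 / ?y) ^ Suc (k - vec.dim (A \<inter> U)))"
    using le by (intro sum.cong) (auto simp: tau_def Suc_diff_le)
  also have "\<dots> = (gnum CARD('a) (n - k) * ?y) * (- 1 / ?y) ^ Suc (k - vec.dim (A \<inter> U))"
    using card_covers_near(2)[OF AP(1) U] AP(3) by simp
  finally have "sum (tau (Suc k) U) ?X = gnum CARD('a) (n - k) * (- 1 / ?y) ^ (k - vec.dim (A \<inter> U))
      + (gnum CARD('a) (n - k) * ?y) * (- 1 / ?y) ^ Suc (k - vec.dim (A \<inter> U))" .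
  also have "(gnum CARD('a) (n - k) * ?y) * (- 1 / ?y) ^ Suc (k - vec.dim (A \<inter> U))
      = - (gnum CARD('a) (n - k) * (- 1 / ?y) ^ (k - vec.dim (A \<inter> U)))"
    using y by (simp del: of_nat_mult of_nat_power)
  finally show ?thesis by simp
qed

lemma card_below_meet:
  fixes R S W :: "('a ^ 'm) set"
  assumes R: "vec.subspace R" and S: "vec.subspace S" and W: "vec.subspace W" and sub: "R \<subseteq> S" "R \<subseteq> W"
    and d: "vec.dim S = k" "vec.dim (S \<inter> W) + d = k"
  shows "card {A \<in> covers_below R S. vec.dim (A \<inter> W) = vec.dim (S \<inter> W)} = gnum CARD('a) d"
    and "real (card {A \<in> covers_below R S. vec.dim (A \<inter> W) + 1 = vec.dim (S \<inter> W)})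
        = gnum CARD('a) (k - vec.dim R) - real (gnum CARD('a) d)"
    and "\<And>A. A \<in> covers_below R S \<Longrightarrow> vec.dim (A \<inter> W) = vec.dim (S \<inter> W) \<or> vec.dim (A \<inter> W) + 1 = vec.dim (S \<inter> W)"
proof -
  let ?C = "covers_below R S"
  have sSW: "vec.subspace (S \<inter> W)" using S W vec.subspace_inter by blast
  have kd: "k - vec.dim (S \<inter> W) = d" using d(2) by simp
  have AW: "vec.dim (A \<inter> W) = vec.dim (S \<inter> W) \<longleftrightarrow> S \<inter> W \<subseteq> A"
    and two: "vec.dim (A \<inter> W) = vec.dim (S \<inter> W) \<or> vec.dim (A \<inter> W) + 1 = vec.dim (S \<inter> W)"
    if "A \<in> ?C" for A
  proof -
    have A: "vec.subspace A" "A \<subseteq> S" "vec.dim S = vec.dim A + 1" using that by (auto simp: covers_below_def)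
    have sAW: "vec.subspace (A \<inter> W)" using A(1) W vec.subspace_inter by blast
    have sub': "A \<inter> W \<subseteq> S \<inter> W" using A(2) by blast
    show "vec.dim (A \<inter> W) = vec.dim (S \<inter> W) \<longleftrightarrow> S \<inter> W \<subseteq> A"
    proof
      assume "vec.dim (A \<inter> W) = vec.dim (S \<inter> W)"
      then have "A \<inter> W = S \<inter> W" using subspace_dim_eq[OF sAW sSW sub'] by simp
      then show "S \<inter> W \<subseteq> A" by blast
    next
      assume "S \<inter> W \<subseteq> A"
      then have "A \<inter> W = S \<inter> W" using A(2) by blast
      then show "vec.dim (A \<inter> W) = vec.dim (S \<inter> W)" by simp
    qed
    show "vec.dim (A \<inter> W) = vec.dim (S \<inter> W) \<or> vec.dim (A \<inter> W) + 1 = vec.dim (S \<inter> W)"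
      using dim_Int_Suc_le[OF A(1) S W A(2,3)] dim_le_subspace[OF sub'] by linarith
  qed
  show "\<And>A. A \<in> ?C \<Longrightarrow> vec.dim (A \<inter> W) = vec.dim (S \<inter> W) \<or> vec.dim (A \<inter> W) + 1 = vec.dim (S \<inter> W)"
    by (rule two)
  have e1: "{A \<in> ?C. vec.dim (A \<inter> W) = vec.dim (S \<inter> W)} = covers_below (S \<inter> W) S"
    using AW sub unfolding covers_below_def by blast
  then show c1: "card {A \<in> ?C. vec.dim (A \<inter> W) = vec.dim (S \<inter> W)} = gnum CARD('a) d"
    using card_covers_below[OF sSW S] kd d(1) by simp
  have "{A \<in> ?C. vec.dim (A \<inter> W) + 1 = vec.dim (S \<inter> W)} = ?C - {A \<in> ?C. vec.dim (A \<inter> W) = vec.dim (S \<inter> W)}"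
    using two by fastforce
  then have "card {A \<in> ?C. vec.dim (A \<inter> W) + 1 = vec.dim (S \<inter> W)} = card ?C - gnum CARD('a) d"
    using c1 by (simp add: card_Diff_subset)
  moreover have "gnum CARD('a) d \<le> card ?C" unfolding c1[symmetric] by (rule card_mono) auto
  ultimately show "real (card {A \<in> ?C. vec.dim (A \<inter> W) + 1 = vec.dim (S \<inter> W)})
        = gnum CARD('a) (k - vec.dim R) - real (gnum CARD('a) d)"
    using card_covers_below[OF R S sub(1)] d by simp
qed

text \<open>Sum the vanishing condition over all A at distance d from W. A subspace S is reached
  from distance d + 1 through its hyperplanes containing \<open>S \<inter> W\<close>, and from
  distance d through the others; no other distance occurs.\<close>

lemma layer_recursion:
  fixes f :: "('a ^ 'm) set \<Rightarrow> real" and K :: "nat \<Rightarrow> real"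
  assumes R: "R \<in> PP" and rk: "vec.dim R \<le> k" and W: "W \<in> gens" "R \<subseteq> W"
    and f: "\<And>A. A \<in> level R k \<Longrightarrow> (\<Sum>S | S \<in> level R (Suc k) \<and> A \<subseteq> S. f S) = 0"
  defines "K \<equiv> \<lambda>d. (\<Sum>S | S \<in> level R (Suc k) \<and> vec.dim (S \<inter> W) + d = Suc k. f S)"
  shows "gnum CARD('a) (Suc d) * K (Suc d) = - ((gnum CARD('a) (Suc k - vec.dim R) - real (gnum CARD('a) d)) * K d)"
proof -
  let ?L = "level R (Suc k)"
  let ?A = "{A \<in> level R k. vec.dim (A \<inter> W) + d = k}"
  let ?c = "\<lambda>S. real (card {A \<in> ?A. A \<subseteq> S})"
  have Rs: "vec.subspace R" and Ws: "vec.subspace W" using R W by (auto simp: PP_subspace gens_subspace)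
  have fin: "finite ?L" "finite ?A" by auto
  have cS: "?c S = (if vec.dim (S \<inter> W) + d = Suc k then gnum CARD('a) (Suc k - vec.dim R) - real (gnum CARD('a) d)
      else if vec.dim (S \<inter> W) + Suc d = Suc k then gnum CARD('a) (Suc d) else 0)" if S: "S \<in> ?L" for S
  proof -
    have S': "S \<in> PP" "vec.subspace S" "R \<subseteq> S" "vec.dim S = Suc k" using S by (auto simp: level_def PP_subspace)
    have eq: "{A \<in> ?A. A \<subseteq> S} = {A \<in> covers_below R S. vec.dim (A \<inter> W) + d = k}"
      using S' PP_down[OF S'(1)] by (auto simp: level_def covers_below_def PP_subspace)
    have "vec.dim (S \<inter> W) \<le> Suc k" using dim_le_subspace[of "S \<inter> W" S] S'(4) by simp
    then obtain e where e: "vec.dim (S \<inter> W) + e = Suc k" using le_Suc_ex by metis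
    note c = card_below_meet[OF Rs S'(2) Ws S'(3) W(2) S'(4) e]
    show ?thesis
    proof (cases "e = d")
      case True
      then have "{A \<in> ?A. A \<subseteq> S} = {A \<in> covers_below R S. vec.dim (A \<inter> W) + 1 = vec.dim (S \<inter> W)}"
        unfolding eq using e by auto
      then show ?thesis using c(2) e True by simp
    next
      case ne: False
      show ?thesis
      proof (cases "e = Suc d")
        case True
        then have "{A \<in> ?A. A \<subseteq> S} = {A \<in> covers_below R S. vec.dim (A \<inter> W) = vec.dim (S \<inter> W)}"
          unfolding eq using e by auto
        then show ?thesis using c(1) e True by simp
      next
        case False
        have "\<not> (vec.dim (A \<inter> W) + d = k)" if "A \<in> covers_below R S" for A
          using c(3)[OF that] ne False e by linarith
        then have "{A \<in> ?A. A \<subseteq> S} = {}" unfolding eq by blast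
        then show ?thesis using e ne False by simp
      qed
    qed
  qed
  have "0 = (\<Sum>A\<in>?A. \<Sum>S | S \<in> ?L \<and> A \<subseteq> S. f S)" using f by simp
  also have "\<dots> = (\<Sum>A\<in>?A. \<Sum>S\<in>?L. if A \<subseteq> S then f S else 0)"
  proof (rule sum.cong[OF refl])
    fix A
    have "(\<Sum>S\<in>?L. if A \<subseteq> S then f S else 0) = sum f (?L \<inter> {S. A \<subseteq> S})"
      using sum.inter_restrict[OF fin(1), of f "{S. A \<subseteq> S}"] by (simp cong: if_cong)
    then show "(\<Sum>S | S \<in> ?L \<and> A \<subseteq> S. f S) = (\<Sum>S\<in>?L. if A \<subseteq> S then f S else 0)"
      by (simp add: Int_def)
  qed
  also have "\<dots> = (\<Sum>S\<in>?L. \<Sum>A\<in>?A. if A \<subseteq> S then f S else 0)" by (rule sum.swap)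
  also have "\<dots> = (\<Sum>S\<in>?L. ?c S * f S)"
  proof (rule sum.cong[OF refl])
    fix S
    have "(\<Sum>A\<in>?A. if A \<subseteq> S then f S else 0) = (\<Sum>A\<in>?A \<inter> {A. A \<subseteq> S}. f S)"
      using sum.inter_restrict[OF fin(2), of "\<lambda>_. f S" "{A. A \<subseteq> S}"] by (simp cong: if_cong)
    moreover have "?A \<inter> {A. A \<subseteq> S} = {A \<in> ?A. A \<subseteq> S}" by blast
    ultimately show "(\<Sum>A\<in>?A. if A \<subseteq> S then f S else 0) = ?c S * f S" by simp
  qed
  also have "\<dots> = (\<Sum>S\<in>?L. (if vec.dim (S \<inter> W) + d = Suc k then (gnum CARD('a) (Suc k - vec.dim R) - real (gnum CARD('a) d)) * f S else 0)
      + (if vec.dim (S \<inter> W) + Suc d = Suc k then gnum CARD('a) (Suc d) * f S else 0))"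
    by (intro sum.cong refl) (use cS in auto)
  also have "\<dots> = (\<Sum>S\<in>?L. if vec.dim (S \<inter> W) + d = Suc k then (gnum CARD('a) (Suc k - vec.dim R) - real (gnum CARD('a) d)) * f S else 0)
      + (\<Sum>S\<in>?L. if vec.dim (S \<inter> W) + Suc d = Suc k then gnum CARD('a) (Suc d) * f S else 0)"
    by (rule sum.distrib)
  also have "\<dots> = (gnum CARD('a) (Suc k - vec.dim R) - real (gnum CARD('a) d)) * K d + gnum CARD('a) (Suc d) * K (Suc d)"
  proof -
    have "(\<Sum>S\<in>?L. if Q S then c * f S else 0) = c * (\<Sum>S | S \<in> ?L \<and> Q S. f S)" for Q c
      using sum.inter_filter[OF fin(1), of "\<lambda>S. c * f S" Q] by (simp add: sum_distrib_left)
    then show ?thesis unfolding K_def by simp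
  qed
  finally show ?thesis by simp
qed

text \<open>A function with vanishing sums through every A has only one free layer sum around W, the
  one over the subspaces of W. This is the analogue of a zonal spherical function and the reason why
  the Gram matrix of the \<open>tau\<close> can be evaluated.\<close>

lemma layer_sum:
  fixes f :: "('a ^ 'm) set \<Rightarrow> real"
  assumes R: "R \<in> PP" and rk: "vec.dim R \<le> k" and W: "W \<in> gens" "R \<subseteq> W"
    and f: "\<And>A. A \<in> level R k \<Longrightarrow> (\<Sum>S | S \<in> level R (Suc k) \<and> A \<subseteq> S. f S) = 0"
  shows "(\<Sum>S | S \<in> level R (Suc k) \<and> vec.dim (S \<inter> W) + d = Suc k. f S)
     = (- 1) ^ d * layer_coeff CARD('a) (Suc k - vec.dim R) d * (\<Sum>S | S \<in> level R (Suc k) \<and> S \<subseteq> W. f S)"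
proof (induction d)
  case 0
  have "vec.dim (S \<inter> W) = Suc k \<longleftrightarrow> S \<subseteq> W" if "S \<in> level R (Suc k)" for S
  proof -
    have S: "vec.subspace S" "vec.dim S = Suc k" using that by (auto simp: level_def PP_subspace)
    have "vec.subspace (S \<inter> W)" using S(1) gens_subspace[OF W(1)] vec.subspace_inter by blast
    then show ?thesis using subspace_dim_eq[of "S \<inter> W" S] S by (auto simp: Int_absorb2)
  qed
  then have "{S. S \<in> level R (Suc k) \<and> vec.dim (S \<inter> W) + 0 = Suc k} = {S. S \<in> level R (Suc k) \<and> S \<subseteq> W}" by auto
  then show ?case by simp
next
  case (Suc d)
  let ?g = "\<lambda>d. real (gnum CARD('a) d)"
  have g: "?g (Suc d) > 0" using gnum_pos by simp
  have "?g (Suc d) * (\<Sum>S | S \<in> level R (Suc k) \<and> vec.dim (S \<inter> W) + Suc d = Suc k. f S)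
    = - ((?g (Suc k - vec.dim R) - ?g d) * ((- 1) ^ d * layer_coeff CARD('a) (Suc k - vec.dim R) d * (\<Sum>S | S \<in> level R (Suc k) \<and> S \<subseteq> W. f S)))"
    using layer_recursion[OF R rk W f, of d] Suc by simp
  then show ?case using g by (simp add: field_simps)
qed

text \<open>Since \<open>tau (Suc k) W\<close> depends only on the distance from W,
  \<open>layer_sum\<close> makes its inner product with \<open>tau (Suc k) U\<close> a constant C >
  0 times the sum of \<open>tau (Suc k) U\<close> over the subspaces of W. The right-hand side is
  therefore 1/C times the squared norm of the sum of all \<open>tau (Suc k) U\<close>.\<close>

theorem lp_inequality:
  assumes R: "R \<in> PP" and rk: "vec.dim R \<le> k" "k < n" and E: "E > 0"
    and Y: "Y \<subseteq> gens" "\<And>W. W \<in> Y \<Longrightarrow> R \<subseteq> W"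
  shows "0 \<le> (\<Sum>U\<in>Y. \<Sum>W\<in>Y. \<Sum>S | S \<in> level R (Suc k) \<and> S \<subseteq> W. tau (Suc k) U S)"
proof -
  let ?L = "level R (Suc k)"
  let ?y = "real (E * CARD('a) ^ (n - Suc k))"
  have y: "?y > 0" using E by simp
  define C where "C = (\<Sum>d\<le>Suc k. layer_coeff CARD('a) (Suc k - vec.dim R) d / ?y ^ d)"
  \<comment> \<open>The two signs (-1)^d multiply to 1, so C is a sum of nonnegative terms whose
    first one is 1.\<close>
  have "C \<ge> layer_coeff CARD('a) (Suc k - vec.dim R) 0 / ?y ^ 0" unfolding C_def
    by (rule member_le_sum) (use y in \<open>auto intro!: divide_nonneg_nonneg layer_coeff_nonneg simp del: of_nat_mult\<close>)
  then have C: "C > 0" by simp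
  have inner: "(\<Sum>S\<in>?L. tau (Suc k) U S * tau (Suc k) W S) = C * (\<Sum>S | S \<in> ?L \<and> S \<subseteq> W. tau (Suc k) U S)"
    if UW: "U \<in> Y" "W \<in> Y" for U W
  proof -
    have U: "U \<in> gens" and W: "W \<in> gens" "R \<subseteq> W" using UW Y by auto
    let ?LW = "\<lambda>d. {S. S \<in> ?L \<and> vec.dim (S \<inter> W) + d = Suc k}"
    have "?L = (\<Union>d\<in>{..Suc k}. ?LW d)"
    proof -
      have "\<exists>d\<le>Suc k. vec.dim (S \<inter> W) + d = Suc k" if "S \<in> ?L" for S
      proof -
        have "vec.dim (S \<inter> W) \<le> Suc k" using that dim_le_subspace[of "S \<inter> W" S] by (auto simp: level_def)
        then show ?thesis by (intro exI[of _ "Suc k - vec.dim (S \<inter> W)"]) auto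
      qed
      then show ?thesis by blast
    qed
    then have "(\<Sum>S\<in>?L. tau (Suc k) U S * tau (Suc k) W S)
        = (\<Sum>d\<le>Suc k. \<Sum>S\<in>?LW d. tau (Suc k) U S * tau (Suc k) W S)"
      using sum.UNION_disjoint[of "{..Suc k}" ?LW "\<lambda>S. tau (Suc k) U S * tau (Suc k) W S"] by fastforce
    also have "\<dots> = (\<Sum>d\<le>Suc k. (- 1 / ?y) ^ d * (\<Sum>S\<in>?LW d. tau (Suc k) U S))"
    proof (rule sum.cong[OF refl])
      fix d
      have "tau (Suc k) W S = (- 1 / ?y) ^ d" if "S \<in> ?LW d" for S
      proof -
        have "Suc k - vec.dim (S \<inter> W) = d" using that by auto
        then show ?thesis by (simp add: tau_def)
      qed
      then have "(\<Sum>S\<in>?LW d. tau (Suc k) U S * tau (Suc k) W S) = (\<Sum>S\<in>?LW d. (- 1 / ?y) ^ d * tau (Suc k) U S)"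
        by (intro sum.cong) auto
      then show "(\<Sum>S\<in>?LW d. tau (Suc k) U S * tau (Suc k) W S) = (- 1 / ?y) ^ d * (\<Sum>S\<in>?LW d. tau (Suc k) U S)"
        by (simp only: sum_distrib_left)
    qed
    also have "\<dots> = (\<Sum>d\<le>Suc k. (- 1 / ?y) ^ d * ((- 1) ^ d * layer_coeff CARD('a) (Suc k - vec.dim R) d
        * (\<Sum>S | S \<in> ?L \<and> S \<subseteq> W. tau (Suc k) U S)))"
      using layer_sum[OF R rk(1) W tau_sum_zero[OF _ rk(2) U E]] by simp
    also have "\<dots> = (\<Sum>d\<le>Suc k. layer_coeff CARD('a) (Suc k - vec.dim R) d / ?y ^ d
        * (\<Sum>S | S \<in> ?L \<and> S \<subseteq> W. tau (Suc k) U S))"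
    proof (rule sum.cong[OF refl])
      fix d
      have "(- 1 / ?y) ^ d * (- 1) ^ d = 1 / ?y ^ d"
        by (simp add: power_mult_distrib[symmetric] power_divide del: of_nat_mult of_nat_power)
      then show "(- 1 / ?y) ^ d * ((- 1) ^ d * layer_coeff CARD('a) (Suc k - vec.dim R) d
          * (\<Sum>S | S \<in> ?L \<and> S \<subseteq> W. tau (Suc k) U S))
        = layer_coeff CARD('a) (Suc k - vec.dim R) d / ?y ^ d * (\<Sum>S | S \<in> ?L \<and> S \<subseteq> W. tau (Suc k) U S)"
        by (simp add: mult.assoc[symmetric] del: of_nat_mult of_nat_power)
    qed
    also have "\<dots> = C * (\<Sum>S | S \<in> ?L \<and> S \<subseteq> W. tau (Suc k) U S)"
      unfolding C_def by (rule sum_distrib_right[symmetric])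
    finally show ?thesis .
  qed
  have "0 \<le> (\<Sum>S\<in>?L. (\<Sum>U\<in>Y. tau (Suc k) U S)\<^sup>2)" by (intro sum_nonneg) simp
  also have "\<dots> = (\<Sum>S\<in>?L. \<Sum>U\<in>Y. \<Sum>W\<in>Y. tau (Suc k) U S * tau (Suc k) W S)"
    by (simp add: power2_eq_square sum_product)
  also have "\<dots> = (\<Sum>U\<in>Y. \<Sum>S\<in>?L. \<Sum>W\<in>Y. tau (Suc k) U S * tau (Suc k) W S)"
    by (rule sum.swap)
  also have "\<dots> = (\<Sum>U\<in>Y. \<Sum>W\<in>Y. \<Sum>S\<in>?L. tau (Suc k) U S * tau (Suc k) W S)"
    by (rule sum.cong[OF refl]) (rule sum.swap)
  also have "\<dots> = C * (\<Sum>U\<in>Y. \<Sum>W\<in>Y. \<Sum>S | S \<in> ?L \<and> S \<subseteq> W. tau (Suc k) U S)"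
    using inner by (simp add: sum_distrib_left)
  finally show ?thesis using C by (simp add: zero_le_mult_iff)
qed

lemma kernel_top:
  assumes "U \<in> gens" "W \<in> gens" "R \<subseteq> W"
  shows "(\<Sum>S | S \<in> level R n \<and> S \<subseteq> W. tau n U S) = (- 1 / E) ^ (n - vec.dim (U \<inter> W))"
proof -
  have "{S. S \<in> level R n \<and> S \<subseteq> W} = {W}"
  proof -
    have "S = W" if "S \<in> level R n" "S \<subseteq> W" for S
      using that assms(2) gens_eqI[of S W] by (auto simp: level_def gens_def)
    then show ?thesis using assms by (auto simp: level_def gens_def)
  qed
  then show ?thesis by (simp add: tau_def Int_commute)
qed

text \<open>The first term comes from the hyperplanes of W that contain \<open>U \<inter> W\<close>,
  the second from those that lose one dimension of it.\<close>

lemma kernel_below_top: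
  assumes U: "U \<in> gens" "R \<subseteq> U" and W: "W \<in> gens" "R \<subseteq> W" and R: "R \<in> PP" "vec.dim R < n"
    and i: "i = vec.dim (U \<inter> W)"
  shows "(\<Sum>S | S \<in> level R (n - 1) \<and> S \<subseteq> W. tau (n - 1) U S)
    = gnum CARD('a) (n - i) * (- 1 / (E * CARD('a))) ^ (n - 1 - i)
    + (gnum CARD('a) (n - vec.dim R) - real (gnum CARD('a) (n - i))) * (- 1 / (E * CARD('a))) ^ (n - i)"
proof -
  let ?y = "- 1 / (E * CARD('a)) :: real"
  have n0: "n > 0" using R(2) by simp
  have iW: "vec.dim (W \<inter> U) + (n - i) = n"
    using i dim_le_subspace[of "W \<inter> U" W] gens_dim[OF W(1)] by (simp add: Int_commute)
  note c = card_below_meet[OF PP_subspace[OF R(1)] gens_subspace[OF W(1)] gens_subspace[OF U(1)] W(2) U(2) gens_dim[OF W(1)] iW]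
  let ?C = "covers_below R W"
  let ?C1 = "{A \<in> ?C. vec.dim (A \<inter> U) = vec.dim (W \<inter> U)}" and ?C2 = "{A \<in> ?C. vec.dim (A \<inter> U) + 1 = vec.dim (W \<inter> U)}"
  have eq: "{S. S \<in> level R (n - 1) \<and> S \<subseteq> W} = ?C1 \<union> ?C2"
  proof -
    have "{S. S \<in> level R (n - 1) \<and> S \<subseteq> W} = ?C"
      using PP_down[OF gens_PP[OF W(1)]] gens_dim[OF W(1)] n0 by (auto simp: level_def covers_below_def PP_subspace)
    then show ?thesis using c(3) by blast
  qed
  have y: "tau (n - 1) U S = ?y ^ (n - 1 - vec.dim (S \<inter> U))" for S using n0 by (simp add: tau_def)
  have "(\<Sum>S | S \<in> level R (n - 1) \<and> S \<subseteq> W. tau (n - 1) U S) = sum (tau (n - 1) U) ?C1 + sum (tau (n - 1) U) ?C2"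
    unfolding eq by (rule sum.union_disjoint) auto
  also have "sum (tau (n - 1) U) ?C1 = (\<Sum>S\<in>?C1. ?y ^ (n - 1 - i))"
    unfolding y i by (intro sum.cong refl) (simp add: Int_commute)
  also have "sum (tau (n - 1) U) ?C2 = (\<Sum>S\<in>?C2. ?y ^ (n - i))"
  proof (rule sum.cong[OF refl])
    fix S assume "S \<in> ?C2"
    then have "n - 1 - vec.dim (S \<inter> U) = n - i" using i by (simp add: Int_commute)
    then show "tau (n - 1) U S = ?y ^ (n - i)" unfolding y by simp
  qed
  finally show ?thesis using c(1,2) by simp
qed

end

section \<open>Nonexistence from intersection numbers and linear programming\<close>

lemma gbinom_1 [simp]: "gbinom q c (Suc 0) = gnum q c"
  by simp

lemma gbinom_2: "gbinom q c 2 = gnum q c * gnum q (c - 1) / (1 + q)"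
  by (simp add: numeral_2_eq_2 gnum_Suc)

context polar_space
begin

lemma lam2:
  assumes "n = r + (j + 2)"
  shows "real (lam (r + 2) r) = (real E * real CARD('a) ^ (j + 1) + 1) * (real E * real CARD('a) ^ j + 1)"
    and "real (lam (r + 2) (r + 1)) = real E * real CARD('a) ^ j + 1"
proof -
  have *: "{r..<r + 2} = {r, r + 1}" "{r + 1..<r + 2} = {r + 1}" by auto
  have "n - Suc r = j + 1" "n - Suc (r + 1) = j" using assms by auto
  then show "real (lam (r + 2) r) = (real E * real CARD('a) ^ (j + 1) + 1) * (real E * real CARD('a) ^ j + 1)"
    and "real (lam (r + 2) (r + 1)) = real E * real CARD('a) ^ j + 1"
    unfolding lam_def * by (simp_all add: algebra_simps)
qed

lemma lam3:
  assumes "n = r + (j + 3)"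
  shows "real (lam (r + 3) r) = (real E * real CARD('a) ^ (j + 2) + 1) * (real E * real CARD('a) ^ (j + 1) + 1) * (real E * real CARD('a) ^ j + 1)"
    and "real (lam (r + 3) (r + 1)) = (real E * real CARD('a) ^ (j + 1) + 1) * (real E * real CARD('a) ^ j + 1)"
    and "real (lam (r + 3) (r + 2)) = real E * real CARD('a) ^ j + 1"
proof -
  have *: "{r..<r + 3} = {r, r + 1, r + 2}" "{r + 1..<r + 3} = {r + 1, r + 2}" "{r + 2..<r + 3} = {r + 2}" by auto
  have e: "n - Suc r = j + 2" "n - Suc (r + 1) = j + 1" "n - Suc (r + 2) = j" using assms by auto
  show "real (lam (r + 3) r) = (real E * real CARD('a) ^ (j + 2) + 1) * (real E * real CARD('a) ^ (j + 1) + 1) * (real E * real CARD('a) ^ j + 1)"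
    and "real (lam (r + 3) (r + 1)) = (real E * real CARD('a) ^ (j + 1) + 1) * (real E * real CARD('a) ^ j + 1)"
    and "real (lam (r + 3) (r + 2)) = real E * real CARD('a) ^ j + 1"
    unfolding lam_def * using e by (simp_all add: algebra_simps)
qed

lemma steiner_Int_range:
  assumes "steiner R t Y" "U \<in> Y" "W \<in> Y - {U}"
  shows "vec.dim R \<le> vec.dim (U \<inter> W)" "vec.dim (U \<inter> W) < t"
proof -
  show "vec.dim R \<le> vec.dim (U \<inter> W)"
    using assms steiner_base[OF assms(1)] by (intro dim_le_subspace) auto
  show "vec.dim (U \<inter> W) < t" using steiner_dim_Int[OF assms(1,2)] assms(3) by auto
qed

lemma steiner_sum_split:
  assumes "steiner R t Y" "U \<in> Y"
  shows "(\<Sum>W\<in>Y. F (vec.dim (U \<inter> W))) = F n + (\<Sum>W\<in>Y - {U}. F (vec.dim (U \<inter> W)) :: real)"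
  using sum.remove[of Y U "\<lambda>W. F (vec.dim (U \<inter> W))"] assms gens_dim[OF steiner_gens[OF assms]] by simp

lemma steiner_design_sum':
  assumes st: "steiner R t Y" and U: "U \<in> Y" and j: "vec.dim R + j \<le> t"
  shows "(\<Sum>W\<in>Y - {U}. gbinom CARD('a) (vec.dim (U \<inter> W) - vec.dim R) j)
       = gbinom CARD('a) (n - vec.dim R) j * (real (lam t (vec.dim R + j)) - 1)"
  using steiner_design_sum[OF st steiner_gens[OF st U] steiner_base[OF st U] j]
    steiner_sum_split[OF st U, of "\<lambda>i. gbinom CARD('a) (i - vec.dim R) j"]
  by (simp add: algebra_simps)

text \<open>Members other than U meet U in relative dimension 0 or 1, where every F is a combination
  of the constant 1 and the Gaussian number. The design equations of order 0 and 1 evaluate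
  both.\<close>

lemma steiner2_sum:
  fixes F :: "nat \<Rightarrow> real"
  assumes st: "steiner R (vec.dim R + 2) Y" and U: "U \<in> Y"
  defines "g \<equiv> real (gnum CARD('a) (n - vec.dim R))" and "l0 \<equiv> real (lam (vec.dim R + 2) (vec.dim R))"
    and "l1 \<equiv> real (lam (vec.dim R + 2) (vec.dim R + 1))"
  shows "(\<Sum>W\<in>Y. F (vec.dim (U \<inter> W) - vec.dim R)) = F (n - vec.dim R) + g * (l1 - 1) * F 1 + (l0 - 1 - g * (l1 - 1)) * F 0"
proof -
  let ?r = "vec.dim R"
  have "F (vec.dim (U \<inter> W) - ?r) = F 0 * gbinom CARD('a) (vec.dim (U \<inter> W) - ?r) 0
      + (F 1 - F 0) * gbinom CARD('a) (vec.dim (U \<inter> W) - ?r) 1" if W: "W \<in> Y - {U}" for W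
  proof -
    have "vec.dim (U \<inter> W) - ?r = 0 \<or> vec.dim (U \<inter> W) - ?r = 1"
      using steiner_Int_range[OF st U W] by linarith
    then show ?thesis by auto
  qed
  then have "(\<Sum>W\<in>Y - {U}. F (vec.dim (U \<inter> W) - ?r))
    = (\<Sum>W\<in>Y - {U}. F 0 * gbinom CARD('a) (vec.dim (U \<inter> W) - ?r) 0 + (F 1 - F 0) * gbinom CARD('a) (vec.dim (U \<inter> W) - ?r) 1)"
    by (intro sum.cong) auto
  also have "\<dots> = F 0 * (\<Sum>W\<in>Y - {U}. gbinom CARD('a) (vec.dim (U \<inter> W) - ?r) 0)
      + (F 1 - F 0) * (\<Sum>W\<in>Y - {U}. gbinom CARD('a) (vec.dim (U \<inter> W) - ?r) 1)"
    by (simp only: sum.distrib sum_distrib_left)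
  also have "\<dots> = F 0 * (l0 - 1) + (F 1 - F 0) * (g * (l1 - 1))"
    using steiner_design_sum'[OF st U, of 0] steiner_design_sum'[OF st U, of 1]
    by (simp add: g_def l0_def l1_def)
  finally show ?thesis
    using steiner_sum_split[OF st U, of "\<lambda>i. F (i - ?r)"] by (simp add: algebra_simps)
qed

text \<open>Interpolation at the relative dimensions 0, 1, 2: the Gaussian binomials of order 0, 1,
  2 take there the values 1, 1, 1 and 0, 1, 1 + Q and 0, 0, 1, a triangular system.\<close>

lemma steiner3_sum:
  fixes F :: "nat \<Rightarrow> real"
  assumes st: "steiner R (vec.dim R + 3) Y" and U: "U \<in> Y"
  defines "g \<equiv> real (gnum CARD('a) (n - vec.dim R))" and "l0 \<equiv> real (lam (vec.dim R + 3) (vec.dim R))"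
    and "l1 \<equiv> real (lam (vec.dim R + 3) (vec.dim R + 1))" and "l2 \<equiv> real (lam (vec.dim R + 3) (vec.dim R + 2))"
  shows "(\<Sum>W\<in>Y. F (vec.dim (U \<inter> W) - vec.dim R)) = F (n - vec.dim R) + F 0 * (l0 - 1) + (F 1 - F 0) * (g * (l1 - 1))
     + (F 2 - F 0 - (F 1 - F 0) * (1 + CARD('a))) * (gbinom CARD('a) (n - vec.dim R) 2 * (l2 - 1))"
proof -
  let ?r = "vec.dim R"
  let ?c = "F 2 - F 0 - (F 1 - F 0) * (1 + CARD('a))"
  let ?b = "\<lambda>W j. gbinom CARD('a) (vec.dim (U \<inter> W) - ?r) j"
  have "F (vec.dim (U \<inter> W) - ?r) = F 0 * ?b W 0 + (F 1 - F 0) * ?b W 1 + ?c * ?b W 2" if W: "W \<in> Y - {U}" for W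
  proof -
    have "vec.dim (U \<inter> W) - ?r = 0 \<or> vec.dim (U \<inter> W) - ?r = 1 \<or> vec.dim (U \<inter> W) - ?r = 2"
      using steiner_Int_range[OF st U W] by linarith
    then show ?thesis
      by (elim disjE) (simp_all only: gbinom_2, simp_all add: gnum_Suc numeral_2_eq_2 algebra_simps)
  qed
  then have "(\<Sum>W\<in>Y - {U}. F (vec.dim (U \<inter> W) - ?r)) = (\<Sum>W\<in>Y - {U}. F 0 * ?b W 0 + (F 1 - F 0) * ?b W 1 + ?c * ?b W 2)"
    by (intro sum.cong) auto
  also have "\<dots> = F 0 * (\<Sum>W\<in>Y - {U}. ?b W 0) + (F 1 - F 0) * (\<Sum>W\<in>Y - {U}. ?b W 1) + ?c * (\<Sum>W\<in>Y - {U}. ?b W 2)"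
    by (simp only: sum.distrib sum_distrib_left)
  also have "\<dots> = F 0 * (l0 - 1) + (F 1 - F 0) * (g * (l1 - 1)) + ?c * (gbinom CARD('a) (n - ?r) 2 * (l2 - 1))"
    using steiner_design_sum'[OF st U, of 0] steiner_design_sum'[OF st U, of 1] steiner_design_sum'[OF st U, of 2]
    by (simp add: g_def l0_def l1_def l2_def)
  finally show ?thesis using steiner_sum_split[OF st U, of "\<lambda>i. F (i - ?r)"] by linarith
qed

lemma gnum_real_Suc: "real (gnum CARD('a) (Suc k)) = gnum CARD('a) k + real CARD('a) ^ k"
  and gnum_real_Suc': "real (gnum CARD('a) (Suc k)) = 1 + CARD('a) * real (gnum CARD('a) k)"
proof -
  show "real (gnum CARD('a) (Suc k)) = gnum CARD('a) k + real CARD('a) ^ k" by (simp add: gnum_Suc)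
  show "real (gnum CARD('a) (Suc k)) = 1 + CARD('a) * real (gnum CARD('a) k)" unfolding gnum_Suc' by simp
qed

lemma Q_ge2: "real CARD('a) \<ge> 2"
  using CARD_field_gt_1[where 'a = 'a] by linarith

lemma gnum_ge_power: "real CARD('a) ^ k \<le> gnum CARD('a) (Suc k)"
  using gnum_real_Suc[of k] by simp

text \<open>With F the indicator of relative dimension 0, the sum counts the members that meet U
  only in R. It equals Q^j (Q + 1 - gnum Q (j + 1)), which is negative from relative rank 4
  on.\<close>

theorem no_steiner2_hyperbolic:
  assumes st: "steiner R (vec.dim R + 2) Y" and E: "E = 1" and m: "n \<ge> vec.dim R + 4"
  shows False
proof -
  let ?r = "vec.dim R" and ?q = "real CARD('a)"
  obtain U where U: "U \<in> Y" using steiner_nonempty[OF st] by blast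
  define j where "j = n - ?r - 2"
  have j: "n = ?r + (j + 2)" "j \<ge> 2" using m by (auto simp: j_def)
  have m_eq: "n - ?r = j + 2" using j by simp
  let ?F = "\<lambda>i::nat. if i = 0 then 1 else 0 :: real"
  have "0 \<le> (\<Sum>W\<in>Y. ?F (vec.dim (U \<inter> W) - ?r))" by (intro sum_nonneg) auto
  also have "(\<Sum>W\<in>Y. ?F (vec.dim (U \<inter> W) - ?r)) = (?q ^ (j + 1) + 1) * (?q ^ j + 1) - 1 - gnum CARD('a) (j + 2) * ?q ^ j"
    using steiner2_sum[OF st U, of ?F] E unfolding lam2[OF j(1)] m_eq by simp
  also have "\<dots> = ?q ^ j * (?q ^ (j + 1) + ?q + 1 - gnum CARD('a) (j + 2))"
    by (simp add: algebra_simps)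
  also have "real (gnum CARD('a) (j + 2)) = gnum CARD('a) (j + 1) + ?q ^ (j + 1)"
    using gnum_real_Suc[of "j + 1"] by simp
  finally have "0 \<le> ?q ^ j * (?q + 1 - gnum CARD('a) (j + 1))" by (simp add: algebra_simps)
  moreover have "real (gnum CARD('a) (j + 1)) > ?q + 1"
  proof -
    obtain i where i: "j = Suc (Suc i)" using j(2) by (metis Suc_le_D numeral_2_eq_2 Suc_le_mono)
    have "real (gnum CARD('a) (Suc i)) > 0" using gnum_pos by simp
    then have "?q * (?q * gnum CARD('a) (Suc i)) > 0" using Q_ge2 by simp
    then show ?thesis using i gnum_real_Suc'[of j] gnum_real_Suc'[of "Suc i"] by (simp add: algebra_simps)
  qed
  moreover have "?q ^ j > 0" by simp
  ultimately show False by (smt (verit) mult_pos_neg)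
qed

text \<open>If the kernel sum around a member is the same number c for all members, the double sum
  of \<open>lp_inequality\<close> is \<open>card Y * c\<close>, so a single row sum decides.
  \<open>lp_below\<close> is the same for the level n - 1.\<close>

lemma lp_top:
  fixes F :: "nat \<Rightarrow> real"
  assumes st: "steiner R t Y" and U: "U \<in> Y" and E: "E > 0" and r: "vec.dim R < n"
    and F: "\<And>i. i \<le> n - vec.dim R \<Longrightarrow> F i = (- 1 / E) ^ (n - vec.dim R - i)"
    and c: "\<And>U. U \<in> Y \<Longrightarrow> (\<Sum>W\<in>Y. F (vec.dim (U \<inter> W) - vec.dim R)) = c"
  shows "0 \<le> c"
proof -
  have R: "R \<in> PP" using steiner_PP[OF st] .
  have "0 \<le> (\<Sum>U\<in>Y. \<Sum>W\<in>Y. \<Sum>S | S \<in> level R (Suc (n - 1)) \<and> S \<subseteq> W. tau (Suc (n - 1)) U S)"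
    using st r E by (intro lp_inequality[OF R]) (auto simp: steiner_def)
  also have "\<dots> = (\<Sum>U\<in>Y. \<Sum>W\<in>Y. F (vec.dim (U \<inter> W) - vec.dim R))"
  proof (intro sum.cong refl)
    fix U W assume UW: "U \<in> Y" "W \<in> Y"
    have d: "vec.dim R \<le> vec.dim (U \<inter> W)" "vec.dim (U \<inter> W) \<le> n"
      using UW steiner_base[OF st] gens_dim[OF steiner_gens[OF st UW(1)]]
        dim_le_subspace[of R "U \<inter> W"] dim_le_subspace[of "U \<inter> W" U] by auto
    have "F (vec.dim (U \<inter> W) - vec.dim R) = (- 1 / E) ^ (n - vec.dim R - (vec.dim (U \<inter> W) - vec.dim R))"
      using d by (intro F) simp
    also have "n - vec.dim R - (vec.dim (U \<inter> W) - vec.dim R) = n - vec.dim (U \<inter> W)" using d by simp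
    finally show "(\<Sum>S | S \<in> level R (Suc (n - 1)) \<and> S \<subseteq> W. tau (Suc (n - 1)) U S) = F (vec.dim (U \<inter> W) - vec.dim R)"
      using kernel_top[OF steiner_gens[OF st UW(1)] steiner_gens[OF st UW(2)] steiner_base[OF st UW(2)]] r by simp
  qed
  also have "\<dots> = card Y * c" using c by simp
  finally have "0 \<le> real (card Y) * c" .
  moreover have "real (card Y) > 0" using U by (auto simp: card_gt_0_iff)
  ultimately show ?thesis by (meson not_less mult_pos_neg)
qed

lemma lp_below:
  fixes F :: "nat \<Rightarrow> real"
  assumes st: "steiner R t Y" and U: "U \<in> Y" and E: "E > 0" and r: "vec.dim R + 1 < n"
    and F: "\<And>i. i \<le> n - vec.dim R \<Longrightarrow> F i = gnum CARD('a) (n - vec.dim R - i) * (- 1 / (E * CARD('a))) ^ (n - vec.dim R - 1 - i)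
      + (gnum CARD('a) (n - vec.dim R) - real (gnum CARD('a) (n - vec.dim R - i))) * (- 1 / (E * CARD('a))) ^ (n - vec.dim R - i)"
    and c: "\<And>U. U \<in> Y \<Longrightarrow> (\<Sum>W\<in>Y. F (vec.dim (U \<inter> W) - vec.dim R)) = c"
  shows "0 \<le> c"
proof -
  have R: "R \<in> PP" using steiner_PP[OF st] .
  have "0 \<le> (\<Sum>U\<in>Y. \<Sum>W\<in>Y. \<Sum>S | S \<in> level R (Suc (n - 2)) \<and> S \<subseteq> W. tau (Suc (n - 2)) U S)"
    using st r E by (intro lp_inequality[OF R]) (auto simp: steiner_def)
  also have "Suc (n - 2) = n - 1" using r by simp
  also have "(\<Sum>U\<in>Y. \<Sum>W\<in>Y. \<Sum>S | S \<in> level R (n - 1) \<and> S \<subseteq> W. tau (n - 1) U S) = (\<Sum>U\<in>Y. \<Sum>W\<in>Y. F (vec.dim (U \<inter> W) - vec.dim R))"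
  proof (intro sum.cong refl)
    fix U W assume UW: "U \<in> Y" "W \<in> Y"
    let ?i = "vec.dim (U \<inter> W)"
    have d: "vec.dim R \<le> ?i" "?i \<le> n"
      using UW steiner_base[OF st] gens_dim[OF steiner_gens[OF st UW(1)]]
        dim_le_subspace[of R "U \<inter> W"] dim_le_subspace[of "U \<inter> W" U] by auto
    have e: "n - vec.dim R - (?i - vec.dim R) = n - ?i" "n - vec.dim R - 1 - (?i - vec.dim R) = n - 1 - ?i"
      using d by auto
    have "F (?i - vec.dim R) = gnum CARD('a) (n - ?i) * (- 1 / (E * CARD('a))) ^ (n - 1 - ?i)
      + (gnum CARD('a) (n - vec.dim R) - real (gnum CARD('a) (n - ?i))) * (- 1 / (E * CARD('a))) ^ (n - ?i)"
      using F[of "?i - vec.dim R"] d unfolding e by simp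
    then show "(\<Sum>S | S \<in> level R (n - 1) \<and> S \<subseteq> W. tau (n - 1) U S) = F (?i - vec.dim R)"
      using kernel_below_top[OF steiner_gens[OF st UW(1)] steiner_base[OF st UW(1)] steiner_gens[OF st UW(2)]
        steiner_base[OF st UW(2)] R _ refl] r by simp
  qed
  also have "\<dots> = card Y * c" using c by simp
  finally have "0 \<le> real (card Y) * c" .
  moreover have "real (card Y) > 0" using U by (auto simp: card_gt_0_iff)
  ultimately show ?thesis by (meson not_less mult_pos_neg)
qed

text \<open>On generators the kernel has sign (-1)^(rank - i), so in even rank the members meeting U
  in relative dimension 1 have negative weight. Multiplied by e^(j+2) the row sum is e^2 (e^j - P
  gnum Q (j + 1)) - Q^2 P e G, and e \<le> Q^2 gives e^j \<le> P^2 \<le> P gnum Q (j + 1).\<close>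

theorem no_steiner2_even:
  assumes st: "steiner R (vec.dim R + 2) Y" and E: "E > 0" "E \<le> CARD('a)\<^sup>2" and m: "n \<ge> vec.dim R + 4" "even (n - vec.dim R)"
  shows False
proof -
  let ?r = "vec.dim R" and ?q = "real CARD('a)" and ?e = "real E" and ?g = "\<lambda>k. real (gnum CARD('a) k)"
  obtain U where U: "U \<in> Y" using steiner_nonempty[OF st] by blast
  define j where "j = n - ?r - 2"
  have j: "n = ?r + (j + 2)" "j \<ge> 2" "even j" using m by (auto simp: j_def)
  have m_eq: "n - ?r = j + 2" using j by simp
  have e0: "?e > 0" using E by simp
  let ?F = "\<lambda>i::nat. (- 1 / ?e) ^ (j + 2 - i)"
  let ?l1 = "?e * ?q ^ j + 1" and ?l0 = "(?e * ?q ^ (j + 1) + 1) * (?e * ?q ^ j + 1)"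
  have l: "real (lam (?r + 2) ?r) = ?l0" "real (lam (?r + 2) (?r + 1)) = ?l1"
    using lam2[OF j(1)] by simp_all
  let ?c = "?F (j + 2) + ?g (j + 2) * (?l1 - 1) * ?F 1 + (?l0 - 1 - ?g (j + 2) * (?l1 - 1)) * ?F 0"
  have "0 \<le> ?c"
  proof (rule lp_top[OF st U E(1), of ?F])
    show "(\<Sum>W\<in>Y. ?F (vec.dim (U \<inter> W) - ?r)) = ?c" if "U \<in> Y" for U
      using steiner2_sum[OF st that, of ?F] unfolding l m_eq by simp
  qed (use j in auto)
  moreover have "?F 1 = - 1 / ?e ^ (j + 1)" "?F 0 = 1 / ?e ^ (j + 2)" "?F (j + 2) = 1"
    using j(3) by (simp_all add: power_divide)
  ultimately have "0 \<le> 1 + ?g (j + 2) * (?l1 - 1) * (- 1 / ?e ^ (j + 1)) + (?l0 - 1 - ?g (j + 2) * (?l1 - 1)) * (1 / ?e ^ (j + 2))"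
    by metis
  then have "0 \<le> (1 + ?g (j + 2) * (?l1 - 1) * (- 1 / ?e ^ (j + 1)) + (?l0 - 1 - ?g (j + 2) * (?l1 - 1)) * (1 / ?e ^ (j + 2))) * ?e ^ (j + 2)"
    using e0 by (intro mult_nonneg_nonneg) auto
  also have "\<dots> = ?e ^ (j + 2) - ?g (j + 2) * (?l1 - 1) * ?e + (?l0 - 1 - ?g (j + 2) * (?l1 - 1))"
    using e0 by (simp add: field_simps)
  finally have ineq: "0 \<le> ?e ^ (j + 2) - ?g (j + 2) * (?l1 - 1) * ?e + (?l0 - 1 - ?g (j + 2) * (?l1 - 1))" .
  define G P where "G = ?g j" and "P = ?q ^ j"
  have g: "?g (j + 2) = 1 + ?q * (1 + ?q * G)" "?g (j + 1) = 1 + ?q * G" "1 + ?q * G = G + P"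
    using gnum_real_Suc'[of "j + 1"] gnum_real_Suc'[of j] gnum_real_Suc[of j] by (simp_all add: G_def P_def)
  have P: "P = 1 + ?q * G - G" using g(3) by simp
  have G: "G > 0" using gnum_pos[of j "CARD('a)"] j(2) by (simp add: G_def)
  have "?e ^ (j + 2) - ?g (j + 2) * (?l1 - 1) * ?e + (?l0 - 1 - ?g (j + 2) * (?l1 - 1))
      = ?e\<^sup>2 * ?e ^ j - ?e\<^sup>2 * P * ?g (j + 1) - ?q\<^sup>2 * P * ?e * G"
    unfolding g power_add P_def[symmetric] by (simp add: P power2_eq_square algebra_simps)
  moreover have "?e ^ j \<le> P * P"
  proof -
    have "?e \<le> ?q\<^sup>2" using E(2) by (metis of_nat_le_iff of_nat_power)
    then have "?e ^ j \<le> (?q\<^sup>2) ^ j" using e0 by (intro power_mono) auto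
    then show ?thesis by (simp add: P_def power2_eq_square power_mult_distrib)
  qed
  moreover have "P * P \<le> P * ?g (j + 1)"
    using gnum_ge_power[of j] by (intro mult_left_mono) (auto simp: P_def)
  moreover have "?q\<^sup>2 * P * ?e * G > 0" using G e0 Q_ge2 by (simp add: P_def)
  ultimately show False using ineq e0
    by (smt (verit, ccfv_SIG) mult.assoc mult_left_mono zero_le_power2)
qed

text \<open>On the level n - 1 the exponent of the kernel drops by one, which restores the
  favourable sign in odd rank. The price is the denominator y = e Q, so that now e^j must be at most
  gnum Q (j + 1); this follows from e \<le> Q, but not from e \<le> Q^2.\<close>

theorem no_steiner2_odd:
  assumes st: "steiner R (vec.dim R + 2) Y" and E: "E > 0" "E \<le> CARD('a)" and m: "n \<ge> vec.dim R + 5" "odd (n - vec.dim R)"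
  shows False
proof -
  let ?r = "vec.dim R" and ?q = "real CARD('a)" and ?e = "real E" and ?g = "\<lambda>k. real (gnum CARD('a) k)"
  obtain U where U: "U \<in> Y" using steiner_nonempty[OF st] by blast
  define j where "j = n - ?r - 3"
  have j: "n = ?r + (j + 3)" "j \<ge> 2" "even j" using m by (auto simp: j_def)
  have m_eq: "n - ?r = j + 3" using j by simp
  have e0: "?e > 0" using E by simp
  define y where "y = ?e * ?q"
  have y0: "y > 0" using e0 Q_ge2 by (simp add: y_def)
  let ?F = "\<lambda>i::nat. ?g (j + 3 - i) * (- 1 / y) ^ (j + 3 - 1 - i) + (?g (j + 3) - ?g (j + 3 - i)) * (- 1 / y) ^ (j + 3 - i)"
  let ?l1 = "?e * ?q ^ (j + 1) + 1" and ?l0 = "(?e * ?q ^ (j + 2) + 1) * (?e * ?q ^ (j + 1) + 1)"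
  have l: "real (lam (?r + 2) ?r) = ?l0" "real (lam (?r + 2) (?r + 1)) = ?l1"
    using lam2[of ?r "j + 1"] j(1) by (simp_all add: add.assoc)
  let ?a1 = "?g (j + 3) * (?l1 - 1)"
  let ?c = "?F (j + 3) + ?a1 * ?F 1 + (?l0 - 1 - ?a1) * ?F 0"
  have "0 \<le> ?c"
  proof (rule lp_below[OF st U E(1), of ?F])
    show "(\<Sum>W\<in>Y. ?F (vec.dim (U \<inter> W) - ?r)) = ?c" if "U \<in> Y" for U
      using steiner2_sum[OF st that, of ?F] unfolding l m_eq by simp
  qed (use j in \<open>auto simp: y_def\<close>)
  moreover have "?F 1 = - (?g (j + 2) * y - (?g (j + 3) - ?g (j + 2))) / y ^ (j + 2)"
    and "?F 0 = ?g (j + 3) / y ^ (j + 2)" and "?F (j + 3) = ?g (j + 3)"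
    using j(3) y0 by (simp_all add: power_divide field_simps)
  ultimately have "0 \<le> ?g (j + 3) + ?a1 * (- (?g (j + 2) * y - (?g (j + 3) - ?g (j + 2))) / y ^ (j + 2)) + (?l0 - 1 - ?a1) * (?g (j + 3) / y ^ (j + 2))"
    by metis
  then have "0 \<le> (?g (j + 3) + ?a1 * (- (?g (j + 2) * y - (?g (j + 3) - ?g (j + 2))) / y ^ (j + 2)) + (?l0 - 1 - ?a1) * (?g (j + 3) / y ^ (j + 2))) * y ^ (j + 2)"
    using y0 by (intro mult_nonneg_nonneg) auto
  also have "\<dots> = ?g (j + 3) * y ^ (j + 2) - ?a1 * (?g (j + 2) * y - (?g (j + 3) - ?g (j + 2))) + (?l0 - 1 - ?a1) * ?g (j + 3)"
    using y0 by (simp add: field_simps)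
  also have "\<dots> = ?g (j + 3) * (y ^ (j + 2) - (?l1 - 1) * (?g (j + 2) * y - (?g (j + 3) - ?g (j + 2))) + (?l0 - 1 - ?a1))"
    by (simp add: algebra_simps)
  finally have "0 \<le> ?g (j + 3) * (y ^ (j + 2) - (?l1 - 1) * (?g (j + 2) * y - (?g (j + 3) - ?g (j + 2))) + (?l0 - 1 - ?a1))" .
  moreover have "?g (j + 3) > 0" using gnum_pos by simp
  ultimately have ineq: "0 \<le> y ^ (j + 2) - (?l1 - 1) * (?g (j + 2) * y - (?g (j + 3) - ?g (j + 2))) + (?l0 - 1 - ?a1)"
    by (simp add: zero_le_mult_iff)
  define G P where "G = ?g j" and "P = ?q ^ j"
  have g: "?g (j + 3) = 1 + ?q * (1 + ?q * (1 + ?q * G))" "?g (j + 2) = 1 + ?q * (1 + ?q * G)" "?g (j + 1) = 1 + ?q * G" "1 + ?q * G = G + P"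
    using gnum_real_Suc'[of "j + 2"] gnum_real_Suc'[of "j + 1"] gnum_real_Suc'[of j] gnum_real_Suc[of j]
    by (simp_all add: G_def P_def numeral_3_eq_3)
  have P: "P = 1 + ?q * G - G" using g(4) by simp
  have G: "G > 0" using gnum_pos[of j "CARD('a)"] j(2) by (simp add: G_def)
  have P0: "P > 0" using Q_ge2 by (simp add: P_def)
  have "y ^ (j + 2) - (?l1 - 1) * (?g (j + 2) * y - (?g (j + 3) - ?g (j + 2))) + (?l0 - 1 - ?a1)
      = (?q * P * ?e) * (?q * ?e * ?e ^ j - ?q * ?e * ?g (j + 1) - ?q\<^sup>2 * G)"
    unfolding g power_add power_mult_distrib y_def P_def[symmetric]
    by (simp add: P power2_eq_square power3_eq_cube algebra_simps)
  note eq = this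
  have "?e ^ j \<le> P" using E(2) by (auto simp: P_def intro: power_mono)
  moreover have "P \<le> ?g (j + 1)" using gnum_ge_power[of j] unfolding P_def Suc_eq_plus1 .
  ultimately have "?e ^ j \<le> ?g (j + 1)" by linarith
  then have "?q * ?e * ?e ^ j \<le> ?q * ?e * ?g (j + 1)" using e0 by (intro mult_left_mono) auto
  moreover have "?q\<^sup>2 * G > 0" using G Q_ge2 by simp
  ultimately have "(?q * P * ?e) * (?q * ?e * ?e ^ j - ?q * ?e * ?g (j + 1) - ?q\<^sup>2 * G) < 0"
    using P0 e0 Q_ge2 by (intro mult_pos_neg mult_pos_pos) linarith+
  then show False using ineq eq by linarith
qed

text \<open>The numerical core of \<open>no_steiner3_even\<close>. G and P stand for
  \<open>gnum q j\<close> and q^j, g1, g2, g3 for the next three Gaussian numbers, and d for the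
  quotient of g2 by 1 + q that occurs in the Gaussian binomial of order 2.\<close>

lemma steiner3_polynomial:
  fixes q e G P d :: real
  assumes P: "P = 1 + q * G - G" and q: "q \<ge> 2" and P3: "P \<ge> q ^ 3" and e: "e > 0"
  defines "g1 \<equiv> 1 + q * G" and "g2 \<equiv> 1 + q * (1 + q * G)" and "g3 \<equiv> 1 + q * (1 + q * (1 + q * G))" and "z \<equiv> e * P"
  assumes d: "(1 + q) * d = g2"
  shows "z ^ 3 - ((q\<^sup>2 * z + 1) * (q * z + 1) * (z + 1) - 1)
    + (q * z + q + 1 - g2) * z * (g2 * (e * q) + g2)
    - d * z * (g1 * (e * q)\<^sup>2 - (q\<^sup>2 * P + q * P) * (e * q) - g3) < 0" (is "?L < 0")
proof -
  \<comment> \<open>After division by z the left side is a quadratic in e with coefficients X2, X1,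
    X0. The factor (q - 1)^2 (1 + q) clears d and G = (P - 1)/(q - 1), and leaves quadratics in P
    alone, each negative once P \<ge> 4 q.\<close>
  let ?X2 = "P\<^sup>2 - q ^ 3 * P\<^sup>2 + q\<^sup>2 * P * g2 - d * g1 * q\<^sup>2"
  let ?X1 = "- (q ^ 3 + q\<^sup>2 + q) * P + q * P * g2 + (q + 1 - g2) * g2 * q + g2 * q\<^sup>2 * P"
  let ?X0 = "- (q\<^sup>2 + q + 1) + (q + 1 - g2) * g2 + d * g3"
  let ?c2 = "- (q\<^sup>2 + q - 1) * P\<^sup>2 + (q ^ 3 + q\<^sup>2) * P - q\<^sup>2"
  let ?c1 = "- (q ^ 3) * P\<^sup>2 + (q ^ 4 + q\<^sup>2) * P - q ^ 3"
  let ?c0 = "- (q ^ 4) * P\<^sup>2 + (q ^ 5 + q ^ 4) * P - q ^ 5"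
  have "d * (q\<^sup>2 * P + q * P) * q = ((1 + q) * d) * (q\<^sup>2 * P)"
    by (simp add: algebra_simps power2_eq_square)
  then have dP: "d * (q\<^sup>2 * P + q * P) * q = g2 * (q\<^sup>2 * P)" unfolding d .
  have "?L = z * (e\<^sup>2 * ?X2 + e * (?X1 - g2 * q\<^sup>2 * P + d * (q\<^sup>2 * P + q * P) * q) + ?X0)"
    unfolding z_def by (simp add: algebra_simps power2_eq_square power3_eq_cube)
  then have L: "?L = z * (e\<^sup>2 * ?X2 + e * ?X1 + ?X0)" unfolding dP by (simp add: algebra_simps)
  have "?X2 * ((q - 1)\<^sup>2 * (1 + q)) = (q - 1)\<^sup>2 * ((1 + q) * (P\<^sup>2 - q ^ 3 * P\<^sup>2 + q\<^sup>2 * P * g2) - ((1 + q) * d) * g1 * q\<^sup>2)"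
    by (simp add: algebra_simps)
  also have "\<dots> = ?c2" unfolding d unfolding g1_def g2_def P by algebra
  finally have x2: "?X2 * ((q - 1)\<^sup>2 * (1 + q)) = ?c2" .
  have x1: "?X1 * ((q - 1)\<^sup>2 * (1 + q)) = (q + 1) * ?c1" unfolding g2_def P by algebra
  have "?X0 * ((q - 1)\<^sup>2 * (1 + q)) = (q - 1)\<^sup>2 * ((1 + q) * (- (q\<^sup>2 + q + 1) + (q + 1 - g2) * g2) + ((1 + q) * d) * g3)"
    by (simp add: algebra_simps)
  also have "\<dots> = ?c0" unfolding d unfolding g3_def g2_def P by algebra
  finally have x0: "?X0 * ((q - 1)\<^sup>2 * (1 + q)) = ?c0" .
  have w: "(q - 1)\<^sup>2 * (1 + q) > 0" using q by simp
  have q0: "q > 0" using q by simp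
  have P0: "P > 0" using P3 zero_less_power[OF q0, of 3] by linarith
  have q4: "4 * q \<le> q ^ 3"
  proof -
    have "2 * 2 \<le> q * q" using q by (intro mult_mono) auto
    then have "4 * q \<le> (q * q) * q" using q0 by (intro mult_right_mono) auto
    then show ?thesis by (simp add: power3_eq_cube)
  qed
  then have P4: "P \<ge> 4 * q" using P3 by linarith
  have neg: "- a * P\<^sup>2 + b * P - c < 0" if "b \<le> a * (4 * q)" "a \<ge> 0" "c > 0" for a b c
  proof -
    have "b \<le> a * P" using that(1) mult_left_mono[OF P4 that(2)] by linarith
    then have "b * P \<le> a * P * P" using P0 by (intro mult_right_mono) auto
    then show ?thesis using that(3) by (simp add: power2_eq_square)
  qed
  have "?c2 < 0"
  proof (rule neg)
    have "q * q \<ge> 2 * 2" using q by (intro mult_mono) auto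
    then have "3 * (q * q) + 3 * q \<ge> 4" using q0 by linarith
    then have "q * (3 * (q * q) + 3 * q - 4) \<ge> 0" using q0 by simp
    then show "q ^ 3 + q\<^sup>2 \<le> (q\<^sup>2 + q - 1) * (4 * q)"
      by (simp add: algebra_simps power2_eq_square power3_eq_cube)
    show "q\<^sup>2 + q - 1 \<ge> 0" using q zero_le_power2[of q] by linarith
    show "q\<^sup>2 > 0" using q0 by simp
  qed
  moreover have "?c1 < 0"
  proof (rule neg)
    have "q\<^sup>2 \<le> q ^ 4" using q by (intro power_increasing) auto
    moreover have "0 \<le> q ^ 4" using q0 by simp
    ultimately show "q ^ 4 + q\<^sup>2 \<le> q ^ 3 * (4 * q)" by (simp add: power_numeral_reduce algebra_simps)
  qed (use q0 in auto)
  moreover have "?c0 < 0"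
  proof (rule neg)
    have "q ^ 4 \<le> q ^ 5" using q by (intro power_increasing) auto
    moreover have "0 \<le> q ^ 5" using q0 by simp
    ultimately show "q ^ 5 + q ^ 4 \<le> q ^ 4 * (4 * q)" by (simp add: power_numeral_reduce algebra_simps)
  qed (use q0 in auto)
  ultimately have "?X2 * ((q - 1)\<^sup>2 * (1 + q)) < 0" "?X1 * ((q - 1)\<^sup>2 * (1 + q)) < 0" "?X0 * ((q - 1)\<^sup>2 * (1 + q)) < 0"
    unfolding x2 x1 x0 using q0 by (auto intro: mult_pos_neg)
  moreover have "x < 0" if "x * ((q - 1)\<^sup>2 * (1 + q)) < 0" for x
    using that w by (meson mult_nonneg_nonneg not_less less_imp_le)
  ultimately have "?X2 < 0" "?X1 < 0" "?X0 < 0" by (simp_all only:)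
  then have "e\<^sup>2 * ?X2 < 0" "e * ?X1 < 0" using e by (intro mult_pos_neg; simp)+
  then have "e\<^sup>2 * ?X2 + e * ?X1 + ?X0 < 0" using \<open>?X0 < 0\<close> by linarith
  then show ?thesis unfolding L using e P0 by (intro mult_pos_neg) (auto simp: z_def)
qed

lemma clear_denominator:
  fixes Y :: real
  assumes "0 \<le> g + (a / Y) * A + (b / Y - a / Y) * B + (c / Y - a / Y - (b / Y - a / Y) * k) * M" "Y > 0"
  shows "0 \<le> g * Y + a * A + (b - a) * B + (c - a - (b - a) * k) * M"
proof -
  have "0 \<le> (g + (a / Y) * A + (b / Y - a / Y) * B + (c / Y - a / Y - (b / Y - a / Y) * k) * M) * Y"
    using assms by simp
  also have "\<dots> = g * Y + a * A + (b - a) * B + (c - a - (b - a) * k) * M"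
    using assms(2) by (simp add: field_simps)
  finally show ?thesis .
qed

text \<open>In even rank the level n - 1 gives negative weight to the members meeting U in relative
  dimension 0 or 2, and they prevail from relative rank 6 on.\<close>

theorem no_steiner3_even:
  assumes st: "steiner R (vec.dim R + 3) Y" and E: "E > 0" "E \<le> CARD('a)\<^sup>2" and m: "n \<ge> vec.dim R + 6" "even (n - vec.dim R)"
  shows False
proof -
  let ?r = "vec.dim R" and ?q = "real CARD('a)" and ?e = "real E" and ?g = "\<lambda>k. real (gnum CARD('a) k)"
  obtain U where U: "U \<in> Y" using steiner_nonempty[OF st] by blast
  define j where "j = n - ?r - 3"
  have j: "n = ?r + (j + 3)" "j \<ge> 3" "odd j" using m by (auto simp: j_def)
  have m_eq: "n - ?r = j + 3" using j by simp
  have e0: "?e > 0" using E by simp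
  define y where "y = ?e * ?q"
  have y0: "y > 0" using e0 Q_ge2 by (simp add: y_def)
  let ?F = "\<lambda>i::nat. ?g (j + 3 - i) * (- 1 / y) ^ (j + 3 - 1 - i) + (?g (j + 3) - ?g (j + 3 - i)) * (- 1 / y) ^ (j + 3 - i)"
  define G P z where "G = ?g j" and "P = ?q ^ j" and "z = ?e * P"
  have g: "?g (j + 3) = 1 + ?q * (1 + ?q * (1 + ?q * G))" "?g (j + 2) = 1 + ?q * (1 + ?q * G)" "?g (j + 1) = 1 + ?q * G" "1 + ?q * G = G + P"
    using gnum_real_Suc'[of "j + 2"] gnum_real_Suc'[of "j + 1"] gnum_real_Suc'[of j] gnum_real_Suc[of j]
    by (simp_all add: G_def P_def numeral_3_eq_3)
  have P: "P = 1 + ?q * G - G" using g(4) by simp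
  have l: "real (lam (?r + 3) ?r) = (?q\<^sup>2 * z + 1) * (?q * z + 1) * (z + 1)"
    "real (lam (?r + 3) (?r + 1)) = (?q * z + 1) * (z + 1)" "real (lam (?r + 3) (?r + 2)) = z + 1"
    unfolding lam3[OF j(1)] by (simp_all add: z_def P_def power_add power2_eq_square algebra_simps)
  let ?l0 = "(?q\<^sup>2 * z + 1) * (?q * z + 1) * (z + 1)" and ?l1 = "(?q * z + 1) * (z + 1)"
  let ?b = "?g (j + 3) * ?g (j + 2) / (1 + ?q)"
  let ?c = "?F (j + 3) + ?F 0 * (?l0 - 1) + (?F 1 - ?F 0) * (?g (j + 3) * (?l1 - 1))
     + (?F 2 - ?F 0 - (?F 1 - ?F 0) * (1 + ?q)) * (?b * z)"
  have b: "gbinom CARD('a) (j + 3) 2 = ?b" unfolding gbinom_2 by simp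
  have "0 \<le> ?c"
  proof (rule lp_below[OF st U E(1), of ?F])
    show "(\<Sum>W\<in>Y. ?F (vec.dim (U \<inter> W) - ?r)) = ?c" if "U \<in> Y" for U
      using steiner3_sum[OF st that, of ?F] unfolding l m_eq b by simp
  qed (use j in \<open>auto simp: y_def\<close>)
  moreover have F1: "?F 1 = (?g (j + 2) * y - (?g (j + 3) - ?g (j + 2))) / y ^ (j + 2)"
    and F0: "?F 0 = - ?g (j + 3) / y ^ (j + 2)" and F3: "?F (j + 3) = ?g (j + 3)"
    using j(3) y0 by (simp_all add: power_divide field_simps)
  moreover have F2: "?F 2 = - (?g (j + 1) * y\<^sup>2 - (?g (j + 3) - ?g (j + 1)) * y) / y ^ (j + 2)"
    using j(3) y0 by (simp add: power_divide field_simps power2_eq_square)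
  ultimately have "0 \<le> ?g (j + 3) + (- ?g (j + 3) / y ^ (j + 2)) * (?l0 - 1)
     + ((?g (j + 2) * y - (?g (j + 3) - ?g (j + 2))) / y ^ (j + 2) - (- ?g (j + 3) / y ^ (j + 2))) * (?g (j + 3) * (?l1 - 1))
     + (- (?g (j + 1) * y\<^sup>2 - (?g (j + 3) - ?g (j + 1)) * y) / y ^ (j + 2) - (- ?g (j + 3) / y ^ (j + 2))
        - ((?g (j + 2) * y - (?g (j + 3) - ?g (j + 2))) / y ^ (j + 2) - (- ?g (j + 3) / y ^ (j + 2))) * (1 + ?q)) * (?b * z)"
    by (simp only:)
  from clear_denominator[OF this zero_less_power[OF y0]]
  have D: "0 \<le> ?g (j + 3) * y ^ (j + 2) + (- ?g (j + 3)) * (?l0 - 1)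
     + ((?g (j + 2) * y - (?g (j + 3) - ?g (j + 2))) - (- ?g (j + 3))) * (?g (j + 3) * (?l1 - 1))
     + (- (?g (j + 1) * y\<^sup>2 - (?g (j + 3) - ?g (j + 1)) * y) - (- ?g (j + 3))
        - ((?g (j + 2) * y - (?g (j + 3) - ?g (j + 2))) - (- ?g (j + 3))) * (1 + ?q)) * (?b * z)" .
  define d where "d = ?g (j + 2) / (1 + ?q)"
  have d: "(1 + ?q) * d = ?g (j + 2)" using Q_ge2 by (simp add: d_def)
  have bd: "?b = ?g (j + 3) * d" by (simp add: d_def)
  have "?g (j + 3) > 0" using gnum_pos by simp
  moreover have "?g (j + 3) * y ^ (j + 2) + (- ?g (j + 3)) * (?l0 - 1)
     + ((?g (j + 2) * y - (?g (j + 3) - ?g (j + 2))) - (- ?g (j + 3))) * (?g (j + 3) * (?l1 - 1))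
     + (- (?g (j + 1) * y\<^sup>2 - (?g (j + 3) - ?g (j + 1)) * y) - (- ?g (j + 3))
        - ((?g (j + 2) * y - (?g (j + 3) - ?g (j + 2))) - (- ?g (j + 3))) * (1 + ?q)) * (?b * z)
     = ?g (j + 3) * (y ^ (j + 2) - (?l0 - 1) + ((?l1 - 1) - ((1 + ?q) * d) * z) * (?g (j + 2) * y + ?g (j + 2))
        - d * z * (?g (j + 1) * y\<^sup>2 - (?g (j + 3) - ?g (j + 1)) * y - ?g (j + 3)))"
    unfolding bd by (simp add: algebra_simps)
  ultimately have "0 \<le> y ^ (j + 2) - (?l0 - 1) + ((?l1 - 1) - ((1 + ?q) * d) * z) * (?g (j + 2) * y + ?g (j + 2))
        - d * z * (?g (j + 1) * y\<^sup>2 - (?g (j + 3) - ?g (j + 1)) * y - ?g (j + 3))"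
    using D by (simp only: zero_le_mult_iff) linarith
  also have "?g (j + 3) - ?g (j + 1) = ?q\<^sup>2 * P + ?q * P"
    unfolding g(1-3) P by (simp add: algebra_simps power2_eq_square)
  also have "?l1 - 1 - ((1 + ?q) * d) * z = (?q * z + ?q + 1 - ?g (j + 2)) * z"
    unfolding d by (simp add: algebra_simps)
  \<comment> \<open>E \<le> Q^2 is used only here: y^(j+2) = e^(j-1) e^3 Q^(j+2) is at most Q^(2j-2)
    e^3 Q^(j+2) = z^3, after which j occurs only through P and the Gaussian numbers.\<close>
  also have "y ^ (j + 2) - (?l0 - 1) + (?q * z + ?q + 1 - ?g (j + 2)) * z * (?g (j + 2) * y + ?g (j + 2))
      - d * z * (?g (j + 1) * y\<^sup>2 - (?q\<^sup>2 * P + ?q * P) * y - ?g (j + 3))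
    \<le> z ^ 3 - (?l0 - 1) + (?q * z + ?q + 1 - ?g (j + 2)) * z * (?g (j + 2) * y + ?g (j + 2))
      - d * z * (?g (j + 1) * y\<^sup>2 - (?q\<^sup>2 * P + ?q * P) * y - ?g (j + 3))"
  proof -
    have "?e \<le> ?q\<^sup>2" using E(2) by (metis of_nat_le_iff of_nat_power)
    then have "?e ^ (j - 1) \<le> (?q\<^sup>2) ^ (j - 1)" using e0 by (intro power_mono) auto
    then have "?e ^ (j - 1) * (?e ^ 3 * ?q ^ (j + 2)) \<le> (?q\<^sup>2) ^ (j - 1) * (?e ^ 3 * ?q ^ (j + 2))"
      using e0 by (intro mult_right_mono) auto
    moreover have "?e ^ (j - 1) * (?e ^ 3 * ?q ^ (j + 2)) = y ^ (j + 2)"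
    proof -
      have "j + 2 = (j - 1) + 3" using j by simp
      then have "?e ^ (j + 2) = ?e ^ (j - 1) * ?e ^ 3" by (simp only: power_add)
      then show ?thesis by (simp only: y_def power_mult_distrib mult.assoc)
    qed
    moreover have "(?q\<^sup>2) ^ (j - 1) * (?e ^ 3 * ?q ^ (j + 2)) = z ^ 3"
    proof -
      have "2 * (j - 1) + (j + 2) = j * 3" using j by simp
      then have "(?q\<^sup>2) ^ (j - 1) * ?q ^ (j + 2) = (?q ^ j) ^ 3" by (simp only: power_mult[symmetric] power_add[symmetric])
      then show ?thesis by (simp only: z_def P_def power_mult_distrib mult.assoc mult.left_commute)
    qed
    ultimately show ?thesis by linarith
  qed
  also have "\<dots> < 0"
    unfolding g(1-3) z_def y_def
    by (rule steiner3_polynomial[OF P Q_ge2 _ e0])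
      (use j(2) Q_ge2 d[unfolded g(1-3)] in \<open>auto simp: P_def intro: power_increasing\<close>)
  finally show False by simp
qed

end

section \<open>The generators opposite to a fixed one\<close>

context polar_space
begin

definition opposite :: "('a ^ 'm) set \<Rightarrow> ('a ^ 'm) set \<Rightarrow> ('a ^ 'm) set set" where
  "opposite R F = {S \<in> gens. S \<inter> F = R}"

definition subcount :: "('a ^ 'm) set \<Rightarrow> (('a ^ 'm) set \<Rightarrow> bool) \<Rightarrow> nat \<Rightarrow> ('a ^ 'm) set \<Rightarrow> nat" where
  "subcount R p k S = card {M \<in> subs_between R S k. p M}"

lemma subspace_Int: "vec.subspace A \<Longrightarrow> vec.subspace B \<Longrightarrow> vec.subspace (A \<inter> B)" for A B :: "('a ^ 'm) set"
  by (rule vec.subspace_inter)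

lemma gens_eq_span:
  assumes "S \<in> gens" "vec.subspace L" "vec.subspace M" "L \<subseteq> S" "M \<subseteq> S" "vec.dim L + 1 = n" "\<not> M \<subseteq> L"
  shows "S = vec.span (L \<union> M)" "vec.dim (M \<inter> L) + 1 = vec.dim M"
proof -
  have sub: "vec.span (L \<union> M) \<subseteq> S" using assms by (intro vec.span_minimal gens_subspace) auto
  have "vec.dim (L \<inter> M) < vec.dim M"
  proof (rule ccontr)
    assume "\<not> vec.dim (L \<inter> M) < vec.dim M"
    then have "L \<inter> M = M" using subspace_dim_eq[OF subspace_Int[OF assms(2,3)] assms(3)] by simp
    then show False using assms(7) by blast
  qed
  moreover have "vec.dim (vec.span (L \<union> M)) \<le> n" using dim_le_subspace[OF sub] gens_dim[OF assms(1)] by simp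
  ultimately have d: "vec.dim (vec.span (L \<union> M)) = n" "vec.dim (L \<inter> M) + 1 = vec.dim M"
    using dim_span_Un[OF assms(2,3)] assms(6) by linarith+
  show "S = vec.span (L \<union> M)"
    using subspace_dim_eq[OF vec.subspace_span gens_subspace[OF assms(1)] sub] d gens_dim[OF assms(1)] by simp
  show "vec.dim (M \<inter> L) + 1 = vec.dim M" using d by (simp add: Int_commute)
qed

lemma opposite_above:
  assumes F: "F \<in> gens" and L: "L \<in> PP" "L \<inter> F = R" "vec.dim L + 1 = n" and S: "S \<in> gens" "L \<subseteq> S"
  shows "S \<in> opposite R F \<longleftrightarrow> S \<noteq> proj L F"
proof
  assume "S \<in> opposite R F"
  then have "S \<inter> F = R" by (simp add: opposite_def)
  moreover have "vec.dim (proj L F \<inter> F) = vec.dim R + 1"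
    using dim_proj_Int[OF L(1) F] L(2,3) by simp
  ultimately show "S \<noteq> proj L F" by auto
next
  assume ne: "S \<noteq> proj L F"
  have "proj L F \<inter> S = L"
    using gens_Int_eq[OF S(1) proj_gens[OF L(1) F] _ PP_subspace[OF L(1)] L(3) S(2) proj_superset] ne by blast
  moreover have "S \<inter> F \<subseteq> proj L F" using Int_subset_proj[OF gens_PP[OF S(1)] S(2)] .
  ultimately have "S \<inter> F \<subseteq> L" by blast
  then show "S \<in> opposite R F" using L(2) S by (auto simp: opposite_def)
qed

lemma card_opposite_above:
  assumes F: "F \<in> gens" and L: "L \<in> PP" "L \<inter> F = R" "vec.dim L + 1 = n"
  shows "card {S \<in> opposite R F. L \<subseteq> S} = E"
proof -
  have "{S \<in> opposite R F. L \<subseteq> S} = {S \<in> gens. L \<subseteq> S} - {proj L F}"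
    using opposite_above[OF F L] by (auto simp: opposite_def)
  moreover have "proj L F \<in> {S \<in> gens. L \<subseteq> S}" using proj_gens[OF L(1) F] proj_superset by blast
  ultimately show ?thesis using gens_count[OF L(1,3)] by (simp add: card_Diff_singleton)
qed

text \<open>
  The local count: a subspace \<open>M\<close> of an opposite generator through \<open>L\<close> that meets \<open>L\<close> in \<open>M'\<close> and
  whose projection lies in \<open>Y\<close> corresponds to a hyperplane of the projection of \<open>M'\<close>.
\<close>

lemma card_local:
  assumes st: "steiner R t Y" and t: "t + 1 = n" and F: "F \<in> gens" "R \<subseteq> F"
    and L: "L \<in> PP" "L \<inter> F = R" "vec.dim L + 1 = n"
    and M': "M' \<in> subs_between R L k" and k: "vec.dim R + k < n"
  shows "card {M. \<exists>S\<in>opposite R F. L \<subseteq> S \<and> M \<in> subs_between R S (Suc k) \<and> M \<inter> L = M' \<and> proj M F \<in> Y}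
       = (if proj M' F \<in> Y then 0 else CARD('a) ^ (n - vec.dim R - Suc k))" (is "card ?M = _")
proof -
  let ?r = "vec.dim R"
  have R: "R \<in> PP" "vec.subspace R" using steiner_PP[OF st] PP_subspace by auto
  have sF: "vec.subspace F" and sL: "vec.subspace L" using F L by (auto simp: gens_subspace PP_subspace)
  have RL: "R \<subseteq> L" using L(2) by blast
  have M'2: "vec.subspace M'" "R \<subseteq> M'" "M' \<subseteq> L" "vec.dim M' = ?r + k" using M' by (auto simp: subs_between_def)
  have M'P: "M' \<in> PP" using PP_down[OF L(1) M'2(1,3)] .
  have M'F: "M' \<inter> F = R" using M'2 L(2) by blast
  define F' where "F' = proj M' F"
  have F': "F' \<in> gens" unfolding F'_def by (rule proj_gens[OF M'P F(1)])
  have sF': "vec.subspace F'" using F' by (rule gens_subspace)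
  have M'F': "M' \<subseteq> F'" unfolding F'_def by (rule proj_superset)
  have F'F: "F' \<inter> F = F \<inter> orth M'" unfolding F'_def by (rule proj_Int[OF M'P])
  have dF'F: "vec.dim (F' \<inter> F) + k = n" using dim_proj_Int[OF M'P F(1)] M'F M'2(4) by (simp add: F'_def)
  have decomp: "\<exists>m f. x = m + f \<and> m \<in> M' \<and> f \<in> F \<and> f \<in> F'" if "x \<in> F'" for x
    using that span_Un_subspaces[OF M'2(1) subspace_Int_orth[OF sF, of M']] F'F
    unfolding F'_def proj_def by fastforce
  have in_M': "x \<in> M'" if x: "x \<in> F'" and S: "vec.subspace S" "M' \<subseteq> S" "S \<inter> F = R" "x \<in> S" for x S
  proof -
    obtain m f where mf: "x = m + f" "m \<in> M'" "f \<in> F" using decomp[OF x] by blast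
    have "f = x - m" using mf by simp
    then have "f \<in> S" using S mf(2) vec.subspace_diff by blast
    then have "f \<in> R" using S(3) mf(3) by blast
    then show ?thesis using mf M'2 vec.subspace_add by blast
  qed
  have LF': "L \<inter> F' = M'" using in_M'[OF _ sL M'2(3) L(2)] M'2(3) M'F' by blast
  \<comment> \<open>X is one dimension larger than M'. The hyperplanes of F' through X are the ones
    to be left out: a vector of X outside M' in the projection of M would be orthogonal to L and M,
    hence lie in S, although S is opposite to F.\<close>
  define X where "X = F' \<inter> orth L"
  have sX: "vec.subspace X" unfolding X_def by (rule subspace_Int_orth[OF sF'])
  have dX: "vec.dim X = ?r + k + 1"
    using dim_gen_orth[OF L(1) F'] L(3) LF' M'2(4) by (simp add: X_def)
  have M'X: "M' \<subseteq> X" using M'F' M'2(3) PP_orth[OF L(1)] by (auto simp: X_def)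
  have Ypi: "vec.dim (proj M F \<inter> F) + ?r + k + 1 = n + ?r" "M \<subseteq> proj M F" "proj M F \<in> gens"
    if "M \<in> PP" "M \<inter> F = R" "vec.dim M = ?r + Suc k" for M
    using dim_proj_Int[OF that(1) F(1)] that proj_superset proj_gens[OF that(1) F(1)] by auto
  have member: "M \<in> PP" "M \<inter> F = R" "vec.dim M = ?r + Suc k" "M \<inter> L = M'" "proj M F \<in> Y" "\<not> M \<subseteq> L"
      "M \<subseteq> orth L" "\<exists>S\<in>gens. S \<inter> F = R \<and> S = vec.span (L \<union> M)"
    if M: "M \<in> ?M" for M
  proof -
    obtain S where S: "S \<in> gens" "S \<inter> F = R" "L \<subseteq> S" "vec.subspace M" "R \<subseteq> M" "M \<subseteq> S" "vec.dim M = ?r + Suc k"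
      "M \<inter> L = M'" "proj M F \<in> Y"
      using M by (auto simp: opposite_def subs_between_def)
    show "M \<in> PP" using PP_down[OF gens_PP[OF S(1)] S(4,6)] .
    show "M \<inter> F = R" using S F(2) by blast
    show "vec.dim M = ?r + Suc k" "M \<inter> L = M'" "proj M F \<in> Y" using S by auto
    show nML: "\<not> M \<subseteq> L"
    proof
      assume "M \<subseteq> L"
      then have "M = M'" using S(8) by blast
      then show False using S(7) M'2(4) by simp
    qed
    show "M \<subseteq> orth L" using S(6) PP_subset_orth[OF gens_PP[OF S(1)] S(3)] by blast
    show "\<exists>S\<in>gens. S \<inter> F = R \<and> S = vec.span (L \<union> M)"
      using gens_eq_span(1)[OF S(1) sL S(4,3,6) L(3) nML] S(1,2) by blast
  qed
  \<comment> \<open>Both \<open>proj M F\<close> and F' contain M', and the part of F in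
    \<open>proj M F\<close> lies in F'; together they span a subspace of dimension n - 1.\<close>
  have big: "vec.dim (proj M F \<inter> F') + 1 \<ge> n" and M'pi: "M' \<subseteq> proj M F" if M: "M \<in> ?M" for M
  proof -
    note m = member[OF M]
    have "M' \<subseteq> M" using m(4) by blast
    then show M'pi: "M' \<subseteq> proj M F" using Ypi(2)[OF m(1-3)] by blast
    have spi: "vec.subspace (proj M F \<inter> F)" using gens_subspace[OF Ypi(3)[OF m(1-3)]] sF by (rule subspace_Int)
    have "proj M F \<inter> F \<subseteq> F'" unfolding F'_def
      using Int_subset_proj[OF gens_PP[OF Ypi(3)[OF m(1-3)]] M'pi] .
    then have sub: "vec.span (M' \<union> (proj M F \<inter> F)) \<subseteq> proj M F \<inter> F'"
      using M'pi M'F' gens_subspace[OF Ypi(3)[OF m(1-3)]] sF' by (intro vec.span_minimal subspace_Int) auto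
    have "M' \<inter> (proj M F \<inter> F) = R" using M'F M'pi by blast
    then have "vec.dim (vec.span (M' \<union> (proj M F \<inter> F))) + 1 = n"
      using dim_span_Un[OF M'2(1) spi] Ypi(1)[OF m(1-3)] M'2(4) by simp
    then show "vec.dim (proj M F \<inter> F') + 1 \<ge> n" using dim_le_subspace[OF sub] by simp
  qed
  show ?thesis
  proof (cases "F' \<in> Y")
    case True
    have "?M = {}"
    proof (rule ccontr)
      assume "?M \<noteq> {}"
      then obtain M where M: "M \<in> ?M" by blast
      note m = member[OF M]
      \<comment> \<open>The common subspace has dimension at least t, so the two members F' and
        \<open>proj M F\<close> coincide, although they meet F in different dimensions.\<close>
      have "proj M F \<inter> F' \<in> PP" using PP_Int[OF gens_PP[OF Ypi(3)[OF m(1-3)]] sF'] .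
      then have "proj M F = F'"
        using steiner_eq[OF st, of "proj M F \<inter> F'"] big[OF M] t m(5) True steiner_base[OF st] M'2(2) M'F' M'pi[OF M] by auto
      then show False using Ypi(1)[OF m(1-3)] dF'F by simp
    qed
    then show ?thesis using True by (simp add: F'_def)
  next
    case False
    let ?H = "{H \<in> covers_below M' F'. \<not> X \<subseteq> H}"
    have H: "vec.subspace H" "M' \<subseteq> H" "H \<subseteq> F'" "vec.dim H + 1 = n" "H \<in> PP" "R \<subseteq> H" "vec.span (H \<union> X) = F'" "X \<inter> H = M'"
      if "H \<in> ?H" for H
    proof -
      show H1: "vec.subspace H" "M' \<subseteq> H" "H \<subseteq> F'" "vec.dim H + 1 = n"
        using that gens_dim[OF F'] by (auto simp: covers_below_def)
      show "H \<in> PP" using PP_down[OF gens_PP[OF F'] H1(1,3)] .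
      show "R \<subseteq> H" using H1(2) M'2(2) by blast
      have XF: "X \<subseteq> F'" by (auto simp: X_def)
      have nX: "\<not> X \<subseteq> H" using that by blast
      show "vec.span (H \<union> X) = F'" using gens_eq_span(1)[OF F' H1(1) sX H1(3) XF H1(4) nX] by simp
      have "vec.dim (X \<inter> H) \<le> vec.dim M'"
        using gens_eq_span(2)[OF F' H1(1) sX H1(3) XF H1(4) nX] dX M'2(4) by simp
      then show "X \<inter> H = M'"
        using subspace_dim_eq[OF M'2(1) subspace_Int[OF sX H1(1)]] M'X H1(2) by auto
    qed
    have in_orthF': "z \<in> F'" if "H \<in> ?H" "z \<in> orth H" "z \<in> L" for H z
    proof -
      have "z \<in> orth X" using that(3) subset_orth_sym[of X L] by (auto simp: X_def)
      then have "z \<in> orth (vec.span (H \<union> X))" using that(2) by (simp add: orth_span orth_Un)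
      then show ?thesis using gens_max[OF F'] H(7)[OF that(1)] PP_sing[OF L(1) that(3)] by simp
    qed
    have Lpi: "L \<inter> W = M'" if HH: "H \<in> ?H" and W: "W \<in> gens" "H \<subseteq> W" for H W
    proof
      show "M' \<subseteq> L \<inter> W" using M'2(3) H(2)[OF HH] W(2) by blast
      show "L \<inter> W \<subseteq> M'"
      proof
        fix z assume z: "z \<in> L \<inter> W"
        then have "z \<in> orth H" using PP_subset_orth[OF gens_PP[OF W(1)] W(2)] by blast
        then have "z \<in> F'" using in_orthF'[OF HH] z by blast
        then show "z \<in> M'" using z LF' by blast
      qed
    qed
    have dWL: "vec.dim (W \<inter> orth L) = ?r + Suc k" if HH: "H \<in> ?H" and W: "W \<in> gens" "H \<subseteq> W" for H W
      using dim_gen_orth[OF L(1) W(1)] Lpi[OF HH W] L(3) M'2(4) by simp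
    have "bij_betw (\<lambda>M. proj M F \<inter> F') ?M ?H"
      unfolding bij_betw_def
    proof
      have img: "proj M F \<inter> F' \<in> ?H" if M: "M \<in> ?M" for M
      proof -
        note m = member[OF M] and pi = Ypi[OF member(1-3)[OF M]]
        have spi: "vec.subspace (proj M F \<inter> F')" using gens_subspace[OF pi(3)] sF' by (rule subspace_Int)
        have "vec.dim (proj M F \<inter> F') \<noteq> n"
        proof
          assume "vec.dim (proj M F \<inter> F') = n"
          then have "proj M F \<inter> F' = F'" using subspace_dim_eq[OF spi sF'] gens_dim[OF F'] by simp
          then have "F' = proj M F" using gens_eqI[OF F' pi(3)] by blast
          then show False using False m(5) by simp
        qed
        then have d: "vec.dim (proj M F \<inter> F') + 1 = n"
          using big[OF M] dim_le_subspace[of "proj M F \<inter> F'" F'] gens_dim[OF F'] by simp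
        have "\<not> X \<subseteq> proj M F \<inter> F'"
        proof
          assume XH: "X \<subseteq> proj M F \<inter> F'"
          have "X \<noteq> M'" using dX M'2(4) by auto
          then obtain x where x: "x \<in> X" "x \<notin> M'" using M'X by blast
          obtain S where S: "S \<in> gens" "S \<inter> F = R" "S = vec.span (L \<union> M)" using m(8) by blast
          have "x \<in> orth M" using XH x(1) PP_subset_orth[OF gens_PP[OF pi(3)] pi(2)] by blast
          moreover have "x \<in> orth L" using x(1) by (simp add: X_def)
          ultimately have "x \<in> orth S" by (simp add: S(3) orth_span orth_Un)
          moreover have xF': "x \<in> F'" using x(1) by (simp add: X_def)
          ultimately have "x \<in> S" using gens_max[OF S(1)] PP_sing[OF gens_PP[OF F']] by blast
          moreover have "M' \<subseteq> S" using M'2(3) S(3) vec.span_superset[of "L \<union> M"] by blast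
          ultimately have "x \<in> M'" using in_M'[OF xF' gens_subspace[OF S(1)] _ S(2)] by blast
          then show False using x(2) by simp
        qed
        then show ?thesis using spi M'pi[OF M] M'F' d gens_dim[OF F'] by (auto simp: covers_below_def)
      qed
      show "inj_on (\<lambda>M. proj M F \<inter> F') ?M"
      proof (rule inj_onI)
        fix M1 M2 assume M: "M1 \<in> ?M" "M2 \<in> ?M" and eq: "proj M1 F \<inter> F' = proj M2 F \<inter> F'"
        let ?K = "proj M1 F \<inter> F'"
        note K = H[OF img[OF M(1)]]
        have same: "proj M1 F = proj M2 F"
          using steiner_eq[OF st K(5,6) _ member(5)[OF M(1)] member(5)[OF M(2)]] K(4) t eq by auto
        \<comment> \<open>M is recovered from its projection by intersecting with
          \<open>orth L\<close>; the projection is in turn the only member through its hyperplane in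
          F'.\<close>
        have sel: "Mi = proj Mi F \<inter> orth L" if Mi: "Mi \<in> ?M" for Mi
        proof -
          note m = member[OF Mi] and pi = Ypi[OF member(1-3)[OF Mi]]
          have "Mi \<subseteq> proj Mi F \<inter> orth L" using pi(2) m(7) by blast
          moreover have "vec.dim (proj Mi F \<inter> orth L) = ?r + Suc k"
            using dWL[OF img[OF Mi] pi(3)] by blast
          ultimately show ?thesis
            using subspace_dim_eq[OF PP_subspace[OF m(1)] subspace_Int_orth[OF gens_subspace[OF pi(3)]]] m(3) by simp
        qed
        have "M1 = proj M1 F \<inter> orth L" by (rule sel[OF M(1)])
        also have "\<dots> = proj M2 F \<inter> orth L" by (simp only: same)
        also have "\<dots> = M2" by (rule sel[OF M(2), symmetric])
        finally show "M1 = M2" .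
      qed
      show "(\<lambda>M. proj M F \<inter> F') ` ?M = ?H"
      proof
        show "(\<lambda>M. proj M F \<inter> F') ` ?M \<subseteq> ?H" using img by blast
        show "?H \<subseteq> (\<lambda>M. proj M F \<inter> F') ` ?M"
        proof
          fix K assume K: "K \<in> ?H"
          note h = H[OF K]
          have dK: "vec.dim K = t" using h(4) t by simp
          \<comment> \<open>The inverse map: K has dimension t, so exactly one member W contains it,
            and M is taken to be \<open>W \<inter> orth L\<close>.\<close>
          then obtain W where W: "W \<in> Y" "K \<subseteq> W" using st h(5,6) unfolding steiner_def by blast
          have Wg: "W \<in> gens" using steiner_gens[OF st W(1)] .
          have sW: "vec.subspace W" using Wg by (rule gens_subspace)
          have WF': "W \<noteq> F'" using W(1) False by blast
          have WK: "W \<inter> F' = K" using gens_Int_eq[OF F' Wg WF' h(1,4,3) W(2)] .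
          have M'W: "M' \<subseteq> W" using h(2) W(2) by blast
          define M where "M = W \<inter> orth L"
          have sM: "vec.subspace M" unfolding M_def by (rule subspace_Int_orth[OF sW])
          have MP: "M \<in> PP" using PP_down[OF gens_PP[OF Wg] sM] by (auto simp: M_def)
          have dM: "vec.dim M = ?r + Suc k" unfolding M_def by (rule dWL[OF K Wg W(2)])
          have LW: "L \<inter> W = M'" by (rule Lpi[OF K Wg W(2)])
          have MintL: "M \<inter> L = M'" using LW PP_orth[OF L(1)] by (auto simp: M_def)
          have M'M: "M' \<subseteq> M" using MintL by blast
          have MF': "M \<inter> F' \<subseteq> M'"
          proof
            fix y assume y: "y \<in> M \<inter> F'"
            then have "y \<in> X" "y \<in> K" using WK by (auto simp: M_def X_def)
            then show "y \<in> M'" using h(8) by blast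
          qed
          have WFF': "W \<inter> F \<subseteq> F'" unfolding F'_def by (rule Int_subset_proj[OF gens_PP[OF Wg] M'W])
          have MF: "M \<inter> F = R"
          proof
            show "R \<subseteq> M \<inter> F" using M'2(2) M'M F(2) by blast
            have "M \<inter> F \<subseteq> M \<inter> F'" using WFF' by (auto simp: M_def)
            then show "M \<inter> F \<subseteq> R" using MF' M'F by blast
          qed
          have piW: "proj M F = W"
          proof -
            have sF'F: "vec.subspace (F' \<inter> F)" using sF' sF by (rule subspace_Int)
            have "F' \<subseteq> vec.span (K \<union> (F' \<inter> F))"
            proof
              fix x assume "x \<in> F'"
              then obtain m f where mf: "x = m + f" "m \<in> M'" "f \<in> F" "f \<in> F'" using decomp by blast
              have "m \<in> vec.span (K \<union> (F' \<inter> F))" using mf(2) h(2) by (intro vec.span_base) blast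
              moreover have "f \<in> vec.span (K \<union> (F' \<inter> F))" using mf(3,4) by (intro vec.span_base) blast
              ultimately show "x \<in> vec.span (K \<union> (F' \<inter> F))" unfolding mf(1) by (rule vec.span_add)
            qed
            then have "n \<le> vec.dim (vec.span (K \<union> (F' \<inter> F)))" using dim_le_subspace gens_dim[OF F'] by metis
            moreover have "vec.dim (vec.span (K \<union> (F' \<inter> F))) \<le> n"
              using dim_le_subspace[OF vec.span_minimal[OF _ sF', of "K \<union> (F' \<inter> F)"]] h(3) gens_dim[OF F'] by auto
            ultimately have "vec.dim (K \<inter> (F' \<inter> F)) + k + 1 = n"
              using dim_span_Un[OF h(1) sF'F] h(4) dF'F by linarith
            moreover have "K \<inter> (F' \<inter> F) \<subseteq> W \<inter> F" using W(2) by blast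
            ultimately have ge: "vec.dim (W \<inter> F) + k + 1 \<ge> n" using dim_le_subspace[of "K \<inter> (F' \<inter> F)" "W \<inter> F"] by linarith
            have MW: "M \<subseteq> W" by (auto simp: M_def)
            have "W \<inter> F \<subseteq> F \<inter> orth M" using PP_subset_orth[OF gens_PP[OF Wg] MW] by blast
            moreover have "vec.dim (F \<inter> orth M) \<le> vec.dim (W \<inter> F)"
              using dim_gen_orth[OF MP F(1)] MF dM ge by simp
            ultimately have "W \<inter> F = F \<inter> orth M"
              using subspace_dim_eq[OF subspace_Int[OF sW sF] subspace_Int_orth[OF sF]] by blast
            then have "proj M F \<subseteq> W" unfolding proj_def using MW by (intro vec.span_minimal sW) blast
            then show ?thesis using gens_eqI[OF proj_gens[OF MP F(1)] Wg] by blast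
          qed
          define S where "S = vec.span (L \<union> M)"
          have LoM: "L \<subseteq> orth M" by (rule subset_orth_sym) (auto simp: M_def)
          have SP: "S \<in> PP" unfolding S_def by (rule PP_span_Un[OF L(1) MP LoM])
          have "vec.dim S = n"
            using dim_span_Un[OF sL sM] MintL dM M'2(4) L(3) by (simp add: S_def Int_commute)
          then have Sg: "S \<in> gens" using SP by (simp add: gens_def)
          have LS: "L \<subseteq> S" "M \<subseteq> S" using vec.span_superset[of "L \<union> M"] by (auto simp: S_def)
          \<comment> \<open>Otherwise S contains a vector f of F outside R. Then f lies in X, and in
            f = l + y with l in L and y in M both summands turn out to lie in M', so f lies in
            \<open>M' \<inter> F = R\<close>.\<close>
          have "S \<noteq> proj L F"
          proof
            assume eq: "S = proj L F"
            have "vec.dim (S \<inter> F) = ?r + 1" using dim_proj_Int[OF L(1) F(1)] L(2,3) eq by simp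
            then have "S \<inter> F \<noteq> R" by auto
            moreover have "R \<subseteq> S \<inter> F" using RL LS F(2) by blast
            ultimately obtain f where f: "f \<in> S" "f \<in> F" "f \<notin> R" by blast
            have fL: "f \<in> orth L" using f(1) eq proj_orth[OF L(1)] by blast
            then have "f \<in> orth M'" using orth_anti[OF M'2(3)] by blast
            then have fF': "f \<in> F'" using f(2) F'F by blast
            have fX: "f \<in> X" using fF' fL by (simp add: X_def)
            have fM': "f \<notin> M'" using f M'F by blast
            obtain l y where ly: "f = l + y" "l \<in> L" "y \<in> M"
              using f(1) span_Un_subspaces[OF sL sM] by (auto simp: S_def)
            have "y \<in> orth K" using ly(3) PP_subset_orth[OF gens_PP[OF Wg] W(2)] by (auto simp: M_def)
            moreover have "f \<in> orth K" using fF' PP_subset_orth[OF gens_PP[OF F'] h(3)] by blast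
            moreover have "l = f - y" using ly(1) by simp
            ultimately have "l \<in> orth K" using vec.subspace_diff[OF subspace_orth] by blast
            then have lF': "l \<in> F'" using in_orthF'[OF K] ly(2) by blast
            then have lM': "l \<in> M'" using LF' ly(2) by blast
            have "y = f - l" using ly(1) by simp
            then have "y \<in> F'" using vec.subspace_diff[OF sF' fF' lF'] by simp
            then have "y \<in> M'" using MF' ly(3) by blast
            then have "f \<in> M'" using ly(1) lM' vec.subspace_add[OF M'2(1)] by blast
            then show False using fM' by simp
          qed
          then have "S \<in> opposite R F" using opposite_above[OF F(1) L Sg LS(1)] by simp
          then have "M \<in> ?M"
            using LS sM M'2(2) M'M dM MintL piW W(1) by (auto simp: subs_between_def)
          then show "K \<in> (\<lambda>M. proj M F \<inter> F') ` ?M" using piW WK by blast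
        qed
      qed
    qed
    then have "card ?M = card ?H" by (rule bij_betw_same_card)
    also have "?H = covers_below M' F' - covers_below X F'"
      using M'X by (auto simp: covers_below_def)
    also have "card \<dots> = card (covers_below M' F') - card (covers_below X F')"
      using M'X by (intro card_Diff_subset) (auto simp: covers_below_def)
    also have "\<dots> = gnum CARD('a) (n - (?r + k)) - gnum CARD('a) (n - (?r + k + 1))"
      using card_covers_below[OF M'2(1) sF' M'F'] card_covers_below[OF sX sF'] gens_dim[OF F'] dX M'2(4)
      by (auto simp: X_def)
    also have "\<dots> = CARD('a) ^ (n - ?r - Suc k)"
    proof -
      have "n - (?r + k) = Suc (n - ?r - Suc k)" "n - (?r + k + 1) = n - ?r - Suc k" using k by auto
      then show ?thesis by (simp add: gnum_Suc)
    qed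
    finally show ?thesis using False by (simp add: F'_def)
  qed
qed

lemma proj_self: "S \<in> gens \<Longrightarrow> F \<in> gens \<Longrightarrow> proj S F = S"
  using gens_eqI[of S "proj S F"] proj_gens[OF gens_PP[of S], of F] proj_superset[of S F] by simp

lemma proj_base: "R \<in> PP \<Longrightarrow> F \<in> gens \<Longrightarrow> R \<subseteq> F \<Longrightarrow> proj R F = F"
proof -
  assume R: "R \<in> PP" "F \<in> gens" "R \<subseteq> F"
  have "F \<subseteq> orth R" using PP_subset_orth[OF gens_PP[OF R(2)] R(3)] .
  then have "F \<subseteq> proj R F" using proj_superset'[of F R] by blast
  then show ?thesis using gens_eqI[OF R(2) proj_gens[OF R(1,2)]] by simp
qed

lemma subcount_top:
  assumes "S \<in> opposite R F" "F \<in> gens" "vec.dim R + m = n"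
  shows "subcount R (\<lambda>M. proj M F \<in> Y) m S = (if S \<in> Y then 1 else 0)"
proof -
  have S: "S \<in> gens" "R \<subseteq> S" using assms by (auto simp: opposite_def)
  have "subs_between R S m = {S}"
    using subs_between_full[OF gens_subspace[OF S(1)] S(2)] gens_dim[OF S(1)] assms(3) by simp
  then have "{M \<in> subs_between R S m. proj M F \<in> Y} = (if S \<in> Y then {S} else {})"
    using proj_self[OF S(1) assms(2)] by auto
  then show ?thesis by (simp add: subcount_def)
qed

text \<open>A subspace M of L is counted in each of the E opposite generators through L. Any other M
  meets L in a hyperplane M' of M and spans S together with L, so it is counted once;
  \<open>card_local\<close> counts these for each M'.\<close>

lemma sum_subcount_above:
  assumes st: "steiner R t Y" and t: "t + 1 = n" and F: "F \<in> gens" "R \<subseteq> F"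
    and L: "L \<in> PP" "L \<inter> F = R" "vec.dim L + 1 = n" and k: "vec.dim R + k < n"
  defines "h \<equiv> \<lambda>M. proj M F \<in> Y"
  shows "(\<Sum>S | S \<in> opposite R F \<and> L \<subseteq> S. real (subcount R h (Suc k) S))
    = E * real (subcount R h (Suc k) L)
    + CARD('a) ^ (n - vec.dim R - Suc k) * (gbinom CARD('a) (n - 1 - vec.dim R) k - real (subcount R h k L))"
proof -
  let ?G = "{S. S \<in> opposite R F \<and> L \<subseteq> S}"
  let ?A = "\<lambda>S. {M \<in> subs_between R S (Suc k). h M}"
  let ?c = "CARD('a) ^ (n - vec.dim R - Suc k)"
  have R: "R \<in> PP" "vec.subspace R" using steiner_PP[OF st] PP_subspace by auto
  have RL: "R \<subseteq> L" using L(2) by blast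
  have sL: "vec.subspace L" using L by (simp add: PP_subspace)
  have split: "real (subcount R h (Suc k) S) = real (subcount R h (Suc k) L) + real (card (?A S - ?A L))" if "S \<in> ?G" for S
  proof -
    have "?A L \<subseteq> ?A S" using that by (auto simp: subs_between_def)
    then have "card (?A S - ?A L) = card (?A S) - card (?A L)" "card (?A L) \<le> card (?A S)"
      by (auto intro: card_Diff_subset card_mono)
    then show ?thesis by (simp add: subcount_def)
  qed
  have "(\<Sum>S\<in>?G. real (subcount R h (Suc k) S)) = card ?G * real (subcount R h (Suc k) L) + (\<Sum>S\<in>?G. real (card (?A S - ?A L)))"
    using split by (simp add: sum.distrib)
  moreover have "card ?G = E" using card_opposite_above[OF F(1) L] by simp
  moreover have "(\<Sum>S\<in>?G. card (?A S - ?A L)) = ?c * (card (subs_between R L k) - subcount R h k L)"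
  proof -
    let ?Z = "\<lambda>M'. {M. \<exists>S\<in>opposite R F. L \<subseteq> S \<and> M \<in> subs_between R S (Suc k) \<and> M \<inter> L = M' \<and> proj M F \<in> Y}"
    have meet: "M \<inter> L \<in> subs_between R L k" and SM: "S = vec.span (L \<union> M)"
      if "S \<in> ?G" "M \<in> ?A S - ?A L" for S M
    proof -
      have S: "S \<in> gens" "L \<subseteq> S" using that by (auto simp: opposite_def)
      have M: "vec.subspace M" "R \<subseteq> M" "M \<subseteq> S" "vec.dim M = vec.dim R + Suc k" "\<not> M \<subseteq> L"
        using that by (auto simp: subs_between_def)
      show "S = vec.span (L \<union> M)" by (rule gens_eq_span(1)[OF S(1) sL M(1) S(2) M(3) L(3) M(5)])
      have "vec.dim (M \<inter> L) = vec.dim R + k"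
        using gens_eq_span(2)[OF S(1) sL M(1) S(2) M(3) L(3) M(5)] M(4) by simp
      then show "M \<inter> L \<in> subs_between R L k"
        using M(2) RL subspace_Int[OF M(1) sL] by (auto simp: subs_between_def)
    qed
    have "(\<Sum>S\<in>?G. card (?A S - ?A L)) = card (\<Union>S\<in>?G. ?A S - ?A L)"
    proof (rule card_UN_disjoint[symmetric])
      show "\<forall>S\<in>?G. \<forall>T\<in>?G. S \<noteq> T \<longrightarrow> (?A S - ?A L) \<inter> (?A T - ?A L) = {}"
      proof (intro ballI impI equals0I)
        fix S T M assume a: "S \<in> ?G" "T \<in> ?G" "S \<noteq> T" "M \<in> (?A S - ?A L) \<inter> (?A T - ?A L)"
        then have "S = vec.span (L \<union> M)" "T = vec.span (L \<union> M)" using SM by blast+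
        then show False using a(3) by simp
      qed
    qed auto
    also have "(\<Union>S\<in>?G. ?A S - ?A L) = (\<Union>M'\<in>subs_between R L k. ?Z M')"
    proof
      show "(\<Union>S\<in>?G. ?A S - ?A L) \<subseteq> (\<Union>M'\<in>subs_between R L k. ?Z M')"
      proof
        fix M assume "M \<in> (\<Union>S\<in>?G. ?A S - ?A L)"
        then obtain S where S: "S \<in> ?G" "M \<in> ?A S - ?A L" by blast
        then have "M \<in> ?Z (M \<inter> L)" unfolding h_def by blast
        then show "M \<in> (\<Union>M'\<in>subs_between R L k. ?Z M')" using meet[OF S] by blast
      qed
      show "(\<Union>M'\<in>subs_between R L k. ?Z M') \<subseteq> (\<Union>S\<in>?G. ?A S - ?A L)"
      proof
        fix M assume "M \<in> (\<Union>M'\<in>subs_between R L k. ?Z M')"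
        then obtain S where S: "S \<in> opposite R F" "L \<subseteq> S" "M \<in> subs_between R S (Suc k)" "M \<inter> L \<in> subs_between R L k" "proj M F \<in> Y"
          by blast
        have "\<not> M \<subseteq> L"
        proof
          assume "M \<subseteq> L"
          then have "M \<inter> L = M" by blast
          then show False using S(3,4) by (simp add: subs_between_def)
        qed
        then show "M \<in> (\<Union>S\<in>?G. ?A S - ?A L)" using S by (auto simp: h_def subs_between_def)
      qed
    qed
    also have "card \<dots> = (\<Sum>M'\<in>subs_between R L k. card (?Z M'))"
      by (rule card_UN_disjoint) auto
    also have "\<dots> = (\<Sum>M'\<in>subs_between R L k. if h M' then 0 else ?c)"
      using card_local[OF st t F L _ k] by (intro sum.cong) (auto simp: h_def)
    also have "\<dots> = ?c * card {M' \<in> subs_between R L k. \<not> h M'}"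
      by (simp add: sum.If_cases Int_def Compl_eq)
    also have "{M' \<in> subs_between R L k. \<not> h M'} = subs_between R L k - {M' \<in> subs_between R L k. h M'}" by blast
    also have "card \<dots> = card (subs_between R L k) - subcount R h k L"
      unfolding subcount_def by (rule card_Diff_subset) auto
    finally show ?thesis .
  qed
  moreover have "subcount R h k L \<le> card (subs_between R L k)" unfolding subcount_def by (rule card_mono) auto
  moreover have "real (card (subs_between R L k)) = gbinom CARD('a) (n - 1 - vec.dim R) k"
  proof -
    have "vec.dim L = n - 1" using L(3) by simp
    then show ?thesis using card_subs_between[OF R(2) sL RL, of k] by simp
  qed
  ultimately show ?thesis by (simp flip: of_nat_sum add: of_nat_diff)
qed

text \<open>Every M of relative dimension k < m lies in equally many hyperplanes of S over R, so up
  to a positive factor the count is a sum, over those hyperplanes L, of numbers depending on L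
  alone. Exchanging the sums exposes the vanishing sums of g.\<close>

lemma subcount_orthogonal:
  fixes g :: "('a ^ 'm) set \<Rightarrow> real"
  assumes R: "R \<in> PP" and k: "vec.dim R + k < n"
    and g: "\<And>L. L \<in> PP \<Longrightarrow> L \<inter> F = R \<Longrightarrow> vec.dim L + 1 = n \<Longrightarrow> (\<Sum>S | S \<in> opposite R F \<and> L \<subseteq> S. g S) = 0"
  shows "(\<Sum>S\<in>opposite R F. g S * real (subcount R p k S)) = 0"
proof -
  let ?G = "opposite R F" and ?Ls = "{L \<in> PP. L \<inter> F = R \<and> vec.dim L + 1 = n}"
  let ?c = "gnum CARD('a) (n - (vec.dim R + k))"
  have c0: "?c > 0" using k by (intro gnum_pos) simp
  have below: "{L \<in> ?Ls. L \<subseteq> S} = covers_below R S" if "S \<in> ?G" for S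
  proof -
    have S: "S \<in> gens" "S \<inter> F = R" using that by (auto simp: opposite_def)
    have "L \<inter> F = R" if "R \<subseteq> L" "L \<subseteq> S" for L using that S(2) by blast
    then show ?thesis using S(2) gens_dim[OF S(1)] PP_down[OF gens_PP[OF S(1)]] PP_subspace
      unfolding covers_below_def by auto
  qed
  have dc: "?c * subcount R p k S = (\<Sum>L | L \<in> ?Ls \<and> L \<subseteq> S. subcount R p k L)" if SG: "S \<in> ?G" for S
  proof -
    have S: "S \<in> gens" "R \<subseteq> S" using SG by (auto simp: opposite_def)
    let ?M = "{M \<in> subs_between R S k. p M}"
    have "(\<Sum>L\<in>covers_below R S. card {M \<in> ?M. M \<subseteq> L}) = (\<Sum>M\<in>?M. card {L \<in> covers_below R S. M \<subseteq> L})"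
      by (rule double_count) auto
    moreover have "card {M \<in> ?M. M \<subseteq> L} = subcount R p k L" if "L \<in> covers_below R S" for L
    proof -
      have "{M \<in> ?M. M \<subseteq> L} = {M \<in> subs_between R L k. p M}"
        using that by (auto simp: subs_between_def covers_below_def)
      then show ?thesis by (simp add: subcount_def)
    qed
    moreover have "card {L \<in> covers_below R S. M \<subseteq> L} = ?c" if "M \<in> ?M" for M
    proof -
      have M: "vec.subspace M" "R \<subseteq> M" "M \<subseteq> S" "vec.dim M = vec.dim R + k" using that by (auto simp: subs_between_def)
      have "{L \<in> covers_below R S. M \<subseteq> L} = covers_below M S" using M(2) by (auto simp: covers_below_def)
      then show ?thesis using card_covers_below[OF M(1) gens_subspace[OF S(1)] M(3)] M(4) gens_dim[OF S(1)] by simp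
    qed
    ultimately have "(\<Sum>L\<in>covers_below R S. subcount R p k L) = card ?M * ?c" by simp
    moreover have "{L. L \<in> ?Ls \<and> L \<subseteq> S} = covers_below R S" using below[OF SG] by auto
    ultimately show ?thesis by (simp add: subcount_def mult.commute)
  qed
  have "?c * (\<Sum>S\<in>?G. g S * real (subcount R p k S)) = (\<Sum>S\<in>?G. g S * real (?c * subcount R p k S))"
    by (simp add: sum_distrib_left algebra_simps)
  also have "\<dots> = (\<Sum>S\<in>?G. g S * (\<Sum>L | L \<in> ?Ls \<and> L \<subseteq> S. real (subcount R p k L)))"
    using dc by (intro sum.cong refl) simp
  also have "\<dots> = (\<Sum>S\<in>?G. \<Sum>L\<in>?Ls. if L \<subseteq> S then g S * real (subcount R p k L) else 0)"
    by (intro sum.cong refl) (simp add: sum_distrib_left sum.inter_filter[symmetric])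
  also have "\<dots> = (\<Sum>L\<in>?Ls. \<Sum>S\<in>?G. if L \<subseteq> S then g S * real (subcount R p k L) else 0)"
    by (rule sum.swap)
  also have "\<dots> = (\<Sum>L\<in>?Ls. (\<Sum>S | S \<in> ?G \<and> L \<subseteq> S. g S) * real (subcount R p k L))"
    by (intro sum.cong refl) (simp add: sum_distrib_right sum.inter_filter[symmetric])
  also have "\<dots> = 0" using g by simp
  finally show ?thesis using c0 by simp
qed

text \<open>
  The function \<open>g\<close> below has sum zero over the opposite generators through any \<open>L\<close>, so it is
  orthogonal to everything in its definition except the indicator function of \<open>Y\<close>; hence the sum of
  \<open>g\<^sup>2\<close> is the sum of \<open>g\<close> over \<open>Y\<close>.
\<close>

theorem opposite_inequality:
  fixes \<gamma> :: "nat \<Rightarrow> real" and c :: real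
  assumes st: "steiner R t Y" and t: "t + 1 = n" and F: "F \<in> gens" "R \<subseteq> F" and m: "vec.dim R + m = n" "m > 0"
    and \<gamma>: "\<gamma> m = 1" "\<And>k. k < m \<Longrightarrow> \<gamma> k * E = \<gamma> (Suc k) * CARD('a) ^ (m - Suc k)"
    and c: "c * E = (\<Sum>k<m. \<gamma> (Suc k) * CARD('a) ^ (m - Suc k) * gbinom CARD('a) (m - 1) k)"
  defines "g \<equiv> \<lambda>S. (\<Sum>k\<le>m. \<gamma> k * real (subcount R (\<lambda>M. proj M F \<in> Y) k S)) - c"
  shows "0 \<le> (\<Sum>S\<in>opposite R F \<inter> Y. g S)"
proof -
  let ?G = "opposite R F" and ?N = "subcount R (\<lambda>M. proj M F \<in> Y)"
  have R: "R \<in> PP" using steiner_PP[OF st] .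
  \<comment> \<open>By \<open>sum_subcount_above\<close> each k contributes a multiple of E
    N_(k+1)(L), a multiple of N_k(L) with negative sign, and a constant. The recursion for
    \<open>\<gamma>\<close> matches the first two, and c absorbs the constants.\<close>
  have zero: "(\<Sum>S | S \<in> ?G \<and> L \<subseteq> S. g S) = 0" if L: "L \<in> PP" "L \<inter> F = R" "vec.dim L + 1 = n" for L
  proof -
    let ?GL = "{S. S \<in> ?G \<and> L \<subseteq> S}"
    have cG: "real (card ?GL) = E" using card_opposite_above[OF F(1) L] by simp
    have N0: "?N 0 S = ?N 0 L" if "R \<subseteq> S" for S
      using that L(2) subs_between_0[OF PP_subspace[OF R]] by (auto simp: subcount_def)
    have Nm: "?N m L = 0"
    proof -
      have "vec.dim M \<noteq> vec.dim R + m" if "M \<subseteq> L" for M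
        using dim_le_subspace[OF that] m L(3) by linarith
      then have "subs_between R L m = {}" unfolding subs_between_def by blast
      then show ?thesis by (simp add: subcount_def)
    qed
    have step: "(\<Sum>S\<in>?GL. real (?N (Suc k) S)) = E * real (?N (Suc k) L)
        + CARD('a) ^ (m - Suc k) * (gbinom CARD('a) (m - 1) k - real (?N k L))" if "k < m" for k
    proof -
      have "vec.dim R + k < n" "n - vec.dim R = m" "n - 1 - vec.dim R = m - 1" using that m by auto
      then show ?thesis using sum_subcount_above[OF st t F L, of k] by simp
    qed
    have "(\<Sum>S\<in>?GL. g S) = (\<Sum>S\<in>?GL. \<Sum>k\<le>m. \<gamma> k * real (?N k S)) - card ?GL * c"
      unfolding g_def by (simp add: sum_subtractf)
    also have "(\<Sum>S\<in>?GL. \<Sum>k\<le>m. \<gamma> k * real (?N k S)) = (\<Sum>k\<le>m. \<Sum>S\<in>?GL. \<gamma> k * real (?N k S))"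
      by (rule sum.swap)
    also have "\<dots> = (\<Sum>k\<le>m. \<gamma> k * (\<Sum>S\<in>?GL. real (?N k S)))" by (simp only: sum_distrib_left)
    also have "(\<Sum>k\<le>m. \<gamma> k * (\<Sum>S\<in>?GL. real (?N k S)))
        = \<gamma> 0 * (\<Sum>S\<in>?GL. real (?N 0 S)) + (\<Sum>k<m. \<gamma> (Suc k) * (\<Sum>S\<in>?GL. real (?N (Suc k) S)))"
      by (simp only: sum.atMost_shift)
    also have "(\<Sum>S\<in>?GL. real (?N 0 S)) = (\<Sum>S\<in>?GL. real (?N 0 L))"
    proof (rule sum.cong[OF refl])
      fix S assume "S \<in> ?GL"
      then have "R \<subseteq> S" by (auto simp: opposite_def)
      then show "real (?N 0 S) = real (?N 0 L)" using N0 by simp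
    qed
    also have "\<dots> = E * real (?N 0 L)" using cG by simp
    also have "(\<Sum>k<m. \<gamma> (Suc k) * (\<Sum>S\<in>?GL. real (?N (Suc k) S)))
        = (\<Sum>k<m. \<gamma> (Suc k) * E * real (?N (Suc k) L) + \<gamma> (Suc k) * CARD('a) ^ (m - Suc k) * gbinom CARD('a) (m - 1) k
            - \<gamma> (Suc k) * CARD('a) ^ (m - Suc k) * real (?N k L))"
    proof (rule sum.cong[OF refl])
      fix k assume "k \<in> {..<m}"
      then have k: "k < m" by simp
      show "\<gamma> (Suc k) * (\<Sum>S\<in>?GL. real (?N (Suc k) S)) = \<gamma> (Suc k) * E * real (?N (Suc k) L)
          + \<gamma> (Suc k) * CARD('a) ^ (m - Suc k) * gbinom CARD('a) (m - 1) k - \<gamma> (Suc k) * CARD('a) ^ (m - Suc k) * real (?N k L)"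
        unfolding step[OF k] by (simp add: algebra_simps)
    qed
    also have "\<dots> = (\<Sum>k<m. \<gamma> (Suc k) * E * real (?N (Suc k) L)) + c * E
        - (\<Sum>k<m. \<gamma> k * E * real (?N k L))"
    proof -
      have "(\<Sum>k<m. \<gamma> (Suc k) * CARD('a) ^ (m - Suc k) * real (?N k L)) = (\<Sum>k<m. \<gamma> k * E * real (?N k L))"
        using \<gamma>(2) by (intro sum.cong refl) simp
      then show ?thesis unfolding c by (simp add: sum.distrib sum_subtractf)
    qed
    \<comment> \<open>No subspace of L has relative dimension m, so the shifted sum misses only its
      term at k = 0, which is the term split off before.\<close>
    also have "(\<Sum>k<m. \<gamma> (Suc k) * E * real (?N (Suc k) L)) = (\<Sum>k<m. \<gamma> k * E * real (?N k L)) - \<gamma> 0 * E * real (?N 0 L)"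
    proof -
      have "(\<Sum>k<Suc m. \<gamma> k * E * real (?N k L)) = \<gamma> 0 * E * real (?N 0 L) + (\<Sum>k<m. \<gamma> (Suc k) * E * real (?N (Suc k) L))"
        by (rule sum.lessThan_Suc_shift)
      moreover have "(\<Sum>k<Suc m. \<gamma> k * E * real (?N k L)) = (\<Sum>k<m. \<gamma> k * E * real (?N k L))" using Nm by simp
      ultimately show ?thesis by simp
    qed
    finally show ?thesis using cG by (simp add: algebra_simps)
  qed
  have const: "(\<Sum>S\<in>?G. g S * c) = 0"
  proof -
    have "vec.dim R + 0 < n" using m by simp
    from subcount_orthogonal[OF R this zero, of "\<lambda>_. True"]
    have "(\<Sum>S\<in>?G. g S * real (subcount R (\<lambda>_. True) 0 S)) = 0" by simp
    moreover have "subcount R (\<lambda>_. True) 0 S = 1" if "S \<in> ?G" for S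
      using that subs_between_0[OF PP_subspace[OF R], of S] by (auto simp: subcount_def opposite_def)
    ultimately have "(\<Sum>S\<in>?G. g S) = 0" by simp
    then show ?thesis by (simp flip: sum_distrib_right)
  qed
  have "0 \<le> (\<Sum>S\<in>?G. g S * g S)" by (intro sum_nonneg) simp
  also have "\<dots> = (\<Sum>S\<in>?G. \<Sum>k\<le>m. \<gamma> k * (g S * real (?N k S))) - (\<Sum>S\<in>?G. g S * c)"
  proof -
    have "g S * g S = (\<Sum>k\<le>m. \<gamma> k * (g S * real (?N k S))) - g S * c" for S
    proof -
      have "g S * g S = g S * ((\<Sum>k\<le>m. \<gamma> k * real (?N k S)) - c)" by (simp add: g_def)
      also have "\<dots> = (\<Sum>k\<le>m. g S * (\<gamma> k * real (?N k S))) - g S * c" by (simp add: right_diff_distrib sum_distrib_left)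
      finally show ?thesis by (simp add: algebra_simps)
    qed
    then show ?thesis by (simp add: sum_subtractf)
  qed
  also have "(\<Sum>S\<in>?G. \<Sum>k\<le>m. \<gamma> k * (g S * real (?N k S))) = (\<Sum>k\<le>m. \<Sum>S\<in>?G. \<gamma> k * (g S * real (?N k S)))"
    by (rule sum.swap)
  also have "\<dots> = (\<Sum>k\<le>m. \<gamma> k * (\<Sum>S\<in>?G. g S * real (?N k S)))" by (simp add: sum_distrib_left)
  also have "\<dots> = (\<Sum>k<m. \<gamma> k * (\<Sum>S\<in>?G. g S * real (?N k S))) + (\<Sum>S\<in>?G. g S * real (?N m S))"
    using \<gamma>(1) by (simp flip: lessThan_Suc_atMost)
  also have "(\<Sum>k<m. \<gamma> k * (\<Sum>S\<in>?G. g S * real (?N k S))) = 0"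
  proof (rule sum.neutral, intro ballI)
    fix k assume "k \<in> {..<m}"
    then have "vec.dim R + k < n" using m by simp
    from subcount_orthogonal[OF R this zero]
    show "\<gamma> k * (\<Sum>S\<in>?G. g S * real (?N k S)) = 0" by simp
  qed
  also have "(\<Sum>S\<in>?G. g S * real (?N m S)) = (\<Sum>S\<in>?G. if S \<in> Y then g S else 0)"
    using subcount_top[OF _ F(1) m(1)] by (intro sum.cong refl) simp
  also have "\<dots> = (\<Sum>S\<in>?G \<inter> Y. g S)" by (simp add: sum.inter_restrict)
  finally show ?thesis using const by simp
qed

end

section \<open>Rank 3 with E at most Q, and rank 4 over the field with four elements\<close>

context polar_space
begin

lemma dim_proj_opposite:
  assumes M: "M \<in> subs_between R S k" and S: "S \<in> opposite R F" and F: "F \<in> gens"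
  shows "M \<in> PP" "M \<inter> F = R" "vec.dim (proj M F \<inter> F) + k = n"
proof -
  have S': "S \<in> gens" "S \<inter> F = R" using S by (auto simp: opposite_def)
  have M': "vec.subspace M" "R \<subseteq> M" "M \<subseteq> S" "vec.dim M = vec.dim R + k" using M by (auto simp: subs_between_def)
  show MP: "M \<in> PP" using PP_down[OF gens_PP[OF S'(1)] M'(1,3)] .
  show MF: "M \<inter> F = R" using M' S'(2) by blast
  show "vec.dim (proj M F \<inter> F) + k = n" using dim_proj_Int[OF MP F] MF M'(4) by simp
qed

text \<open>A hyperplane of the member S has dimension t, so a projection lying in Y would be S
  itself; but the projection meets F in more than R.\<close>

lemma subcount_hyperplane_zero:
  assumes st: "steiner R t Y" and k: "vec.dim R + k = t" "t + 1 = n" "k > 0" and S: "S \<in> opposite R F" "S \<in> Y" and F: "F \<in> gens"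
  shows "subcount R (\<lambda>M. proj M F \<in> Y) k S = 0"
proof -
  have "proj M F \<notin> Y" if M: "M \<in> subs_between R S k" for M
  proof
    assume Y: "proj M F \<in> Y"
    note d = dim_proj_opposite[OF M S(1) F]
    have "R \<subseteq> M" "M \<subseteq> S" "vec.dim M = t" using M k by (auto simp: subs_between_def)
    then have "proj M F = S" using steiner_eq[OF st d(1) _ _ Y S(2) proj_superset] by auto
    then show False using d(3) S(1) k by (auto simp: opposite_def)
  qed
  then have "{M \<in> subs_between R S k. proj M F \<in> Y} = {}" by blast
  then show ?thesis by (simp add: subcount_def)
qed

text \<open>The projection of a point meets F in a hyperplane, of dimension t. As F is a member, a
  projection lying in Y would equal F and contain the point, which is not in F.\<close>

lemma subcount_point_zero:
  assumes st: "steiner R t Y" and t: "t + 1 = n" and S: "S \<in> opposite R F" and F: "F \<in> Y"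
  shows "subcount R (\<lambda>M. proj M F \<in> Y) 1 S = 0"
proof -
  have Fg: "F \<in> gens" using steiner_gens[OF st F] .
  have "proj M F \<notin> Y" if M: "M \<in> subs_between R S 1" for M
  proof
    assume Y: "proj M F \<in> Y"
    note d = dim_proj_opposite[OF M S Fg]
    have "proj M F \<inter> F \<in> PP" using PP_Int[OF gens_PP[OF steiner_gens[OF st Y]] gens_subspace[OF Fg]] .
    then have "proj M F = F"
      using steiner_eq[OF st, of "proj M F \<inter> F"] d(3) t Y F steiner_base[OF st Y] steiner_base[OF st F] by auto
    then have "M = R" using proj_superset[of M F] d(2) by blast
    then show False using M by (auto simp: subs_between_def)
  qed
  then have "{M \<in> subs_between R S 1. proj M F \<in> Y} = {}" by blast
  then show ?thesis by (simp add: subcount_def)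
qed

lemma card_rank3_disjoint:
  assumes st: "steiner R (vec.dim R + 2) Y" and n: "n = vec.dim R + 3" and U: "U \<in> Y"
  shows "real (card {W \<in> Y. U \<inter> W = R}) = real CARD('a) ^ 3 * real E * (real E - 1)"
proof -
  let ?q = "real CARD('a)" and ?e = "real E" and ?r = "vec.dim R"
  let ?F = "\<lambda>i::nat. if i = 0 then 1 else 0 :: real"
  have dim: "vec.dim (U \<inter> W) - ?r = 0 \<longleftrightarrow> U \<inter> W = R" if "W \<in> Y" for W
  proof -
    have sub: "R \<subseteq> U \<inter> W" using steiner_base[OF st U] steiner_base[OF st that] by blast
    have "vec.subspace (U \<inter> W)" using U that steiner_gens[OF st] by (intro subspace_Int gens_subspace) auto
    then show ?thesis using subspace_dim_eq[OF PP_subspace[OF steiner_PP[OF st]] _ sub] by auto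
  qed
  have "real (card {W \<in> Y. U \<inter> W = R}) = (\<Sum>W\<in>Y. if U \<inter> W = R then 1 else 0)"
    by (simp add: sum.If_cases Int_def)
  also have "\<dots> = (\<Sum>W\<in>Y. ?F (vec.dim (U \<inter> W) - ?r))"
    using dim by (intro sum.cong refl) auto
  also have "\<dots> = (?e * ?q ^ 2 + 1) * (?e * ?q + 1) - 1 - gnum CARD('a) 3 * (?e * ?q)"
    using steiner2_sum[OF st U, of ?F] lam2[of ?r 1] n by (simp add: numeral_2_eq_2 numeral_3_eq_3)
  also have "real (gnum CARD('a) 3) = 1 + ?q + ?q ^ 2" by (simp add: numeral_3_eq_3 gnum_Suc numeral_2_eq_2)
  also have "(?e * ?q ^ 2 + 1) * (?e * ?q + 1) - 1 - (1 + ?q + ?q ^ 2) * (?e * ?q) = ?q ^ 3 * ?e * (?e - 1)"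
    by (simp add: algebra_simps power2_eq_square power3_eq_cube)
  finally show ?thesis .
qed

text \<open>Seen from a member F, the counts at relative dimensions 1 and 2 vanish on opposite
  members, and those at 0 and 3 are 1. Hence g is constant on them, while its sum over them must be
  nonnegative.\<close>

theorem no_steiner_rank3:
  assumes st: "steiner R (vec.dim R + 2) Y" and n: "n = vec.dim R + 3" and E: "1 < E" "E \<le> CARD('a)"
  shows False
proof -
  let ?q = "real CARD('a)" and ?e = "real E"
  obtain F where F: "F \<in> Y" using steiner_nonempty[OF st] by blast
  have Fg: "F \<in> gens" "R \<subseteq> F" using steiner_gens[OF st F] steiner_base[OF st F] by auto
  have e: "?e > 1" "?e \<le> ?q" using E by auto
  \<comment> \<open>Solution of the recursion for \<open>\<gamma>\<close> downwards from the value 1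
    at relative dimension 3; c is forced by the condition on the constants.\<close>
  define \<gamma> where "\<gamma> = (\<lambda>k::nat. if k = 3 then 1 else if k = 2 then 1 / ?e else if k = 1 then ?q / ?e ^ 2 else ?q ^ 3 / ?e ^ 3)"
  define c where "c = (?q ^ 3 / ?e ^ 2 + ?q * (?q + 1) / ?e + 1) / ?e"
  let ?g = "\<lambda>S. (\<Sum>k\<le>3. \<gamma> k * real (subcount R (\<lambda>M. proj M F \<in> Y) k S)) - c"
  have ineq: "0 \<le> (\<Sum>S\<in>opposite R F \<inter> Y. ?g S)"
  proof (rule opposite_inequality[OF st _ Fg, of 3])
    fix k :: nat assume "k < 3"
    then consider "k = 0" | "k = 1" | "k = 2" by linarith
    then show "\<gamma> k * ?e = \<gamma> (Suc k) * CARD('a) ^ (3 - Suc k)"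
      using e by cases (simp_all add: \<gamma>_def field_simps power2_eq_square power3_eq_cube)
  next
    show "c * ?e = (\<Sum>k<3. \<gamma> (Suc k) * CARD('a) ^ (3 - Suc k) * gbinom CARD('a) (3 - 1) k)"
      using e by (simp add: c_def \<gamma>_def numeral_3_eq_3 gnum_Suc field_simps power2_eq_square)
  qed (use n in \<open>auto simp: \<gamma>_def\<close>)
  have g: "?g S = 1 + ?q ^ 3 / ?e ^ 3 - c" if S: "S \<in> opposite R F \<inter> Y" for S
  proof -
    have S': "S \<in> opposite R F" "S \<in> Y" using S by auto
    have n3: "vec.dim R + 3 = n" "vec.dim R + 2 + 1 = n" using n by auto
    have N3: "subcount R (\<lambda>M. proj M F \<in> Y) 3 S = 1"
      unfolding subcount_top[OF S'(1) Fg(1) n3(1)] using S'(2) by simp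
    have N2: "subcount R (\<lambda>M. proj M F \<in> Y) 2 S = 0"
      by (rule subcount_hyperplane_zero[OF st refl n3(2) _ S' Fg(1)]) simp
    have N1: "subcount R (\<lambda>M. proj M F \<in> Y) 1 S = 0"
      by (rule subcount_point_zero[OF st n3(2) S'(1) F])
    have N0: "subcount R (\<lambda>M. proj M F \<in> Y) 0 S = 1"
    proof -
      have "R \<subseteq> S" using S by (auto simp: opposite_def)
      then have "{M \<in> subs_between R S 0. proj M F \<in> Y} = {R}"
        using subs_between_0[OF PP_subspace[OF steiner_PP[OF st]]] proj_base[OF steiner_PP[OF st] Fg] F by auto
      then show ?thesis by (simp add: subcount_def)
    qed
    have "{..3} = {0, 1, 2, 3 :: nat}" by auto
    then show ?thesis using N0 N1 N2 N3 by (simp add: \<gamma>_def)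
  qed
  \<comment> \<open>The numerator factors as (e + q)(e - q - 1), so it is negative exactly for e < q
    + 1.\<close>
  have "1 + ?q ^ 3 / ?e ^ 3 - c = (?e ^ 2 - ?q * (?q + 1) - ?e) / ?e ^ 2"
    using e by (simp add: c_def field_simps power2_eq_square power3_eq_cube)
  moreover have "?e ^ 2 \<le> ?q * ?q" using e unfolding power2_eq_square by (intro mult_mono) auto
  then have "?e ^ 2 - ?q * (?q + 1) - ?e < 0" using e by (simp add: algebra_simps)
  ultimately have neg: "1 + ?q ^ 3 / ?e ^ 3 - c < 0" using e by (simp add: divide_neg_pos)
  have "card (opposite R F \<inter> Y) > 0"
  proof -
    have "{W \<in> Y. F \<inter> W = R} = opposite R F \<inter> Y" using steiner_gens[OF st] by (auto simp: opposite_def)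
    moreover have "real (card {W \<in> Y. F \<inter> W = R}) > 0"
      unfolding card_rank3_disjoint[OF st n F] using e Q_ge2 by simp
    ultimately show ?thesis by simp
  qed
  then have "(\<Sum>S\<in>opposite R F \<inter> Y. ?g S) < 0" using g neg by (simp add: mult_pos_neg)
  then show False using ineq by linarith
qed

text \<open>These are the parameters of the Hermitian space in odd dimension for q = 2. For a
  generator F outside Y the count at relative dimension 0 vanishes, and upper bounds for the total
  counts of points and lines suffice to make the sum of g negative.\<close>

theorem no_steiner_rank4_hermitian:
  assumes st: "steiner R (vec.dim R + 3) Y" and n: "n = vec.dim R + 4" and E: "E = 8" and q: "CARD('a) = 4"
  shows False
proof -
  let ?r = "vec.dim R"
  have R: "R \<in> PP" "vec.subspace R" using steiner_PP[OF st] PP_subspace by auto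
  have m4: "n - ?r = 4" using n by simp
  have gn: "gnum 4 (Suc 0) = 1" "gnum 4 2 = 5" "gnum 4 3 = 21" "gnum 4 4 = 85"
    by (simp_all add: gnum_def eval_nat_numeral)
  \<comment> \<open>Any generator other than U through a hyperplane of a member U is outside Y,
    because the hyperplane has dimension t.\<close>
  obtain F where Fg: "F \<in> gens" "R \<subseteq> F" and FY: "F \<notin> Y"
  proof -
    obtain U where U: "U \<in> Y" using steiner_nonempty[OF st] by blast
    have Ug: "U \<in> gens" "R \<subseteq> U" using steiner_gens[OF st U] steiner_base[OF st U] by auto
    have "card (covers_below R U) > 0"
      using card_covers_below[OF R(2) gens_subspace[OF Ug(1)] Ug(2)] gens_dim[OF Ug(1)] n gnum_pos[of 4] by simp
    then obtain H where H: "H \<in> covers_below R U" by (metis card.empty ex_in_conv less_irrefl)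
    then have H': "vec.subspace H" "R \<subseteq> H" "H \<subseteq> U" "vec.dim H + 1 = n" using gens_dim[OF Ug(1)] by (auto simp: covers_below_def)
    have HP: "H \<in> PP" using PP_down[OF gens_PP[OF Ug(1)] H'(1,3)] .
    have "card ({G \<in> gens. H \<subseteq> G} - {U}) > 0"
      using gens_count[OF HP H'(4)] Ug H'(3) E by (simp add: card_Diff_singleton)
    then obtain G where G: "G \<in> gens" "H \<subseteq> G" "G \<noteq> U" by (metis (mono_tags, lifting) DiffE card.empty ex_in_conv insertI1 less_irrefl mem_Collect_eq)
    have "G \<notin> Y" using steiner_eq[OF st HP H'(2) _ _ U G(2) H'(3)] G(3) H'(4) n by auto
    then show ?thesis using that[of G] G H'(2) by blast
  qed
  define h where "h = (\<lambda>M. proj M F \<in> Y)"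
  \<comment> \<open>The recursion for \<open>\<gamma>\<close> with E = 8 and Q = 4. The constant
    81/16 comes from 8 c = 8 + 21 + 21/2 + 1.\<close>
  define \<gamma> where "\<gamma> = (\<lambda>k::nat. if k = 4 then 1 else if k = 3 then 1 / 8 else if k = 2 then 1 / 16 else if k = 1 then 1 / 8 else 1 :: real)"
  let ?g = "\<lambda>S. (\<Sum>k\<le>4. \<gamma> k * real (subcount R (\<lambda>M. proj M F \<in> Y) k S)) - 81 / 16"
  let ?S = "opposite R F \<inter> Y"
  have ineq: "0 \<le> (\<Sum>S\<in>?S. ?g S)"
  proof (rule opposite_inequality[OF st _ Fg, of 4])
    fix k :: nat assume "k < 4"
    then consider "k = 0" | "k = 1" | "k = 2" | "k = 3" by linarith
    then show "\<gamma> k * real E = \<gamma> (Suc k) * CARD('a) ^ (4 - Suc k)"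
      unfolding q E by cases (simp_all add: \<gamma>_def)
  next
    have "{..<4} = {0, 1, 2, 3 :: nat}" by auto
    then show "81 / 16 * real E = (\<Sum>k<4. \<gamma> (Suc k) * CARD('a) ^ (4 - Suc k) * gbinom CARD('a) (4 - 1) k)"
      unfolding q E by (simp add: \<gamma>_def gn numeral_2_eq_2 numeral_3_eq_3 gnum_def)
  qed (use n in \<open>auto simp: \<gamma>_def\<close>)
  have g: "?g S = real (subcount R h 2 S) / 16 + real (subcount R h 1 S) / 8 - 65 / 16" if S: "S \<in> ?S" for S
  proof -
    have S': "S \<in> opposite R F" "S \<in> Y" using S by auto
    have n4: "vec.dim R + 4 = n" "vec.dim R + 3 + 1 = n" using n by auto
    have N4: "subcount R (\<lambda>M. proj M F \<in> Y) 4 S = 1"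
      unfolding subcount_top[OF S'(1) Fg(1) n4(1)] using S'(2) by simp
    have N3: "subcount R (\<lambda>M. proj M F \<in> Y) 3 S = 0"
      by (rule subcount_hyperplane_zero[OF st refl n4(2) _ S' Fg(1)]) simp
    have N0: "subcount R (\<lambda>M. proj M F \<in> Y) 0 S = 0"
    proof -
      have "R \<subseteq> S" using S by (auto simp: opposite_def)
      then have "{M \<in> subs_between R S 0. proj M F \<in> Y} = {}"
        using subs_between_0[OF R(2)] proj_base[OF R(1) Fg] FY by auto
      then show ?thesis by (simp add: subcount_def)
    qed
    have "{..4} = {0, 1, 2, 3, 4 :: nat}" by auto
    then show ?thesis using N0 N3 N4 by (simp add: \<gamma>_def h_def)
  qed
  define b where "b = (\<lambda>i. real (card {W \<in> Y. vec.dim (F \<inter> W) = ?r + i}))"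
  have lam: "real (lam (?r + 3) ?r) = 2183841" "real (lam (?r + 3) (?r + 1)) = 4257" "real (lam (?r + 3) (?r + 2)) = 33"
    using lam3[of ?r 1] n E q by simp_all
  have rng: "\<exists>i\<in>{0, 1, 2, 3}. vec.dim (F \<inter> W) = ?r + i" if W: "W \<in> Y" for W
  proof -
    have Wg: "W \<in> gens" "R \<subseteq> W" using steiner_gens[OF st W] steiner_base[OF st W] by auto
    have lo: "?r \<le> vec.dim (F \<inter> W)" using Fg Wg by (intro dim_le_subspace) auto
    have "vec.dim (F \<inter> W) \<noteq> n"
    proof
      assume "vec.dim (F \<inter> W) = n"
      then have "F \<inter> W = F" using subspace_dim_eq[OF subspace_Int[OF gens_subspace[OF Fg(1)] gens_subspace[OF Wg(1)]] gens_subspace[OF Fg(1)]]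
        gens_dim[OF Fg(1)] by simp
      then have "F = W" using gens_eqI[OF Fg(1) Wg(1)] by blast
      then show False using FY W by simp
    qed
    moreover have "vec.dim (F \<inter> W) \<le> n" using dim_le_subspace[of "F \<inter> W" F] gens_dim[OF Fg(1)] by simp
    ultimately have "vec.dim (F \<inter> W) - ?r \<in> {0, 1, 2, 3}" "vec.dim (F \<inter> W) = ?r + (vec.dim (F \<inter> W) - ?r)"
      using lo n by auto
    then show ?thesis by blast
  qed
  have rng2: "vec.dim (F \<inter> W) - ?r \<in> {0, 1, 2, 3}" if "W \<in> Y" for W
    using rng[OF that] by (elim bexE) simp
  have gb: "gbinom 4 i 0 = 1" "gbinom 4 0 1 = 0" "gbinom 4 1 1 = 1" "gbinom 4 2 1 = 5" "gbinom 4 3 1 = 21" "gbinom 4 4 1 = 85"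
    "gbinom 4 0 2 = 0" "gbinom 4 1 2 = 0" "gbinom 4 2 2 = 1" "gbinom 4 3 2 = 21" "gbinom 4 4 2 = 357"
    "gbinom 4 0 3 = 0" "gbinom 4 1 3 = 0" "gbinom 4 2 3 = 0" "gbinom 4 3 3 = 1" "gbinom 4 4 3 = 85" for i
    by (simp_all add: eval_nat_numeral gnum_def)
  have ind: "b i = (\<Sum>W\<in>Y. if vec.dim (F \<inter> W) - ?r = i then 1 else 0)" for i
  proof -
    have "{W \<in> Y. vec.dim (F \<inter> W) = ?r + i} = Y \<inter> {W. vec.dim (F \<inter> W) - ?r = i}"
    proof -
      have "vec.dim (F \<inter> W) = ?r + i \<longleftrightarrow> vec.dim (F \<inter> W) - ?r = i" if "W \<in> Y" for W
        using rng[OF that] by (elim bexE) auto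
      then show ?thesis by blast
    qed
    then show ?thesis by (simp add: b_def sum.If_cases)
  qed
  have des: "(\<Sum>W\<in>Y. gbinom 4 (vec.dim (F \<inter> W) - ?r) 0) = 2183841"
    "(\<Sum>W\<in>Y. gbinom 4 (vec.dim (F \<inter> W) - ?r) 1) = 85 * 4257"
    "(\<Sum>W\<in>Y. gbinom 4 (vec.dim (F \<inter> W) - ?r) 2) = 357 * 33"
    "(\<Sum>W\<in>Y. gbinom 4 (vec.dim (F \<inter> W) - ?r) 3) = 85"
    using steiner_design_sum[OF st Fg, of 0] steiner_design_sum[OF st Fg, of 1] steiner_design_sum[OF st Fg, of 2]
      steiner_design_sum[OF st Fg, of 3] lam gb unfolding q m4 by simp_all
  have lin: "(\<Sum>W\<in>Y. x0 * gbinom 4 (vec.dim (F \<inter> W) - ?r) 0 + x1 * gbinom 4 (vec.dim (F \<inter> W) - ?r) 1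
      + x2 * gbinom 4 (vec.dim (F \<inter> W) - ?r) 2 + x3 * gbinom 4 (vec.dim (F \<inter> W) - ?r) 3)
      = x0 * 2183841 + x1 * (85 * 4257) + x2 * (357 * 33) + x3 * 85" for x0 x1 x2 x3
    unfolding sum.distrib sum_distrib_left[symmetric] des ..
  have b0: "b 0 = 1863680"
  proof -
    \<comment> \<open>Gaussian inversion: the coefficients are (-1)^j 4^(j(j-1)/2) for j = 0, 1, 2,
      3. For \<open>b 2\<close> below, 21 is the Gaussian binomial of 3 over 2.\<close>
    have "b 0 = (\<Sum>W\<in>Y. 1 * gbinom 4 (vec.dim (F \<inter> W) - ?r) 0 + (- 1) * gbinom 4 (vec.dim (F \<inter> W) - ?r) 1
      + 4 * gbinom 4 (vec.dim (F \<inter> W) - ?r) 2 + (- 64) * gbinom 4 (vec.dim (F \<inter> W) - ?r) 3)"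
      unfolding ind
    proof (rule sum.cong[OF refl])
      fix W assume "W \<in> Y"
      then have i: "vec.dim (F \<inter> W) - ?r \<in> {0, 1, 2, 3}" by (rule rng2)
      then show "(if vec.dim (F \<inter> W) - ?r = 0 then 1 else 0) = 1 * gbinom 4 (vec.dim (F \<inter> W) - ?r) 0 + (- 1) * gbinom 4 (vec.dim (F \<inter> W) - ?r) 1
        + 4 * gbinom 4 (vec.dim (F \<inter> W) - ?r) 2 + (- 64) * gbinom 4 (vec.dim (F \<inter> W) - ?r) 3"
        by (elim insertE emptyE) (simp_all only: gb, simp_all)
    qed
    then show ?thesis unfolding lin by simp
  qed
  have b2: "b 2 = 9996"
  proof -
    have "b 2 = (\<Sum>W\<in>Y. 0 * gbinom 4 (vec.dim (F \<inter> W) - ?r) 0 + 0 * gbinom 4 (vec.dim (F \<inter> W) - ?r) 1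
      + 1 * gbinom 4 (vec.dim (F \<inter> W) - ?r) 2 + (- 21) * gbinom 4 (vec.dim (F \<inter> W) - ?r) 3)"
      unfolding ind
    proof (rule sum.cong[OF refl])
      fix W assume "W \<in> Y"
      then have i: "vec.dim (F \<inter> W) - ?r \<in> {0, 1, 2, 3}" by (rule rng2)
      then show "(if vec.dim (F \<inter> W) - ?r = 2 then 1 else 0) = 0 * gbinom 4 (vec.dim (F \<inter> W) - ?r) 0 + 0 * gbinom 4 (vec.dim (F \<inter> W) - ?r) 1
        + 1 * gbinom 4 (vec.dim (F \<inter> W) - ?r) 2 + (- 21) * gbinom 4 (vec.dim (F \<inter> W) - ?r) 3"
        by (elim insertE emptyE) (simp_all only: gb, simp_all)
    qed
    then show ?thesis unfolding lin by simp
  qed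
  have b3: "b 3 = 85"
  proof -
    have "b 3 = (\<Sum>W\<in>Y. gbinom 4 (vec.dim (F \<inter> W) - ?r) 3)"
      unfolding ind
    proof (rule sum.cong[OF refl])
      fix W assume "W \<in> Y"
      then have i: "vec.dim (F \<inter> W) - ?r \<in> {0, 1, 2, 3}" by (rule rng2)
      then show "(if vec.dim (F \<inter> W) - ?r = 3 then 1 else 0) = gbinom 4 (vec.dim (F \<inter> W) - ?r) 3"
        by (elim insertE emptyE) (simp_all only: gb, simp_all)
    qed
    then show ?thesis unfolding des .
  qed
  have cS: "real (card ?S) = 1863680"
  proof -
    have "W \<inter> F = R \<longleftrightarrow> vec.dim (F \<inter> W) = ?r + 0" if "W \<in> Y" for W
    proof -
      have Wg: "W \<in> gens" "R \<subseteq> W" using steiner_gens[OF st that] steiner_base[OF st that] by auto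
      have "R \<subseteq> F \<inter> W" using Fg Wg by blast
      then show ?thesis using subspace_dim_eq[OF R(2) subspace_Int[OF gens_subspace[OF Fg(1)] gens_subspace[OF Wg(1)]]]
        by (auto simp: Int_commute)
    qed
    then have "?S = {W \<in> Y. vec.dim (F \<inter> W) = ?r + 0}" using steiner_gens[OF st] by (auto simp: opposite_def)
    then show ?thesis using b0 by (simp add: b_def)
  qed
  \<comment> \<open>The subspaces of relative dimension k that meet F only in R and project into Y.
    The totals are evaluated by counting, for each of them, the opposite members containing
    it.\<close>
  define Mk where "Mk = (\<lambda>k. {M \<in> PP. M \<inter> F = R \<and> vec.dim M = ?r + k \<and> h M})"
  have sumN: "(\<Sum>S\<in>?S. real (subcount R h k S)) = (\<Sum>M\<in>Mk k. real (card {S \<in> ?S. M \<subseteq> S}))" for k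
  proof -
    have "(\<Sum>S\<in>?S. card {M \<in> Mk k. M \<subseteq> S}) = (\<Sum>M\<in>Mk k. card {S \<in> ?S. M \<subseteq> S})"
      by (rule double_count) auto
    moreover have "subcount R h k S = card {M \<in> Mk k. M \<subseteq> S}" if S: "S \<in> ?S" for S
    proof -
      have So: "S \<in> opposite R F" using S by blast
      have "{M \<in> subs_between R S k. h M} = {M \<in> Mk k. M \<subseteq> S}"
      proof (intro set_eqI iffI)
        fix M assume "M \<in> {M \<in> subs_between R S k. h M}"
        then have M: "M \<in> subs_between R S k" "h M" by auto
        then show "M \<in> {M \<in> Mk k. M \<subseteq> S}"
          using dim_proj_opposite(1,2)[OF M(1) So Fg(1)] by (simp add: Mk_def subs_between_def)
      next
        fix M assume M: "M \<in> {M \<in> Mk k. M \<subseteq> S}"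
        then have "M \<in> PP" "M \<inter> F = R" by (auto simp: Mk_def)
        then have "vec.subspace M" "R \<subseteq> M" using PP_subspace by blast+
        then show "M \<in> {M \<in> subs_between R S k. h M}" using M by (simp add: Mk_def subs_between_def)
      qed
      then show ?thesis by (simp add: subcount_def)
    qed
    ultimately show ?thesis by (simp flip: of_nat_sum)
  qed
  have pi: "proj M F \<in> Y" "M \<subseteq> proj M F" "vec.dim (F \<inter> proj M F) + k = n" "M \<in> PP" "R \<subseteq> M" "M \<inter> F = R" "vec.dim M = ?r + k"
    if "M \<in> Mk k" for M k
  proof -
    show M: "M \<in> PP" "M \<inter> F = R" "vec.dim M = ?r + k" "proj M F \<in> Y" using that by (auto simp: Mk_def h_def)
    show "M \<subseteq> proj M F" by (rule proj_superset)
    show "R \<subseteq> M" using M(2) by blast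
    show "vec.dim (F \<inter> proj M F) + k = n" using dim_proj_Int[OF M(1) Fg(1)] M(2,3) by (simp add: Int_commute)
  qed
  \<comment> \<open>A line lies in 33 members, one of which is its own projection; that one is not
    opposite to F.\<close>
  have "(\<Sum>M\<in>Mk 2. real (card {S \<in> ?S. M \<subseteq> S})) \<le> (\<Sum>M\<in>Mk 2. 32)"
  proof (rule sum_mono)
    fix M assume M: "M \<in> Mk 2"
    note p = pi[OF M]
    have "vec.dim (F \<inter> proj M F) \<noteq> ?r" using p(3) n by linarith
    then have "F \<inter> proj M F \<noteq> R" by blast
    then have "proj M F \<notin> opposite R F" by (simp add: opposite_def Int_commute)
    then have "{S \<in> ?S. M \<subseteq> S} \<subseteq> {W \<in> Y. M \<subseteq> W} - {proj M F}" by blast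
    then have "card {S \<in> ?S. M \<subseteq> S} \<le> card ({W \<in> Y. M \<subseteq> W} - {proj M F})" by (intro card_mono) auto
    also have "\<dots> = lam (?r + 3) (?r + 2) - 1"
    proof -
      have "proj M F \<in> {W \<in> Y. M \<subseteq> W}" using p(1,2) by blast
      moreover have "card {W \<in> Y. M \<subseteq> W} = lam (?r + 3) (?r + 2)" using card_steiner_above[OF st p(4,5)] p(7) by simp
      ultimately show ?thesis by (simp add: card_Diff_singleton)
    qed
    finally show "real (card {S \<in> ?S. M \<subseteq> S}) \<le> 32" using lam(3) by simp
  qed
  then have N2: "(\<Sum>S\<in>?S. real (subcount R h 2 S)) \<le> 32 * real (card (Mk 2))" unfolding sumN by simp
  \<comment> \<open>An opposite member through the point M meets \<open>proj M F\<close> only in M.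
    In the rank 3 residue of M, \<open>card_rank3_disjoint\<close> counts the members disjoint from
    a given one: 4^3 * 8 * 7 = 3584.\<close>
  have "(\<Sum>M\<in>Mk 1. real (card {S \<in> ?S. M \<subseteq> S})) \<le> (\<Sum>M\<in>Mk 1. 3584)"
  proof (rule sum_mono)
    fix M assume M: "M \<in> Mk 1"
    note p = pi[OF M]
    have dM: "vec.dim M + 2 = ?r + 3" "vec.dim M \<le> ?r + 3" using p(7) by simp_all
    have st': "steiner M (vec.dim M + 2) {W \<in> Y. M \<subseteq> W}" unfolding dM(1) by (rule steiner_residue[OF st p(4,5) dM(2)])
    have "{S \<in> ?S. M \<subseteq> S} \<subseteq> {W \<in> {W \<in> Y. M \<subseteq> W}. proj M F \<inter> W = M}"
    proof
      fix S assume S: "S \<in> {S \<in> ?S. M \<subseteq> S}"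
      then have S': "S \<in> gens" "S \<inter> F = R" "S \<in> Y" "M \<subseteq> S" by (auto simp: opposite_def)
      have "proj M F \<inter> S \<subseteq> M"
      proof
        fix x assume x: "x \<in> proj M F \<inter> S"
        then have "x \<in> {x + y |x y. x \<in> M \<and> y \<in> F \<inter> orth M}"
          unfolding proj_def span_Un_subspaces[OF PP_subspace[OF p(4)] subspace_Int_orth[OF gens_subspace[OF Fg(1)], of M]] by blast
        then obtain m f where mf: "x = m + f" "m \<in> M" "f \<in> F" by blast
        have "f = x - m" using mf by simp
        then have "f \<in> S" using x mf S'(4) vec.subspace_diff[OF gens_subspace[OF S'(1)]] by blast
        then have "f \<in> M" using mf(3) S'(2) p(5) by blast
        then show "x \<in> M" using mf vec.subspace_add[OF PP_subspace[OF p(4)]] by blast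
      qed
      then show "S \<in> {W \<in> {W \<in> Y. M \<subseteq> W}. proj M F \<inter> W = M}" using S' p(2) by blast
    qed
    then have "card {S \<in> ?S. M \<subseteq> S} \<le> card {W \<in> {W \<in> Y. M \<subseteq> W}. proj M F \<inter> W = M}" by (intro card_mono) auto
    moreover have "real (card {W \<in> {W \<in> Y. M \<subseteq> W}. proj M F \<inter> W = M}) = 3584"
    proof -
      have "n = vec.dim M + 3" using p(7) n by simp
      moreover have "proj M F \<in> {W \<in> Y. M \<subseteq> W}" using p(1,2) by blast
      ultimately show ?thesis using card_rank3_disjoint[OF st', of "proj M F"] unfolding E q by simp
    qed
    ultimately show "real (card {S \<in> ?S. M \<subseteq> S}) \<le> 3584" by linarith
  qed
  then have N1: "(\<Sum>S\<in>?S. real (subcount R h 1 S)) \<le> 3584 * real (card (Mk 1))" unfolding sumN by simp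
  \<comment> \<open>The projection of a point meets F in relative dimension 3. There are
    \<open>b 3 = 85\<close> such members, with 85 - 21 = 64 points outside F each.\<close>
  have c1: "card (Mk 1) \<le> 85 * 64"
  proof -
    let ?W = "{W \<in> Y. vec.dim (F \<inter> W) = ?r + 3}"
    have "Mk 1 \<subseteq> (\<Union>W\<in>?W. covers_above R W - covers_above R (F \<inter> W))"
    proof
      fix M assume M: "M \<in> Mk 1"
      note p = pi[OF M]
      have "\<not> M \<subseteq> F"
      proof
        assume "M \<subseteq> F"
        then have "M = R" using p(6) by blast
        then show False using p(7) by simp
      qed
      then have "M \<in> covers_above R (proj M F) - covers_above R (F \<inter> proj M F)"
        using p(2,5,7) PP_subspace[OF p(4)] by (simp add: covers_above_def)
      moreover have "vec.dim (F \<inter> proj M F) = ?r + 3" using p(3) n by linarith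
      ultimately show "M \<in> (\<Union>W\<in>?W. covers_above R W - covers_above R (F \<inter> W))" using p(1) by blast
    qed
    then have "card (Mk 1) \<le> card (\<Union>W\<in>?W. covers_above R W - covers_above R (F \<inter> W))" by (intro card_mono) auto
    also have "\<dots> \<le> (\<Sum>W\<in>?W. card (covers_above R W - covers_above R (F \<inter> W)))" by (intro card_UN_le) auto
    also have "\<dots> = (\<Sum>W\<in>?W. 64)"
    proof (rule sum.cong[OF refl])
      fix W assume W: "W \<in> ?W"
      then have Wg: "W \<in> gens" "R \<subseteq> W" using steiner_gens[OF st] steiner_base[OF st] by auto
      have "card (covers_above R W - covers_above R (F \<inter> W)) = card (covers_above R W) - card (covers_above R (F \<inter> W))"
        by (intro card_Diff_subset) (auto simp: covers_above_def)
      moreover have "card (covers_above R W) = 85"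
        using card_covers_above[OF R(2) gens_subspace[OF Wg(1)] Wg(2)] unfolding gens_dim[OF Wg(1)] m4 q gn .
      moreover have "card (covers_above R (F \<inter> W)) = 21"
      proof -
        have "R \<subseteq> F \<inter> W" using Fg(2) Wg(2) by blast
        moreover have "vec.dim (F \<inter> W) - ?r = 3" using W by simp
        ultimately show ?thesis
          using card_covers_above[OF R(2) subspace_Int[OF gens_subspace[OF Fg(1)] gens_subspace[OF Wg(1)]]] by (simp only: q gn)
      qed
      ultimately show "card (covers_above R W - covers_above R (F \<inter> W)) = 64" by simp
    qed
    also have "\<dots> = card ?W * 64" by simp
    also have "card ?W = 85" using b3 by (simp add: b_def)
    finally show ?thesis by simp
  qed
  \<comment> \<open>The projection of a line meets F in relative dimension 2. In each of the
    \<open>b 2 = 9996\<close> such members at most 80 * 16 / 5 = 256 lines are disjoint from that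
    intersection: 80 points off it, at most 16 lines through each, 5 points on every line.\<close>
  have c2: "card (Mk 2) \<le> 9996 * 256"
  proof -
    let ?W = "{W \<in> Y. vec.dim (F \<inter> W) = ?r + 2}"
    let ?C = "\<lambda>W. {M \<in> subs_between R W 2. M \<inter> (F \<inter> W) = R}"
    have "Mk 2 \<subseteq> (\<Union>W\<in>?W. ?C W)"
    proof
      fix M assume M: "M \<in> Mk 2"
      note p = pi[OF M]
      have "M \<inter> (F \<inter> proj M F) = R" using p(2,6) by blast
      then have "M \<in> ?C (proj M F)" using p(2,5,7) PP_subspace[OF p(4)] by (simp add: subs_between_def)
      moreover have "vec.dim (F \<inter> proj M F) = ?r + 2" using p(3) n by linarith
      ultimately show "M \<in> (\<Union>W\<in>?W. ?C W)" using p(1) by blast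
    qed
    then have "card (Mk 2) \<le> card (\<Union>W\<in>?W. ?C W)" by (intro card_mono) auto
    also have "\<dots> \<le> (\<Sum>W\<in>?W. card (?C W))" by (intro card_UN_le) auto
    also have "\<dots> \<le> (\<Sum>W\<in>?W. 256)"
    proof (rule sum_mono)
      fix W assume W: "W \<in> ?W"
      then have Wg: "W \<in> gens" "R \<subseteq> W" using steiner_gens[OF st] steiner_base[OF st] by auto
      let ?A = "F \<inter> W"
      have sA: "vec.subspace ?A" "R \<subseteq> ?A" "vec.dim ?A = ?r + 2" "?A \<subseteq> W"
        using W Fg Wg subspace_Int[OF gens_subspace[OF Fg(1)] gens_subspace[OF Wg(1)]] by blast+
      let ?P = "covers_above R W - covers_above R ?A"
      have cP: "card ?P = 80"
      proof -
        have "card ?P = card (covers_above R W) - card (covers_above R ?A)"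
          by (intro card_Diff_subset) (auto simp: covers_above_def)
        moreover have "card (covers_above R W) = 85"
          using card_covers_above[OF R(2) gens_subspace[OF Wg(1)] Wg(2)] unfolding gens_dim[OF Wg(1)] m4 q gn .
        moreover have "card (covers_above R ?A) = 5"
          using card_covers_above[OF R(2) sA(1,2)] unfolding sA(3) q by (simp add: gn)
        ultimately show ?thesis by simp
      qed
      have "(\<Sum>M\<in>?C W. card {L \<in> ?P. L \<subseteq> M}) = (\<Sum>L\<in>?P. card {M \<in> ?C W. L \<subseteq> M})"
        by (rule double_count) auto
      moreover have "card {L \<in> ?P. L \<subseteq> M} = 5" if M: "M \<in> ?C W" for M
      proof -
        have M': "vec.subspace M" "R \<subseteq> M" "M \<subseteq> W" "vec.dim M = ?r + 2" "M \<inter> ?A = R"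
          using M by (auto simp: subs_between_def)
        have "\<not> L \<subseteq> ?A" if "L \<in> covers_above R M" for L
        proof
          assume "L \<subseteq> ?A"
          then have "L \<subseteq> R" using that M'(5) by (auto simp: covers_above_def)
          then show False using dim_le_subspace[of L R] that by (simp add: covers_above_def)
        qed
        then have "{L \<in> ?P. L \<subseteq> M} = covers_above R M"
          using M'(3) by (auto simp: covers_above_def)
        then show ?thesis using card_covers_above[OF R(2) M'(1,2)] M'(4) q gn by simp
      qed
      moreover have "card {M \<in> ?C W. L \<subseteq> M} \<le> 16" if L: "L \<in> ?P" for L
      proof -
        have L': "vec.subspace L" "R \<subseteq> L" "L \<subseteq> W" "vec.dim L = ?r + 1" "\<not> L \<subseteq> ?A"
          using L by (auto simp: covers_above_def)
        let ?T = "vec.span (L \<union> ?A)"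
        have LA: "L \<inter> ?A = R"
        proof -
          have sLA: "vec.subspace (L \<inter> ?A)" using L'(1) sA(1) by (rule subspace_Int)
          have "vec.dim (L \<inter> ?A) \<noteq> ?r + 1" using subspace_dim_eq[OF sLA L'(1)] L'(4,5) by auto
          moreover have "vec.dim (L \<inter> ?A) \<le> ?r + 1" using dim_le_subspace[of "L \<inter> ?A" L] L'(4) by simp
          moreover have "R \<subseteq> L \<inter> ?A" using L'(2) sA(2) by blast
          ultimately show ?thesis using subspace_dim_eq[OF R(2) sLA] by force
        qed
        have dT: "vec.dim ?T = ?r + 3" using dim_span_Un[OF L'(1) sA(1)] LA L'(4) sA(3) by simp
        have TW: "?T \<subseteq> W" using L'(3) sA(4) by (intro vec.span_minimal gens_subspace[OF Wg(1)]) auto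
        have LT: "L \<subseteq> ?T" "?A \<subseteq> ?T" using vec.span_superset[of "L \<union> ?A"] by auto
        have "{M \<in> ?C W. L \<subseteq> M} \<subseteq> covers_above L W - covers_above L ?T"
        proof
          fix M assume M: "M \<in> {M \<in> ?C W. L \<subseteq> M}"
          then have M': "vec.subspace M" "R \<subseteq> M" "M \<subseteq> W" "vec.dim M = ?r + 2" "M \<inter> ?A = R" "L \<subseteq> M"
            by (auto simp: subs_between_def)
          have "\<not> M \<subseteq> ?T"
          proof
            assume "M \<subseteq> ?T"
            then have "vec.span (M \<union> ?A) \<subseteq> ?T" using LT(2) by (intro vec.span_minimal vec.subspace_span) auto
            then have "vec.dim (vec.span (M \<union> ?A)) \<le> ?r + 3" using dim_le_subspace dT by metis
            then show False using dim_span_Un[OF M'(1) sA(1)] M'(4,5) sA(3) by simp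
          qed
          then show "M \<in> covers_above L W - covers_above L ?T" using M' L'(4) by (auto simp: covers_above_def)
        qed
        then have "card {M \<in> ?C W. L \<subseteq> M} \<le> card (covers_above L W - covers_above L ?T)" by (intro card_mono) auto
        also have "\<dots> = card (covers_above L W) - card (covers_above L ?T)"
          using TW by (intro card_Diff_subset) (auto simp: covers_above_def)
        also have "card (covers_above L W) = 21"
        proof -
          have "vec.dim W - vec.dim L = 3" using gens_dim[OF Wg(1)] L'(4) n by linarith
          then show ?thesis using card_covers_above[OF L'(1) gens_subspace[OF Wg(1)] L'(3)] by (simp only: q gn)
        qed
        also have "card (covers_above L ?T) = 5"
        proof -
          have "vec.dim ?T - vec.dim L = 2" using dT L'(4) by linarith
          then show ?thesis using card_covers_above[OF L'(1) vec.subspace_span LT(1)] by (simp only: q gn)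
        qed
        also have "21 - 5 = (16 :: nat)" by simp
        finally show ?thesis .
      qed
      then have "(\<Sum>L\<in>?P. card {M \<in> ?C W. L \<subseteq> M}) \<le> (\<Sum>L\<in>?P. 16)" by (intro sum_mono) auto
      ultimately have "card (?C W) * 5 \<le> 80 * 16" using cP by simp
      then show "card (?C W) \<le> 256" by simp
    qed
    also have "\<dots> = card ?W * 256" by simp
    also have "card ?W = 9996" using b2 by (simp add: b_def)
    finally show ?thesis by simp
  qed
  have "(\<Sum>S\<in>?S. ?g S) = (\<Sum>S\<in>?S. real (subcount R h 2 S) / 16 + real (subcount R h 1 S) / 8 - 65 / 16)"
    using g by (intro sum.cong refl)
  also have "\<dots> = (\<Sum>S\<in>?S. real (subcount R h 2 S)) / 16 + (\<Sum>S\<in>?S. real (subcount R h 1 S)) / 8 - real (card ?S) * (65 / 16)"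
    by (simp add: sum.distrib sum_subtractf sum_divide_distrib)
  \<comment> \<open>The values are 5117952 + 2437120 = 7555072 against 7571200, so the margin is
    small and all the preceding bounds are needed nearly sharp.\<close>
  also have "\<dots> \<le> 32 * real (9996 * 256) / 16 + 3584 * real (85 * 64) / 8 - 1863680 * (65 / 16)"
  proof -
    have "real (card (Mk 2)) \<le> real (9996 * 256)" "real (card (Mk 1)) \<le> real (85 * 64)"
      using c1 c2 of_nat_le_iff by blast+
    then show ?thesis using N1 N2 cS by linarith
  qed
  also have "\<dots> < 0" by simp
  finally show False using ineq by linarith
qed

end

section \<open>The elliptic quadric over the field with two elements\<close>

text \<open>
  The eight bits of a character are the coordinates of a vector with respect to
  \<open>x\<^sub>1, y\<^sub>1, x\<^sub>2, y\<^sub>2, x\<^sub>3, y\<^sub>3, z\<^sub>1, z\<^sub>2\<close>, and \<open>byte_form\<close> is the elliptic quadratic form with hyperbolic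
  pairs \<open>x\<^sub>i, y\<^sub>i\<close> and anisotropic part spanned by \<open>z\<^sub>1, z\<^sub>2\<close>.
\<close>

fun byte_add :: "char \<Rightarrow> char \<Rightarrow> char" (infixl \<open>\<oplus>\<close> 65) where
  "Char a b c d e f g h \<oplus> Char a' b' c' d' e' f' g' h' =
     Char (a \<noteq> a') (b \<noteq> b') (c \<noteq> c') (d \<noteq> d') (e \<noteq> e') (f \<noteq> f') (g \<noteq> g') (h \<noteq> h')"

text \<open>Inequality of truth values is addition modulo 2, and \<open>g \<or> h\<close> is g^2 + g
  h + h^2, the norm form of the field with four elements.\<close>

fun byte_form :: "char \<Rightarrow> bool" where
  "byte_form (Char a b c d e f g h) \<longleftrightarrow> ((a \<and> b) \<noteq> (c \<and> d)) \<noteq> ((e \<and> f) \<noteq> (g \<or> h))"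

fun byte_polar :: "char \<Rightarrow> char \<Rightarrow> bool" where
  "byte_polar (Char a b c d e f g h) (Char a' b' c' d' e' f' g' h') \<longleftrightarrow>
     (((a \<and> b') \<noteq> (b \<and> a')) \<noteq> ((c \<and> d') \<noteq> (d \<and> c'))) \<noteq>
     (((e \<and> f') \<noteq> (f \<and> e')) \<noteq> ((g \<and> h') \<noteq> (h \<and> g')))"

definition byte_plane :: "char \<Rightarrow> char \<Rightarrow> char \<Rightarrow> char list" where
  "byte_plane u v w = [u, v, u \<oplus> v, w, u \<oplus> w, v \<oplus> w, (u \<oplus> v) \<oplus> w]"

text \<open>
  A goal is a list of labelled planes assumed to belong to the Steiner system.  A certificate node
  names a singular line \<open>u, v\<close> and the five planes through it; each of the five planes either shares a
  second line with an assumed plane, whose label is given, or yields a new goal, in which it is added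
  under that label.  A node is a string of five labels followed by \<open>u\<close>, \<open>v\<close> and four vectors spanning the
  planes; the fifth plane is spanned by their sum.  Vectors are written as two hexadecimal digits,
  lower digit first, with the letters from \<open>@\<close> to \<open>O\<close> as digits.
\<close>

type_synonym goal = "(char \<times> char list) list"

fun hex_bytes :: "string \<Rightarrow> char list" where
  "hex_bytes (Char a b c d _ _ _ _ # Char e f g h _ _ _ _ # s) = Char a b c d e f g h # hex_bytes s"
| "hex_bytes _ = []"

text \<open>An absent label yields the empty list, which conflicts with nothing; this is how a node
  announces that a subgoal is to be opened under a fresh label.\<close>

fun lookup_plane :: "goal \<Rightarrow> char \<Rightarrow> char list" where
  "lookup_plane [] i = []"
| "lookup_plane ((j, p) # g) i = (if i = j then p else lookup_plane g i)"

text \<open>Two distinct nonzero common vectors force the members containing p and r to coincide,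
  and a pair of vectors that are not perpendicular makes this impossible. Testing the first two
  common vectors keeps the check cheap.\<close>

definition conflict :: "char list \<Rightarrow> char list \<Rightarrow> bool" where
  "conflict p r \<longleftrightarrow> (case filter (\<lambda>c. c \<in> set r) p of
      a # b # _ \<Rightarrow> a \<noteq> b \<and> a \<noteq> CHR 0x00 \<and> b \<noteq> CHR 0x00 \<and> list_ex (\<lambda>c. list_ex (byte_polar c) r) p
    | _ \<Rightarrow> False)"

text \<open>Together with \<open>pairwise_polar\<close> this says that the vectors in ws span, with
  the singular line of u and v, pairwise different singular planes. Five of them are all E + 1
  planes through the line.\<close>

definition valid_pencil :: "char \<Rightarrow> char \<Rightarrow> char list \<Rightarrow> bool" where
  "valid_pencil u v ws \<longleftrightarrow> u \<noteq> CHR 0x00 \<and> v \<noteq> CHR 0x00 \<and> u \<noteq> v \<and>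
     \<not> byte_form u \<and> \<not> byte_form v \<and> \<not> byte_polar u v \<and>
     list_all (\<lambda>w. \<not> byte_form w \<and> \<not> byte_polar u w \<and> \<not> byte_polar v w) ws"

fun pairwise_polar :: "char list \<Rightarrow> bool" where
  "pairwise_polar [] \<longleftrightarrow> True"
| "pairwise_polar (w # ws) \<longleftrightarrow> list_all (byte_polar w) ws \<and> pairwise_polar ws"

fun subgoals :: "goal \<Rightarrow> char \<Rightarrow> char \<Rightarrow> char list \<Rightarrow> string \<Rightarrow> goal list" where
  "subgoals g u v (w # ws) (i # is) =
     (if conflict (byte_plane u v w) (lookup_plane g i) then subgoals g u v ws is
      else ((i, byte_plane u v w) # g) # subgoals g u v ws is)"
| "subgoals _ _ _ _ _ = []"

definition expand :: "goal \<Rightarrow> string \<Rightarrow> char list \<Rightarrow> goal list option" where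
  "expand g is bs = (case bs of
      [u, v, a, b, c, d] \<Rightarrow>
        (if valid_pencil u v [a, b, c, d, (a \<oplus> b) \<oplus> (c \<oplus> d)] \<and>
            pairwise_polar [a, b, c, d, (a \<oplus> b) \<oplus> (c \<oplus> d)] \<and> length is = 5
         then Some (subgoals g u v [a, b, c, d, (a \<oplus> b) \<oplus> (c \<oplus> d)] is) else None)
    | _ \<Rightarrow> None)"

definition expand_node :: "goal \<Rightarrow> string \<Rightarrow> goal list option" where
  "expand_node g s = (case s of i # j # k # l # m # s' \<Rightarrow> expand g [i, j, k, l, m] (hex_bytes s') | _ \<Rightarrow> None)"

text \<open>The certificate is the preorder listing of a search tree, and the second argument is the
  stack of open goals of a depth-first traversal.\<close>

fun refutes :: "string list \<Rightarrow> goal list \<Rightarrow> bool" where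
  "refutes [] gs \<longleftrightarrow> gs = []"
| "refutes (s # ss) gs \<longleftrightarrow> (case gs of [] \<Rightarrow> False | g # gs' \<Rightarrow>
     (case expand_node g s of None \<Rightarrow> False | Some hs \<Rightarrow> refutes ss (hs @ gs')))"

text \<open>
  The members \<open>F = \<langle>x\<^sub>1, x\<^sub>2, x\<^sub>3\<rangle>\<close> and \<open>S = \<langle>y\<^sub>1, y\<^sub>2, y\<^sub>3\<rangle>\<close> form the base goal.  A line \<open>\<langle>x, y\<rangle>\<close> joining
  perpendicular points \<open>x\<close> of \<open>F\<close> and \<open>y\<close> of \<open>S\<close> lies in three planes that are not excluded by \<open>F\<close> or \<open>S\<close>; they
  correspond to the colours \<open>z\<^sub>1\<close>, \<open>z\<^sub>2\<close> and \<open>z\<^sub>1 + z\<^sub>2\<close>.  The other goals prescribe the colours of lines through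
  \<open>x\<^sub>1\<close>: in \<open>pair_goal\<close> the lines to \<open>y\<^sub>2\<close> and \<open>y\<^sub>3\<close> have the same colour, which the line to \<open>y\<^sub>2 + y\<^sub>3\<close> shares in
  \<open>mono_goal\<close> but not in \<open>mixed_goal\<close>; in \<open>rainbow_goal\<close> the three colours are distinct.
\<close>

definition base_goal :: goal where
  "base_goal =
     [(CHR ''A'', byte_plane (CHR 0x01) (CHR 0x04) (CHR 0x10)),
      (CHR ''B'', byte_plane (CHR 0x02) (CHR 0x08) (CHR 0x20))]"

definition pair_goal :: goal where
  "pair_goal = [(CHR ''D'', byte_plane (CHR 0x01) (CHR 0x20) (CHR 0x4C)),
            (CHR ''C'', byte_plane (CHR 0x01) (CHR 0x08) (CHR 0x70))] @ base_goal"

definition mono_goal :: goal where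
  "mono_goal = (CHR ''E'', byte_plane (CHR 0x01) (CHR 0x28) (CHR 0x5C)) # pair_goal"

definition mixed_goal :: goal where
  "mixed_goal = (CHR ''E'', byte_plane (CHR 0x01) (CHR 0x28) (CHR 0x9C)) # pair_goal"

definition rainbow_goal :: goal where
  "rainbow_goal = [(CHR ''F'', byte_plane (CHR 0x10) (CHR 0x08) (CHR 0x83)),
            (CHR ''E'', byte_plane (CHR 0x01) (CHR 0x28) (CHR 0xDC)),
            (CHR ''D'', byte_plane (CHR 0x01) (CHR 0x20) (CHR 0x8C)),
            (CHR ''C'', byte_plane (CHR 0x01) (CHR 0x08) (CHR 0x70))] @ base_goal"

lemma refutes_mono_goal: "refutes [
    ''ADFECA@LH@A@BLCDG'', ''ADFECA@LL@A@BLCDG''] [mono_goal]"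
  by code_simp

lemma refutes_mixed_goal: "refutes [
    ''AEDFCA@LJDAHA@BLE'', ''CAEDGA@HKH@DADBLD'', ''AHEDCA@LM@ADBHBLF'', ''AIEDCA@DOD@HAHBLD'', ''ACJFDA@@KD@H@LCLE'',
    ''KBKKFBBCMD@H@OAND'', ''KBLLGBBGED@J@IALH'', ''LBMJKOABBF@J@LDLH'', ''BNJLKBBLHB@AAOAGE'', ''HBNLMBBMMF@J@AAND'',
    ''BLIMMBBNLB@EAIACE'', ''NBMJKOABBF@J@LDLH'', ''BOMLKBBLDB@AAOAGI'', ''KBJPMBBCID@H@OAND'', ''MBQKGBBKIF@H@EALD'',
    ''KBNLRBBGID@J@IALD'', ''DSSLSLDEKA@O@BABB'', ''JTQSTGCMHJ@AAFACD'', ''BUTSGB@HKH@DADBLD'', ''MCUTSAGJKE@H@FAFB'',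
    ''SAUTME@JKJ@AAABKD'', ''TSFKVKDJKE@H@FAFB'', ''BWUSCH@BKB@AAABCD'', ''XOVHXEBKDE@FAHAGI'', ''AYXULE@@GA@J@KCKI'',
    ''ASZRXE@@KA@J@KCKE'', ''YAUPZE@JOJ@AAABKD'', ''AXYPTE@KD@A@BKCAK'', ''CWBXZH@AKA@BABBCD'', ''YODZSNCLDB@AAOAGH'',
    ''NTSJTBAOBF@J@LDLH'', ''ATUSKD@BAB@ABCFCJ'', ''STUPFBANDB@EBIBCJ'', ''ABSUTB@@AD@H@LDLH'', ''SITPUBAMNF@J@ABND'',
    ''TNTSGF@BGB@IAIBKH'', ''TSIMUBGNIB@EAIAAB'', ''TQSVFBGLJB@EAIAAB'', ''GUQWSBGIKF@H@EAEB'', ''BXUVSJ@BGB@EAEBGH'',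
    ''KVIYSBGGHD@J@IAIB'', ''ZBUDZ@BCLD@H@O@MD'', ''AZTaKD@CD@A@BCCAK'', ''bIZVPHAGNI@J@DBKD'', ''BHbaYJBLMB@O@AAGD'',
    ''AKZaTD@CNAABA@BCE'', ''ABZbWE@@BA@J@KDKH'', ''bNEaXOAKJE@F@HBLD'', ''AUTSQEAGFD@J@IBKH'', ''KUITSBGGHD@J@IAIB'',
    ''ABMLNAABBD@H@LDLH'', ''BMOLKBBLDB@AAOAGI'', ''BPLMKBBNDB@EAIACI'', ''QBLKMBBMIF@J@AAND'', ''KBRLNBBGID@J@IALD'',
    ''SNSHSKFFKF@AAJAEB'', ''TTIKSKFNIE@BAIAFB'', ''UCBTSH@CFAABA@BCI'', ''SCPTVBAKFF@H@EBLH'', ''TPUHWEBNDE@BAIACI'',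
    ''MIWVSKFGHDAIAJA@B'', ''AOUTSE@KFAAJA@BKI'', ''VRSTFKFLJDAIAJA@B'', ''SWUIRIAKFF@H@EBGH'', ''XVXDKLFOKO@DAHAAB'',
    ''SBJYXB@@KD@H@LCLE'', ''AXRYSE@@KA@J@KCKE'', ''AUYXME@KL@A@BKCAG'', ''XBYCWH@CL@A@BCCAG'', ''TTSJKJAFBB@O@MDMH'',
    ''ATPSUO@EAE@FBCFCJ'', ''TVDRUJAABE@H@MDMH'', ''TOVUGJANFB@E@IBMH'', ''ITUMSJALNB@O@ABGD'', ''SVELUJANJB@E@IBMD'',
    ''WCTWNCCCDD@H@O@MI'', ''WTDXNBAABD@H@LDLH'', ''BTWXIIAJBH@O@GDGH'', ''XSBFWB@LJDAHA@BLE'', ''XLVDWMFNJDAHAOA@B'',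
    ''TTRFSJALJB@O@ABGD'', ''TQJUSF@@KB@I@KCKE'', ''TSUDOLDFKB@O@AAAB'', ''STLDUMFFKF@EAHAAB'', ''VCTMSHGFKB@I@EAEB'',
    ''QWSUCI@FKF@AAABGD'', ''VSWDOLDFKB@O@AAAB'', ''KBLLIIABBF@H@NDNH'', ''BALMKD@BBB@AACECI'', ''HBKLNBBMMF@J@AAND'',
    ''HBOMLBBKMF@H@EALD'', ''BPKMPBBLDB@AAOAGI'', ''BKPQHF@BBB@IAKEKI'', ''PBLRKBBKEF@H@EALH'', ''AQSSS@AMHA@F@J@CD'',
    ''TIBTSJ@EOE@BABBGD'', ''TUBSGJ@EGE@BABBGH'', ''BVSTGJ@BKB@EAEBGD'', ''SBHUVJ@GM@ABBEBGF'', ''BTUFSJ@@OB@E@GCGE'',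
    ''BUVSHJ@EBE@BAGEGI'', ''FPWVWMEKJF@AAJAEB'', ''CXWSRJACFH@O@DBMH'', ''SHYNWJAGLJ@DBIBKF'', ''WXQYGJACJH@O@DBMD'',
    ''SXPWFJAGDJ@DBIBKJ'', ''UWKJYMCKLF@EAHAGD'', ''HKXYUIADBA@F@GDGH'', ''BTTSD@BNLB@E@I@CD'', ''STOCUI@GL@A@BGCAG'',
    ''VTOSFNCNLB@E@I@CE'', ''SDOUVMDCH@A@BGCKC'', ''SMUTFMECI@ABBEBIB'', ''GTOSVFGHKB@I@EAEB'', ''SBWGUB@LL@A@BLCDG'',
    ''XDXVNMDNH@A@BGCKC'', ''XDVYQF@KD@A@BKCBK'', ''XPZFUF@KE@ABBIBKJ'', ''ABZYWB@D@@A@B@G@K'', ''WIBYXB@DOD@HAHBLD'',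
    ''KIXYUOAKNE@F@HBLD'', ''STBTCH@CM@AABBBCF'', ''THKSUEBCMD@O@HAND'', ''KTIVSFBCMD@O@HAMD'', ''WIKSUNCCMDAHAOAND'',
    ''EBXUXHBMEA@J@FACH'', ''YXPUFJAGDJ@DBIBKJ'', ''ZTXMJKDAKE@H@FAFB'', ''DZYVOMDDKA@F@JAJB'', ''WIYXQF@KNBAIA@BKE'',
    ''AVXOZEAKHE@FBHBGF'', ''aUPFXOBMEF@J@AACH'', ''QYJaZF@KH@A@BKCBG'', ''UTKDSABCMD@H@OAMD'', ''KVITSFBCMD@O@HAMD'',
    ''SFUVTMENH@ABBEBIB'', ''BKQPHF@BBB@IAKEKI'', ''ABPRKAABBD@H@LDLH'', ''SSQHSDBGDD@IAJAKI'', ''CTSTKOAGFI@J@DBLH'',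
    ''SLTUEIBNDI@BAEACI'', ''PGTSUGFIKI@BAEADB'', ''SLUTEIBNDI@BAEACI'', ''PGUSTGFIKI@BAEADB'', ''TSETRNEMI@ADBHBOB'',
    ''TSBFUB@LE@ADBHBLJ'', ''TUMGSNECI@AABFBJB'', ''USBFTB@LE@ADBHBLJ'', ''UTMGSNECI@AABFBJB'', ''LSTITIAGDI@DBJBKJ'',
    ''ASTMUD@CD@A@BCCAK'', ''LVCSUI@GD@A@BGCAK'', ''SVRJUGDLH@A@BCCMC'', ''STRJUGDLH@A@BCCMC'', ''BUTVSJBGDJ@DAIAKI'',
    ''PWWVFLEKI@ADBIBJB'', ''BXWSHB@DBD@HALELI'', ''AXQWSE@ABA@JAKEKI'', ''XAMUWD@BKB@AAABCD'', ''XSWDNMDBKF@J@AAAB'',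
    ''BAMLKD@BBB@AACECI'', ''HBKNLBBMMF@J@AAND'', ''HBOLMBBKMF@H@EALD'', ''PBNPKBBKEF@H@EALH'', ''ABPQKAABBD@H@LDLH'',
    ''BPKLRBBLDB@AAOAGI'', ''SSSHRNFBKB@AAOAEB'', ''STETPF@BKB@IAIBKD'', ''ATQUSAACJD@H@OBMD'', ''BTVUGJ@BKB@EAEBGD'',
    ''MCSVUAGBKD@H@OAOB'', ''MCSUTAGBKD@H@OAOB'', ''BVUTGJ@BKB@EAEBGD'', ''PGSUWOGBKF@J@AAAB'', ''XXBFSB@LE@ADBHBLJ'',
    ''XDKVYOALDO@ABBBGJ'', ''CXWYRLCLDA@B@O@GI'', ''SBYGXB@LL@A@BLCDG'', ''XAZNU@ANDB@E@I@CH'', ''WZMJYLCGEDAIAJALH'',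
    ''JTTKSMCNIBAEAIAMD'', ''TLUFSO@CJEAFA@BCE'', ''SLTIVIACJH@O@DBND'', ''AWUMVD@CJAABA@BCE'', ''MXFSVCECJD@H@O@MC'',
    ''VGYYQDGOKE@F@HAHB'', ''YBXCZH@CL@A@BCCAG'', ''KHaYSO@CM@AEBFBCF'', ''NZWaJKDAKE@H@FAFB'', ''AWZMYD@CNAABA@BCE'',
    ''SRYZJNFMHAAFAJA@B'', ''TBUDS@BCHD@H@O@MD'', ''COSTUHGCJH@EAFADB'', ''TSETKOAKJE@F@HBLD'', ''TUDSKOAABE@I@LDLH'',
    ''IVKTSOAMNF@J@ABCD'', ''PGSWWOGBKF@J@AAAB'', ''IOWTXJALNB@O@ABGD'', ''DULYWABMHA@FAJACE'', ''XBJYVJ@GH@A@BGCBG'',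
    ''ATLXWE@KH@A@BKCAG'', ''XWVHLFGNHB@I@EAEB'', ''ABUSTJ@EAE@BBGFGJ'', ''KISTUOAKNE@F@HBLD'', ''BKPQHF@BBB@IAKEKI'',
    ''ABRPKAABBD@H@LDLH'', ''SAQSSE@JKJ@AAABKD'', ''STITMGEJKJ@DAIAAB'', ''STFUKKDJKE@H@FAFB'', ''GSVTKFGJKB@O@AAAB'',
    ''BTUWGB@HKH@DADBLD'', ''SCVMWAGJKE@H@FAFB'', ''USTHOCDJKH@O@DADB'', ''AUVRTAAKJE@H@FBLD'', ''SPWDUMFJKJ@DAIAAB'',
    ''CSPXVIGJKH@O@DADB'', ''YWDQYF@KFBAIA@BKI'', ''QVJZYF@KH@A@BKCBG'', ''BaYSIJ@BAB@EBGFGJ'', ''ZaRFXOBMEF@J@AACH'',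
    ''YAZUMD@BKB@AAABCD'', ''YRFZXMEFKF@AAJAEB'', ''CTRTSCCKDH@EAFAGH'', ''BTUSEHBKDH@EAFAGI'', ''VHTSLKDGI@AEBFBHB'',
    ''PWSJUKDLH@A@BCCMC'', ''NXUTJKDAKE@H@FAFB'', ''OUIVYKDGJEAFAHA@B'', ''ZWJZPO@CH@A@BCCEG'', ''ABaZVB@@AD@H@LDLH'',
    ''AQZVa@AKHE@F@H@GD'', ''CaBSZH@AOA@BABBCD'', ''bDRZXO@CD@A@BCCEK'', ''RabDYLDGJAABAOA@B'', ''SDBTU@BKDE@F@H@GH'',
    ''TSOHUKDBKF@H@EAEB'', ''TTKJSMCKLF@EAHAGD'', ''STBUD@BKLE@F@H@GD'', ''STUEROGDKE@F@HAHB'', ''UTHSRCCKLH@EAFAGD'',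
    ''TNSDULFGJEAFAHA@B'', ''BLIKLBBNLB@EAIACE'', ''MBKLGBBGED@J@IALH'', ''MBJKLBBCID@H@OAND'', ''BAMLKD@BBB@AACECI'',
    ''BNLKHF@BBB@IAKEKI'', ''ABLKOAABBD@H@LDLH'', ''ABKPLEABBD@J@NDNH'', ''BKJMQBBLHB@AAOAGE'', ''HBLRMBBKMF@H@EALD'',
    ''SSMGSNCKDE@FAHAGH'', ''OTHSTNCMMAAFAJAND'', ''SUDTRNCLDB@AAOAGH'', ''JSPTUNCNHB@E@I@CE'', ''BUSETFAHBB@I@KDKH'',
    ''STIQVNCKLE@FAHAGD'', ''JWUQSNCLHB@AAOAGD'', ''UXHSRNCGLI@DAJAKD'', ''VYUSFNCCIDAHAOAND'', ''MIZZWGECJD@IAJAHB'',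
    ''OUaZCI@GNAAFA@BGE'', ''ZYFaOCDMJDAHAOA@B'', ''SAaZLE@JGJ@AAABKH'', ''LGXaZOGHKI@J@DADB'', ''KTTHSCFOKO@AABADB'',
    ''USNJTMCNEBAEAIAMH'', ''UPITSCFNHBAEAIA@B'', ''AUSPTEACFD@O@HBNH'', ''OSUTJCFMHAAFAJA@B'', ''TOFTSLEBKB@AAOAEB'',
    ''TNESUF@BKB@IAIBKD'', ''TUSDKLFBKB@EAIAAB'', ''UNESTF@BKB@IAIBKD'', ''UTSDKLFBKB@EAIAAB''] [mixed_goal]"
  by code_simp

lemma refutes_rainbow_goal: "refutes [
    ''ADCGEA@LD@A@BLCDK'', ''ACEDHA@LE@ADBHBLJ'', ''CIBIFH@AOA@BABBCD'', ''BICFJH@CCAABACDCH'', ''FBCKIH@CD@A@BCCAK'',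
    ''CBFILH@@KA@B@CCCE'', ''BMFICH@BKB@AAABCD'', ''FNBJIH@CE@AABBBCJ'', ''AOEDOA@DGD@HAHBLH'', ''AOCPEA@DBD@HALELI'',
    ''AOCDQA@LCDAHALDLH'', ''RRIRQGDFKD@I@JAJB'', ''ABRSSD@@BA@B@CDCH'', ''ATRSJD@CCAABACDCH'', ''ATRLSD@CM@AABBBCF'',
    ''TANRSD@BGB@AAABCH'', ''ARUSLD@@KA@B@CCCE'', ''UVMQVMCGHJ@DAIAKD'', ''SEWNVIBNLI@BAEACE'', ''QVSKXMCGLJ@DAIAKD'',
    ''LWOXRMFFKF@EAHAAB'', ''DBWVS@BLDA@B@O@GH'', ''TWNVGNCLDB@AAOAGH'', ''SRDSNABNIE@I@BAMD'', ''SRTHLO@@KE@F@CCCE'',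
    ''PBTRUBBMIF@J@AAND'', ''RKUETKDOKE@F@HAHB'', ''SPFRTDBKIE@F@HAGD'', ''RBUETHBGII@J@DAKD'', ''RKVETKDOKE@F@HAHB'',
    ''UWDJTCCLHO@AABAGD'', ''DVFXXHAMJA@J@FBCD'', ''AXWMYAANNE@I@BBMD'', ''IRQXYOANNE@I@BBCD'', ''ATJYXD@CL@A@BCCAG'',
    ''BUEYXHBCLH@DAOAME'', ''ANRSSDAGDD@IBJBKJ'', ''FSERTGDKI@ADBIBJB'', ''AUTKRD@CD@A@BCCAK'', ''VUOMTIAGDI@DBJBKJ'',
    ''UNWERIBGDI@DAJAKI'', ''TNUQXMCGDJ@DAIAKH'', ''YBWYHBBMEF@J@AANH'', ''AVYFZF@@AB@I@KDKH'', ''SMDYZF@KJBAIA@BKE'',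
    ''ZANYXE@JGJ@AAABKH'', ''AFaYV@ACLD@H@O@MD'', ''aUZGKO@CD@A@BCCEK'', ''SMHTRGDKJDAIAJA@B'', ''KGSRTGDEKD@J@IAIB'',
    ''APODEA@HAH@DBLFLJ'', ''AODQEA@LFDAHA@BLI'', ''RRMQROBMIF@J@AACD'', ''ARSSIF@BAB@IBKFKJ'', ''BPSRTF@BBB@IAKEKI'',
    ''USRKOF@IKI@BABBKD'', ''FDUTSF@KH@A@BKCBG'', ''RSTHLF@@KB@I@KCKE'', ''CSUTRF@IGI@BABBKH'', ''UBVGVBBKMF@H@EALD'',
    ''WJVHROBCLO@DAHAME'', ''SMHWVGDKJDAIAJA@B'', ''ABUVWAABBD@H@LDLH'', ''BUVWQBBNDB@EAIACI'', ''SMSRENFBKB@AAOAEB'',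
    ''SMRGTF@BKB@IAIBKD'', ''RFDSTABCID@H@OAMD'', ''HMSRTLEBKB@AAOAEB'', ''FRUUOKCCHH@DAOAMD'', ''AUSVIE@JAJ@ABKFKJ'',
    ''WITUEBAIBF@H@NDNH'', ''VRWKHOBNIE@I@BACD'', ''FUVQSOACHO@DBHBMF'', ''UTWHJKCLEAABAOAKH'', ''AWSVIE@JAJ@ABKFKJ'',
    ''NSSDRABNEE@I@BAMH'', ''TASFR@ANDB@E@I@CH'', ''STKRONEIKI@BAEADB'', ''SATFR@ANDB@E@I@CH'', ''TSKRONEIKI@BAEADB'',
    ''BJCJIH@BAB@ABCFCJ'', ''IJBKCH@CJAABA@BCE'', ''CJBILH@AKA@BABBCD'', ''FJBMCH@CM@AABBBCF'', ''BNJICH@BOB@AAABCD'',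
    ''AOCOEA@DBD@HALELI'', ''AODPEA@LFDAHA@BLI'', ''AOEDQA@DGD@HAHBLH'', ''RHKRRKE@KE@F@H@GC'', ''SSORFHANNB@I@EBCD'',
    ''RTSQLGEIKI@DAJABB'', ''TFPURMFCHDAHAOA@B'', ''SRCTU@GNIB@E@I@CC'', ''RSTIPOANNE@I@BBCD'', ''BRSDU@BNLB@E@I@CD'',
    ''VSPLRBGLIB@AAOAEB'', ''SREUWJANNB@E@IBMD'', ''XXWGINFGII@DAJABB'', ''XOYVNIAGHI@DBJBKF'', ''VXYMQFBNIB@I@EAMD'',
    ''ABXYVB@DAD@HBLFLJ'', ''AJXYTDAIBA@F@GDGH'', ''SRSIGGCNLI@BAEACD'', ''AJTRSD@CCAABACDCH'', ''OBTRSJ@GCBAEAGDGH'',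
    ''JTRDSFAABD@I@MDMH'', ''TORFSHAOBI@J@CDCH'', ''SSBPRJ@GFBAEA@BGI'', ''ASRTLEAGFD@J@IBKH'', ''SCUTRI@GFAAFA@BGI'',
    ''SCRTVFAGFD@I@JBKH'', ''ASUWMD@CFAABA@BCI'', ''MSXUGGFDKD@HAOAIB'', ''DVYNYIALJA@O@BBGD'', ''AZYRME@@KA@J@KCKE'',
    ''UYOaNIANDI@BBEBCJ'', ''QZVaIFGJKB@O@AAAB'', ''ZOYXNF@IAI@BBKFKJ'', ''ZYOWNIANHI@BBEBCF'', ''TSJRQBAGFD@J@IBLH'',
    ''URSIGGFNII@BAEADB'', ''TOSVIDBCDD@HAOAMI'', ''UJREVIBNDI@BAEACI'', ''PPBPD@BKDE@F@H@GH'', ''QOFPQEBCID@O@HAND'',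
    ''ORPQNIAEBA@O@NDNH'', ''QRPKOEBCED@O@HANH'', ''JRPOQBAEBD@J@NDNH'', ''POSKQEBNHE@BAIACE'', ''ERTPKEBMMA@J@FAND'',
    ''SUDUINCLHB@AAOAGD'', ''ABVUTAABBD@H@LDLH'', ''WERMUOBKME@F@HALD'', ''DIQVWMELJA@FAJABB'', ''VBRUGJ@GD@A@BGCBK'',
    ''ARWUNAAOBE@I@LDLH'', ''VPWHIFAKDF@EBHBGJ'', ''PQJQGKCMDF@AAJACH'', ''FPGQRMDCH@A@BGCKC'', ''EPSQLMDIKA@F@JAJB'',
    ''TPLGRMDNH@A@BGCKC'', ''HKSUUNDCJBAEAIA@B'', ''AQVNUAANFE@I@BBMH'', ''PVWKHF@KE@ABBIBKJ'', ''HVITWMEJKJ@AAFADB'',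
    ''VNPHUF@KNBAIA@BKE'', ''VFRUHNFCHDAHAOA@B'', ''APQRNAAMDA@FBJBCJ'', ''NQGPSMDNJAAFAJA@B'', ''EPRSLMDIKA@F@JAJB'',
    ''PKEQQKEGH@ADBIBJB'', ''RQJPGCCGHD@IAJAKD'', ''RQOPLNCGHI@DAJAKD'', ''QRJPGCCGHD@IAJAKD'', ''QROPLNCGHI@DAJAKD'',
    ''BJCFKH@CCAABACDCH'', ''ALEDLA@DGD@HAHBLH'', ''ALCMEA@DBD@HALELI'', ''ALCDNA@LCDAHALDLH'', ''BOOICH@BOB@AAABCD'',
    ''BJPFOH@ABA@BACECI'', ''OCBFQH@CFAABA@BCI'', ''RBRRHBBCID@H@OAND'', ''SONSRFBMLF@AAJACE'', ''STPREO@FBF@EACECI'',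
    ''MRTQSFBNIB@I@EAMD'', ''SOTDTGDLJDAIAJA@B'', ''TOESUOAKNE@F@HBLD'', ''RBNVTBBCMD@H@OAND'', ''WVDKUCCLHO@AABAGD'',
    ''QXUVGGFDKD@HAOAIB'', ''AWYSKEAFBD@O@KDKH'', ''REXQYFBCMD@O@HAMD'', ''AUTRID@CD@A@BCCAK'', ''VIRETKDGI@AEBFBHB'',
    ''DSBUW@BMLA@F@J@CD'', ''TWJVEOGCJO@AABADB'', ''SOESROAKNE@F@HBLD'', ''SRTMKOADBE@F@CDCH'', ''SLTRQOAKFE@F@HBLH'',
    ''RMTTKCCMIAAFAJACD'', ''SINUTJAKNE@H@FBGD'', ''VQLRTEGNJE@FAHABB'', ''WPLVSFBCED@O@HAMH'', ''VBNUXJBKME@H@FAGD'',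
    ''FYVUHMECH@ADBHBOB'', ''AYTWXD@CH@A@BCCAG'', ''AFSTU@ACDD@H@O@MH'', ''KTEVSCCGLD@IAJAKD'', ''TQLRWEGNJE@FAHABB'',
    ''TLXIUGCCDD@HAOAMH'', ''FVWHXLEKI@ADBIBJB'', ''SJRHSJGAKE@H@FAFB'', ''STJRHOBNIE@I@BACD'', ''DUJSRLCMHA@FAJACD'',
    ''VIHRSCDAKD@H@OAOB'', ''WPWEVIBGDI@DAJAKI'', ''AWXRIE@KD@A@BKCAK'', ''BSWDY@BNLB@E@I@CD'', ''FTMYXKCCHH@DAOAMD'',
    ''ABWXRAABBD@H@LDLH'', ''AWPUYEAIBA@O@NDNH'', ''RBYGXBBKMF@H@EALD'', ''AJRSTD@AKA@BABBCD'', ''RIHUSKDAKE@H@FAFB'',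
    ''JVRHTOANJE@I@BBCD'', ''WVPDWOAABE@I@LDLH'', ''BWXMUB@DBD@HALELI'', ''TOWMXDBGLD@IAJAKE'', ''AXWFU@ALLA@B@O@GD'',
    ''VWKGYOAGNI@J@DBLD'', ''TLBYXB@DGD@HAHBLH'', ''ABPIOH@AAA@BBCFCJ'', ''FOBJQH@CE@AABBBCJ'', ''ARRFR@ALLA@B@O@GD'',
    ''RSESQKEGH@ADBIBJB'', ''TPRSECFOKO@AABADB'', ''RSUIENFBKB@AAOAEB'', ''SFMVVDBCHD@HAOAME'', ''FDTWVO@CH@A@BCCEG'',
    ''AUXIVEAGJD@J@IBKD'', ''AXTJWO@EAE@FBCFCJ'', ''BWVMRB@DBD@HALELI'', ''OVWMSDBKME@F@HAGD'', ''RKETSOACLO@DBHBMF'',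
    ''ESRITEBLMA@O@BAKD'', ''RSSQNKEGI@AABBBOB'', ''RSNJTBALLB@ABOBGF'', ''UUBGSB@DKD@HAHBLD'', ''UJMVRO@FKF@EAEBCD'',
    ''UWFSLHANJB@I@EBCD'', ''UWDVKKCMHF@AAJACD'', ''UASIVD@BKB@AAABCD'', ''UTFWLHAGJI@J@DBKD'', ''RKWHVOBCLO@DAHAME'',
    ''PSRTNKFGJAABAOA@B'', ''LRJSTEGIKA@O@BABB'', ''SSDRKKCGIDAIAJAKD'', ''RSTPLIANHI@BBEBCF'', ''ROGSTLDGI@AABBBOB'',
    ''STJRHFBGID@I@JAKD'', ''UTDORABGID@I@JALD'', ''ROGTVLDGI@AABBBOB'', ''RUHWKLEGI@AEBFBHB'', ''VXPRHJGGIJ@DAIAAB'',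
    ''RKEYYOACLO@DBHBMF'', ''AJSZYD@AKA@BABBCD'', ''AaKYXDACLD@HBOBMF'', ''BaWZEHBCDH@DAOAMI'', ''XLBZYB@LFDAHA@BLI'',
    ''JYDaVF@KJBAIA@BKE'', ''UFZNaCFCID@H@O@MC'', ''AMLDEA@HAH@DBLFLJ'', ''ALDNEA@LFDAHA@BLI'', ''BJOFOH@ABA@BACECI'',
    ''ABOIPH@AAA@BBCFCJ'', ''FMQQQHACLH@DBOBMF'', ''RRODQFAABD@I@MDMH'', ''RQSILGCCDD@HAOAMH'', ''TRQIGGCNLI@BAEACD'',
    ''AQSUPAAFBD@I@MDMH'', ''VSOGQGCMDJ@AAFACH'', ''DQWOWABMLA@FAJACE'', ''BAVXWJ@@AB@E@GDGH'', ''IWTGXJACNH@O@DBMD'',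
    ''FXUNWO@CI@AEBFBCF'', ''FWSXGKFCIH@DAOAEB'', ''SQRILGCCDD@HAOAMH'', ''TJRQNGCLIAABAOAGD'', ''STOGQGCMDJ@AAFACH'',
    ''AQRPRAANJE@I@BBMD'', ''QJRGSJANJB@E@IBMD'', ''IQHSRCDNJDAHAOA@B'', ''QJSGRJANJB@E@IBMD'', ''IQHRSCDNJDAHAOA@B'',
    ''QRJREFGKJF@AAJAEB'', ''BSRQHJBLEB@O@AAGH'', ''QSTNJJALFB@O@ABGH'', ''UPNSQFGMIF@AAJAEB'', ''VSFETFGCHD@O@HAHB'',
    ''DUBWW@BMLA@F@J@CD'', ''ABWVXD@@BA@B@CDCH'', ''WDBRX@BKHE@F@H@GD'', ''AQXPWAANFE@I@BBMH'', ''WOXEQIBGDI@DAJAKI'',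
    ''SQBRLB@DGD@HAHBLH'', ''SRNQIFGGHD@I@JAJB'', ''ABPIOH@AAA@BBCFCJ'', ''FOBJQH@CE@AABBBCJ'', ''RRFRHGFKHEAFAHA@B'',
    ''ASRSQEANDE@BBIBCJ'', ''ATSJRO@EAE@FBCFCJ'', ''AKURSEAKLE@FBHBGF'', ''AVTISEAGJD@J@IBKD'', ''FWVWLKCCHH@DAOAMD'',
    ''WVXQLFANJB@I@EBMD'', ''BWYUEHBCHH@DAOAME'', ''XYSDOFAABD@I@MDMH'', ''FDTXWO@CH@A@BCCEG'', ''YSWNJJALFB@O@ABGH'',
    ''RXYGINFGII@DAJABB'', ''ABRTSJ@EAE@BBGFGJ'', ''AROTSEANLE@BBIBCF'', ''SSDIRFALJB@O@ABKD'', ''TMPSRO@FAF@EBCFCJ'',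
    ''BTUREFAHBB@I@KDKH'', ''RTKGUFANNB@I@EBMD'', ''ABTSRB@DAD@HBLFLJ'', ''UMTRKFAEBD@O@KDKH'', ''UREQTFACND@O@HBMD'',
    ''SMJSRLCGIDAIAJALD'', ''JTSGROAKJE@F@HBLD'', ''STJRNLFKJDAIAJA@B'', ''AJRTSE@KJAAJA@BKE'', ''AIUSRAAKJE@H@FBLD'',
    ''AJSRVDAKJE@F@HBGD'', ''JWDTSF@KJBAIA@BKE'', ''XVLOXDGGJD@HAOAIB'', ''ABXWYB@D@@A@B@G@K'', ''ARXYID@CD@A@BCCAK'',
    ''BMXWYIAJBH@O@GDGH'', ''OXMZVEBCMD@O@HAND'', ''ZIYEUNDJKB@E@IAIB''] [rainbow_goal]"
  by code_simp

section \<open>Soundness of the certificates\<close>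

lemma byte_form_add: "byte_form (c \<oplus> d) \<longleftrightarrow> ((byte_form c \<noteq> byte_form d) \<noteq> byte_polar c d)"
proof (cases c, cases d)
  fix a b c1 d1 e f g h a' b' c' d' e' f' g' h'
  assume *: "c = Char a b c1 d1 e f g h" "d = Char a' b' c' d' e' f' g' h'"
  have hyp: "((p \<noteq> p') \<and> (r \<noteq> r')) = (((p \<and> r) \<noteq> (p' \<and> r')) \<noteq> ((p \<and> r') \<noteq> (r \<and> p')))" for p p' r r'
    by (cases p; cases r; cases p'; cases r') simp_all
  have ani: "((p \<noteq> p') \<or> (r \<noteq> r')) = (((p \<or> r) \<noteq> (p' \<or> r')) \<noteq> ((p \<and> r') \<noteq> (r \<and> p')))" for p p' r r'
    by (cases p; cases r; cases p'; cases r') simp_all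
  \<comment> \<open>A regrouping of a sum of twelve terms modulo 2, obtained from repeated use of
    one exchange law; splitting into the cases of all variables would be far larger.\<close>
  have comb: "((((A \<noteq> A') \<noteq> A'') \<noteq> ((B \<noteq> B') \<noteq> B'')) \<noteq> (((C \<noteq> C') \<noteq> C'') \<noteq> ((D \<noteq> D') \<noteq> D''))) =
     ((((A \<noteq> B) \<noteq> (C \<noteq> D)) \<noteq> ((A' \<noteq> B') \<noteq> (C' \<noteq> D'))) \<noteq> ((A'' \<noteq> B'') \<noteq> (C'' \<noteq> D'')))" for A A' A'' B B' B'' C C' C'' D D' D'' :: bool
  proof -
    have m: "((P \<noteq> Q) \<noteq> (P' \<noteq> Q')) = ((P \<noteq> P') \<noteq> (Q \<noteq> Q'))" for P Q P' Q' :: bool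
      by (cases P; cases Q; cases P'; cases Q') simp_all
    show ?thesis
      unfolding m[of "A \<noteq> A'" A'' "B \<noteq> B'" B''] m[of "C \<noteq> C'" C'' "D \<noteq> D'" D'']
        m[of "(A \<noteq> A') \<noteq> (B \<noteq> B')" "A'' \<noteq> B''" "(C \<noteq> C') \<noteq> (D \<noteq> D')" "C'' \<noteq> D''"]
      unfolding m[of A A' B B'] m[of C C' D D'] m[of "A \<noteq> B" "A' \<noteq> B'" "C \<noteq> D" "C' \<noteq> D'"] ..
  qed
  show ?thesis unfolding * byte_add.simps byte_form.simps byte_polar.simps hyp ani by (rule comb)
qed

lemma byte_polar_nondeg: "c \<noteq> CHR 0x00 \<Longrightarrow> \<exists>d. byte_polar c d"
proof (cases c)
  case (Char a b c1 d1 e f g h)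
  assume "c \<noteq> CHR 0x00"
  then consider a | b | c1 | d1 | e | f | g | h using Char by auto
  then show ?thesis
  proof cases
    case 1 then show ?thesis by (intro exI[of _ "CHR 0x02"]) (simp add: Char)
  next
    case 2 then show ?thesis by (intro exI[of _ "CHR 0x01"]) (simp add: Char)
  next
    case 3 then show ?thesis by (intro exI[of _ "CHR 0x08"]) (simp add: Char)
  next
    case 4 then show ?thesis by (intro exI[of _ "CHR 0x04"]) (simp add: Char)
  next
    case 5 then show ?thesis by (intro exI[of _ "CHR 0x20"]) (simp add: Char)
  next
    case 6 then show ?thesis by (intro exI[of _ "CHR 0x10"]) (simp add: Char)
  next
    case 7 then show ?thesis by (intro exI[of _ "CHR 0x80"]) (simp add: Char)
  next
    case 8 then show ?thesis by (intro exI[of _ "CHR 0x40"]) (simp add: Char)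
  qed
qed

lemma byte_add_eq_0: "c \<oplus> d = CHR 0x00 \<Longrightarrow> c = d"
  by (cases c; cases d) simp

lemma binary_field_cases:
  fixes k :: "'a::{field,finite}"
  assumes "CARD('a) = 2"
  shows "k = 0 \<or> k = 1"
proof (rule ccontr)
  assume "\<not> (k = 0 \<or> k = 1)"
  then have "card {0, 1, k} = 3" by auto
  moreover have "card {0, 1, k} \<le> CARD('a)" by (intro card_mono) auto
  ultimately show False using assms by simp
qed

lemma binary_field_one_add_one:
  assumes "CARD('a::{field,finite}) = 2"
  shows "(1 :: 'a) + 1 = 0"
proof -
  have "(1 :: 'a) + 1 \<noteq> 1" by (metis add_cancel_right_right zero_neq_one)
  then show ?thesis using binary_field_cases[OF assms, of "1 + 1"] by blast
qed

text \<open>Over the field with two elements a form value is determined by whether it vanishes. So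
  additivity of the polar form and the polarization identity become equivalences between
  \<open>perp\<close> and \<open>sing\<close>, and no form has to be mentioned.\<close>

locale binary_elliptic = polar_space perp sing n 4
  for perp :: "'a::{field,finite} ^ 'm \<Rightarrow> 'a ^ 'm \<Rightarrow> bool" and sing n +
  fixes R :: "('a ^ 'm) set" and Y :: "('a ^ 'm) set set"
  assumes card2: "CARD('a) = 2"
    and perp_add: "perp x (y + z) \<longleftrightarrow> (perp x y \<longleftrightarrow> perp x z)"
    and sing_add_iff: "sing (x + y) \<longleftrightarrow> ((sing x \<longleftrightarrow> sing y) \<longleftrightarrow> perp x y)"
    and rank3: "n = vec.dim R + 3"
    and st: "steiner R (vec.dim R + 2) Y"
begin

lemma scalar_cases: "k = 0 \<or> k = 1" for k :: 'a
  by (rule binary_field_cases[OF card2])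

lemma add_self: "x + x = (0 :: 'a ^ 'm)"
proof -
  have "(1 :: 'a) + 1 = 0" by (rule binary_field_one_add_one[OF card2])
  then have "(1 + 1) *s x = 0" by simp
  then show ?thesis by (simp only: vec.scale_left_distrib vec.scale_one)
qed

lemma add_self_left: "x + (x + y) = (y :: 'a ^ 'm)"
  using add_self by (simp flip: add.assoc)

lemma perp_sym_iff: "perp x y \<longleftrightarrow> perp y x"
  using perp_sym by blast

lemma perp_add_left: "perp (y + z) x \<longleftrightarrow> (perp y x \<longleftrightarrow> perp z x)"
  unfolding perp_sym_iff[of _ x] by (rule perp_add)

lemma R_PP: "R \<in> PP" by (rule steiner_PP[OF st])

text \<open>Coordinates on the residue of R: modulo R, e is an isometric embedding of the space of
  bytes. It is injective because the form on bytes is nondegenerate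
  (\<open>frame_notin_base\<close>).\<close>

definition frame :: "(char \<Rightarrow> 'a ^ 'm) \<Rightarrow> bool" where
  "frame e \<longleftrightarrow> (\<forall>c d. e (c \<oplus> d) = e c + e d) \<and> (\<forall>c. e c \<in> orth R) \<and> (\<forall>c. sing (e c) \<longleftrightarrow> \<not> byte_form c)"

lemma frame_add: "frame e \<Longrightarrow> e (c \<oplus> d) = e c + e d"
  and frame_orth: "frame e \<Longrightarrow> e c \<in> orth R"
  and frame_sing: "frame e \<Longrightarrow> sing (e c) \<longleftrightarrow> \<not> byte_form c"
  by (auto simp: frame_def)

lemma frame_perp: assumes "frame e" shows "perp (e c) (e d) \<longleftrightarrow> \<not> byte_polar c d"
  using sing_add_iff[of "e c" "e d"] frame_sing[OF assms, of "c \<oplus> d"] frame_sing[OF assms, of c] frame_sing[OF assms, of d]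
  unfolding byte_form_add frame_add[OF assms]
  by (cases "byte_form c"; cases "byte_form d"; cases "byte_polar c d") simp_all

lemma frame_notin_base: assumes "frame e" "c \<noteq> CHR 0x00" shows "e c \<notin> R"
proof
  assume "e c \<in> R"
  obtain d where "byte_polar c d" using byte_polar_nondeg[OF assms(2)] ..
  then have "\<not> perp (e c) (e d)" using frame_perp[OF assms(1)] by simp
  then show False using orthD[OF frame_orth[OF assms(1)] \<open>e c \<in> R\<close>] by simp
qed

definition line :: "(char \<Rightarrow> 'a ^ 'm) \<Rightarrow> char \<Rightarrow> char \<Rightarrow> ('a ^ 'm) set" where
  "line e u v = vec.span (insert (e v) (vec.span (insert (e u) R)))"

lemma line_superset: "R \<subseteq> line e u v" "e u \<in> line e u v" "e v \<in> line e u v"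
  using vec.span_superset[of "insert (e v) (vec.span (insert (e u) R))"] vec.span_superset[of "insert (e u) R"]
  by (auto simp: line_def)

lemma line_minimal: "vec.subspace W \<Longrightarrow> R \<subseteq> W \<Longrightarrow> e u \<in> W \<Longrightarrow> e v \<in> W \<Longrightarrow> line e u v \<subseteq> W"
  unfolding line_def by (intro vec.span_minimal insert_subsetI) auto

lemma dim_line:
  assumes "frame e" "u \<noteq> CHR 0x00" "v \<noteq> CHR 0x00" "u \<noteq> v"
  shows "vec.dim (line e u v) = vec.dim R + 2"
proof -
  have sR: "vec.subspace R" by (rule PP_subspace[OF R_PP])
  have d: "vec.dim (vec.span (insert (e u) R)) = vec.dim R + 1"
    by (rule dim_span_insert[OF sR frame_notin_base[OF assms(1,2)]])
  have "e v \<notin> vec.span (insert (e u) R)"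
  proof
    assume "e v \<in> vec.span (insert (e u) R)"
    then obtain k r where k: "e v = k *s e u + r" "r \<in> R" unfolding span_insert_eq[OF sR] by blast
    show False
    proof (cases "k = 0")
      case True
      then show False using k frame_notin_base[OF assms(1,3)] by simp
    next
      case False
      then have "e v = e u + r" using k(1) scalar_cases[of k] by simp
      then have "e (u \<oplus> v) \<in> R" using k(2) by (simp add: frame_add[OF assms(1)] add_self_left)
      then have "u \<oplus> v = CHR 0x00" using frame_notin_base[OF assms(1)] by blast
      then show False using byte_add_eq_0 assms(4) by blast
    qed
  qed
  from dim_span_insert[OF vec.subspace_span this] show ?thesis unfolding line_def d by linarith
qed

lemma orth_insert_iff: "w \<in> orth (insert a A) \<longleftrightarrow> perp a w \<and> w \<in> orth A"
  by (auto simp: orth_def)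

lemma orth_line_iff: "w \<in> orth (line e u v) \<longleftrightarrow> perp (e v) w \<and> perp (e u) w \<and> w \<in> orth R"
  unfolding line_def orth_span orth_insert_iff ..

lemma line_PP:
  assumes "frame e" "\<not> byte_form u" "\<not> byte_form v" "\<not> byte_polar u v"
  shows "line e u v \<in> PP"
proof -
  have 1: "vec.span (insert (e u) R) \<in> PP"
    by (rule PP_insert[OF R_PP]) (use assms frame_sing frame_orth in auto)
  have "e v \<in> orth (insert (e u) R)"
    using frame_perp[OF assms(1)] frame_orth[OF assms(1), of v] assms(4) by (simp add: orth_def)
  then show ?thesis unfolding line_def
    by (intro PP_insert[OF 1]) (use assms frame_sing in \<open>auto simp: orth_span\<close>)
qed

lemma steiner_unique:
  assumes "frame e" "a \<noteq> CHR 0x00" "b \<noteq> CHR 0x00" "a \<noteq> b" "W \<in> Y" "W' \<in> Y"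
    "e a \<in> W" "e b \<in> W" "e a \<in> W'" "e b \<in> W'"
  shows "W = W'"
proof -
  have s: "vec.subspace W" "vec.subspace W'" "R \<subseteq> W" "R \<subseteq> W'"
    using assms steiner_gens[OF st] steiner_base[OF st] gens_subspace by auto
  have 1: "line e a b \<subseteq> W" by (rule line_minimal) (use s assms in auto)
  have 2: "line e a b \<subseteq> W'" by (rule line_minimal) (use s assms in auto)
  have "line e a b \<in> PP"
    by (rule PP_down[OF gens_PP[OF steiner_gens[OF st assms(5)]] _ 1]) (simp add: line_def)
  then show ?thesis using steiner_eq[OF st _ line_superset(1) _ assms(5,6) 1 2] dim_line[OF assms(1-4)] by simp
qed

lemma pencil_distinct:
  "pairwise_polar ws \<Longrightarrow> distinct ws \<and> (\<forall>w\<in>set ws. \<forall>w'\<in>set ws. w \<noteq> w' \<longrightarrow> byte_polar w w' \<or> byte_polar w' w)"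
proof (induction ws)
  case (Cons w ws)
  have "\<not> byte_polar c c" for c by (cases c) auto
  then show ?case using Cons by (auto simp: list_all_iff)
qed simp

text \<open>Vectors that are not perpendicular cannot share a totally singular subspace, so the five
  vectors give five different generators through the line. As E = 4 these are all of them, and the
  member through the line is among them.\<close>

lemma steiner_covers_pencil:
  assumes e: "frame e" and v: "valid_pencil u v ws" and p: "pairwise_polar ws" and l: "length ws = 5"
  shows "\<exists>W\<in>Y. e u \<in> W \<and> e v \<in> W \<and> (\<exists>w\<in>set ws. e w \<in> W)"
proof -
  have uv: "u \<noteq> CHR 0x00" "v \<noteq> CHR 0x00" "u \<noteq> v" "\<not> byte_form u" "\<not> byte_form v" "\<not> byte_polar u v"
    and ws: "\<And>w. w \<in> set ws \<Longrightarrow> \<not> byte_form w \<and> \<not> byte_polar u w \<and> \<not> byte_polar v w"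
    using v by (auto simp: valid_pencil_def list_all_iff)
  let ?L = "line e u v"
  let ?G = "\<lambda>w. vec.span (insert (e w) ?L)"
  have L: "?L \<in> PP" "vec.dim ?L = vec.dim R + 2" using line_PP[OF e] dim_line[OF e] uv by auto
  have eo: "e w \<in> orth ?L" if w: "w \<in> set ws" for w
    using ws[OF w] frame_perp[OF e] frame_orth[OF e, of w] by (simp add: orth_line_iff)
  have GP: "?G w \<in> PP" if w: "w \<in> set ws" for w
    by (rule PP_insert[OF L(1) _ eo[OF w]]) (use ws[OF w] frame_sing[OF e] in simp)
  have ne: "\<not> (e w \<in> U \<and> e w' \<in> U)" if "w \<in> set ws" "w' \<in> set ws" "w \<noteq> w'" "U \<in> PP" for w w' U
  proof
    assume U: "e w \<in> U \<and> e w' \<in> U"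
    then have "perp (e w) (e w')" "perp (e w') (e w)" using PP_perp[OF that(4)] by blast+
    then have "\<not> byte_polar w w'" "\<not> byte_polar w' w" using frame_perp[OF e] by simp_all
    then show False using pencil_distinct[OF p] that(1-3) by blast
  qed
  have in_G: "e w \<in> ?G w" for w by (rule vec.span_base) simp
  have inj: "inj_on ?G (set ws)"
  proof (rule inj_onI, rule ccontr)
    fix w w' assume w: "w \<in> set ws" "w' \<in> set ws" "?G w = ?G w'" "w \<noteq> w'"
    then have "e w' \<in> ?G w" using in_G[of w'] by simp
    then show False using ne[OF w(1,2,4) GP[OF w(1)]] in_G[of w] by blast
  qed
  have Gg: "?G w \<in> {G \<in> gens. ?L \<subseteq> G}" if w: "w \<in> set ws" for w
  proof -
    have "set ws \<noteq> {w}" using l pencil_distinct[OF p] distinct_card[of ws] by auto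
    then obtain w' where w': "w' \<in> set ws" "w' \<noteq> w" using w by blast
    have "e w \<notin> ?L"
    proof
      assume "e w \<in> ?L"
      then have "e w \<in> ?G w'" using vec.span_superset[of "insert (e w') ?L"] by blast
      then show False using ne[OF w w'(1) _ GP[OF w'(1)]] in_G[of w'] w'(2) by blast
    qed
    then have "vec.dim (?G w) = n" using dim_span_insert[OF PP_subspace[OF L(1)]] L(2) rank3 by simp
    moreover have "?L \<subseteq> ?G w" using vec.span_superset[of "insert (e w) ?L"] by blast
    ultimately show ?thesis using GP[OF w] by (simp add: gens_def)
  qed
  have "card {G \<in> gens. ?L \<subseteq> G} = 5" using gens_count[OF L(1)] L(2) rank3 by simp
  moreover have "card (?G ` set ws) = 5"
    using card_image[OF inj] distinct_card[of ws] pencil_distinct[OF p] l by simp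
  moreover have "?G ` set ws \<subseteq> {G \<in> gens. ?L \<subseteq> G}" using Gg by blast
  ultimately have eq: "?G ` set ws = {G \<in> gens. ?L \<subseteq> G}" by (intro card_subset_eq) auto
  obtain W where W: "W \<in> Y" "?L \<subseteq> W"
    using st L line_superset(1)[of e u v] unfolding steiner_def by metis
  then have "W \<in> ?G ` set ws" using steiner_gens[OF st] unfolding eq by blast
  then obtain w where w: "w \<in> set ws" "W = ?G w" by blast
  have "e w \<in> W" unfolding w(2) by (rule in_G)
  then show ?thesis
    using w(1) W(1) subsetD[OF W(2) line_superset(2)] subsetD[OF W(2) line_superset(3)] by blast
qed

definition holds :: "(char \<Rightarrow> 'a ^ 'm) \<Rightarrow> goal \<Rightarrow> bool" where
  "holds e g \<longleftrightarrow> (\<forall>(i, p)\<in>set g. \<exists>W\<in>Y. \<forall>c\<in>set p. e c \<in> W)"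

lemma byte_plane_mem:
  assumes "frame e" "vec.subspace W" "e u \<in> W" "e v \<in> W" "e w \<in> W"
  shows "\<forall>c\<in>set (byte_plane u v w). e c \<in> W"
  using assms(3-5) vec.subspace_add[OF assms(2)] by (simp add: byte_plane_def frame_add[OF assms(1)])

text \<open>The common vectors span together with R a subspace of dimension t, so both members are
  equal; then perpendicularity inside one member contradicts the polar pair.\<close>

lemma conflict_sound:
  assumes e: "frame e" and c: "conflict p r" and W: "W \<in> Y" "\<forall>c\<in>set p. e c \<in> W" and W': "W' \<in> Y" "\<forall>c\<in>set r. e c \<in> W'"
  shows False
proof -
  obtain a b xs where ab: "filter (\<lambda>c. c \<in> set r) p = a # b # xs" "a \<noteq> b" "a \<noteq> CHR 0x00" "b \<noteq> CHR 0x00"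
    "list_ex (\<lambda>c. list_ex (byte_polar c) r) p"
    using c unfolding conflict_def by (auto split: list.splits)
  have "a \<in> set (filter (\<lambda>c. c \<in> set r) p)" "b \<in> set (filter (\<lambda>c. c \<in> set r) p)" unfolding ab(1) by auto
  then have "a \<in> set p" "a \<in> set r" "b \<in> set p" "b \<in> set r" by auto
  then have eq: "W = W'" using steiner_unique[OF e ab(3,4,2) W(1) W'(1)] W(2) W'(2) by blast
  obtain c d where cd: "c \<in> set p" "d \<in> set r" "byte_polar c d" using ab(5) by (auto simp: list_ex_iff)
  have "perp (e c) (e d)" using PP_perp[OF gens_PP[OF steiner_gens[OF st W(1)]]] cd W(2) W'(2) eq by blast
  then show False using frame_perp[OF e] cd(3) by blast
qed

lemma lookup_plane_cases: "lookup_plane g i = [] \<or> (i, lookup_plane g i) \<in> set g"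
  by (induction g i rule: lookup_plane.induct) auto

lemma subgoals_sound:
  assumes e: "frame e" and g: "holds e g" and W: "W \<in> Y" "e u \<in> W" "e v \<in> W"
  shows "w \<in> set ws \<Longrightarrow> e w \<in> W \<Longrightarrow> length is = length ws \<Longrightarrow> \<exists>h\<in>set (subgoals g u v ws is). holds e h"
proof (induction ws arbitrary: "is")
  case (Cons w' ws)
  then obtain i is' where is': "is = i # is'" "length is' = length ws" by (cases "is") auto
  show ?case
  proof (cases "w = w'")
    case True
    have p: "\<forall>c\<in>set (byte_plane u v w). e c \<in> W"
      by (rule byte_plane_mem[OF e gens_subspace[OF steiner_gens[OF st W(1)]] W(2,3) Cons.prems(2)])
    have "\<not> conflict (byte_plane u v w) (lookup_plane g i)"
    proof
      assume c: "conflict (byte_plane u v w) (lookup_plane g i)"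
      have "lookup_plane g i \<noteq> []"
      proof
        assume "lookup_plane g i = []"
        then show False using c by (simp add: conflict_def)
      qed
      then obtain W' where "W' \<in> Y" "\<forall>c\<in>set (lookup_plane g i). e c \<in> W'"
        using lookup_plane_cases[of g i] g unfolding holds_def by blast
      then show False using conflict_sound[OF e c W(1) p] by blast
    qed
    moreover have "holds e ((i, byte_plane u v w) # g)" using g W(1) p by (auto simp: holds_def)
    ultimately show ?thesis using True is'(1) by auto
  next
    case False
    then have "\<exists>h\<in>set (subgoals g u v ws is'). holds e h" using Cons is' by simp
    then show ?thesis using is'(1) by auto
  qed
qed simp

definition inconsistent :: "goal \<Rightarrow> bool" where
  "inconsistent g \<longleftrightarrow> (\<forall>e. frame e \<longrightarrow> \<not> holds e g)"

lemma expand_node_sound: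
  assumes s: "expand_node g s = Some hs" and hs: "\<forall>h\<in>set hs. inconsistent h"
  shows "inconsistent g"
  unfolding inconsistent_def
proof (intro allI impI notI)
  fix e assume e: "frame e" "holds e g"
  obtain i j k l m s' where s': "expand g [i, j, k, l, m] (hex_bytes s') = Some hs"
    using s unfolding expand_node_def by (auto split: list.splits)
  define "is" bs where "is = [i, j, k, l, m]" and "bs = hex_bytes s'"
  have i: "length is = 5" "expand g is bs = Some hs" using s' by (simp_all add: is_def bs_def)
  obtain u v a b c d where bs: "bs = [u, v, a, b, c, d]"
    using i(2) unfolding expand_def by (auto split: list.splits)
  define ws where "ws = [a, b, c, d, (a \<oplus> b) \<oplus> (c \<oplus> d)]"
  have ws: "length ws = 5" by (simp add: ws_def)
  have v: "valid_pencil u v ws" "pairwise_polar ws" "hs = subgoals g u v ws is"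
    using i(2) unfolding bs expand_def ws_def by (simp_all split: if_splits)
  obtain W w where "W \<in> Y" "e u \<in> W" "e v \<in> W" "w \<in> set ws" "e w \<in> W"
    using steiner_covers_pencil[OF e(1) v(1,2) ws] by blast
  then have "\<exists>h\<in>set hs. holds e h" using subgoals_sound[OF e] i(1) ws v(3) by metis
  then show False using hs e(1) by (auto simp: inconsistent_def)
qed

lemma refutes_sound: "refutes ss gs \<Longrightarrow> g \<in> set gs \<Longrightarrow> inconsistent g"
proof (induction ss arbitrary: gs g)
  case (Cons s ss)
  obtain g0 gs' where gs: "gs = g0 # gs'" using Cons.prems by (cases gs) auto
  obtain hs where hs: "expand_node g0 s = Some hs" "refutes ss (hs @ gs')"
    using Cons.prems(1) gs by (auto split: option.splits)
  have all: "inconsistent h" if "h \<in> set (hs @ gs')" for h using Cons.IH[OF hs(2) that] .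
  then have "inconsistent g0" by (intro expand_node_sound[OF hs(1)]) auto
  then show ?case using Cons.prems(2) gs all by auto
qed simp

end

section \<open>Symmetries of the coordinates, and reduction of the base goal to two certified
  cases\<close>

definition carried :: "(char \<Rightarrow> char) \<Rightarrow> goal \<Rightarrow> goal \<Rightarrow> bool" where
  "carried f g g' \<longleftrightarrow> list_all (\<lambda>(i, p). list_ex (\<lambda>(j, r). list_all (\<lambda>c. f c \<in> set r) p) g) g'"

definition byte_isometry :: "(char \<Rightarrow> char) \<Rightarrow> bool" where
  "byte_isometry f \<longleftrightarrow> (\<forall>c d. f (c \<oplus> d) = f c \<oplus> f d) \<and> (\<forall>c. byte_form (f c) \<longleftrightarrow> byte_form c)"

text \<open>This map and the next two induce the three transpositions of the colours and fix all
  hyperbolic coordinates.\<close>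

fun swap_z :: "char \<Rightarrow> char" where
  "swap_z (Char a b c d e f g h) = Char a b c d e f h g"

fun shear_z1 :: "char \<Rightarrow> char" where
  "shear_z1 (Char a b c d e f g h) = Char a b c d e f g (g \<noteq> h)"

fun shear_z2 :: "char \<Rightarrow> char" where
  "shear_z2 (Char a b c d e f g h) = Char a b c d e f (g \<noteq> h) h"

text \<open>It replaces x2 by x2 + x3 and y3 by y2 + y3 and fixes the other basis vectors.\<close>

fun shear_xy :: "char \<Rightarrow> char" where
  "shear_xy (Char a b c d e f g h) = Char a b c (d \<noteq> f) (c \<noteq> e) f g h"

text \<open>It permutes y2, y3, y2 + y3 cyclically, acts contragrediently on x2 and x3, and
  exchanges z1 and z2.\<close>

fun rotate_xy :: "char \<Rightarrow> char" where
  "rotate_xy (Char a b c d e f g h) = Char a b (c \<noteq> e) f c (d \<noteq> f) h g"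

text \<open>It exchanges the two planes of the base goal by swapping x1 with y2, x2 with y1 and x3
  with y3.\<close>

fun dual_xy :: "char \<Rightarrow> char" where
  "dual_xy (Char a b c d e f g h) = Char d c b a f e g h"

lemma byte_isometries:
  "byte_isometry swap_z" "byte_isometry shear_z1" "byte_isometry shear_z2" "byte_isometry shear_xy"
  "byte_isometry rotate_xy" "byte_isometry dual_xy" "byte_isometry (shear_xy \<circ> shear_z2)"
proof -
  have I: "byte_isometry f" if "\<And>c d. f (c \<oplus> d) = f c \<oplus> f d" "\<And>c. byte_form (f c) \<longleftrightarrow> byte_form c" for f
    using that by (simp add: byte_isometry_def)
  show 1: "byte_isometry swap_z"
  proof (rule I)
    show "swap_z (c \<oplus> d) = swap_z c \<oplus> swap_z d" for c d by (cases c; cases d) simp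
    show "byte_form (swap_z c) \<longleftrightarrow> byte_form c" for c by (cases c) auto
  qed
  show "byte_isometry shear_z1"
  proof (rule I)
    show "shear_z1 (c \<oplus> d) = shear_z1 c \<oplus> shear_z1 d" for c d by (cases c; cases d) auto
    show "byte_form (shear_z1 c) \<longleftrightarrow> byte_form c" for c by (cases c) auto
  qed
  show z2: "byte_isometry shear_z2"
  proof (rule I)
    show "shear_z2 (c \<oplus> d) = shear_z2 c \<oplus> shear_z2 d" for c d by (cases c; cases d) auto
    show "byte_form (shear_z2 c) \<longleftrightarrow> byte_form c" for c by (cases c) auto
  qed
  show xy: "byte_isometry shear_xy"
  proof (rule I)
    show "shear_xy (c \<oplus> d) = shear_xy c \<oplus> shear_xy d" for c d by (cases c; cases d) auto
    show "byte_form (shear_xy c) \<longleftrightarrow> byte_form c" for c by (cases c) auto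
  qed
  show "byte_isometry rotate_xy"
  proof (rule I)
    show "rotate_xy (c \<oplus> d) = rotate_xy c \<oplus> rotate_xy d" for c d by (cases c; cases d) auto
    show "byte_form (rotate_xy c) \<longleftrightarrow> byte_form c" for c by (cases c) auto
  qed
  show "byte_isometry dual_xy"
  proof (rule I)
    show "dual_xy (c \<oplus> d) = dual_xy c \<oplus> dual_xy d" for c d by (cases c; cases d) simp
    show "byte_form (dual_xy c) \<longleftrightarrow> byte_form c" for c by (cases c) auto
  qed
  show "byte_isometry (shear_xy \<circ> shear_z2)" using xy z2 by (simp add: byte_isometry_def)
qed

context binary_elliptic
begin

text \<open>Precomposing a frame with an isometry is again a frame. If f maps the planes of g' into
  planes of g, a frame realizing g turns into one realizing g'.\<close>

lemma inconsistent_carried: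
  assumes "inconsistent g'" "byte_isometry f" "carried f g g'"
  shows "inconsistent g"
  unfolding inconsistent_def
proof (intro allI impI notI)
  fix e assume e: "frame e" "holds e g"
  have "frame (e \<circ> f)" using e(1) assms(2) by (simp add: frame_def byte_isometry_def)
  moreover have "holds (e \<circ> f) g'"
    unfolding holds_def
  proof clarify
    fix i p assume "(i, p) \<in> set g'"
    then obtain j r where jr: "(j, r) \<in> set g" "\<forall>c\<in>set p. f c \<in> set r"
      using assms(3) by (fastforce simp: carried_def list_all_iff list_ex_iff)
    then obtain W where "W \<in> Y" "\<forall>c\<in>set r. e c \<in> W" using e(2) by (auto simp: holds_def)
    then show "\<exists>W\<in>Y. \<forall>c\<in>set p. (e \<circ> f) c \<in> W" using jr(2) by auto
  qed
  ultimately show False using assms(1) by (simp add: inconsistent_def)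
qed

text \<open>The line from x1 to y2 + y3 has one of three colours. The colour already used twice
  gives \<open>mono_goal\<close>; \<open>shear_z2\<close> fixes it and exchanges the other two, so
  one certificate serves both.\<close>

lemma inconsistent_pair_goal: "inconsistent pair_goal"
proof (rule expand_node_sound)
  let ?p = "\<lambda>w. (CHR ''E'', byte_plane (CHR 0x01) (CHR 0x28) w) # pair_goal"
  show "expand_node pair_goal ''BAEEEA@HBH@DALELI'' = Some [?p (CHR 0x5C), ?p (CHR 0x9C), ?p (CHR 0xDC)]"
    by code_simp
  have 2: "inconsistent mixed_goal" using refutes_sound[OF refutes_mixed_goal] by simp
  have "carried shear_z2 (?p (CHR 0xDC)) mixed_goal" by code_simp
  with 2 byte_isometries(3) have "inconsistent (?p (CHR 0xDC))" by (rule inconsistent_carried)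
  then show "\<forall>h\<in>set [?p (CHR 0x5C), ?p (CHR 0x9C), ?p (CHR 0xDC)]. inconsistent h"
    using refutes_sound[OF refutes_mono_goal] 2 by (simp add: mono_goal_def mixed_goal_def)
qed

text \<open>The colours of the lines from x1 to y2, y3 and y2 + y3 are branched on in turn.
  Permuting the colours normalizes the first to z1; whenever two agree, an isometry leads back to
  \<open>pair_goal\<close>, so only three distinct colours remain.\<close>

lemma inconsistent_base: "inconsistent base_goal"
proof -
  let ?c = "\<lambda>w. (CHR ''C'', byte_plane (CHR 0x01) (CHR 0x08) w) # base_goal"
  let ?d = "\<lambda>w. (CHR ''D'', byte_plane (CHR 0x01) (CHR 0x20) w) # ?c (CHR 0x70)"
  let ?e = "\<lambda>w. (CHR ''E'', byte_plane (CHR 0x01) (CHR 0x28) w) # ?d (CHR 0x8C)"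
  let ?f = "\<lambda>w. (CHR ''F'', byte_plane (CHR 0x10) (CHR 0x08) w) # ?e (CHR 0xDC)"
  have A: "inconsistent (?d (CHR 0x4C))" using inconsistent_pair_goal by (simp add: pair_goal_def)
  have B: "inconsistent (?f (CHR 0x83))" using refutes_sound[OF refutes_rainbow_goal] by (simp add: rainbow_goal_def)
  have e: "inconsistent (?e (CHR 0xDC))"
  proof (rule expand_node_sound)
    show "expand_node (?e (CHR 0xDC)) ''ABFFF@AH@A@B@CDCH'' = Some [?f (CHR 0x43), ?f (CHR 0x83), ?f (CHR 0xC3)]"
      by code_simp
    \<comment> \<open>Now the lines from y2 to x1 and to x3 agree in colour, which is the situation
      of \<open>pair_goal\<close> with both planes exchanged.\<close>
    have "carried dual_xy (?f (CHR 0x43)) (?d (CHR 0x4C))" by code_simp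
    with A byte_isometries(6) have 1: "inconsistent (?f (CHR 0x43))" by (rule inconsistent_carried)
    \<comment> \<open>The composition exchanges the lines to y3 and y2 + y3 together with their
      colours z2 and z1 + z2, so it preserves the prescribed planes and exchanges the last two
      choices.\<close>
    have "carried (shear_xy \<circ> shear_z2) (?f (CHR 0xC3)) (?f (CHR 0x83))" by code_simp
    with B byte_isometries(7) have "inconsistent (?f (CHR 0xC3))" by (rule inconsistent_carried)
    with 1 B show "\<forall>h\<in>set [?f (CHR 0x43), ?f (CHR 0x83), ?f (CHR 0xC3)]. inconsistent h" by simp
  qed
  have d: "inconsistent (?d (CHR 0x8C))"
  proof (rule expand_node_sound)
    show "expand_node (?d (CHR 0x8C)) ''BAEEEA@HBH@DALELI'' = Some [?e (CHR 0x5C), ?e (CHR 0x9C), ?e (CHR 0xDC)]"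
      by code_simp
    \<comment> \<open>The lines to y2 and y2 + y3 agree in the colour z1.\<close>
    have "carried shear_xy (?e (CHR 0x5C)) (?d (CHR 0x4C))" by code_simp
    with A byte_isometries(4) have 1: "inconsistent (?e (CHR 0x5C))" by (rule inconsistent_carried)
    \<comment> \<open>The lines to y3 and y2 + y3 agree in the colour z2.\<close>
    have "carried rotate_xy (?e (CHR 0x9C)) (?d (CHR 0x4C))" by code_simp
    with A byte_isometries(5) have "inconsistent (?e (CHR 0x9C))" by (rule inconsistent_carried)
    with 1 e show "\<forall>h\<in>set [?e (CHR 0x5C), ?e (CHR 0x9C), ?e (CHR 0xDC)]. inconsistent h" by simp
  qed
  have c: "inconsistent (?c (CHR 0x70))"
  proof (rule expand_node_sound)
    show "expand_node (?c (CHR 0x70)) ''ABDDDA@@BD@H@LDLH'' = Some [?d (CHR 0x4C), ?d (CHR 0x8C), ?d (CHR 0xCC)]"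
      by code_simp
    have "carried shear_z2 (?d (CHR 0xCC)) (?d (CHR 0x8C))" by code_simp
    with d byte_isometries(3) have "inconsistent (?d (CHR 0xCC))" by (rule inconsistent_carried)
    with A d show "\<forall>h\<in>set [?d (CHR 0x4C), ?d (CHR 0x8C), ?d (CHR 0xCC)]. inconsistent h" by simp
  qed
  show ?thesis
  proof (rule expand_node_sound)
    show "expand_node base_goal ''ABCCCA@H@@A@B@G@K'' = Some [?c (CHR 0x70), ?c (CHR 0xB0), ?c (CHR 0xF0)]"
      by code_simp
    have "carried swap_z (?c (CHR 0xB0)) (?c (CHR 0x70))" by code_simp
    with c byte_isometries(1) have 1: "inconsistent (?c (CHR 0xB0))" by (rule inconsistent_carried)
    have "carried shear_z1 (?c (CHR 0xF0)) (?c (CHR 0x70))" by code_simp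
    with c byte_isometries(2) have "inconsistent (?c (CHR 0xF0))" by (rule inconsistent_carried)
    with 1 c show "\<forall>h\<in>set [?c (CHR 0x70), ?c (CHR 0xB0), ?c (CHR 0xF0)]. inconsistent h" by simp
  qed
qed

text \<open>Two members meeting only in R pair nondegenerately modulo R, which yields dual bases x_i
  and y_i. The anisotropic part is found from two further generators through the line of x1 and y2,
  so no classification of quadratic forms is required.\<close>

lemma ex_base_frame: "\<exists>e. frame e \<and> holds e base_goal"
proof -
  obtain F where F: "F \<in> Y" using steiner_nonempty[OF st] by blast
  have "real (card {W \<in> Y. F \<inter> W = R}) = 96" using card_rank3_disjoint[OF st rank3 F] card2 by simp
  then have "{W \<in> Y. F \<inter> W = R} \<noteq> {}" by (metis card.empty of_nat_0 zero_neq_numeral)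
  then obtain S where S: "S \<in> Y" "F \<inter> S = R" by blast
  have Fg: "F \<in> gens" "S \<in> gens" using F S steiner_gens[OF st] by auto
  have RF: "R \<subseteq> F" "R \<subseteq> S" using S(2) by auto
  have PF: "F \<in> PP" "S \<in> PP" using Fg gens_PP by auto
  have sF: "vec.subspace F" "vec.subspace S" using Fg gens_subspace by auto
  have oR: "x \<in> orth R" if "x \<in> F \<or> x \<in> S" for x
    using that PP_subset_orth[OF PF(1) RF(1)] PP_subset_orth[OF PF(2) RF(2)] by blast
  have np: "\<exists>y\<in>S. \<not> perp x y" if x: "x \<in> F" "x \<notin> R" for x
  proof (rule ccontr)
    assume "\<not> (\<exists>y\<in>S. \<not> perp x y)"
    then have "x \<in> orth S" by (intro orthI) (auto intro: perp_sym)
    then have "x \<in> S" by (rule gens_max[OF Fg(2) PP_sing[OF PF(1) x(1)]])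
    then show False using x S(2) by blast
  qed
  have ex: "\<exists>x\<in>F. x \<notin> R \<and> (\<forall>y\<in>X. perp x y)" if X: "finite X" "card X < 3" for X
  proof -
    have "vec.dim R < vec.dim (F \<inter> orth X)"
      using dim_le_orth_card[OF sF(1) X(1)] X(2) gens_dim[OF Fg(1)] rank3 by linarith
    then have "\<not> F \<inter> orth X \<subseteq> R" using dim_le_subspace[of "F \<inter> orth X" R] by linarith
    then show ?thesis unfolding orth_def using perp_sym by blast
  qed
  obtain x1 where x1: "x1 \<in> F" "x1 \<notin> R" using ex[of "{}"] by auto
  obtain y1 where y1: "y1 \<in> S" "\<not> perp x1 y1" using np[OF x1] by blast
  obtain x2 where x2: "x2 \<in> F" "x2 \<notin> R" "perp x2 y1" using ex[of "{y1}"] by auto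
  obtain y2' where y2': "y2' \<in> S" "\<not> perp x2 y2'" using np[OF x2(1,2)] by blast
  \<comment> \<open>Adding y1 flips the value against x1 and keeps the one against x2:
    orthogonalization where the only nonzero scalar is 1. The same correction produces y3.\<close>
  define y2 where "y2 = (if perp x1 y2' then y2' else y2' + y1)"
  have y2: "y2 \<in> S" "perp x1 y2" "\<not> perp x2 y2"
    using y1 y2' x2 vec.subspace_add[OF sF(2)] by (auto simp: y2_def perp_add)
  have "card {y1, y2} < 3" by (cases "y1 = y2") simp_all
  then obtain x3 where x3: "x3 \<in> F" "x3 \<notin> R" "perp x3 y1" "perp x3 y2" using ex[of "{y1, y2}"] by auto
  obtain y3' where y3': "y3' \<in> S" "\<not> perp x3 y3'" using np[OF x3(1,2)] by blast
  define y3'' where "y3'' = (if perp x1 y3' then y3' else y3' + y1)"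
  have y3'': "y3'' \<in> S" "perp x1 y3''" "\<not> perp x3 y3''"
    using y1 y3' x3 vec.subspace_add[OF sF(2)] by (auto simp: y3''_def perp_add)
  define y3 where "y3 = (if perp x2 y3'' then y3'' else y3'' + y2)"
  have y3: "y3 \<in> S" "perp x1 y3" "perp x2 y3" "\<not> perp x3 y3"
    using y2 y3'' x3 vec.subspace_add[OF sF(2)] by (auto simp: y3_def perp_add)
  have ff: "perp x y" if "x \<in> F" "y \<in> F" for x y using PP_perp[OF PF(1)] that by blast
  have ss: "perp x y" if "x \<in> S" "y \<in> S" for x y using PP_perp[OF PF(2)] that by blast
  \<comment> \<open>Of the five generators through L, one contains x3 and one y3. At least three
    remain, and two of these provide z1 and z2.\<close>
  define L where "L = vec.span (insert y2 (vec.span (insert x1 R)))"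
  have sR: "vec.subspace R" by (rule PP_subspace[OF R_PP])
  have oL: "v \<in> orth L" if "v \<in> orth R" "perp x1 v" "perp y2 v" for v
    using that unfolding L_def orth_span orth_insert_iff by blast
  have L1: "vec.span (insert x1 R) \<in> PP" by (rule PP_insert[OF R_PP PP_sing[OF PF(1) x1(1)]]) (use oR x1 in blast)
  have L: "L \<in> PP" unfolding L_def
    by (rule PP_insert[OF L1 PP_sing[OF PF(2) y2(1)]]) (use oR y2 in \<open>simp add: orth_span orth_insert_iff\<close>)
  have "y2 \<notin> vec.span (insert x1 R)"
  proof
    assume "y2 \<in> vec.span (insert x1 R)"
    moreover have "vec.span (insert x1 R) \<subseteq> F" by (rule vec.span_minimal[OF _ sF(1)]) (use x1 RF in auto)
    ultimately show False using ff x2(1) y2(3) by blast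
  qed
  from dim_span_insert[OF vec.subspace_span this] have dL: "vec.dim L = vec.dim R + 2"
    unfolding L_def dim_span_insert[OF sR x1(2)] by linarith
  have LR: "R \<subseteq> L" "x1 \<in> L" "y2 \<in> L" 
    using vec.span_superset[of "insert y2 (vec.span (insert x1 R))"] vec.span_superset[of "insert x1 R"]
    by (auto simp: L_def)
  have x3L: "x3 \<notin> L" "y3 \<notin> L"
  proof -
    have "y3 \<in> orth L" by (rule oL) (use oR y3 ss y2 in auto)
    then show "x3 \<notin> L" using orthD y3(4) by blast
    have "x3 \<in> orth L" by (rule oL) (use oR x3 x1 ff perp_sym in auto)
    then show "y3 \<notin> L" using orthD y3(4) perp_sym by blast
  qed
  have Geq: "G = vec.span (insert v L)" if "G \<in> gens" "L \<subseteq> G" "v \<in> G" "v \<notin> L" for G v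
    using subspace_eq_span_insert[OF PP_subspace[OF L] gens_subspace[OF that(1)] that(2) _ that(3,4)]
      gens_dim[OF that(1)] dL rank3 by simp
  define A where "A = {G \<in> gens. L \<subseteq> G} - {vec.span (insert x3 L), vec.span (insert y3 L)}"
  have A: "G \<in> gens" "L \<subseteq> G" "G \<noteq> vec.span (insert x3 L)" "G \<noteq> vec.span (insert y3 L)" if "G \<in> A" for G
    using that by (simp_all add: A_def)
  have "card {G \<in> gens. L \<subseteq> G} = 5" using gens_count[OF L] dL rank3 by simp
  moreover have "card {G \<in> gens. L \<subseteq> G} - card {vec.span (insert x3 L), vec.span (insert y3 L)} \<le> card A"
    unfolding A_def by (rule diff_card_le_card_Diff) simp
  moreover have "card {vec.span (insert x3 L), vec.span (insert y3 L)} \<le> 2"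
    by (cases "vec.span (insert x3 L) = vec.span (insert y3 L)") simp_all
  ultimately have "\<not> card A \<le> Suc 0" by linarith
  then obtain G1 G2 where G12: "G1 \<in> A" "G2 \<in> A" "G1 \<noteq> G2"
    using card_le_Suc0_iff_eq[OF finite[of A]] by blast
  have exw: "\<exists>w\<in>G. G = vec.span (insert w L) \<and> perp w y1 \<and> perp w x2 \<and> \<not> perp w x3 \<and> \<not> perp w y3"
    if G: "G \<in> A" for G
  proof -
    note Gg = A(1,2)[OF G]
    have nin: "x3 \<notin> G" "y3 \<notin> G" using Geq[OF Gg _ x3L(1)] Geq[OF Gg _ x3L(2)] A(3,4)[OF G] by blast+
    have "L \<noteq> G" using gens_dim[OF Gg(1)] dL rank3 by auto
    then obtain w0 where w0: "w0 \<in> G" "w0 \<notin> L" using Gg(2) by blast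
    \<comment> \<open>Otherwise v would be singular and orthogonal to the generator G, hence
      contained in it.\<close>
    have nperp: "\<not> perp w0 v" if "v \<notin> G" "sing v" "v \<in> orth L" for v
    proof
      assume "perp w0 v"
      then have "v \<in> orth (insert w0 L)" using that(3) by (simp add: orth_def)
      then have "v \<in> orth G" unfolding Geq[OF Gg w0] orth_span .
      then show False using gens_max[OF Gg(1) that(2)] that(1) by blast
    qed
    have "y3 \<in> orth L" by (rule oL) (use oR y3 ss y2 in auto)
    then have n1: "\<not> perp w0 y3" using nperp nin(2) PP_sing[OF PF(2) y3(1)] by blast
    have "x3 \<in> orth L" by (rule oL) (use oR x3 x1 ff perp_sym in auto)
    then have n2: "\<not> perp w0 x3" using nperp nin(1) PP_sing[OF PF(1) x3(1)] by blast
    have sG: "vec.subspace G" by (rule gens_subspace[OF Gg(1)])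
    \<comment> \<open>Adding x1 corrects the value against y1, and below adding y2 corrects the
      value against x2; both stay in G and leave the values against x3 and y3 unchanged.\<close>
    define w1 where "w1 = (if perp w0 y1 then w0 else w0 + x1)"
    have "x1 \<in> G" "y2 \<in> G" using LR Gg by auto
    have w1: "w1 \<in> G" "perp w1 y1" "\<not> perp w1 x3" "\<not> perp w1 y3"
      using w0 \<open>x1 \<in> G\<close> n1 n2 y1 y3 ff[OF x1(1) x3(1)] vec.subspace_add[OF sG] by (auto simp: w1_def perp_add_left)
    define w where "w = (if perp w1 x2 then w1 else w1 + y2)"
    have w: "w \<in> G" "perp w y1" "perp w x2" "\<not> perp w x3" "\<not> perp w y3"
      using w1 \<open>y2 \<in> G\<close> y2 x3(4) ss[OF y2(1) y1(1)] ss[OF y2(1) y3(1)] vec.subspace_add[OF sG] perp_sym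
      by (auto simp: w_def perp_add_left)
    have "w \<notin> L" using orthD[of y3 L w] \<open>y3 \<in> orth L\<close> w(5) by blast
    then show ?thesis using w Geq[OF Gg w(1)] by blast
  qed
  obtain w1 where w1: "w1 \<in> G1" "G1 = vec.span (insert w1 L)" "perp w1 y1" "perp w1 x2" "\<not> perp w1 x3" "\<not> perp w1 y3"
    using exw[OF G12(1)] by blast
  obtain w2 where w2: "w2 \<in> G2" "G2 = vec.span (insert w2 L)" "perp w2 y1" "perp w2 x2" "\<not> perp w2 x3" "\<not> perp w2 y3"
    using exw[OF G12(2)] by blast
  have GP: "G1 \<in> PP" "G2 \<in> PP" "L \<subseteq> G1" "L \<subseteq> G2" using A(1,2)[OF G12(1)] A(1,2)[OF G12(2)] gens_PP by simp_all
  have wL: "w1 \<in> orth L" "w2 \<in> orth L"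
    using PP_subset_orth[OF GP(1,3)] PP_subset_orth[OF GP(2,4)] w1(1) w2(1) by (simp_all add: subset_iff)
  have wR: "w1 \<in> orth R" "w2 \<in> orth R" using wL orth_anti[OF LR(1)] by (simp_all add: subset_iff)
  have wp: "perp w1 x1" "perp w1 y2" "perp w2 x1" "perp w2 y2"
    using perp_sym[OF orthD[OF wL(1) LR(2)]] perp_sym[OF orthD[OF wL(1) LR(3)]]
      perp_sym[OF orthD[OF wL(2) LR(2)]] perp_sym[OF orthD[OF wL(2) LR(3)]] by simp_all
  have ws: "sing w1" "sing w2" using PP_sing[OF GP(1) w1(1)] PP_sing[OF GP(2) w2(1)] by simp_all
  have w12: "\<not> perp w1 w2"
  proof
    assume "perp w1 w2"
    then have "w2 \<in> orth (insert w1 L)" using wL(2) by (simp add: orth_def)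
    then have "w2 \<in> orth G1" unfolding w1(2) orth_span .
    then have "w2 \<in> G1" by (rule gens_max[OF A(1)[OF G12(1)] ws(2)])
    then have "G2 \<subseteq> G1" unfolding w2(2) using GP(3) by (intro vec.span_minimal PP_subspace[OF GP(1)]) auto
    then show False using gens_eqI[OF A(1)[OF G12(2)] A(1)[OF G12(1)]] G12(3) by simp
  qed
  \<comment> \<open>Adding x3 + y3 makes the vector perpendicular to x3 and y3 as well. It also
    makes it nonsingular, since x3 + y3 is nonsingular and perpendicular to w1.\<close>
  define z1 where "z1 = w1 + (x3 + y3)"
  define z2 where "z2 = w2 + (x3 + y3)"
  note base = y1(2) x2(3) y2(2,3) x3(3,4) y3(2-4) ff[OF x1(1) x2(1)] ff[OF x1(1) x3(1)] ff[OF x2(1) x3(1)]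
    ff[OF x3(1) x3(1)] ff[OF x2(1) x2(1)] ff[OF x1(1) x1(1)]
    ss[OF y1(1) y2(1)] ss[OF y1(1) y3(1)] ss[OF y2(1) y3(1)] ss[OF y1(1) y1(1)] ss[OF y2(1) y2(1)] ss[OF y3(1) y3(1)]
  have sg: "sing x1" "sing x2" "sing x3" "sing y1" "sing y2" "sing y3"
    using PP_sing[OF PF(1)] PP_sing[OF PF(2)] x1(1) x2(1) x3(1) y1(1) y2(1) y3(1) by auto
  have p21: "perp x2 x1" "perp x3 x1" "perp x3 x2" "perp y2 y1" "perp y3 y1" "perp y3 y2" "\<not> perp y1 x1" "perp y1 x2"
     "perp y2 x1" "\<not> perp y2 x2" "perp y1 x3" "perp y2 x3" "perp y3 x1" "perp y3 x2" "\<not> perp y3 x3"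
    using base perp_sym by blast+
  have pz: "perp v x1" "perp v y1" "perp v x2" "perp v y2" "perp v x3" "perp v y3" "\<not> sing v" "v \<in> orth R"
    if v: "v = w + (x3 + y3)" "perp w x1" "perp w y1" "perp w x2" "perp w y2" "\<not> perp w x3" "\<not> perp w y3" "sing w" "w \<in> orth R" for v w
    using v(2-9) oR x3(1) y3(1) sg base p21 vec.subspace_add[OF subspace_orth] unfolding v(1)
    by (auto simp: perp_add perp_add_left sing_add_iff)
  note z1 = pz[OF z1_def wp(1) w1(3,4) wp(2) w1(5,6) ws(1) wR(1)]
  note z2 = pz[OF z2_def wp(3) w2(3,4) wp(4) w2(5,6) ws(2) wR(2)]
  have z12: "\<not> perp z1 z2"
    using w12 w1(5,6) w2(5,6) base p21 perp_sym unfolding z1_def z2_def by (auto simp: perp_add perp_add_left)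
  define t where "t p v = (if p then v else 0)" for p and v :: "'a ^ 'm"
  have t_add: "t (a \<noteq> b) v = t a v + t b v" for a b v by (cases a; cases b) (simp_all add: t_def add_self)
  have perp0: "perp v 0" for v using vec.subspace_0[OF perp_subspace[of v]] by simp
  have t_perp: "perp (t a u) (t b v) \<longleftrightarrow> (a \<and> b \<longrightarrow> perp u v)" for a b u v
    using perp0 perp_sym[OF perp0] by (auto simp: t_def)
  have t_sing: "sing (t a u) \<longleftrightarrow> (a \<longrightarrow> sing u)" for a u by (auto simp: t_def sing_0)
  have t_orth: "u \<in> orth R \<Longrightarrow> t a u \<in> orth R" for a u using vec.subspace_0[OF subspace_orth] by (simp add: t_def)
  define e where "e c = (case c of Char a b c d e f g h \<Rightarrow>
    (t a x1 + t b y1) + ((t c x2 + t d y2) + ((t e x3 + t f y3) + (t g z1 + t h z2))))" for c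
  have "e (c \<oplus> d) = e c + e d" for c d
    by (cases c; cases d) (simp only: e_def byte_add.simps char.case t_add ac_simps)
  moreover have "e c \<in> orth R" for c
  proof (cases c)
    case (Char a b c d e f g h)
    have "x1 \<in> orth R" "x2 \<in> orth R" "x3 \<in> orth R" "y1 \<in> orth R" "y2 \<in> orth R" "y3 \<in> orth R"
      using oR x1(1) x2(1) x3(1) y1(1) y2(1) y3(1) by blast+
    then show ?thesis unfolding Char e_def char.case
      using z1(8) z2(8) by (intro vec.subspace_add[OF subspace_orth] t_orth)
  qed
  moreover have "sing (e c) \<longleftrightarrow> \<not> byte_form c" for c
  proof (cases c)
    case (Char a b c d e f g h)
    have zz: "perp x1 z1" "perp x2 z1" "perp x3 z1" "perp y1 z1" "perp y2 z1" "perp y3 z1"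
      "perp x1 z2" "perp x2 z2" "perp x3 z2" "perp y1 z2" "perp y2 z2" "perp y3 z2" using z1 z2 perp_sym by blast+
    show ?thesis unfolding Char e_def char.case byte_form.simps sing_add_iff perp_add perp_add_left t_perp t_sing
      by (simp add: base p21 zz z1(7) z2(7) z12 sg, cases a; cases c; cases e; cases g; simp; cases b; cases d; cases f; simp)
  qed
  ultimately have "frame e" by (simp add: frame_def)
  moreover have "holds e base_goal"
  proof -
    have 1: "\<forall>c\<in>set (byte_plane (CHR 0x01) (CHR 0x04) (CHR 0x10)). e c \<in> F"
      by (rule byte_plane_mem[OF \<open>frame e\<close> sF(1)]) (simp_all add: e_def t_def x1 x2 x3)
    have 2: "\<forall>c\<in>set (byte_plane (CHR 0x02) (CHR 0x08) (CHR 0x20)). e c \<in> S"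
      by (rule byte_plane_mem[OF \<open>frame e\<close> sF(2)]) (simp_all add: e_def t_def y1 y2 y3)
    show ?thesis using 1 2 F S(1) unfolding holds_def base_goal_def by auto
  qed
  ultimately show ?thesis by blast
qed

theorem no_steiner_rank3_elliptic_binary: False
  using ex_base_frame inconsistent_base by (auto simp: inconsistent_def)

end

section \<open>Classical polar spaces\<close>

text \<open>The number \<open>\<nu>\<close> of singular points on the affine line y + c x is the
  only numerical difference between the forms: 1 for quadratic, q for Hermitian and Q for
  alternating ones.\<close>

locale formed_space = singular_space perp sing
  for perp :: "'a::{field,finite} ^ 'm \<Rightarrow> 'a ^ 'm \<Rightarrow> bool" and sing +
  fixes \<nu> :: nat
  assumes card_sing_line: "sing x \<Longrightarrow> \<not> perp x y \<Longrightarrow> card {c. sing (y + c *s x)} = \<nu>"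
    and sing_radical: "sing x \<Longrightarrow> (\<And>y. perp x y) \<Longrightarrow> x = 0"
begin

definition maximal :: "('a ^ 'm) set \<Rightarrow> bool" where
  "maximal U \<longleftrightarrow> U \<in> PP \<and> (\<forall>W\<in>PP. U \<subseteq> W \<longrightarrow> W = U)"

lemma maximal_mem:
  assumes U: "maximal U" and x: "sing x" "x \<in> orth U"
  shows "x \<in> U"
proof -
  have "vec.span (insert x U) \<in> PP" using U x by (intro PP_insert) (auto simp: maximal_def)
  moreover have "insert x U \<subseteq> vec.span (insert x U)" by (rule vec.span_superset)
  ultimately have "vec.span (insert x U) = U" using U by (auto simp: maximal_def)
  then show ?thesis using vec.span_superset[of "insert x U"] by auto
qed

lemma ex_maximal: assumes "U \<in> PP" shows "\<exists>M. maximal M \<and> U \<subseteq> M"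
proof -
  have "finite {W \<in> PP. U \<subseteq> W}" by simp
  moreover have "U \<in> {W \<in> PP. U \<subseteq> W}" using assms by simp
  ultimately obtain M where "M \<in> {W \<in> PP. U \<subseteq> W}" "\<forall>W\<in>{W \<in> PP. U \<subseteq> W}. M \<subseteq> W \<longrightarrow> M = W"
    using finite_has_maximal2[of "{W \<in> PP. U \<subseteq> W}" U] by blast
  then have "maximal M \<and> U \<subseteq> M" by (auto simp: maximal_def)
  then show ?thesis by blast
qed

text \<open>Vectors of W orthogonal to U are singular, hence lie in U by maximality;
  \<open>dim_pairing\<close> converts this inclusion into a comparison of dimensions.\<close>

lemma dim_le_maximal:
  assumes U: "maximal U" and W: "W \<in> PP"
  shows "vec.dim W \<le> vec.dim U"
proof -
  have UP: "U \<in> PP" using U by (simp add: maximal_def)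
  have "W \<inter> orth U \<subseteq> U \<inter> orth W"
    using maximal_mem[OF U] PP_sing[OF W] PP_orth[OF W] by blast
  then have "vec.dim (W \<inter> orth U) \<le> vec.dim (U \<inter> orth W)" by (rule dim_le_subspace)
  then show ?thesis using dim_pairing[OF PP_subspace[OF UP] PP_subspace[OF W]] by linarith
qed

lemma dim_orth: assumes "A \<in> PP" shows "vec.dim (orth A) + vec.dim A = CARD('m)"
proof -
  have "x = 0" if "x \<in> A \<inter> orth UNIV" for x
  proof (rule sing_radical)
    show "sing x" using that PP_sing[OF assms] by blast
    show "perp x y" for y using that by (intro perp_sym[OF orthD[of x UNIV]]) auto
  qed
  moreover have "0 \<in> A \<inter> orth UNIV"
    using vec.subspace_0[OF PP_subspace[OF assms]] vec.subspace_0[OF subspace_orth] by simp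
  ultimately have "A \<inter> orth UNIV = {0}" by blast
  then have "vec.dim (A \<inter> orth UNIV) = 0" by simp
  then show ?thesis
    using dim_pairing[OF PP_subspace[OF assms] vec.subspace_UNIV] by (simp only: vec_dim_card Int_UNIV_left)
qed

lemma dim_maximal_le: assumes "maximal U" shows "2 * vec.dim U \<le> CARD('m)"
proof -
  have "U \<in> PP" using assms by (simp add: maximal_def)
  then show ?thesis using dim_orth[of U] dim_le_subspace[OF PP_orth[of U]] by linarith
qed

text \<open>
  Relative to a fixed generator \<open>U \<supseteq> S\<close>, the singular vectors of \<open>orth S\<close> outside \<open>orth U\<close> are counted
  once along the cosets of a vector of \<open>U\<close>, and once along the generators through \<open>S\<close> other than \<open>U\<close>.
\<close>

lemma card_generators:
  assumes S: "S \<in> PP" and U: "maximal U" and SU: "S \<subseteq> U" "vec.dim S + 1 = vec.dim U"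
  shows "card {G \<in> PP. vec.dim G = vec.dim U \<and> S \<subseteq> G} = \<nu> * CARD('a) ^ (CARD('m) - 2 * vec.dim U) + 1"
proof -
  let ?n = "vec.dim U" and ?q = "CARD('a)"
  have UP: "U \<in> PP" using U by (simp add: maximal_def)
  have sub: "vec.subspace U" "vec.subspace S" using UP S PP_subspace by auto
  obtain u where u: "u \<in> U" "u \<notin> S" using SU by (metis add_cancel_right_right one_neq_zero subset_antisym subsetI)
  have Uu: "U = vec.span (insert u S)" by (rule subspace_eq_span_insert[OF sub(2,1) SU(1) _ u]) (use SU in simp)
  have orthU: "y \<in> orth U \<longleftrightarrow> perp u y \<and> y \<in> orth S" for y
    unfolding Uu orth_span by (auto simp: orth_def)
  let ?Z = "orth S - orth U"
  let ?Zs = "{y \<in> ?Z. sing y}"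
  have uS: "u \<in> orth S" using u(1) PP_orth[OF UP] orth_anti[OF SU(1)] by blast
  have su: "sing u" by (rule PP_sing[OF UP u(1)])
  have puu: "perp u u" by (rule sing_perp[OF su])
  have shift: "y + c *s u \<in> ?Z" if "y \<in> ?Z" for y c
  proof -
    have "y + c *s u \<in> orth S" using that uS vec.subspace_add[OF subspace_orth] vec.subspace_scale[OF subspace_orth] by blast
    moreover have "\<not> perp u (y + c *s u)"
    proof
      assume "perp u (y + c *s u)"
      then have "y + c *s u - c *s u \<in> {y. perp u y}"
        using puu vec.subspace_diff[OF perp_subspace] vec.subspace_scale[OF perp_subspace] by blast
      then show False using that orthU by simp
    qed
    ultimately show ?thesis using orthU by blast
  qed
  have bij: "card {y \<in> ?Z. sing (y + c *s u)} = card ?Zs" for c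
  proof (rule bij_betw_same_card[of "\<lambda>y. y + c *s u"], rule bij_betwI[where g = "\<lambda>y. y + (- c) *s u"])
    show "(\<lambda>y. y + c *s u) \<in> {y \<in> ?Z. sing (y + c *s u)} \<rightarrow> ?Zs" using shift by blast
    show "(\<lambda>y. y + (- c) *s u) \<in> ?Zs \<rightarrow> {y \<in> ?Z. sing (y + c *s u)}" using shift[of _ "- c"] by auto
  qed auto
  have "(\<Sum>y\<in>?Z. card {c. sing (y + c *s u)}) = (\<Sum>y\<in>?Z. \<nu>)"
    by (rule sum.cong[OF refl]) (use orthU card_sing_line[OF su] in auto)
  moreover have "(\<Sum>y\<in>?Z. card {c. sing (y + c *s u)}) = (\<Sum>c\<in>UNIV. card {y \<in> ?Z. sing (y + c *s u)})"
    using double_count[of ?Z "UNIV :: 'a set" "\<lambda>y c. sing (y + c *s u)"] by simp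
  ultimately have Zs: "?q * card ?Zs = \<nu> * card ?Z" unfolding bij by (simp add: mult.commute)
  have nN: "2 * ?n \<le> CARD('m)" by (rule dim_maximal_le[OF U])
  have n1: "?n \<ge> 1" using SU by simp
  have dS: "vec.dim (orth S) = CARD('m) - ?n + 1" "vec.dim (orth U) = CARD('m) - ?n"
    using dim_orth[OF S] dim_orth[OF UP] SU(2) nN by linarith+
  have "card ?Z = card (orth S) - card (orth U)" by (rule card_Diff_subset) (auto intro: orth_anti[OF SU(1), THEN subsetD])
  also have "\<dots> = ?q ^ (CARD('m) - ?n) * (?q - 1)"
    using card_subspace[OF subspace_orth[of S]] card_subspace[OF subspace_orth[of U]] dS by (simp add: algebra_simps)
  finally have cZ: "card ?Z = ?q ^ (CARD('m) - ?n) * (?q - 1)" .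
  let ?G = "{G \<in> PP. vec.dim G = ?n \<and> S \<subseteq> G} - {U}"
  have Gmem: "g \<in> ?Zs" if G: "G \<in> ?G" and g: "g \<in> G" "g \<notin> S" for G g
  proof -
    have GP: "G \<in> PP" "vec.dim G = ?n" "S \<subseteq> G" "G \<noteq> U" using G by auto
    have "g \<in> orth S" using g(1) PP_orth[OF GP(1)] orth_anti[OF GP(3)] by blast
    moreover have "g \<notin> orth U"
    proof
      assume "g \<in> orth U"
      then have "g \<in> U" using maximal_mem[OF U PP_sing[OF GP(1) g(1)]] by simp
      moreover have "G = vec.span (insert g S)"
        by (rule subspace_eq_span_insert[OF sub(2) PP_subspace[OF GP(1)] GP(3) _ g]) (use SU GP in simp)
      moreover have "U = vec.span (insert g S)"
        by (rule subspace_eq_span_insert[OF sub(2,1) SU(1) _ \<open>g \<in> U\<close> g(2)]) (use SU in simp)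
      ultimately show False using GP(4) by simp
    qed
    ultimately show ?thesis using PP_sing[OF GP(1) g(1)] by blast
  qed
  have Geq: "G = vec.span (insert g S)" if "G \<in> ?G" "g \<in> G" "g \<notin> S" for G g
    by (rule subspace_eq_span_insert[OF sub(2) _ _ _ that(2,3)]) (use that(1) SU PP_subspace in auto)
  have "?Zs = (\<Union>G\<in>?G. G - S)"
  proof (intro subset_antisym subsetI)
    fix y assume y: "y \<in> ?Zs"
    have yS: "y \<notin> S"
    proof
      assume "y \<in> S"
      then have "y \<in> orth U" using SU(1) PP_orth[OF UP] by blast
      then show False using y by simp
    qed
    let ?H = "vec.span (insert y S)"
    have "?H \<in> PP" using y by (intro PP_insert[OF S]) auto
    moreover have "vec.dim ?H = ?n" using dim_span_insert[OF sub(2) yS] SU(2) by linarith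
    moreover have "y \<in> ?H" "S \<subseteq> ?H" using vec.span_superset[of "insert y S"] by auto
    moreover have "?H \<noteq> U" using \<open>y \<in> ?H\<close> y PP_orth[OF UP] by blast
    ultimately show "y \<in> (\<Union>G\<in>?G. G - S)" using yS by blast
  next
    fix y assume "y \<in> (\<Union>G\<in>?G. G - S)"
    then show "y \<in> ?Zs" using Gmem by blast
  qed
  then have "card ?Zs = card (\<Union>G\<in>?G. G - S)" by simp
  also have "\<dots> = (\<Sum>G\<in>?G. card (G - S))"
  proof (rule card_UN_disjoint)
    show "\<forall>G\<in>?G. \<forall>G'\<in>?G. G \<noteq> G' \<longrightarrow> (G - S) \<inter> (G' - S) = {}"
    proof (intro ballI impI)
      fix G G' assume g: "G \<in> ?G" "G' \<in> ?G" "G \<noteq> G'"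
      show "(G - S) \<inter> (G' - S) = {}"
      proof (rule ccontr)
        assume "(G - S) \<inter> (G' - S) \<noteq> {}"
        then obtain y where "y \<in> G" "y \<in> G'" "y \<notin> S" by blast
        then show False using Geq[OF g(1)] Geq[OF g(2)] g(3) by blast
      qed
    qed
  qed auto
  also have "\<dots> = (\<Sum>G\<in>?G. ?q ^ (?n - 1) * (?q - 1))"
  proof (rule sum.cong[OF refl])
    fix G assume G: "G \<in> ?G"
    then have GP: "vec.subspace G" "vec.dim G = ?n" "S \<subseteq> G" using PP_subspace by auto
    have "card (G - S) = card G - card S" by (rule card_Diff_subset) (use GP in auto)
    also have "\<dots> = ?q ^ ?n - ?q ^ (?n - 1)" using card_subspace[OF GP(1)] card_subspace[OF sub(2)] GP(2) SU(2)
      by (metis add_diff_cancel_right')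
    also have "?q ^ ?n = ?q ^ (?n - 1) * ?q" using n1 by (metis le_add_diff_inverse2 power_Suc2 Suc_eq_plus1)
    finally show "card (G - S) = ?q ^ (?n - 1) * (?q - 1)" by (simp add: right_diff_distrib')
  qed
  finally have cZs: "card ?Zs = card ?G * (?q ^ (?n - 1) * (?q - 1))" by simp
  have "CARD('m) - ?n = (CARD('m) - 2 * ?n) + ?n" using nN by simp
  moreover have "?n = Suc (?n - 1)" using n1 by simp
  ultimately have pw: "?q ^ (CARD('m) - ?n) = ?q ^ (CARD('m) - 2 * ?n) * (?q * ?q ^ (?n - 1))"
    by (metis power_Suc power_add)
  have "(?q * (?q ^ (?n - 1) * (?q - 1))) * card ?G = (?q * (?q ^ (?n - 1) * (?q - 1))) * (\<nu> * ?q ^ (CARD('m) - 2 * ?n))"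
    using Zs unfolding cZ cZs pw by (simp only: ac_simps)
  moreover have "?q * (?q ^ (?n - 1) * (?q - 1)) > 0" using CARD_field_gt_1[where ?'a = 'a] by simp
  ultimately have cG: "card ?G = \<nu> * ?q ^ (CARD('m) - 2 * ?n)" by (simp only: nat_mult_eq_cancel1)
  have "U \<in> {G \<in> PP. vec.dim G = ?n \<and> S \<subseteq> G}" using UP SU by simp
  from card_Suc_Diff1[OF finite this] show ?thesis unfolding cG by linarith
qed

lemma maximal_dim_eq: "maximal U \<Longrightarrow> maximal W \<Longrightarrow> vec.dim U = vec.dim W"
  using dim_le_maximal[of U W] dim_le_maximal[of W U] by (simp add: maximal_def)

lemma polar_spaceI:
  assumes M: "maximal M" "vec.dim M = n"
  shows "polar_space perp sing n (\<nu> * CARD('a) ^ (CARD('m) - 2 * n))"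
proof unfold_locales
  fix U assume U: "U \<in> PP"
  obtain G where G: "maximal G" "U \<subseteq> G" using ex_maximal[OF U] by blast
  then show "\<exists>G\<in>PP. U \<subseteq> G \<and> vec.dim G = n" using maximal_dim_eq[OF G(1) M(1)] M(2) by (auto simp: maximal_def)
  show "vec.dim U \<le> n" using dim_le_maximal[OF M(1) U] M(2) by simp
next
  fix S assume S: "S \<in> PP" "vec.dim S + 1 = n"
  obtain G where G: "maximal G" "S \<subseteq> G" using ex_maximal[OF S(1)] by blast
  have "vec.dim G = n" using maximal_dim_eq[OF G(1) M(1)] M(2) by simp
  then show "card {G \<in> PP. vec.dim G = n \<and> S \<subseteq> G} = \<nu> * CARD('a) ^ (CARD('m) - 2 * n) + 1"
    using card_generators[OF S(1) G] S(2) by simp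
qed

end

section \<open>Frobenius, trace and norm on the field with q^2 elements\<close>

lemma of_nat_CARD_eq_0: "of_nat CARD('a) = (0 :: 'a::{field,finite})"
proof -
  have "(\<Sum>x\<in>UNIV. x + 1) = (\<Sum>x\<in>UNIV. x :: 'a)"
    by (rule sum.reindex_bij_witness[of _ "\<lambda>x. x - 1" "\<lambda>x. x + 1"]) auto
  then show ?thesis by (simp add: sum.distrib)
qed

lemma power_CARD: "x ^ CARD('a) = (x :: 'a::{field,finite})"
proof (cases "x = 0")
  case False
  have "(\<Prod>y\<in>UNIV - {0}. x * y) = (\<Prod>y\<in>UNIV - {0}. y)"
    by (rule prod.reindex_bij_witness[of _ "\<lambda>y. y / x" "\<lambda>y. x * y"]) (use False in auto)
  then have "x ^ (CARD('a) - 1) * \<Prod>(UNIV - {0}) = 1 * \<Prod>(UNIV - {0})"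
    by (simp add: prod.distrib card_Diff_singleton)
  moreover have "\<Prod>(UNIV - {0}) \<noteq> (0 :: 'a)" by simp
  ultimately have "x ^ (CARD('a) - 1) = 1" by (metis mult_right_cancel)
  then have "x ^ Suc (CARD('a) - 1) = x" by (simp only: power_Suc mult_1_right)
  moreover have "Suc (CARD('a) - 1) = CARD('a)" using CARD_field_gt_1[where ?'a = 'a] by linarith
  ultimately show ?thesis by (simp only:)
qed simp

context
  fixes q :: nat
  assumes q: "primepow q" and card_field: "CARD('a::{field,finite}) = q\<^sup>2"
begin

lemma q_gt_1: "q > 1" using primepow_gt_Suc_0[OF q] by simp

lemma frobenius_add: "(a + b) ^ q = a ^ q + (b :: 'a) ^ q"
proof -
  obtain p k where pk: "prime p" "q = p ^ k" using q by (auto simp: primepow_def)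
  have "CHAR('a) dvd CARD('a)" using of_nat_CARD_eq_0[where ?'a = 'a] of_nat_eq_0_iff_char_dvd by blast
  moreover have pr: "prime CHAR('a)" by (rule prime_CHAR_semidom[OF finite_imp_CHAR_pos]) simp
  ultimately have "CHAR('a) dvd p" unfolding card_field pk(2) using prime_dvd_power by blast
  then have "CHAR('a) = p" using pr pk(1) primes_dvd_imp_eq by blast
  then show ?thesis using pr pk(2) by (intro freshmans_dream') auto
qed

lemma frobenius_twice: "((a :: 'a) ^ q) ^ q = a"
  using power_CARD[of a] unfolding card_field by (simp only: power_mult power2_eq_square)

lemma degree_monom_q: "degree (monom 1 q :: 'a poly) \<le> q" "degree (monom 1 1 :: 'a poly) \<le> q" "degree ([:b:] :: 'a poly) \<le> q"
  using degree_monom_le[of "1 :: 'a" q] degree_monom_le[of "1 :: 'a" 1] q_gt_1 by auto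

lemma card_fixed: "card {b :: 'a. b ^ q = b} \<le> q"
proof -
  let ?p = "monom 1 q - monom 1 1 :: 'a poly"
  have "coeff ?p q = 1" using q_gt_1 by simp
  then have "?p \<noteq> 0" by (metis coeff_0 zero_neq_one)
  from card_poly_roots_bound[OF this] have "card {b :: 'a. b ^ q = b} \<le> degree ?p" by (simp add: poly_monom)
  also have "\<dots> \<le> q" by (intro degree_diff_le degree_monom_q)
  finally show ?thesis .
qed

text \<open>A fibre of a + a^q is the root set of a polynomial of degree q, and the values lie among
  the at most q roots of b^q = b. Distributing q^2 elements, no fibre can be smaller than q.\<close>

lemma card_trace_fibre:
  assumes b: "b ^ q = b"
  shows "card {a :: 'a. a + a ^ q = b} = q"
proof -
  have le: "card {a :: 'a. a + a ^ q = b} \<le> q" for b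
  proof -
    let ?p = "monom 1 q + monom 1 1 - [:b:] :: 'a poly"
    have "coeff ?p q = 1" using q_gt_1 by (simp add: coeff_pCons split: nat.split)
    then have "?p \<noteq> 0" by (metis coeff_0 zero_neq_one)
    from card_poly_roots_bound[OF this] have "card {a. a + a ^ q = b} \<le> degree ?p"
      by (simp add: poly_monom add.commute)
    also have "\<dots> \<le> q" by (intro degree_diff_le degree_add_le degree_monom_q)
    finally show ?thesis .
  qed
  let ?K = "{b :: 'a. b ^ q = b}"
  have K: "a + a ^ q \<in> ?K" for a :: 'a by (simp add: frobenius_add frobenius_twice add.commute)
  have "card {b \<in> ?K. a + a ^ q = b} = 1" for a
  proof -
    have "{b \<in> ?K. a + a ^ q = b} = {a + a ^ q}" using K[of a] by blast
    then show ?thesis by simp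
  qed
  then have sum: "(\<Sum>b\<in>?K. card {a. a + a ^ q = b}) = q\<^sup>2"
    using double_count[of "UNIV :: 'a set" ?K "\<lambda>a b. a + a ^ q = b"] card_field by simp
  show ?thesis
  proof (rule ccontr)
    assume "card {a. a + a ^ q = b} \<noteq> q"
    then have "card {a. a + a ^ q = b} < q" using le[of b] by simp
    then have "(\<Sum>b\<in>?K. card {a. a + a ^ q = b}) < (\<Sum>b\<in>?K. q)" using le b by (intro sum_strict_mono_ex1) auto
    also have "\<dots> \<le> q * q" using card_fixed by simp
    finally show False using sum by (simp add: power2_eq_square)
  qed
qed

text \<open>The same pigeonhole for s^(q+1): fibres of size at most q + 1 over at most q - 1 nonzero
  values must account for q^2 - 1 = (q - 1)(q + 1) elements, so no value is missed.\<close>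

lemma norm_surj:
  assumes b: "b ^ q = b" "b \<noteq> 0"
  shows "\<exists>s :: 'a. s ^ (q + 1) = b"
proof (rule ccontr)
  assume no: "\<nexists>s :: 'a. s ^ (q + 1) = b"
  define N :: "'a \<Rightarrow> 'a" where "N s = s ^ (q + 1)" for s
  define K where "K = {b :: 'a. b ^ q = b} - {0}"
  define X where "X = UNIV - {0 :: 'a}"
  have le: "card {s \<in> X. N s = c} \<le> q + 1" for c
  proof -
    let ?p = "monom 1 (q + 1) - [:c:] :: 'a poly"
    have "coeff ?p (q + 1) = 1" by (simp add: coeff_pCons)
    then have "?p \<noteq> 0" by (metis coeff_0 zero_neq_one)
    from card_poly_roots_bound[OF this] have "card {s. N s = c} \<le> degree ?p" by (simp add: poly_monom N_def)
    also have "\<dots> \<le> q + 1" by (intro degree_diff_le degree_monom_le) simp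
    finally have "card {s. N s = c} \<le> q + 1" .
    moreover have "card {s \<in> X. N s = c} \<le> card {s. N s = c}" by (intro card_mono) auto
    ultimately show ?thesis by linarith
  qed
  have K: "N s \<in> K" if "s \<in> X" for s
    using that by (simp add: N_def K_def X_def power_mult_distrib frobenius_twice mult.commute)
  have "card {c \<in> K. N s = c} = 1" if "s \<in> X" for s
  proof -
    have "{c \<in> K. N s = c} = {N s}" using K[OF that] by auto
    then show ?thesis by simp
  qed
  then have "(\<Sum>s\<in>X. card {c \<in> K. N s = c}) = (\<Sum>s\<in>X. 1)" by (intro sum.cong) auto
  then have "(\<Sum>c\<in>K. card {s \<in> X. N s = c}) = card X"
    using double_count[of X K "\<lambda>s c. N s = c"] by simp
  moreover have "card X = q\<^sup>2 - 1" using card_Diff_singleton[of "0 :: 'a" UNIV] by (simp add: X_def card_field)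
  ultimately have sum: "(\<Sum>c\<in>K. card {s \<in> X. N s = c}) = q\<^sup>2 - 1" by linarith
  have bK: "b \<in> K" using b by (simp add: K_def)
  have "{s \<in> X. N s = b} = {}" using no by (auto simp: N_def)
  then have "(\<Sum>c\<in>K. card {s \<in> X. N s = c}) = (\<Sum>c\<in>K - {b}. card {s \<in> X. N s = c})"
    using sum.remove[OF finite[of K] bK, of "\<lambda>c. card {s \<in> X. N s = c}"] by simp
  also have "\<dots> \<le> (\<Sum>c\<in>K - {b}. q + 1)" by (intro sum_mono le)
  also have "\<dots> = (card K - 1) * (q + 1)" using card_Diff_singleton[OF bK] by simp
  also have "\<dots> \<le> (q - 2) * (q + 1)"
  proof -
    have "card K = card {b :: 'a. b ^ q = b} - 1"
      unfolding K_def using q_gt_1 by (intro card_Diff_singleton) simp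
    then have "card K - 1 \<le> q - 2" using card_fixed by linarith
    then show ?thesis by (rule mult_le_mono1)
  qed
  also have "\<dots> < (q - 1) * (q + 1)" using q_gt_1 by (intro mult_strict_right_mono) auto
  also have "\<dots> = q\<^sup>2 - 1" by (simp add: power2_eq_square algebra_simps)
  finally show False using sum by simp
qed

end

lemma perp_spaceI:
  fixes f :: "'a::{field,finite} ^ 'm \<Rightarrow> 'a ^ 'm \<Rightarrow> 'a"
  assumes add: "\<And>x y z. f x (y + z) = f x y + f x z" and scale: "\<And>x c y. f x (c *s y) = c * f x y"
    and sym: "\<And>x y. f x y = 0 \<Longrightarrow> f y x = 0"
  shows "perp_space (\<lambda>x y. f x y = 0)"
proof
  have f0: "f x 0 = 0" for x using scale[of x 0 0] by simp
  show "vec.subspace {y. f x y = 0}" for x by (simp add: vec.subspace_def f0 add scale)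
  then have sub: "vec.subspace (C \<inter> {y. f x y = 0})" if "vec.subspace C" for C x using that vec.subspace_inter by blast
  show "vec.dim C \<le> vec.dim (C \<inter> {y. f x y = 0}) + 1" if C: "vec.subspace C" for C x
  proof (cases "\<forall>y\<in>C. f x y = 0")
    case True
    then have "C \<inter> {y. f x y = 0} = C" by blast
    then show ?thesis by simp
  next
    case False
    then obtain v where v: "v \<in> C" "f x v \<noteq> 0" by blast
    have "C \<subseteq> vec.span (insert v (C \<inter> {y. f x y = 0}))"
    proof
      fix y assume y: "y \<in> C"
      let ?c = "f x y / f x v"
      have "y - ?c *s v \<in> C" using y v C vec.subspace_diff vec.subspace_scale by blast
      moreover have "f x y = f x (y - ?c *s v) + f x (?c *s v)" by (simp flip: add)
      then have "f x (y - ?c *s v) = 0" using v(2) by (simp add: scale)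
      moreover have "y = ?c *s v + (y - ?c *s v)" by simp
      ultimately show "y \<in> vec.span (insert v (C \<inter> {y. f x y = 0}))"
        unfolding span_insert_eq[OF sub[OF C]] by blast
    qed
    then have "vec.dim C \<le> vec.dim (vec.span (insert v (C \<inter> {y. f x y = 0})))" by (rule dim_le_subspace)
    also have "\<dots> = vec.dim (C \<inter> {y. f x y = 0}) + 1" by (rule dim_span_insert[OF sub[OF C]]) (use v in simp)
    finally show ?thesis .
  qed
qed (rule sym)

lemma linearD:
  fixes f :: "'a::{field,finite} ^ 'm \<Rightarrow> 'a"
  assumes "Vector_Spaces.linear (*s) (*) f"
  shows "f (x + y) = f x + f y" "f (c *s x) = c * f x"
  using assms unfolding Vector_Spaces.linear_iff by auto

subsection \<open>Hermitian forms\<close>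

context
  fixes q :: nat and B :: "'a::{field,finite} ^ 'm \<Rightarrow> 'a ^ 'm \<Rightarrow> 'a"
  assumes q: "primepow q" and card_field: "CARD('a) = q\<^sup>2"
    and herm: "hermitian_form q B" and nondeg: "nondegenerate B"
begin

lemma hermitian_add: "B (x + y) z = B x z + B y z" and hermitian_scale: "B (c *s x) z = c * B x z"
proof -
  have "Vector_Spaces.linear (*s) (*) (\<lambda>u. B u z)" using herm unfolding hermitian_form_def by blast
  from linearD[OF this] show "B (x + y) z = B x z + B y z" "B (c *s x) z = c * B x z" .
qed

lemma hermitian_conj: "B v u = B u v ^ q"
  using herm unfolding hermitian_form_def by blast

lemma hermitian_add_right: "B z (x + y) = B z x + B z y"
  unfolding hermitian_conj[of z] hermitian_add by (rule frobenius_add[OF q card_field])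

lemma hermitian_scale_right: "B z (c *s x) = c ^ q * B z x"
  unfolding hermitian_conj[of z] hermitian_scale by (simp add: power_mult_distrib)

lemma hermitian_zero_sym: "B x y = 0 \<Longrightarrow> B y x = 0"
  unfolding hermitian_conj[of y x] using q_gt_1[OF q card_field] by simp

lemma hermitian_neg_fixed: "(- B y y) ^ q = - B y y"
proof -
  have "(- B y y) ^ q + B y y ^ q = (- B y y + B y y) ^ q" by (rule frobenius_add[OF q card_field, symmetric])
  also have "\<dots> = 0" using q_gt_1[OF q card_field] by simp
  finally show ?thesis unfolding hermitian_conj[of y y, symmetric] by (simp only: eq_neg_iff_add_eq_0)
qed

text \<open>B is linear only in its first argument, so orthogonality is taken as
  \<open>B y x = 0\<close>. With g = B x y, the vector y + c x is isotropic iff c g has trace - B y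
  y, so \<open>\<nu>\<close> is the size of a trace fibre.\<close>

lemma hermitian_formed_space: "formed_space (\<lambda>x y. B y x = 0) (\<lambda>x. B x x = 0) q"
proof -
  interpret perp_space "\<lambda>x y. B y x = 0"
    by (rule perp_spaceI[of "\<lambda>x y. B y x", OF hermitian_add hermitian_scale hermitian_zero_sym])
  have B0: "B 0 x = 0" for x using hermitian_scale[of 0 0 x] by simp
  show ?thesis
  proof
    show "B 0 0 = 0" by (rule B0)
    show "B (c *s x) (c *s x) = 0" if "B x x = 0" for x c
      using that by (simp add: hermitian_scale hermitian_scale_right)
    show "B (x + y) (x + y) = 0" if "B x x = 0" "B y y = 0" "B y x = 0" for x y
      using that hermitian_zero_sym[OF that(3)] by (simp add: hermitian_add hermitian_add_right)
    show "B x x = 0" if "B x x = 0" for x by (rule that)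
    show "card {c. B (y + c *s x) (y + c *s x) = 0} = q" if x: "B x x = 0" "B y x \<noteq> 0" for x y
    proof -
      define g where "g = B x y"
      have g: "g \<noteq> 0" using x(2) hermitian_zero_sym g_def by metis
      have "B (y + c *s x) (y + c *s x) = B y y + (c * g + (c * g) ^ q)" for c
        by (simp add: hermitian_add hermitian_add_right hermitian_scale hermitian_scale_right x(1) g_def
            hermitian_conj[of y x] power_mult_distrib algebra_simps)
      then have "{c. B (y + c *s x) (y + c *s x) = 0} = {c. c * g + (c * g) ^ q = - B y y}"
        by (simp add: add_eq_0_iff2 add.commute eq_neg_iff_add_eq_0)
      moreover have "bij_betw (\<lambda>c. c * g) {c. c * g + (c * g) ^ q = - B y y} {a. a + a ^ q = - B y y}"
        by (rule bij_betwI[where g = "\<lambda>a. a / g"]) (use g in auto)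
      moreover have "card {a. a + a ^ q = - B y y} = q"
        by (rule card_trace_fibre[OF q card_field hermitian_neg_fixed])
      ultimately show ?thesis using bij_betw_same_card[of "\<lambda>c. c * g"] by simp
    qed
    show "x = 0" if "B x x = 0" "\<And>y. B y x = 0" for x
      using nondeg that(2) hermitian_zero_sym unfolding nondegenerate_def by blast
  qed
qed

lemma hermitian_PP: "singular_space.PP (\<lambda>x y. B y x = 0) (\<lambda>x. B x x = 0) = isotropic_subspaces B"
proof -
  interpret formed_space "\<lambda>x y. B y x = 0" "\<lambda>x. B x x = 0" q by (rule hermitian_formed_space)
  show ?thesis unfolding PP_def isotropic_subspaces_def orth_def by blast
qed

text \<open>If \<open>orth U\<close> were two dimensions larger than U, it would contain
  perpendicular nonisotropic e1 and e2 outside U. As norms are surjective, some s e1 + e2 is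
  isotropic and hence lies in U, but it is not perpendicular to e1.\<close>

lemma hermitian_polar_space:
  assumes "CARD('m) = 2 * n \<or> CARD('m) = 2 * n + 1"
  shows "polar_space (\<lambda>x y. B y x = 0) (\<lambda>x. B x x = 0) n (q * CARD('a) ^ (CARD('m) - 2 * n))"
proof -
  interpret formed_space "\<lambda>x y. B y x = 0" "\<lambda>x. B x x = 0" q by (rule hermitian_formed_space)
  obtain U where "maximal U \<and> {0} \<subseteq> U" using ex_maximal[OF zero_PP] ..
  then have U: "maximal U" ..
  have "CARD('m) \<le> 2 * vec.dim U + 1" (is ?R)
  proof (rule ccontr)
    assume "\<not> ?R"
    have UP: "U \<in> PP" using U by (simp add: maximal_def)
    then have dT: "vec.dim U + 2 \<le> vec.dim (orth U)" using dim_orth[OF UP] \<open>\<not> ?R\<close> by linarith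
    let ?T = "orth U"
    have "\<not> ?T \<subseteq> U" using dim_le_subspace[of ?T U] dT by linarith
    then obtain e1 where e1: "e1 \<in> ?T" "e1 \<notin> U" by (auto simp only: subset_iff)
    have "vec.dim ?T \<le> vec.dim (?T \<inter> {y. B y e1 = 0}) + 1" by (rule perp_codim[OF subspace_orth])
    then have "\<not> ?T \<inter> {y. B y e1 = 0} \<subseteq> U" using dim_le_subspace[of "?T \<inter> {y. B y e1 = 0}" U] dT by linarith
    then obtain e2 where e2: "e2 \<in> ?T" "B e2 e1 = 0" "e2 \<notin> U" by (auto simp only: subset_iff Int_iff mem_Collect_eq)
    have ne: "B e1 e1 \<noteq> 0" "B e2 e2 \<noteq> 0" 
      using maximal_mem[OF U, of e1] maximal_mem[OF U, of e2] e1 e2 by (simp_all only:) auto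
    let ?b = "- (B e2 e2 / B e1 e1)"
    have "?b ^ q = ((- B e2 e2) / B e1 e1) ^ q" by simp
    also have "\<dots> = (- B e2 e2) / B e1 e1"
      unfolding power_divide hermitian_neg_fixed hermitian_conj[of e1 e1, symmetric] ..
    finally have "?b ^ q = ?b" by simp
    moreover have "?b \<noteq> 0" using ne by simp
    ultimately obtain s where s: "s ^ (q + 1) = ?b" using norm_surj[OF q card_field] by blast
    let ?v = "s *s e1 + e2"
    have "B ?v ?v = s ^ (q + 1) * B e1 e1 + B e2 e2"
      using e2(2) hermitian_zero_sym[OF e2(2)]
      by (simp add: hermitian_add hermitian_add_right hermitian_scale hermitian_scale_right algebra_simps)
    then have "B ?v ?v = 0" unfolding s using ne by simp
    moreover have "?v \<in> ?T" 
      by (intro vec.subspace_add[OF subspace_orth] vec.subspace_scale[OF subspace_orth] e1(1) e2(1))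
    ultimately have "?v \<in> U" by (rule maximal_mem[OF U])
    then have "B e1 ?v = 0" using e1(1) by (simp add: orth_def)
    then have "B ?v e1 = 0" by (rule hermitian_zero_sym)
    then have "s = 0" using e2(2) ne by (simp add: hermitian_add hermitian_scale)
    then show False using s ne q_gt_1[OF q card_field] by simp
  qed
  then have "vec.dim U = n" using dim_maximal_le[OF U] assms by linarith
  then show ?thesis by (rule polar_spaceI[OF U])
qed

end

subsection \<open>Alternating forms\<close>

context
  fixes B :: "'a::{field,finite} ^ 'm \<Rightarrow> 'a ^ 'm \<Rightarrow> 'a"
  assumes alt: "alternating_form B" and nondeg: "nondegenerate B"
begin

lemma alternating_add: "B x (y + z) = B x y + B x z" "B (x + y) z = B x z + B y z"
  and alternating_scale: "B x (c *s y) = c * B x y" and alternating_self: "B x x = 0"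
proof -
  have 1: "Vector_Spaces.linear (*s) (*) (\<lambda>u. B u z)" and 2: "Vector_Spaces.linear (*s) (*) (\<lambda>v. B x v)"
    and 3: "B x x = 0" using alt unfolding alternating_form_def bilinear_form_def by blast+
  show "B x (y + z) = B x y + B x z" "B (x + y) z = B x z + B y z" "B x (c *s y) = c * B x y" "B x x = 0"
    by (rule linearD(1)[OF 2] linearD(1)[OF 1] linearD(2)[OF 2] 3)+
qed

lemma alternating_zero_sym: "B x y = 0 \<Longrightarrow> B y x = 0"
  using alternating_self[of "x + y"] alternating_self[of x] alternating_self[of y] by (simp add: alternating_add)

lemma alternating_formed_space: "formed_space (\<lambda>x y. B x y = 0) (\<lambda>x. True) CARD('a)"
proof -
  interpret perp_space "\<lambda>x y. B x y = 0"
    by (rule perp_spaceI[of B, OF alternating_add(1) alternating_scale alternating_zero_sym])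
  show ?thesis
    by unfold_locales (use nondeg alternating_self in \<open>auto simp: nondegenerate_def\<close>)
qed

lemma alternating_PP: "singular_space.PP (\<lambda>x y. B x y = 0) (\<lambda>x. True) = isotropic_subspaces B"
proof -
  interpret formed_space "\<lambda>x y. B x y = 0" "\<lambda>x. True" "CARD('a)" by (rule alternating_formed_space)
  show ?thesis unfolding PP_def isotropic_subspaces_def orth_def by blast
qed

lemma alternating_polar_space:
  assumes "CARD('m) = 2 * n"
  shows "polar_space (\<lambda>x y. B x y = 0) (\<lambda>x. True) n CARD('a)"
proof -
  interpret formed_space "\<lambda>x y. B x y = 0" "\<lambda>x. True" "CARD('a)" by (rule alternating_formed_space)
  obtain U where "maximal U \<and> {0} \<subseteq> U" using ex_maximal[OF zero_PP] ..
  then have U: "maximal U" ..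
  have UP: "U \<in> PP" using U by (simp add: maximal_def)
  have "orth U \<subseteq> U" using maximal_mem[OF U] by blast
  then have "vec.dim (orth U) \<le> vec.dim U" by (rule dim_le_subspace)
  then have "vec.dim U = n" using dim_orth[OF UP] dim_maximal_le[OF U] assms by linarith
  from polar_spaceI[OF U this] show ?thesis using assms by simp
qed

end

subsection \<open>Quadratic forms\<close>

text \<open>The sets \<open>{as\<^sup>2}\<close> and \<open>{-c - bt\<^sup>2}\<close> both contain more than half of the scalars and hence meet.\<close>

lemma conic_solvable:
  fixes a b c :: "'a::{field,finite}"
  assumes ne: "a \<noteq> 0" "b \<noteq> 0"
  shows "\<exists>s t. a * s\<^sup>2 + b * t\<^sup>2 + c = 0"
proof -
  let ?S = "range (\<lambda>s :: 'a. s\<^sup>2)"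
  have sq: "CARD('a) + 1 \<le> 2 * card ?S"
  proof -
    have "CARD('a) = card (\<Union>r\<in>?S. {s. s\<^sup>2 = r})" by (rule arg_cong[where f = card]) auto
    also have "\<dots> \<le> (\<Sum>r\<in>?S. card {s. s\<^sup>2 = r})" by (rule card_UN_le) simp
    also have "\<dots> \<le> (\<Sum>r\<in>?S. if r = 0 then 1 else 2)"
    proof (rule sum_mono)
      fix r assume "r \<in> ?S"
      then obtain u where u: "r = u\<^sup>2" by blast
      have sub: "{s. s\<^sup>2 = r} = {u, - u}" unfolding u by (auto simp: power2_eq_iff)
      show "card {s. s\<^sup>2 = r} \<le> (if r = 0 then 1 else 2)" unfolding sub using u by (auto simp: card_insert_if)
    qed
    also have "\<dots> = 1 + 2 * card (?S - {0})"
    proof -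
      have "0 \<in> ?S" by (rule range_eqI[of _ _ 0]) simp
      then show ?thesis by (subst sum.remove[of _ 0]) auto
    qed
    also have "card (?S - {0}) = card ?S - 1"
      by (rule card_Diff_singleton) (rule range_eqI[of _ _ 0], simp)
    finally show ?thesis using CARD_field_gt_1[where ?'a = 'a] by linarith
  qed
  let ?A = "(\<lambda>r. a * r) ` ?S" and ?B = "(\<lambda>r. - c - b * r) ` ?S"
  have A: "card ?A = card ?S" by (rule card_image) (use ne in \<open>auto simp: inj_on_def\<close>)
  have B: "card ?B = card ?S" by (rule card_image) (use ne in \<open>auto simp: inj_on_def\<close>)
  have "?A \<inter> ?B \<noteq> {}"
  proof
    assume "?A \<inter> ?B = {}"
    then have "card (?A \<union> ?B) = 2 * card ?S" using A B by (subst card_Un_disjoint) auto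
    moreover have "card (?A \<union> ?B) \<le> CARD('a)" by (intro card_mono) auto
    ultimately show False using sq by linarith
  qed
  then obtain s t where "a * s\<^sup>2 = - c - b * t\<^sup>2" by blast
  then have "a * s\<^sup>2 + b * t\<^sup>2 + c = 0" by simp
  then show ?thesis by blast
qed

lemma square_surj:
  fixes r :: "'a::{field,finite}"
  assumes "(2 :: 'a) = 0"
  shows "\<exists>s. s\<^sup>2 = r"
proof -
  have "inj (\<lambda>s :: 'a. s\<^sup>2)"
  proof (rule injI)
    fix s t :: 'a assume "s\<^sup>2 = t\<^sup>2"
    then have "s = t \<or> s = - t" by (simp add: power2_eq_iff)
    moreover have "t + t = 0" using assms by (metis mult_2 mult_zero_left)
    then have "- t = t" by (simp add: neg_eq_iff_add_eq_0)
    ultimately show "s = t" by auto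
  qed
  then have "surj (\<lambda>s :: 'a. s\<^sup>2)" by (simp add: finite_UNIV_inj_surj)
  then show ?thesis by (metis surjE)
qed

context
  fixes Q :: "'a::{field,finite} ^ 'm \<Rightarrow> 'a"
  assumes quad: "quadratic_form Q" and nondeg: "nondegenerate_quadratic Q"
begin

lemma polarization_add: "polarization Q x (y + z) = polarization Q x y + polarization Q x z"
  and polarization_scale: "polarization Q x (c *s y) = c * polarization Q x y"
  and quadratic_scale: "Q (c *s x) = c\<^sup>2 * Q x"
proof -
  have 1: "Vector_Spaces.linear (*s) (*) (\<lambda>v. polarization Q x v)" and 2: "Q (c *s x) = c\<^sup>2 * Q x"
    using quad unfolding quadratic_form_def bilinear_form_def by blast+
  show "polarization Q x (y + z) = polarization Q x y + polarization Q x z"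
    "polarization Q x (c *s y) = c * polarization Q x y" "Q (c *s x) = c\<^sup>2 * Q x"
    by (rule linearD[OF 1] 2)+
qed

lemma polarization_sym: "polarization Q x y = polarization Q y x"
  by (simp add: polarization_def add.commute)

lemma quadratic_add: "Q (x + y) = Q x + Q y + polarization Q x y"
  by (simp add: polarization_def)

lemma polarization_self: "polarization Q x x = 2 * Q x"
  using quadratic_scale[of 2 x] quadratic_add[of x x] by (simp add: vec.scale_left_distrib[of 1 1 x, simplified])

lemma quadratic_formed_space: "formed_space (\<lambda>x y. polarization Q x y = 0) (\<lambda>x. Q x = 0) 1"
proof -
  interpret perp_space "\<lambda>x y. polarization Q x y = 0"
    by (rule perp_spaceI[of "polarization Q", OF polarization_add polarization_scale]) (simp add: polarization_sym)
  show ?thesis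
  proof unfold_locales
    show "Q 0 = 0" using quadratic_scale[of 0 0] by simp
    show "Q (c *s x) = 0" if "Q x = 0" for c x using that by (simp add: quadratic_scale)
    show "Q (x + y) = 0" if "Q x = 0" "Q y = 0" "polarization Q x y = 0" for x y using that by (simp add: quadratic_add)
    show "polarization Q x x = 0" if "Q x = 0" for x using that by (simp add: polarization_self)
    show "card {c. Q (y + c *s x) = 0} = 1" if "Q x = 0" "polarization Q x y \<noteq> 0" for x y
    proof -
      have "polarization Q y x \<noteq> 0" using that(2) polarization_sym by metis
      then have "{c. Q (y + c *s x) = 0} = {- Q y / polarization Q y x}"
        using that(1) by (auto simp: quadratic_add quadratic_scale polarization_scale field_simps add_eq_0_iff)
      then show ?thesis by simp
    qed
    show "x = 0" if "Q x = 0" "\<And>y. polarization Q x y = 0" for x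
      using nondeg that unfolding nondegenerate_quadratic_def by blast
  qed
qed

lemma quadratic_PP: "singular_space.PP (\<lambda>x y. polarization Q x y = 0) (\<lambda>x. Q x = 0) = singular_subspaces Q"
proof -
  interpret formed_space "\<lambda>x y. polarization Q x y = 0" "\<lambda>x. Q x = 0" 1 by (rule quadratic_formed_space)
  have "U \<subseteq> orth U" if U: "vec.subspace U" "\<forall>u\<in>U. Q u = 0" for U
  proof
    fix y assume y: "y \<in> U"
    show "y \<in> orth U"
    proof (rule orthI)
      fix x assume "x \<in> U"
      then show "polarization Q x y = 0" using U y vec.subspace_add[OF U(1)] by (simp add: polarization_def)
    qed
  qed
  then show ?thesis unfolding PP_def singular_subspaces_def by blast
qed

lemma quadratic_polar_space:
  assumes "witt_index Q = n"
  shows "polar_space (\<lambda>x y. polarization Q x y = 0) (\<lambda>x. Q x = 0) n (CARD('a) ^ (CARD('m) - 2 * n))"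
proof -
  interpret formed_space "\<lambda>x y. polarization Q x y = 0" "\<lambda>x. Q x = 0" 1 by (rule quadratic_formed_space)
  have n: "n = Max (vec.dim ` PP)" using assms by (simp add: witt_index_def quadratic_PP)
  have fin: "finite (vec.dim ` PP)" "vec.dim ` PP \<noteq> {}" using zero_PP by auto
  obtain U where U: "U \<in> PP" "vec.dim U = n" using Max_in[OF fin] n by auto
  have le: "vec.dim W \<le> n" if "W \<in> PP" for W using Max_ge[OF fin(1)] that n by simp
  have "W = U" if "W \<in> PP" "U \<subseteq> W" for W
    using subspace_dim_eq[OF PP_subspace[OF U(1)] PP_subspace[OF that(1)] that(2)] le[OF that(1)] U(2) by simp
  then have "maximal U" using U(1) by (simp add: maximal_def)
  from polar_spaceI[OF this U(2)] show ?thesis by simp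
qed

text \<open>No three-dimensional quotient of \<open>orth U\<close> by U can be free of singular
  vectors, so the ambient dimension is at most 2 dim U + 2; being odd, it determines dim U.\<close>

lemma parabolic_polar_space:
  assumes "CARD('m) = 2 * n + 1"
  shows "polar_space (\<lambda>x y. polarization Q x y = 0) (\<lambda>x. Q x = 0) n CARD('a)"
proof -
  interpret formed_space "\<lambda>x y. polarization Q x y = 0" "\<lambda>x. Q x = 0" 1 by (rule quadratic_formed_space)
  obtain U where "maximal U \<and> {0} \<subseteq> U" using ex_maximal[OF zero_PP] ..
  then have U: "maximal U" ..
  have UP: "U \<in> PP" using U by (simp add: maximal_def)
  let ?T = "orth U"
  have "CARD('m) \<le> 2 * vec.dim U + 2" (is ?R)
  proof (rule ccontr)
    assume "\<not> ?R"
    then have dT: "vec.dim U + 3 \<le> vec.dim ?T" using dim_orth[OF UP] by linarith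
    have ex: "\<exists>e\<in>?T. e \<notin> U \<and> (\<forall>x\<in>X. polarization Q x e = 0)" if X: "finite X" "card X < 3" for X
    proof -
      have "vec.dim U < vec.dim (?T \<inter> orth X)"
        using dim_le_orth_card[OF subspace_orth X(1), of U] X(2) dT by linarith
      then have "\<not> ?T \<inter> orth X \<subseteq> U" using dim_le_subspace[of "?T \<inter> orth X" U] by linarith
      then show ?thesis unfolding orth_def[of X] by blast
    qed
    have no: "Q e \<noteq> 0" if "e \<in> ?T" "e \<notin> U" for e using maximal_mem[OF U] that by blast
    obtain e1 where e1: "e1 \<in> ?T" "e1 \<notin> U" using ex[of "{}"] by auto
    show False
    proof (cases "(2 :: 'a) = 0")
      case True
      have "vec.dim (?T \<inter> orth {e1}) > vec.dim (vec.span (insert e1 U))"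
        using dim_le_orth_card[OF subspace_orth, of "{e1}" U] dT dim_span_insert[OF PP_subspace[OF UP] e1(2)] by simp
      then have "\<not> ?T \<inter> orth {e1} \<subseteq> vec.span (insert e1 U)"
        using dim_le_subspace[of "?T \<inter> orth {e1}" "vec.span (insert e1 U)"] by linarith
      then obtain e2 where e2: "e2 \<in> ?T" "polarization Q e1 e2 = 0" "e2 \<notin> vec.span (insert e1 U)"
        unfolding orth_def[of "{e1}"] by blast
      obtain s where s: "s\<^sup>2 = - Q e2 / Q e1" using square_surj[OF True] by blast
      let ?v = "e2 + s *s e1"
      have "polarization Q e2 e1 = 0" using e2(2) polarization_sym by metis
      then have "Q ?v = 0" using no[OF e1] by (simp add: quadratic_add quadratic_scale polarization_scale s)
      moreover have "?v \<in> ?T" by (intro vec.subspace_add[OF subspace_orth] vec.subspace_scale[OF subspace_orth] e1(1) e2(1))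
      ultimately have "?v \<in> U" by (rule maximal_mem[OF U])
      then have "(- s) *s e1 + ?v \<in> vec.span (insert e1 U)" unfolding span_insert_eq[OF PP_subspace[OF UP]] by blast
      then show False using e2(3) by (simp add: vec.scale_minus_left)
    next
      case False
      obtain e2 where e2: "e2 \<in> ?T" "e2 \<notin> U" "polarization Q e1 e2 = 0" using ex[of "{e1}"] by auto
      have "card {e1, e2} < 3" by (cases "e1 = e2") simp_all
      then obtain e3 where e3: "e3 \<in> ?T" "e3 \<notin> U" "polarization Q e1 e3 = 0" "polarization Q e2 e3 = 0"
        using ex[of "{e1, e2}"] by auto
      obtain s t where st: "Q e1 * s\<^sup>2 + Q e2 * t\<^sup>2 + Q e3 = 0"
        using conic_solvable[OF no[OF e1] no[OF e2(1,2)]] by blast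
      let ?v = "e3 + (s *s e1 + t *s e2)"
      have p: "polarization Q e3 e1 = 0" "polarization Q e3 e2 = 0" using e3(3,4) polarization_sym by metis+
      have "polarization Q (s *s e1) (t *s e2) = 0"
        using e2(3) polarization_sym[of "s *s e1" e2] polarization_sym[of e2 e1] by (simp add: polarization_scale)
      then have "Q ?v = Q e1 * s\<^sup>2 + Q e2 * t\<^sup>2 + Q e3"
        using p by (simp add: quadratic_add quadratic_scale polarization_add polarization_scale algebra_simps)
      then have "Q ?v = 0" using st by simp
      moreover have "?v \<in> ?T"
        by (intro vec.subspace_add[OF subspace_orth] vec.subspace_scale[OF subspace_orth] e1(1) e2(1) e3(1))
      ultimately have "?v \<in> U" by (rule maximal_mem[OF U])
      then have "polarization Q ?v e3 = 0" by (rule orthD[OF e3(1)])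
      then have "polarization Q e3 ?v = 0" using polarization_sym by metis
      then have "2 * Q e3 = 0" using p by (simp add: polarization_add polarization_scale polarization_self)
      then show False using False no[OF e3(1,2)] by simp
    qed
  qed
  then have "vec.dim U = n" using dim_maximal_le[OF U] assms by linarith
  from polar_spaceI[OF U this] show ?thesis using assms by simp
qed

end

section \<open>The theorem\<close>

context polar_space
begin

lemma generators_PP: "generators PP = gens"
proof (intro subset_antisym subsetI)
  fix U assume U: "U \<in> generators PP"
  then obtain G where G: "G \<in> gens" "U \<subseteq> G" using gen_exE[of U] by (auto simp: generators_def)
  then show "U \<in> gens" using U gens_PP[OF G(1)] by (auto simp: generators_def)
next
  fix U assume U: "U \<in> gens"
  have "W = U" if W: "W \<in> PP" "U \<subseteq> W" for W
    using subspace_dim_eq[OF gens_subspace[OF U] PP_subspace[OF W(1)] W(2)] PP_dim_le[OF W(1)] gens_dim[OF U] by simp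
  then show "U \<in> generators PP" using gens_PP[OF U] by (simp add: generators_def)
qed

lemma steiner_system_residue:
  assumes Y: "steiner_system t PP Y" and t: "t \<le> n" "k \<le> t"
  obtains R Y' where "vec.dim R + k = t" "steiner R (vec.dim R + k) Y'"
proof -
  have 0: "steiner {0} t Y"
    unfolding steiner_def
  proof (intro conjI)
    show "\<forall>W\<in>Y. {0} \<subseteq> W"
      using Y vec.subspace_0[OF gens_subspace] by (auto simp: steiner_system_def generators_PP)
    show "\<forall>S\<in>PP. {0} \<subseteq> S \<and> vec.dim S = t \<longrightarrow> (\<exists>!W. W \<in> Y \<and> S \<subseteq> W)"
      using Y unfolding steiner_system_def by blast
  qed (use zero_PP t Y in \<open>auto simp: steiner_system_def generators_PP\<close>)
  have "d \<le> n \<Longrightarrow> \<exists>R\<in>PP. vec.dim R = d" for d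
  proof (induction d)
    case 0
    then show ?case using zero_PP by (intro bexI[of _ "{0}"]) auto
  next
    case (Suc d)
    then obtain R where R: "R \<in> PP" "vec.dim R = d" by auto
    obtain G where G: "G \<in> gens" "R \<subseteq> G" using gen_exE[OF R(1)] .
    have "R \<noteq> G" using R(2) gens_dim[OF G(1)] Suc.prems by auto
    then obtain x where x: "x \<in> G" "x \<notin> R" using G(2) by blast
    let ?S = "vec.span (insert x R)"
    have "?S \<subseteq> G" using x(1) G(2) by (intro vec.span_minimal gens_subspace[OF G(1)]) simp
    then have "?S \<in> PP" by (rule PP_down[OF gens_PP[OF G(1)] vec.subspace_span])
    moreover have "vec.dim ?S = Suc d" using dim_span_insert[OF PP_subspace[OF R(1)] x(2)] R(2) by linarith
    ultimately show ?case by blast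
  qed
  then obtain R where R: "R \<in> PP" "vec.dim R = t - k" using t by (meson diff_le_self order_trans)
  have "{0} \<subseteq> R" using vec.subspace_0[OF PP_subspace[OF R(1)]] by simp
  moreover have d: "vec.dim R + k = t" using R(2) t(2) by simp
  ultimately have "steiner R t {W \<in> Y. R \<subseteq> W}" using steiner_residue[OF 0 R(1)] by simp
  then show ?thesis using that[OF d] unfolding d by blast
qed

lemma steiner_system_hyperbolic:
  assumes Y: "steiner_system t PP Y" and t: "1 < t" "t < n" and E: "E = 1"
  shows "t = n - 1"
proof (rule ccontr)
  assume "t \<noteq> n - 1"
  obtain R Y' where R: "vec.dim R + 2 = t" and st: "steiner R (vec.dim R + 2) Y'"
    by (rule steiner_system_residue[OF Y, of 2]) (use t in auto)
  show False by (rule no_steiner2_hyperbolic[OF st E]) (use R t \<open>t \<noteq> n - 1\<close> in linarith)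
qed

text \<open>The residue of dimension t - 2 has rank n - t + 2 \<ge> 3; even rank, rank 3 and odd
  rank at least 5 are excluded separately.\<close>

lemma no_steiner_system_small:
  assumes Y: "steiner_system t PP Y" and t: "1 < t" "t < n" and E: "1 < E" "E \<le> CARD('a)"
  shows False
proof -
  obtain R Y' where R: "vec.dim R + 2 = t" and st: "steiner R (vec.dim R + 2) Y'"
    by (rule steiner_system_residue[OF Y, of 2]) (use t in auto)
  have odd_num: "odd (3 :: nat)" "even (4 :: nat)" by simp_all
  have "CARD('a) \<le> CARD('a)\<^sup>2" unfolding power2_eq_square by (rule le_square)
  then have E': "0 < E" "E \<le> CARD('a)\<^sup>2" using E by linarith+
  have m: "n - vec.dim R \<ge> 3" "n \<ge> vec.dim R" using R t by linarith+
  show False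
  proof (cases "even (n - vec.dim R)")
    case True
    then have "n - vec.dim R \<noteq> 3" using odd_num by metis
    then have "n \<ge> vec.dim R + 4" using m by linarith
    then show False by (rule no_steiner2_even[OF st E' _ True])
  next
    case False
    show False
    proof (cases "n - vec.dim R = 3")
      case True
      then have "n = vec.dim R + 3" using m by linarith
      then show False by (rule no_steiner_rank3[OF st _ E])
    next
      case False
      moreover have "n - vec.dim R \<noteq> 4" using \<open>odd (n - vec.dim R)\<close> odd_num by metis
      ultimately have "n \<ge> vec.dim R + 5" using m by linarith
      then show False using no_steiner2_odd[OF st E'(1) E(2)] \<open>odd (n - vec.dim R)\<close> by blast
    qed
  qed
qed

text \<open>Excluding even rank n - t + 2 makes n - t odd. For t \<ge> 3 the residue of dimension t
  - 3 has rank n - t + 3, which is then even, and at least 6 unless t = n - 1.\<close>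

lemma steiner_system_parameters:
  assumes Y: "steiner_system t PP Y" and t: "1 < t" "t < n" and E: "0 < E" "E \<le> CARD('a)\<^sup>2"
  shows "(t = 2 \<and> odd n) \<or> (t = n - 1 \<and> 3 \<le> t)"
proof -
  obtain R Y' where R: "vec.dim R + 2 = t" and st: "steiner R (vec.dim R + 2) Y'"
    by (rule steiner_system_residue[OF Y, of 2]) (use t in auto)
  have od: "odd (n - t)"
  proof (rule ccontr)
    assume "\<not> odd (n - t)"
    moreover have "n - vec.dim R = n - t + 2" using R t by linarith
    ultimately have ev: "even (n - vec.dim R)" by simp
    have "n - t \<noteq> 1" using \<open>\<not> odd (n - t)\<close> odd_one by metis
    then have "n \<ge> vec.dim R + 4" using R t by linarith
    then show False by (rule no_steiner2_even[OF st E _ ev])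
  qed
  show ?thesis
  proof (cases "t = 2")
    case True
    then show ?thesis using od t by simp
  next
    case False
    have "t = n - 1"
    proof (rule ccontr)
      assume "t \<noteq> n - 1"
      obtain R Y' where R: "vec.dim R + 3 = t" and st: "steiner R (vec.dim R + 3) Y'"
        by (rule steiner_system_residue[OF Y, of 3]) (use t False in auto)
      have "n - vec.dim R = n - t + 3" using R t False by linarith
      then have ev: "even (n - vec.dim R)" using od by simp
      have "n - t \<noteq> 2" using od even_numeral by metis
      then have "n \<ge> vec.dim R + 6" using R t False \<open>t \<noteq> n - 1\<close> by linarith
      then show False by (rule no_steiner3_even[OF st E _ ev])
    qed
    then show ?thesis using False t by simp
  qed
qed

end

lemma no_steiner_system_elliptic_binary:
  fixes Q :: "'a::{field,finite} ^ 'm \<Rightarrow> 'a"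
  assumes Q: "quadratic_form Q" "nondegenerate_quadratic Q" "witt_index Q = n" and d: "CARD('m) = 2 * n + 2"
    and q: "CARD('a) = 2" and Y: "steiner_system t (singular_subspaces Q) Y" and t: "t = n - 1" "3 \<le> t"
  shows False
proof -
  interpret polar_space "\<lambda>x y. polarization Q x y = 0" "\<lambda>x. Q x = 0" n 4
    using quadratic_polar_space[OF Q] d q by simp
  have "steiner_system t PP Y" using Y quadratic_PP[OF Q(1,2)] by simp
  then obtain R Y' where R: "vec.dim R + 2 = t" "steiner R (vec.dim R + 2) Y'"
    by (rule steiner_system_residue[where k = 2]) (use t in auto)
  have F2: "a + b = 0 \<longleftrightarrow> (a = 0 \<longleftrightarrow> b = 0)" for a b :: 'a
    using binary_field_cases[OF q, of a] binary_field_cases[OF q, of b] binary_field_one_add_one[OF q] by auto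
  have "binary_elliptic (\<lambda>x y. polarization Q x y = 0) (\<lambda>x. Q x = 0) n R Y'"
  proof unfold_locales
    show "CARD('a) = 2" by (rule q)
    show "polarization Q x (y + z) = 0 \<longleftrightarrow> (polarization Q x y = 0 \<longleftrightarrow> polarization Q x z = 0)" for x y z
      unfolding polarization_add[OF Q(1,2)] F2 ..
    show "Q (x + y) = 0 \<longleftrightarrow> ((Q x = 0 \<longleftrightarrow> Q y = 0) \<longleftrightarrow> polarization Q x y = 0)" for x y
      unfolding quadratic_add[OF Q(1,2)] F2 ..
    show "n = vec.dim R + 3" using R t by linarith
    show "steiner R (vec.dim R + 2) Y'" by (rule R(2))
  qed
  then show False by (rule binary_elliptic.no_steiner_rank3_elliptic_binary)
qed

theorem theorem1p1:
  fixes P :: "('a::{field,finite} ^ 'm) set set"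
    and T :: polar_type and q n t :: nat
  assumes "primepow q"
    and "classical_polar_space T q n P"
    and "1 < t" and "t < n"
    and "\<exists>Y. steiner_system t P Y"
  shows "(t = 2 \<and> (T = Two_A_even \<or> T = Two_D) \<and> odd n) \<or>
         (t = n - 1 \<and> (((T = Two_A_even \<or> T = Two_D) \<and> q \<ge> 3) \<or> T = Type_D))"
proof -
  obtain Y where Y: "steiner_system t P Y" using assms(5) by blast
  have q2: "q > 1" using primepow_gt_Suc_0[OF assms(1)] by simp
  note t = assms(3,4)
  show ?thesis
  proof (cases T)
    case Two_A_odd
    then obtain B where B: "CARD('a) = q\<^sup>2" "CARD('m) = 2 * n" "hermitian_form q B" "nondegenerate B" "P = isotropic_subspaces B"
      using assms(2) by auto
    interpret polar_space "\<lambda>x y. B y x = 0" "\<lambda>x. B x x = 0" n q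
      using hermitian_polar_space[OF assms(1) B(1,3,4), of n] B(2) by simp
    have "steiner_system t PP Y" using Y hermitian_PP[OF assms(1) B(1,3,4)] B(5) by simp
    moreover have "q \<le> CARD('a)" unfolding B(1) using q2 by (simp add: power2_eq_square)
    ultimately show ?thesis using no_steiner_system_small[OF _ t q2] by blast
  next
    case Two_A_even
    then obtain B where B: "CARD('a) = q\<^sup>2" "CARD('m) = 2 * n + 1" "hermitian_form q B" "nondegenerate B" "P = isotropic_subspaces B"
      using assms(2) by auto
    have E: "q * CARD('a) ^ (CARD('m) - 2 * n) = q ^ 3" unfolding B(1,2) by (simp add: power2_eq_square power3_eq_cube)
    interpret polar_space "\<lambda>x y. B y x = 0" "\<lambda>x. B x x = 0" n "q ^ 3"
      using hermitian_polar_space[OF assms(1) B(1,3,4), of n] B(2) unfolding E by simp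
    have Y': "steiner_system t PP Y" using Y hermitian_PP[OF assms(1) B(1,3,4)] B(5) by simp
    \<comment> \<open>Here E = q^3 and Q = q^2, so E \<le> Q^2 holds while E \<le> Q fails.\<close>
    have "q ^ 3 \<le> q ^ 4" using q2 by (intro power_increasing) auto
    then have "q ^ 3 \<le> CARD('a)\<^sup>2" unfolding B(1) by (simp flip: power_mult)
    then consider "t = 2" "odd n" | "t = n - 1" "3 \<le> t" using steiner_system_parameters[OF Y' t] q2 by auto
    then show ?thesis
    proof cases
      case 2
      have "q \<noteq> 2"
      proof
        assume q: "q = 2"
        \<comment> \<open>For q = 2 the residue of dimension t - 3 has rank 4 with Q = 4 and E =
          8.\<close>
        obtain R Y'' where R: "vec.dim R + 3 = t" "steiner R (vec.dim R + 3) Y''"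
          by (rule steiner_system_residue[OF Y', of 3]) (use 2 t in auto)
        have "n = vec.dim R + 4" using R(1) 2 t by linarith
        with R(2) show False by (rule no_steiner_rank4_hermitian) (use q B(1) in auto)
      qed
      then show ?thesis using 2 Two_A_even q2 by simp
    qed (use Two_A_even in simp)
  next
    case Type_C
    then obtain B where B: "CARD('a) = q" "CARD('m) = 2 * n" "alternating_form B" "nondegenerate B" "P = isotropic_subspaces B"
      using assms(2) by auto
    interpret polar_space "\<lambda>x y. B x y = 0" "\<lambda>x. True" n "CARD('a)"
      by (rule alternating_polar_space[OF B(3,4,2)])
    have "steiner_system t PP Y" using Y alternating_PP[OF B(3,4)] B(5) by simp
    then show ?thesis using no_steiner_system_small[OF _ t CARD_field_gt_1 order_refl] by blast
  next
    case Type_D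
    then obtain Q where Q: "CARD('a) = q" "CARD('m) = 2 * n" "quadratic_form Q" "nondegenerate_quadratic Q" "witt_index Q = n"
      "P = singular_subspaces Q" using assms(2) by auto
    interpret polar_space "\<lambda>x y. polarization Q x y = 0" "\<lambda>x. Q x = 0" n 1
      using quadratic_polar_space[OF Q(3-5)] Q(2) by simp
    have "steiner_system t PP Y" using Y quadratic_PP[OF Q(3,4)] Q(6) by simp
    then show ?thesis using steiner_system_hyperbolic[OF _ t refl] Type_D by simp
  next
    case Type_B
    then obtain Q where Q: "CARD('a) = q" "CARD('m) = 2 * n + 1" "quadratic_form Q" "nondegenerate_quadratic Q"
      "P = singular_subspaces Q" using assms(2) by auto
    interpret polar_space "\<lambda>x y. polarization Q x y = 0" "\<lambda>x. Q x = 0" n "CARD('a)"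
      by (rule parabolic_polar_space[OF Q(3,4,2)])
    have "steiner_system t PP Y" using Y quadratic_PP[OF Q(3,4)] Q(5) by simp
    then show ?thesis using no_steiner_system_small[OF _ t CARD_field_gt_1 order_refl] by blast
  next
    case Two_D
    then obtain Q where Q: "CARD('a) = q" "CARD('m) = 2 * n + 2" "quadratic_form Q" "nondegenerate_quadratic Q" "witt_index Q = n"
      "P = singular_subspaces Q" using assms(2) by auto
    interpret polar_space "\<lambda>x y. polarization Q x y = 0" "\<lambda>x. Q x = 0" n "CARD('a)\<^sup>2"
      using quadratic_polar_space[OF Q(3-5)] Q(2) by simp
    have Y': "steiner_system t PP Y" using Y quadratic_PP[OF Q(3,4)] Q(6) by simp
    have "0 < CARD('a)\<^sup>2" by simp
    then consider "t = 2" "odd n" | "t = n - 1" "3 \<le> t" using steiner_system_parameters[OF Y' t _ order_refl] by blast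
    then show ?thesis
    proof cases
      case 2
      have "q \<noteq> 2"
        using no_steiner_system_elliptic_binary[OF Q(3-5,2) _ Y[unfolded Q(6)] 2] Q(1) by blast
      then show ?thesis using 2 Two_D q2 by simp
    qed (use Two_D in simp)
  qed
qed

end
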